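(* Suppose that the family of measures $(\mathbb{P}^u)_{u\in I}$ satisfies conditions (P1), (P2), (P3), (S1), (S2), and that the monotonicity and moment assumption (M) holds. Then, for any $u\in I$, there exist positive constants $c_{21},\dots,c_{25}$ (depending on $u$) such that for $\mathbb{P}^u$-a.e. $\omega$ and all $x\in\mathcal C_\infty(\omega)$ there exist finite $N_8(\omega,x)$ and $N_9(\omega,x)$ such that for all $t\ge N_9(\omega,x)$ and all $y\in\mathcal C_\infty(\omega)$ with $|x-y|\ge N_8(\omega,x)$ the following hold. (i) If $|x-y|\le c_{21}t$, then $$p^\omega_\theta(t,x,y)\le c_{22}\,t^{-d/2}\exp\Big(-c_{23}\frac{|x-y|^2}{t}\Big).$$ (ii) If $|x-y|\ge c_{25}t$, then $$p^\omega_\theta(t,x,y)\le c_{22}\,t^{-d/2}\exp\Big(-c_{24}|x-y|\Big(1\vee\log\frac{|x-y|}{t}\Big)\Big).$$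
   Context: Setup. Let $d\ge2$ and let $E_d$ be the nearest-neighbour edges of $\mathbb{Z}^d$. Let $(\Omega_E,\mathcal F_E)$, $(\Omega_V,\mathcal F_V)$ be measurable, partially ordered spaces. For $e\in E_d$ (resp. $x\in\mathbb{Z}^d$) let $\Omega_e$ (resp. $\Omega_x$) be a copy of $\Omega_E$ (resp. $\Omega_V$), and let $\Omega=\prod_{e\in E_d}\Omega_e\times\prod_{x\in\mathbb{Z}^d}\Omega_x$ with product $\sigma$-algebra $\mathcal F$, coordinatewise partial order, and coordinates $\omega_{\bar e}$, $\bar e\in E_d\cup\mathbb{Z}^d$. Shifts: $(\tau_z\omega)_{\bar e}=\omega_{\bar e+z}$. Fix a finite set $\mathcal N\subset E_d\cup\mathbb{Z}^d$ around the origin, $\Omega_{\mathcal N}=\prod_{\bar e\in\mathcal N}\Omega_{\bar e}$; $\omega_{|\mathcal N+x}$ is viewed as an element of $\Omega_{\mathcal N}$ by translation. $I\subset\mathbb{R}$ is an open interval, $(\mathbb{P}^u)_{u\in I}$ are probability measures on $(\Omega,\mathcal F)$. "Monotone" means increasing or decreasing for the product order. $|\cdot|$ is the $\ell^1$-norm. Random conductances and speed measure. Let $\mathbf a:\Omega_{\mathcal N}\times\Omega_{\mathcal N}\times\Omega_E\to[0,\infty)$ be measurable, symmetric in its first two arguments, with $\mathbf 1_{\{\mathbf a>0\}}$ monotone, and $\boldsymbol\theta:\Omega_{\mathcal N}\to(0,\infty)$ measurable. Set $a^\omega(x,y)=\mathbf a(\omega_{|\mathcal N+x},\omega_{|\mathcal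 N+y},\omega_e)$ for $e=\{x,y\}\in E_d$ (and $0$ for non-edges), $\theta^\omega(x)=\boldsymbol\theta(\omega_{|\mathcal N+x})$. An edge is open if $a^\omega(e)>0$; $\mathcal O(\omega)$ is the set of open edges and $x\sim y$ means $\{x,y\}\in\mathcal O(\omega)$. $\mathcal C_r(\omega)$, $r\in[0,\infty]$, is the set of vertices lying in connected components of $(\mathbb{Z}^d,\mathcal O(\omega))$ of $\ell^1$-diameter at least $r$; $\mathcal C_\infty(\omega)$ is the infinite cluster (a.s. unique under (S1)–(S2)). $\mathbb{P}^u_0=\mathbb{P}^u[\,\cdot\mid 0\in\mathcal C_\infty]$ with expectation $\mathbb{E}^u_0$. $\mu^\omega(x)=\sum_{y\sim x}a^\omega(x,y)$, $\nu^\omega(x)=\sum_{y\sim x}a^\omega(x,y)^{-1}$. $X$ is the continuous-time Markov chain on $\mathcal C_\infty(\omega)$ with generator $(\mathcal L^\omega_\theta f)(x)=\theta^\omega(x)^{-1}\sum_{y\sim x}a^\omega(x,y)(f(y)-f(x))$, with law $P^\omega_x$ when started at $x$, and $p^\omega_\theta(t,x,y)=P^\omega_x(X_t=y)/\theta^\omega(y)$. Notation for the conditions. $Q(x,L)=\{y\in\mathbb{Z}^d:|x-y|_\infty\le L\}$; $\bar Q(x,L)$ is the union of $Q(x,L)$ and the edges with both endpoints in $Q(x,L)$. $d(A,B)$ is the minimal $\ell^\infty$-distance between vertices/endpoints of edges in $A$ and in $B$. $\hat{\mathbb{P}}^u=\mathbb{P}^u\otimes\mathbb{P}^u$ with coordinates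 $(\omega^{(1)},\omega^{(2)})$; $\omega_{|S}=(\omega_{\bar e})_{\bar e\in S}$. An event is increasing (decreasing) if its indicator is. (P1) For each $u\in I$, $\mathbb{P}^u\circ\tau_x^{-1}=\mathbb{P}^u$ for all $x\in\mathbb{Z}^d$, and for each $x\in\mathbb{Z}^d\setminus\{0\}$, $\mathbb{P}^u(A)\in\{0,1\}$ for every $A\in\mathcal F$ with $\tau_x(A)=A$. (P2) $\mathbb{E}^u[f]\le\mathbb{E}^{u'}[f]$ for all increasing $f:\Omega\to[0,1]$ and $u\le u'$ in $I$. (P3) There exist positive constants $R_P,L_P<\infty$, $\xi_P>1$, $\varepsilon_P,a_P,C_P,\chi_P>0$ and $f_P:[0,\infty)\to[0,\infty)$ with $f_P(L)\ge\exp(a_P(\log L)^{\varepsilon_P})$ such that for all $R\ge R_P$, $L\ge L_P$, $x_1,x_2\in\mathbb{Z}^d$ with, writing $\bar Q_i=\bar Q(x_i,L^{\xi_P})$, $d(\bar Q_1,\bar Q_2)\ge RL$, and all $u,\hat u\in I$ with $u\ge\hat u+R^{-\chi_P}$: there is an event $B$ (possibly on an extension of the probability space underlying $\mathbb{P}^{\hat u}$) with $\mathbb{P}^{\hat u}(B^c)\le\exp(-C_Pf_P(L))$ such that for all increasing events $A\subset\prod_{\bar e\in\bar Q_1}\Omega_{\bar e}\times\prod_{\bar e\in\bar Q_2}\Omega_{\bar e}$, $\mathbb{P}^{\hat u}(B,(\omega_{|\bar Q_1},\omega_{|\bar Q_2})\in A)\le\hat{\mathbb{P}}^u((\omega^{(1)}_{|\bar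 Q_1},\omega^{(2)}_{|\bar Q_2})\in A)$; and there is an event $B'$ (possibly on an extension of the space underlying $\mathbb{P}^u$) with $\mathbb{P}^u(B'^c)\le\exp(-C_Pf_P(L))$ such that for all decreasing such $A$, $\mathbb{P}^u(B',(\omega_{|\bar Q_1},\omega_{|\bar Q_2})\in A)\le\hat{\mathbb{P}}^{\hat u}((\omega^{(1)}_{|\bar Q_1},\omega^{(2)}_{|\bar Q_2})\in A)$. (S1) There is $f_S:I\times\mathbb{Z}_+\to\mathbb{R}$ such that for each $u\in I$ there exist $\Delta_S(u)>0$, $R_S(u)<\infty$ with $f_S(u,R)\ge(\log R)^{1+\Delta_S(u)}$ for all $R\ge R_S(u)$, and for all $u\in I$, $R\ge1$: $\mathbb{P}^u[\mathcal C_R\cap[-R,R]^d\ne\varnothing]\ge1-e^{-f_S(u,R)}$ and $\mathbb{P}^u[\forall x,y\in\mathcal C_{R/10}\cap[-R,R]^d:\ x\text{ is connected to }y\text{ by an open path in }[-2R,2R]^d]\ge1-e^{-f_S(u,R)}$. (S2) $u\mapsto\mathbb{P}^u[0\in\mathcal C_\infty]$ is positive and continuous on $I$. (M) (i) The map $\mathbf t:\Omega_{\mathcal N}\times\Omega_{\mathcal N}\times\Omega_E\to[0,\infty)\cup\{\infty\}$, $\mathbf t(\omega^1,\omega^2,\omega_E)=\big(1\wedge\frac{\boldsymbol\theta(\omega^1)\wedge\boldsymbol\theta(\omega^2)}{\mathbf a(\omega^1,\omega^2,\omega_E)}\big)^{1/2}$ if $\mathbf a(\omega^1,\omega^2,\omega_E)\neq0$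 and $=\infty$ otherwise, is monotone. (ii) There exist $p,q,r\in(1,\infty]$ with $\frac1r+\frac1p\frac{r-1}{r}+\frac1q<\frac2d$ such that for every $u\in I$ the quantities $\mathbb{E}^u_0[(\mu^\omega(0)/\theta^\omega(0))^p\theta^\omega(0)]$, $\mathbb{E}^u_0[\nu^\omega(0)^q]$, $\mathbb{E}^u_0[\theta^\omega(0)^r]$, $\mathbb{E}^u_0[\theta^\omega(0)^{-q}]$ are finite (for infinite exponents: the corresponding essential suprema are finite). *)

theory Defs
  imports "HOL-Probability.Probability"
begin

section \<open>The lattice\<close>

type_synonym 'd vertex = "(int, 'd) vec"

definition l1norm :: "'d::finite vertex \<Rightarrow> real" where
  "l1norm x = (\<Sum>i\<in>UNIV. \<bar>real_of_int (x $ i)\<bar>)"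

definition linfnorm :: "'d::finite vertex \<Rightarrow> real" where
  "linfnorm x = Max (range (\<lambda>i. \<bar>real_of_int (x $ i)\<bar>))"

definition lattice_edges :: "'d::finite vertex set set" where
  "lattice_edges = {{x, y} | x y. l1norm (x - y) = 1}"

text \<open>A subset of the disjoint union of edges and vertices is a pair (edge part, vertex part).\<close>

type_synonym 'd region = "'d vertex set set \<times> 'd vertex set"

definition box :: "'d::finite vertex \<Rightarrow> real \<Rightarrow> 'd vertex set" where
  "box x L = {y. linfnorm (x - y) \<le> L}"

definition box_region :: "'d::finite vertex \<Rightarrow> real \<Rightarrow> 'd region" where
  "box_region x L = ({e \<in> lattice_edges. e \<subseteq> box x L}, box x L)"

definition region_vertices :: "'d region \<Rightarrow> 'd vertex set" where
  "region_vertices S = \<Union> (fst S) \<union> snd S"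

definition region_dist :: "'d::finite region \<Rightarrow> 'd region \<Rightarrow> real" where
  "region_dist A B = Inf {linfnorm (x - y) | x y. x \<in> region_vertices A \<and> y \<in> region_vertices B}"


section \<open>Configurations\<close>

text \<open>
  Configurations are pairs of an edge and a vertex configuration, \<^const>\<open>extensional\<close> outside the
  region considered. On such pairs the type class order (pointwise on functions, componentwise
  on pairs) is exactly the coordinatewise order, so \<^const>\<open>monotone_on\<close> can be used directly.
\<close>

type_synonym ('e, 'v, 'd) config = "('d vertex set \<Rightarrow> 'e) \<times> ('d vertex \<Rightarrow> 'v)"

definition region_space :: "'e measure \<Rightarrow> 'v measure \<Rightarrow> 'd region \<Rightarrow> ('e, 'v, 'd) config measure" where
  "region_space ME MV S = PiM (fst S) (\<lambda>_. ME) \<Otimes>\<^sub>M PiM (snd S) (\<lambda>_. MV)"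

definition config_space :: "'e measure \<Rightarrow> 'v measure \<Rightarrow> ('e, 'v, 'd::finite) config measure" where
  "config_space ME MV = region_space ME MV (lattice_edges, UNIV)"

definition restrict_config :: "'d region \<Rightarrow> ('e, 'v, 'd) config \<Rightarrow> ('e, 'v, 'd) config" where
  "restrict_config S \<omega> = (restrict (fst \<omega>) (fst S), restrict (snd \<omega>) (snd S))"

definition shift :: "'d::finite vertex \<Rightarrow> ('e, 'v, 'd) config \<Rightarrow> ('e, 'v, 'd) config" where
  "shift z \<omega> = (\<lambda>e\<in>lattice_edges. fst \<omega> ((\<lambda>x. x + z) ` e), \<lambda>x. snd \<omega> (x + z))"

text \<open>The restriction to \<open>N + x\<close>, viewed as a configuration on \<open>N\<close> by translation.\<close>

definition local_config :: "'d::finite region \<Rightarrow> 'd vertex \<Rightarrow> ('e, 'v, 'd) config \<Rightarrow> ('e, 'v, 'd) config" where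
  "local_config N x \<omega> = restrict_config N (shift x \<omega>)"

definition monotone_fun_on :: "'a::order set \<Rightarrow> ('a \<Rightarrow> 'b::order) \<Rightarrow> bool" where
  "monotone_fun_on A f \<longleftrightarrow> mono_on A f \<or> antimono_on A f"

definition increasing_event :: "'a::order measure \<Rightarrow> 'a set \<Rightarrow> bool" where
  "increasing_event M A \<longleftrightarrow> A \<in> sets M \<and> mono_on (space M) (indicator A :: 'a \<Rightarrow> real)"

definition decreasing_event :: "'a::order measure \<Rightarrow> 'a set \<Rightarrow> bool" where
  "decreasing_event M A \<longleftrightarrow> A \<in> sets M \<and> antimono_on (space M) (indicator A :: 'a \<Rightarrow> real)"


section \<open>Random conductances, speed measure and clusters\<close>

definition conductance ::
  "'d::finite region \<Rightarrow> (('e, 'v, 'd) config \<times> ('e, 'v, 'd) config \<times> 'e \<Rightarrow> real)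
    \<Rightarrow> ('e, 'v, 'd) config \<Rightarrow> 'd vertex \<Rightarrow> 'd vertex \<Rightarrow> real" where
  "conductance N a \<omega> x y =
    (if {x, y} \<in> lattice_edges
     then a (local_config N x \<omega>, local_config N y \<omega>, fst \<omega> {x, y}) else 0)"

definition speed ::
  "'d::finite region \<Rightarrow> (('e, 'v, 'd) config \<Rightarrow> real) \<Rightarrow> ('e, 'v, 'd) config \<Rightarrow> 'd vertex \<Rightarrow> real" where
  "speed N \<theta> \<omega> x = \<theta> (local_config N x \<omega>)"

text \<open>Below, \<open>c\<close> is the conductance function and \<open>s\<close> the speed of one fixed environment.\<close>

definition open_edges :: "('d::finite vertex \<Rightarrow> 'd vertex \<Rightarrow> real) \<Rightarrow> 'd vertex set set" where
  "open_edges c = {{x, y} | x y. {x, y} \<in> lattice_edges \<and> c x y > 0}"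

definition adjacent :: "('d::finite vertex \<Rightarrow> 'd vertex \<Rightarrow> real) \<Rightarrow> 'd vertex \<Rightarrow> 'd vertex \<Rightarrow> bool" where
  "adjacent c x y \<longleftrightarrow> {x, y} \<in> open_edges c"

definition connected_in ::
  "'d vertex set \<Rightarrow> ('d::finite vertex \<Rightarrow> 'd vertex \<Rightarrow> real) \<Rightarrow> 'd vertex \<Rightarrow> 'd vertex \<Rightarrow> bool" where
  "connected_in B c x y \<longleftrightarrow>
    x \<in> B \<and> (\<lambda>v w. v \<in> B \<and> w \<in> B \<and> adjacent c v w)\<^sup>*\<^sup>* x y"

definition component :: "('d::finite vertex \<Rightarrow> 'd vertex \<Rightarrow> real) \<Rightarrow> 'd vertex \<Rightarrow> 'd vertex set" where
  "component c x = {y. connected_in UNIV c x y}"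

definition l1diam :: "'d::finite vertex set \<Rightarrow> ereal" where
  "l1diam A = (SUP x\<in>A. SUP y\<in>A. ereal (l1norm (x - y)))"

definition clusters :: "('d::finite vertex \<Rightarrow> 'd vertex \<Rightarrow> real) \<Rightarrow> ereal \<Rightarrow> 'd vertex set" where
  "clusters c r = {x. r \<le> l1diam (component c x)}"

definition mu :: "('d::finite vertex \<Rightarrow> 'd vertex \<Rightarrow> real) \<Rightarrow> 'd vertex \<Rightarrow> real" where
  "mu c x = (\<Sum>y | adjacent c x y. c x y)"

definition nu :: "('d::finite vertex \<Rightarrow> 'd vertex \<Rightarrow> real) \<Rightarrow> 'd vertex \<Rightarrow> real" where
  "nu c x = (\<Sum>y | adjacent c x y. inverse (c x y))"


section \<open>Continuous-time Markov chains\<close>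

text \<open>
  The (minimal) chain with generator \<open>L\<close> is realised by its jump chain and holding times:
  at \<open>x\<close> it waits an exponential time with rate \<open>- Q x x\<close> and then jumps to \<open>y \<noteq> x\<close>
  with probability \<open>Q x y / (- Q x x)\<close>, where \<open>Q\<close> is the matrix of \<open>L\<close>.
  The noise consists of independent candidates \<open>\<xi> (n, z)\<close> for the jump made at step \<open>n\<close> from
  state \<open>z\<close>, and independent standard exponential variables \<open>\<eta> n\<close>.
  In an absorbing state the holding time is \<open>\<eta> / 0 = \<infinity>\<close> in \<^typ>\<open>ennreal\<close>;
  after a possible explosion the chain is at no state.
\<close>

definition rate_matrix :: "(('s \<Rightarrow> real) \<Rightarrow> 's \<Rightarrow> real) \<Rightarrow> 's \<Rightarrow> 's \<Rightarrow> real" where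
  "rate_matrix L x y = L (indicator {y}) x"

definition exit_rate :: "(('s \<Rightarrow> real) \<Rightarrow> 's \<Rightarrow> real) \<Rightarrow> 's \<Rightarrow> real" where
  "exit_rate L x = - rate_matrix L x x"

definition jump_law :: "(('s \<Rightarrow> real) \<Rightarrow> 's \<Rightarrow> real) \<Rightarrow> 's \<Rightarrow> 's pmf" where
  "jump_law L x =
    (if exit_rate L x = 0 then return_pmf x
     else embed_pmf (\<lambda>y. if y = x then 0 else rate_matrix L x y / exit_rate L x))"

definition chain_noise ::
  "(('s \<Rightarrow> real) \<Rightarrow> 's \<Rightarrow> real) \<Rightarrow> ((nat \<times> 's \<Rightarrow> 's) \<times> (nat \<Rightarrow> real)) measure" where
  "chain_noise L =
    PiM UNIV (\<lambda>(n, z). measure_pmf (jump_law L z)) \<Otimes>\<^sub>M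
    PiM UNIV (\<lambda>n. density lborel (exponential_density 1))"

primrec jump_chain :: "'s \<Rightarrow> (nat \<times> 's \<Rightarrow> 's) \<Rightarrow> nat \<Rightarrow> 's" where
  "jump_chain x \<xi> 0 = x"
| "jump_chain x \<xi> (Suc n) = \<xi> (n, jump_chain x \<xi> n)"

definition jump_time ::
  "(('s \<Rightarrow> real) \<Rightarrow> 's \<Rightarrow> real) \<Rightarrow> 's \<Rightarrow> (nat \<times> 's \<Rightarrow> 's) \<Rightarrow> (nat \<Rightarrow> real) \<Rightarrow> nat \<Rightarrow> ennreal" where
  "jump_time L x \<xi> \<eta> n =
    (\<Sum>k<n. ennreal (\<eta> k) / ennreal (exit_rate L (jump_chain x \<xi> k)))"

definition chain_at ::
  "(('s \<Rightarrow> real) \<Rightarrow> 's \<Rightarrow> real) \<Rightarrow> 's \<Rightarrow> (nat \<times> 's \<Rightarrow> 's) \<Rightarrow> (nat \<Rightarrow> real) \<Rightarrow> real \<Rightarrow> 's \<Rightarrow> bool" where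
  "chain_at L x \<xi> \<eta> t y \<longleftrightarrow>
    (\<exists>n. jump_time L x \<xi> \<eta> n \<le> ennreal t \<and> ennreal t < jump_time L x \<xi> \<eta> (Suc n)
       \<and> jump_chain x \<xi> n = y)"

definition transition_prob :: "(('s \<Rightarrow> real) \<Rightarrow> 's \<Rightarrow> real) \<Rightarrow> real \<Rightarrow> 's \<Rightarrow> 's \<Rightarrow> real" where
  "transition_prob L t x y =
    measure (chain_noise L) {(\<xi>, \<eta>) \<in> space (chain_noise L). chain_at L x \<xi> \<eta> t y}"

definition generator ::
  "('d::finite vertex \<Rightarrow> 'd vertex \<Rightarrow> real) \<Rightarrow> ('d vertex \<Rightarrow> real)
    \<Rightarrow> ('d vertex \<Rightarrow> real) \<Rightarrow> 'd vertex \<Rightarrow> real" where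
  "generator c s f x = inverse (s x) * (\<Sum>y | adjacent c x y. c x y * (f y - f x))"

definition heat_kernel ::
  "('d::finite vertex \<Rightarrow> 'd vertex \<Rightarrow> real) \<Rightarrow> ('d vertex \<Rightarrow> real)
    \<Rightarrow> real \<Rightarrow> 'd vertex \<Rightarrow> 'd vertex \<Rightarrow> real" where
  "heat_kernel c s t x y = transition_prob (generator c s) t x y / s y"


text \<open>
  The matrix of the generator, and a check that \<^const>\<open>jump_law\<close> is the intended distribution.
  In particular the chain started in \<open>clusters c \<infinity>\<close> stays there.
\<close>

lemma finite_adjacent: "finite {y. adjacent c x y}"
proof -
  have "y \<in> vec_lambda ` PiE UNIV (\<lambda>i. {x $ i - 1..x $ i + 1})" if adj: "adjacent c x y" for y
  proof -
    have "{x, y} \<in> lattice_edges"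
      using adj by (auto simp: adjacent_def open_edges_def)
    then obtain v w where "{x, y} = {v, w}" and vw: "l1norm (v - w) = 1"
      unfolding lattice_edges_def by blast
    then consider "x = v" "y = w" | "x = w" "y = v"
      by (auto simp: doubleton_eq_iff)
    then have l1: "(\<Sum>j\<in>UNIV. \<bar>real_of_int (x $ j) - real_of_int (y $ j)\<bar>) = 1"
      using vw by cases (simp_all add: l1norm_def abs_minus_commute)
    have "y $ i \<in> {x $ i - 1..x $ i + 1}" for i
    proof -
      have "\<bar>real_of_int (x $ i) - real_of_int (y $ i)\<bar>
          \<le> (\<Sum>j\<in>UNIV. \<bar>real_of_int (x $ j) - real_of_int (y $ j)\<bar>)"
        by (rule member_le_sum) auto
      then show ?thesis unfolding l1 by auto
    qed
    then have "vec_nth y \<in> PiE UNIV (\<lambda>i. {x $ i - 1..x $ i + 1})" by auto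
    then have "vec_lambda (vec_nth y) \<in> vec_lambda ` PiE UNIV (\<lambda>i. {x $ i - 1..x $ i + 1})"
      by (rule imageI)
    then show ?thesis by simp
  qed
  then have "{y. adjacent c x y} \<subseteq> vec_lambda ` PiE UNIV (\<lambda>i. {x $ i - 1..x $ i + 1})"
    by auto
  moreover have "finite (vec_lambda ` PiE UNIV (\<lambda>i. {x $ i - 1..x $ i + 1}))"
    by (intro finite_imageI finite_PiE) auto
  ultimately show ?thesis by (rule finite_subset)
qed

lemma not_adjacent_self: "\<not> adjacent c x x"
  unfolding adjacent_def open_edges_def lattice_edges_def l1norm_def
  by (auto simp: doubleton_eq_iff)

lemma adjacent_pos:
  assumes "\<And>x y. c x y = c y x" "adjacent c x y" shows "c x y > 0"
  using assms(2) unfolding adjacent_def open_edges_def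
  by (auto simp: doubleton_eq_iff) (metis assms(1))

lemma rate_matrix_generator:
  "rate_matrix (generator c s) x y =
     (if y = x then - mu c x / s x else if adjacent c x y then c x y / s x else 0)"
proof (cases "y = x")
  case True
  have "(\<Sum>z | adjacent c x z. c x z * (indicator {x} z - indicator {x} x)) = (\<Sum>z | adjacent c x z. - c x z)"
    using not_adjacent_self by (intro sum.cong) (auto simp: indicator_def)
  then show ?thesis using True
    by (simp add: rate_matrix_def generator_def mu_def sum_negf field_simps)
next
  case False
  have "(\<Sum>z | adjacent c x z. c x z * (indicator {y} z - indicator {y} x)) = (\<Sum>z | adjacent c x z. if z = y then c x z else 0)"
    using False by (intro sum.cong) (auto simp: indicator_def)
  then show ?thesis using False
    by (simp add: rate_matrix_def generator_def finite_adjacent field_simps)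
qed

lemma pmf_jump_law_generator:
  fixes c :: "'d::finite vertex \<Rightarrow> 'd vertex \<Rightarrow> real"
  assumes sym: "\<And>x y. c x y = c y x" and s: "s x > 0" and ne: "adjacent c x z"
  shows "pmf (jump_law (generator c s) x) y = (if adjacent c x y then c x y / mu c x else 0)"
proof -
  have pos: "c x y > 0" if "adjacent c x y" for y using adjacent_pos[of c] sym that by blast
  have mu: "mu c x > 0" unfolding mu_def
    using ne pos by (intro sum_pos finite_adjacent) auto
  have eq: "(\<lambda>y. if y = x then 0 else rate_matrix (generator c s) x y / exit_rate (generator c s) x)
     = (\<lambda>y. if adjacent c x y then c x y / mu c x else 0)" (is "_ = ?f")
    using s not_adjacent_self by (auto simp: fun_eq_iff rate_matrix_generator exit_rate_def)
  have "(\<integral>\<^sup>+ y. ennreal (?f y) \<partial>count_space UNIV) = (\<integral>\<^sup>+ y. ennreal (c x y / mu c x) \<partial>count_space {y. adjacent c x y})"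
    by (subst nn_integral_count_space_indicator[of "{y. adjacent c x y}"])
       (auto intro!: nn_integral_cong simp: indicator_def)
  also have "\<dots> = (\<Sum>y | adjacent c x y. ennreal (c x y / mu c x))"
    by (rule nn_integral_count_space_finite[OF finite_adjacent])
  also have "\<dots> = ennreal (\<Sum>y | adjacent c x y. c x y / mu c x)"
    using pos mu by (intro sum_ennreal) (auto simp: less_imp_le)
  also have "(\<Sum>y | adjacent c x y. c x y / mu c x) = 1"
    using mu by (simp add: sum_divide_distrib[symmetric] mu_def)
  finally have "pmf (embed_pmf ?f) y = ?f y"
    using pos mu by (intro pmf_embed_pmf) (auto simp: less_imp_le)
  moreover have "exit_rate (generator c s) x \<noteq> 0"
    using mu s by (simp add: exit_rate_def rate_matrix_generator)
  ultimately show ?thesis by (simp add: jump_law_def eq)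
qed

section \<open>Conditions on the family of measures\<close>

definition cond_P1 ::
  "'e measure \<Rightarrow> 'v measure \<Rightarrow> real set \<Rightarrow> (real \<Rightarrow> ('e, 'v, 'd::finite) config measure) \<Rightarrow> bool" where
  "cond_P1 ME MV I P \<longleftrightarrow>
    (\<forall>u\<in>I. (\<forall>x. distr (P u) (config_space ME MV) (shift x) = P u)
      \<and> (\<forall>x A. x \<noteq> 0 \<longrightarrow> A \<in> sets (config_space ME MV) \<longrightarrow> shift x ` A = A
            \<longrightarrow> measure (P u) A \<in> {0, 1}))"

definition cond_P2 ::
  "'e::order measure \<Rightarrow> 'v::order measure \<Rightarrow> real set
    \<Rightarrow> (real \<Rightarrow> ('e, 'v, 'd::finite) config measure) \<Rightarrow> bool" where
  "cond_P2 ME MV I P \<longleftrightarrow>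
    (\<forall>u\<in>I. \<forall>u'\<in>I. u \<le> u' \<longrightarrow>
      (\<forall>f \<in> borel_measurable (config_space ME MV).
         f \<in> space (config_space ME MV) \<rightarrow> {0..1::real} \<longrightarrow> mono_on (space (config_space ME MV)) f
         \<longrightarrow> (\<integral>\<omega>. f \<omega> \<partial>P u) \<le> (\<integral>\<omega>. f \<omega> \<partial>P u')))"

text \<open>
  An event on some extension of the probability space \<open>M\<close>. It suffices to
  consider extensions by a real coordinate, i.e. measures on the product of \<open>M\<close> with the reals
  with first marginal \<open>M\<close>: for an event \<open>B\<close> on an arbitrary extension, the joint law
  of the original coordinate and the indicator of \<open>B\<close> is of this form.
\<close>

definition extension_of :: "'a measure \<Rightarrow> ('a \<times> real) measure \<Rightarrow> bool" where
  "extension_of M M' \<longleftrightarrow> prob_space M' \<and> sets M' = sets (M \<Otimes>\<^sub>M borel) \<and> distr M' M fst = M"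

definition cond_P3 ::
  "'e::order measure \<Rightarrow> 'v::order measure \<Rightarrow> real set
    \<Rightarrow> (real \<Rightarrow> ('e, 'v, 'd::finite) config measure) \<Rightarrow> bool" where
  "cond_P3 ME MV I P \<longleftrightarrow>
    (\<exists>(R\<^sub>P::real) (L\<^sub>P::real) (\<xi>\<^sub>P::real) (\<epsilon>\<^sub>P::real) (a\<^sub>P::real) (C\<^sub>P::real) (\<chi>\<^sub>P::real) (f\<^sub>P :: real \<Rightarrow> real).
      R\<^sub>P > 0 \<and> L\<^sub>P > 0 \<and> \<xi>\<^sub>P > 1 \<and> \<epsilon>\<^sub>P > 0 \<and> a\<^sub>P > 0 \<and> C\<^sub>P > 0 \<and> \<chi>\<^sub>P > 0
      \<and> (\<forall>L\<ge>0. f\<^sub>P L \<ge> 0)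
      \<and> (\<forall>L\<ge>L\<^sub>P. L \<ge> 1 \<longrightarrow> f\<^sub>P L \<ge> exp (a\<^sub>P * (ln L) powr \<epsilon>\<^sub>P))
      \<and> (\<forall>R\<ge>R\<^sub>P. \<forall>L\<ge>L\<^sub>P. \<forall>(x\<^sub>1::'d vertex) (x\<^sub>2::'d vertex).
          let Q\<^sub>1 = box_region x\<^sub>1 (L powr \<xi>\<^sub>P);
              Q\<^sub>2 = box_region x\<^sub>2 (L powr \<xi>\<^sub>P);
              M = region_space ME MV Q\<^sub>1 \<Otimes>\<^sub>M region_space ME MV Q\<^sub>2
          in region_dist Q\<^sub>1 Q\<^sub>2 \<ge> R * L \<longrightarrow>
            (\<forall>u\<in>I. \<forall>u'\<in>I. u \<ge> u' + R powr (- \<chi>\<^sub>P) \<longrightarrow>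
              (\<exists>M' B. extension_of (P u') M' \<and> B \<in> sets M'
                 \<and> measure M' (space M' - B) \<le> exp (- C\<^sub>P * f\<^sub>P L)
                 \<and> (\<forall>A. increasing_event M A \<longrightarrow>
                     measure M' {(\<omega>, s) \<in> B. (restrict_config Q\<^sub>1 \<omega>, restrict_config Q\<^sub>2 \<omega>) \<in> A}
                     \<le> measure (P u \<Otimes>\<^sub>M P u)
                         {(\<omega>\<^sub>1, \<omega>\<^sub>2) \<in> space (P u \<Otimes>\<^sub>M P u).
                            (restrict_config Q\<^sub>1 \<omega>\<^sub>1, restrict_config Q\<^sub>2 \<omega>\<^sub>2) \<in> A}))
              \<and> (\<exists>M' B. extension_of (P u) M' \<and> B \<in> sets M'
                 \<and> measure M' (space M' - B) \<le> exp (- C\<^sub>P * f\<^sub>P L)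
                 \<and> (\<forall>A. decreasing_event M A \<longrightarrow>
                     measure M' {(\<omega>, s) \<in> B. (restrict_config Q\<^sub>1 \<omega>, restrict_config Q\<^sub>2 \<omega>) \<in> A}
                     \<le> measure (P u' \<Otimes>\<^sub>M P u')
                         {(\<omega>\<^sub>1, \<omega>\<^sub>2) \<in> space (P u' \<Otimes>\<^sub>M P u').
                            (restrict_config Q\<^sub>1 \<omega>\<^sub>1, restrict_config Q\<^sub>2 \<omega>\<^sub>2) \<in> A})))))"

text \<open>In the next two conditions \<open>c \<omega>\<close> is the conductance function of the environment \<open>\<omega>\<close>.\<close>

definition cond_S1 ::
  "real set \<Rightarrow> (real \<Rightarrow> ('e, 'v, 'd::finite) config measure)
    \<Rightarrow> (('e, 'v, 'd) config \<Rightarrow> 'd vertex \<Rightarrow> 'd vertex \<Rightarrow> real) \<Rightarrow> bool" where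
  "cond_S1 I P c \<longleftrightarrow>
    (\<exists>f\<^sub>S :: real \<Rightarrow> nat \<Rightarrow> real.
      (\<forall>u\<in>I. \<exists>(\<Delta>::real) (R\<^sub>S::real). \<Delta> > 0
         \<and> (\<forall>R\<ge>1. real R \<ge> R\<^sub>S \<longrightarrow> f\<^sub>S u R \<ge> (ln (real R)) powr (1 + \<Delta>)))
      \<and> (\<forall>u\<in>I. \<forall>R\<ge>1.
           measure (P u) {\<omega> \<in> space (P u). clusters (c \<omega>) (ereal (real R)) \<inter> box 0 (real R) \<noteq> {}}
             \<ge> 1 - exp (- f\<^sub>S u R)
         \<and> measure (P u) {\<omega> \<in> space (P u).
               \<forall>x \<in> clusters (c \<omega>) (ereal (real R / 10)) \<inter> box 0 (real R).
               \<forall>y \<in> clusters (c \<omega>) (ereal (real R / 10)) \<inter> box 0 (real R).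
                 connected_in (box 0 (2 * real R)) (c \<omega>) x y}
             \<ge> 1 - exp (- f\<^sub>S u R)))"

definition cond_S2 ::
  "real set \<Rightarrow> (real \<Rightarrow> ('e, 'v, 'd::finite) config measure)
    \<Rightarrow> (('e, 'v, 'd) config \<Rightarrow> 'd vertex \<Rightarrow> 'd vertex \<Rightarrow> real) \<Rightarrow> bool" where
  "cond_S2 I P c \<longleftrightarrow>
    (\<forall>u\<in>I. measure (P u) {\<omega> \<in> space (P u). 0 \<in> clusters (c \<omega>) \<infinity>} > 0)
    \<and> continuous_on I (\<lambda>u. measure (P u) {\<omega> \<in> space (P u). 0 \<in> clusters (c \<omega>) \<infinity>})"

definition passage_time ::
  "(('e, 'v, 'd) config \<times> ('e, 'v, 'd) config \<times> 'e \<Rightarrow> real) \<Rightarrow> (('e, 'v, 'd) config \<Rightarrow> real)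
    \<Rightarrow> ('e, 'v, 'd) config \<times> ('e, 'v, 'd) config \<times> 'e \<Rightarrow> ennreal" where
  "passage_time a \<theta> = (\<lambda>(\<omega>\<^sub>1, \<omega>\<^sub>2, s).
     if a (\<omega>\<^sub>1, \<omega>\<^sub>2, s) \<noteq> 0
     then ennreal (sqrt (min 1 (min (\<theta> \<omega>\<^sub>1) (\<theta> \<omega>\<^sub>2) / a (\<omega>\<^sub>1, \<omega>\<^sub>2, s)))) else \<infinity>)"

text \<open>
  Finiteness of the expectation of \<open>f\<^sup>p * w\<close> for nonnegative \<open>f\<close> and positive \<open>w\<close>; the weight
  plays no role for \<open>p = \<infinity>\<close>.
\<close>

definition finite_moment :: "'a measure \<Rightarrow> ereal \<Rightarrow> ('a \<Rightarrow> real) \<Rightarrow> ('a \<Rightarrow> real) \<Rightarrow> bool" where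
  "finite_moment M p f w \<longleftrightarrow>
    (if p = \<infinity> then esssup M (\<lambda>\<omega>. ereal (f \<omega>)) < \<infinity>
     else (\<integral>\<^sup>+\<omega>. ennreal (f \<omega> powr real_of_ereal p * w \<omega>) \<partial>M) < \<infinity>)"

text \<open>The factor \<open>1 - 1/r\<close> is \<open>(r - 1)/r\<close>, with its limiting value 1 at \<open>r = \<infinity>\<close>.\<close>

definition cond_M ::
  "'e::order measure \<Rightarrow> 'v::order measure \<Rightarrow> real set
    \<Rightarrow> (real \<Rightarrow> ('e, 'v, 'd::finite) config measure) \<Rightarrow> 'd region
    \<Rightarrow> (('e, 'v, 'd) config \<times> ('e, 'v, 'd) config \<times> 'e \<Rightarrow> real) \<Rightarrow> (('e, 'v, 'd) config \<Rightarrow> real)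
    \<Rightarrow> bool" where
  "cond_M ME MV I P N a \<theta> \<longleftrightarrow>
    monotone_fun_on (space (region_space ME MV N \<Otimes>\<^sub>M region_space ME MV N \<Otimes>\<^sub>M ME)) (passage_time a \<theta>)
    \<and> (\<exists>p q r :: ereal. p > 1 \<and> q > 1 \<and> r > 1
        \<and> 1 / r + 1 / p * (1 - 1 / r) + 1 / q < ereal (2 / real CARD('d))
        \<and> (\<forall>u\<in>I.
             let P\<^sub>0 = uniform_measure (P u)
                        {\<omega> \<in> space (P u). 0 \<in> clusters (conductance N a \<omega>) \<infinity>};
                 m = (\<lambda>\<omega>. mu (conductance N a \<omega>) 0);
                 n = (\<lambda>\<omega>. nu (conductance N a \<omega>) 0);
                 s = (\<lambda>\<omega>. speed N \<theta> \<omega> 0)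
             in finite_moment P\<^sub>0 p (\<lambda>\<omega>. m \<omega> / s \<omega>) s
              \<and> finite_moment P\<^sub>0 q n (\<lambda>_. 1)
              \<and> finite_moment P\<^sub>0 r s (\<lambda>_. 1)
              \<and> finite_moment P\<^sub>0 q (\<lambda>\<omega>. inverse (s \<omega>)) (\<lambda>_. 1)))"

end

theory Submission
 imports Defs "HOL-Library.Transitive_Closure_Table" "HOL-Real_Asymp.Real_Asymp"
begin

text \<open>
 The heat kernel is bounded by the kernels of walks killed outside finite subsets of the cluster,
 uniformly in the subset. For a killed walk, Davies' exponentially weighted estimate with weight
 \<open>\<lambda> * d(x, \<cdot>)\<close>, where \<open>d\<close> is the first passage distance with edge times \<open>sqrt (min 1 (\<theta> / a))\<close>, is
 combined at both end points with a mean value inequality for caloric functions, proved by De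
 Giorgi's iteration. Two properties of the environment enter. A Faber--Krahn inequality at all
 large scales follows by extending functions on the cluster to the lattice through the nearest
 point map and representing them by discrete potentials; the weights are controlled by the
 moments in (M), the good scales from (S1) and a maximal inequality for spatial averages. A linear
 lower bound \<open>d(x, y) >= c * |x - y|\<close> follows from (P3) by a multiscale argument with sprinkling: a fast
 crossing at one scale contains two distant fast crossings at the previous scale. Taking \<open>\<lambda>\<close> of
 order \<open>|x - y| / t\<close> gives the Gaussian bound; for large \<open>|x - y| / t\<close>, Davies' estimate with
 \<open>\<lambda> = ln (|x - y| / t) / 2\<close> suffices.
\<close>

section \<open>The heat flow killed outside a finite set\<close>

text \<open>Conductances and speeds are neither bounded nor bounded away from zero. The edge lengths
  \<open>sqrt (min 1 (\<theta> / a))\<close> answer this twice: the bound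
  \<open>\<theta> / a\<close> makes \<open>c\<close> times a squared increment of the distance at
  most \<open>s\<close>, as energy estimates with cutoffs and weights require, and the bound 1 keeps
  \<open>cosh\<close> under control for large \<lambda>. Balls of this distance lie in lattice boxes
  by the first passage bound, which is the comparison the mean value inequality rests on. On a
  lattice De Giorgi's iteration must stop at unit scale; the gap is closed by a polynomial lower
  bound for the speed, read off the average of \<open>1 / s\<close>. Averages are controlled in
  boxes around a fixed \<open>x\<close> only, so the mean value constant at \<open>y\<close> carries
  a power of \<open>|x - y| / sqrt t\<close>, which part of the Gaussian factor absorbs. The
  constants of the statement must not depend on \<omega>: all averages are bounded by deterministic
  multiples of the volume, and only the scale from which this holds is random.\<close>

locale killed_walk =
 fixes W B :: "'s set" and c :: "'s => 's => real" and s :: "'s => real"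
 assumes finite_W: "finite W" and B_sub: "B \<subseteq> W"
  and c_sym: "c x y = c y x" and c_nonneg: "c x y >= 0"
  and s_pos: "x \<in> B ==> s x > 0"
begin

definition energy :: "('s => real) => ('s => real) => real" where
 "energy f g = (\<Sum>x\<in>W. \<Sum>y\<in>W. c x y * (f x - f y) * (g x - g y)) / 2"

text \<open>The sum runs over \<open>W\<close>, which in use contains all neighbours of
  \<open>B\<close>. The functions considered vanish off \<open>B\<close>, so steps into
  \<open>W - B\<close> act as killing.\<close>

definition lap :: "('s => real) => 's => real" where
 "lap f x = (\<Sum>y\<in>W. c x y * (f y - f x)) / s x"

text \<open>Two-sided derivatives at every real time, negative ones included, let the derivative
  criteria for monotonicity apply up to the end points of a time interval; positivity is asked for
  \<open>t >= 0\<close> only.\<close>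

definition heat_sol :: "(real => 's => real) => bool" where
 "heat_sol u \<longleftrightarrow> (\<forall>t x. x \<notin> B --> u t x = 0) \<and> (\<forall>t\<ge>0. \<forall>x. u t x >= 0)
  \<and> (\<forall>t. \<forall>x\<in>B. ((\<lambda>t. u t x) has_real_derivative lap (u t) x) (at t))"

lemma finite_B: "finite B" using finite_W B_sub finite_subset by blast

lemma sum_B_eq_W: "(\<And>x. x \<notin> B ==> g x = 0) ==> sum g B = sum g W"
 using finite_W B_sub by (intro sum.mono_neutral_left) auto

lemma energy_commute: "energy f g = energy g f" by (simp add: energy_def mult_ac)

lemma green:
 assumes g: "\<And>x. x \<notin> B ==> g x = 0"
 shows "(\<Sum>x\<in>B. s x * (g x * lap f x)) = - energy f g"
proof -
 let ?S = "\<Sum>x\<in>W. \<Sum>y\<in>W. c x y * (f y - f x) * g x"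
 have "(\<Sum>x\<in>B. s x * (g x * lap f x)) = (\<Sum>x\<in>B. \<Sum>y\<in>W. c x y * (f y - f x) * g x)"
 proof (intro sum.cong refl)
  fix x assume "x \<in> B"
  then have "s x * (g x * lap f x) = (\<Sum>y\<in>W. c x y * (f y - f x)) * g x"
   using s_pos[of x] by (simp add: lap_def)
  then show "s x * (g x * lap f x) = (\<Sum>y\<in>W. c x y * (f y - f x) * g x)" by (simp add: sum_distrib_right)
 qed
 also have "... = ?S" using g by (intro sum_B_eq_W) simp
 finally have 1: "(\<Sum>x\<in>B. s x * (g x * lap f x)) = ?S" .
 have 2: "?S = (\<Sum>x\<in>W. \<Sum>y\<in>W. c x y * (f x - f y) * g y)" by (subst sum.swap) (simp add: c_sym)
 have "2 * energy f g = (\<Sum>x\<in>W. \<Sum>y\<in>W. - (c x y * (f y - f x) * g x) - c x y * (f x - f y) * g y)"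
  unfolding energy_def by (simp add: sum_distrib_left algebra_simps)
 also have "... = - ?S - (\<Sum>x\<in>W. \<Sum>y\<in>W. c x y * (f x - f y) * g y)"
  by (simp add: sum_subtractf sum_negf)
 finally have "2 * energy f g = - ?S - ?S" using 2 by simp
 then show ?thesis using 1 by simp
qed

lemma heat_solD:
 assumes "heat_sol u"
 shows "x \<notin> B ==> u t x = 0" "t >= 0 ==> u t x >= 0"
  "x \<in> B ==> ((\<lambda>t. u t x) has_real_derivative lap (u t) x) (at t)"
 using assms by (auto simp: heat_sol_def)

text \<open>By \<open>green\<close> the derivative in \<open>r\<close> is a difference of two equal
  energies. This symmetry moves the evolution, and with it the starting point, from one factor to
  the other.\<close>

lemma duality:
 assumes u: "heat_sol u" and v: "heat_sol v"
 shows "(\<Sum>x\<in>B. s x * (u r x * v (t - r) x)) = (\<Sum>x\<in>B. s x * (u r' x * v (t - r') x))"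
proof -
 have "((\<lambda>r. \<Sum>x\<in>B. s x * (u r x * v (t - r) x)) has_real_derivative 0) (at r)" for r
 proof -
  have "((\<lambda>r. \<Sum>x\<in>B. s x * (u r x * v (t - r) x)) has_real_derivative
    (\<Sum>x\<in>B. s x * (v (t - r) x * lap (u r) x) - s x * (u r x * lap (v (t - r)) x))) (at r)"
  proof (rule DERIV_sum)
   fix x assume x: "x \<in> B"
   have v': "((\<lambda>r. v (t - r) x) has_real_derivative lap (v (t - r)) x * (- 1)) (at r)"
    by (rule DERIV_chain2[where f="\<lambda>t. v t x", OF heat_solD(3)[OF v x]]) (auto intro!: derivative_eq_intros)
   show "((\<lambda>r. s x * (u r x * v (t - r) x)) has_real_derivative
    s x * (v (t - r) x * lap (u r) x) - s x * (u r x * lap (v (t - r)) x)) (at r)"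
    by (rule derivative_eq_intros heat_solD(3)[OF u x] v' refl)+ (simp add: algebra_simps)
  qed
  also have "(\<Sum>x\<in>B. s x * (v (t - r) x * lap (u r) x) - s x * (u r x * lap (v (t - r)) x))
    = - energy (u r) (v (t - r)) + energy (v (t - r)) (u r)"
   using heat_solD(1)[OF u] heat_solD(1)[OF v] by (simp add: sum_subtractf green)
  finally show ?thesis by (simp add: energy_commute)
 qed
 then show ?thesis by (rule DERIV_isconst_all[rule_format])
qed

text \<open>Conjugation by a positive weight; only the cross terms differ from the energy of
  \<open>u * e\<close>. For \<open>e = exp \<psi>\<close> the last factor is
  \<open>2 * (cosh (\<psi> x - \<psi> y) - 1)\<close>.\<close>

lemma energy_transform:
 fixes e :: "'s => real"
 assumes "\<And>x. e x > 0"
 shows "energy u (\<lambda>x. u x * (e x)\<^sup>2) = energy (\<lambda>x. u x * e x) (\<lambda>x. u x * e x)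
  - (\<Sum>x\<in>W. \<Sum>y\<in>W. c x y * (u x * e x) * (u y * e y) * (e x / e y + e y / e x - 2)) / 2"
proof -
 have "c x y * (u x - u y) * (u x * (e x)\<^sup>2 - u y * (e y)\<^sup>2)
  = c x y * (u x * e x - u y * e y) * (u x * e x - u y * e y)
   - c x y * (u x * e x) * (u y * e y) * (e x / e y + e y / e x - 2)" for x y
  using assms[of x] assms[of y] by (simp add: field_simps power2_eq_square)
 then show ?thesis
  unfolding energy_def by (simp add: sum_subtractf diff_divide_distrib)
qed

text \<open>The same computation without division, for cutoffs that may vanish.\<close>

lemma energy_cutoff:
 "energy u (\<lambda>x. u x * (e x)\<^sup>2) = energy (\<lambda>x. u x * e x) (\<lambda>x. u x * e x)
  - (\<Sum>x\<in>W. \<Sum>y\<in>W. c x y * u x * u y * (e x - e y)\<^sup>2) / 2"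
proof -
 have "c x y * (u x - u y) * (u x * (e x)\<^sup>2 - u y * (e y)\<^sup>2)
  = c x y * (u x * e x - u y * e y) * (u x * e x - u y * e y)
   - c x y * u x * u y * (e x - e y)\<^sup>2" for x y by (simp add: field_simps power2_eq_square)
 then show ?thesis
  unfolding energy_def by (simp add: sum_subtractf diff_divide_distrib)
qed

lemma energy_nonneg: "energy f f >= 0"
 unfolding energy_def using c_nonneg by (auto intro!: sum_nonneg simp: mult.assoc)

text \<open>A Schur test: a quadratic form with symmetric nonnegative kernel is bounded by its row
  sums.\<close>

lemma sum_product_le:
 fixes v :: "'s => real"
 assumes w: "\<And>x y. w x y >= 0" "\<And>x y. w x y = w y x"
 shows "(\<Sum>x\<in>W. \<Sum>y\<in>W. w x y * v x * v y) <= (\<Sum>x\<in>W. \<Sum>y\<in>W. w x y * (v x)\<^sup>2)"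
proof -
 have "w x y * v x * v y <= w x y * (v x)\<^sup>2 / 2 + w x y * (v y)\<^sup>2 / 2" for x y
 proof -
  have "2 * (v x * v y) <= (v x)\<^sup>2 + (v y)\<^sup>2" using sum_squares_bound[of "v x" "v y"] by simp
  then have "w x y * (2 * (v x * v y)) <= w x y * ((v x)\<^sup>2 + (v y)\<^sup>2)" by (intro mult_left_mono w)
  then show ?thesis by (simp add: field_simps)
 qed
 then have "(\<Sum>x\<in>W. \<Sum>y\<in>W. w x y * v x * v y)
   <= (\<Sum>x\<in>W. \<Sum>y\<in>W. w x y * (v x)\<^sup>2 / 2) + (\<Sum>x\<in>W. \<Sum>y\<in>W. w x y * (v y)\<^sup>2 / 2)"
  unfolding sum.distrib[symmetric] by (intro sum_mono)
 also have "(\<Sum>x\<in>W. \<Sum>y\<in>W. w x y * (v y)\<^sup>2 / 2) = (\<Sum>x\<in>W. \<Sum>y\<in>W. w x y * (v x)\<^sup>2 / 2)"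
  by (subst sum.swap) (simp add: w(2))
 finally show ?thesis by (simp add: sum_divide_distrib[symmetric])
qed

text \<open>In the derivative of the weighted norm, \<open>energy_transform\<close> splits off a
  nonpositive term; the rest is a quadratic form with kernel \<open>2 * c * (cosh - 1)\<close>,
  which the Schur test reduces to the row sums bounded by \<open>h\<close>. Multiplication by
  \<open>exp (- 2 * h * t)\<close> then gives a nonincreasing function.\<close>

lemma davies:
 assumes u: "heat_sol u" and t: "t >= 0"
  and h: "\<And>x. x \<in> B ==> (\<Sum>y\<in>W. c x y * (cosh (\<psi> x - \<psi> y) - 1)) <= h * s x"
 shows "(\<Sum>x\<in>B. s x * (u t x * exp (\<psi> x))\<^sup>2) <= exp (2 * h * t) * (\<Sum>x\<in>B. s x * (u 0 x * exp (\<psi> x))\<^sup>2)"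
proof -
 define J where "J t = (\<Sum>x\<in>B. s x * (u t x * exp (\<psi> x))\<^sup>2)" for t
 define J' where "J' t = - 2 * energy (u t) (\<lambda>x. u t x * (exp (\<psi> x))\<^sup>2)" for t
 have J: "(J has_real_derivative J' t) (at t)" for t
 proof -
  have "(J has_real_derivative (\<Sum>x\<in>B. 2 * (s x * (u t x * (exp (\<psi> x))\<^sup>2 * lap (u t) x)))) (at t)"
   unfolding J_def
  proof (rule DERIV_sum)
   fix x assume x: "x \<in> B"
   show "((\<lambda>t. s x * (u t x * exp (\<psi> x))\<^sup>2) has_real_derivative
    2 * (s x * (u t x * (exp (\<psi> x))\<^sup>2 * lap (u t) x))) (at t)"
    by (rule derivative_eq_intros heat_solD(3)[OF u x] refl)+ (simp add: power2_eq_square)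
  qed
  also have "(\<Sum>x\<in>B. 2 * (s x * (u t x * (exp (\<psi> x))\<^sup>2 * lap (u t) x))) = J' t"
   unfolding sum_distrib_left[symmetric] J'_def using heat_solD(1)[OF u] by (subst green) auto
  finally show ?thesis .
 qed
 have J'_le: "J' t <= 2 * h * J t" for t
 proof -
  let ?v = "\<lambda>x. u t x * exp (\<psi> x)"
  let ?w = "\<lambda>x y. c x y * (2 * (cosh (\<psi> x - \<psi> y) - 1))"
  have ch: "exp (\<psi> x) / exp (\<psi> y) + exp (\<psi> y) / exp (\<psi> x) - 2 = 2 * (cosh (\<psi> x - \<psi> y) - 1)" for x y
   by (simp add: cosh_def exp_diff exp_minus field_simps)
  have "J' t = - 2 * energy ?v ?v + (\<Sum>x\<in>W. \<Sum>y\<in>W. ?w x y * ?v x * ?v y)"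
   unfolding J'_def by (subst energy_transform) (simp_all add: ch mult_ac)
  also have "... <= (\<Sum>x\<in>W. \<Sum>y\<in>W. ?w x y * ?v x * ?v y)" using energy_nonneg[of ?v] by simp
  also have "... <= (\<Sum>x\<in>W. \<Sum>y\<in>W. ?w x y * (?v x)\<^sup>2)"
  proof (intro sum_product_le)
   show "?w x y >= 0" for x y using c_nonneg[of x y] cosh_real_ge_1[of "\<psi> x - \<psi> y"] by simp
   show "?w x y = ?w y x" for x y using cosh_minus[of "\<psi> x - \<psi> y"] c_sym[of x y] by simp
  qed
  also have "... = (\<Sum>x\<in>B. \<Sum>y\<in>W. ?w x y * (?v x)\<^sup>2)"
   using heat_solD(1)[OF u] by (intro sum_B_eq_W[symmetric]) simp
  also have "... = (\<Sum>x\<in>B. 2 * (?v x)\<^sup>2 * (\<Sum>y\<in>W. c x y * (cosh (\<psi> x - \<psi> y) - 1)))"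
   by (intro sum.cong refl) (simp only: sum_distrib_left mult_ac)
  also have "... <= (\<Sum>x\<in>B. 2 * (?v x)\<^sup>2 * (h * s x))" using h by (intro sum_mono mult_left_mono) auto
  also have "... = 2 * h * J t" by (simp add: J_def sum_distrib_left mult_ac)
  finally show ?thesis .
 qed
 have "exp (- 2 * h * t) * J t <= exp (- 2 * h * 0) * J 0"
 proof (rule DERIV_nonpos_imp_nonincreasing[OF t])
  fix r :: real
  have "((\<lambda>t. exp (- 2 * h * t) * J t) has_real_derivative
    exp (- 2 * h * r) * (J' r - 2 * h * J r)) (at r)" by (rule derivative_eq_intros J refl)+ (simp add: algebra_simps)
  moreover have "exp (- 2 * h * r) * (J' r - 2 * h * J r) <= 0" using J'_le[of r] by (intro mult_nonneg_nonpos) auto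
  ultimately show "\<exists>y. ((\<lambda>t. exp (- 2 * h * t) * J t) has_real_derivative y) (at r) \<and> y <= 0" by blast
 qed
 then have "exp (2 * h * t) * (exp (- 2 * h * t) * J t) <= exp (2 * h * t) * J 0" by (intro mult_left_mono) auto
 then show ?thesis unfolding J_def by (simp add: mult.assoc[symmetric] exp_add[symmetric])
qed


section \<open>Truncated norms and De Giorgi's iteration\<close>

lemma pos_part_sq_deriv: "((\<lambda>z::real. (max 0 (z - k))\<^sup>2) has_real_derivative 2 * max 0 (z - k)) (at z)"
proof -
 consider "z < k" | "z > k" | "z = k" by linarith
 then show ?thesis
 proof cases
  case 1
  have "((\<lambda>z::real. 0) has_real_derivative 0) (at z)" by simp
  moreover have "\<forall>\<^sub>F x in nhds z. x < k" using 1 by (simp add: eventually_nhds_in_open order_less_imp_le eventually_nhds) (metis lessThan_iff open_lessThan)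
  then have "\<forall>\<^sub>F x in nhds z. (max 0 (x - k))\<^sup>2 = 0" by eventually_elim auto
  ultimately have "((\<lambda>z::real. (max 0 (z - k))\<^sup>2) has_real_derivative 0) (at z)"
   using DERIV_cong_ev[OF refl, of "\<lambda>x. (max 0 (x - k))\<^sup>2" "\<lambda>_. 0" z 0 0] by simp
  then show ?thesis using 1 by simp
 next
  case 2
  have "((\<lambda>z::real. (z - k)\<^sup>2) has_real_derivative 2 * (z - k)) (at z)"
   by (auto intro!: derivative_eq_intros)
  moreover have "\<forall>\<^sub>F x in nhds z. x > k" using 2 by (simp add: eventually_nhds) (metis greaterThan_iff open_greaterThan)
  then have "\<forall>\<^sub>F x in nhds z. (max 0 (x - k))\<^sup>2 = (x - k)\<^sup>2" by eventually_elim auto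
  ultimately have "((\<lambda>z::real. (max 0 (z - k))\<^sup>2) has_real_derivative 2 * (z - k)) (at z)"
   using DERIV_cong_ev[OF refl, of "\<lambda>x. (max 0 (x - k))\<^sup>2" "\<lambda>x. (x - k)\<^sup>2" z _ "2 * (z - k)"] by simp
  then show ?thesis using 2 by simp
 next
  case 3
  have "((\<lambda>h. ((max 0 (z + h - k))\<^sup>2 - (max 0 (z - k))\<^sup>2) / h) \<longlongrightarrow> 0) (at 0)"
  proof (rule Lim_null_comparison)
   show "\<forall>\<^sub>F h in at 0. norm (((max 0 (z + h - k))\<^sup>2 - (max 0 (z - k))\<^sup>2) / h) <= \<bar>h\<bar>"
    using 3 by (intro always_eventually) (auto simp: max_def power2_eq_square)
   show "((\<lambda>h::real. \<bar>h\<bar>) \<longlongrightarrow> 0) (at 0)" by (rule tendsto_eq_intros refl | simp)+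
  qed
  then show ?thesis using 3 by (simp add: DERIV_def)
 qed
qed

text \<open>Where the truncation above \<open>k\<^sub>1\<close> is nonzero,
  \<open>u - k\<^sub>0\<close> exceeds \<open>k\<^sub>1 - k\<^sub>0\<close>, so by Chebyshev's
  inequality the support is small enough for \<open>FK\<close>. The energy estimate becomes a linear
  differential inequality with damping rate \<open>2 / F\<close>. What was present at
  \<open>\<tau>\<^sub>0\<close> has decayed by \<open>\<tau>\<^sub>1\<close>, and a cutoff in space
  alone suffices.\<close>

lemma de_giorgi_step:
 fixes u :: "real => 's => real" and \<rho> :: "'s => real"
 assumes u: "heat_sol u" and tau: "0 <= \<tau>\<^sub>0" "\<tau>\<^sub>0 < \<tau>\<^sub>1" and r: "r\<^sub>1 + 4 <= r\<^sub>0"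
  and k: "0 <= k\<^sub>0" "k\<^sub>0 < k\<^sub>1" and F: "F > 0" and A: "A >= 0" and \<kappa>: "\<kappa> >= 0"
  and lip: "\<And>x y. x \<in> W ==> y \<in> W ==> c x y > 0 ==> \<bar>\<rho> x - \<rho> y\<bar> <= 1"
  and carre: "\<And>x. x \<in> B ==> (\<Sum>y\<in>W. c x y * (\<rho> x - \<rho> y)\<^sup>2) <= \<kappa> * s x"
  and init: "\<And>\<tau>. \<tau>\<^sub>0 <= \<tau> ==> \<tau> <= T ==> (\<Sum>x | x \<in> B \<and> \<rho> x < r\<^sub>0. s x * (max 0 (u \<tau> x - k\<^sub>0))\<^sup>2) <= A"
  and FK: "\<And>g. (\<And>x. g x >= 0) ==> (\<And>x. g x ~= 0 ==> x \<in> B \<and> \<rho> x < r\<^sub>0)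
   ==> (\<Sum>x | g x ~= 0. s x) <= A / (k\<^sub>1 - k\<^sub>0)\<^sup>2 ==> (\<Sum>x\<in>B. s x * (g x)\<^sup>2) <= F * energy g g"
  and \<tau>: "\<tau>\<^sub>1 <= \<tau>" "\<tau> <= T"
 shows "(\<Sum>x | x \<in> B \<and> \<rho> x < r\<^sub>1. s x * (max 0 (u \<tau> x - k\<^sub>1))\<^sup>2)
  <= A * (F / (2 * (\<tau>\<^sub>1 - \<tau>\<^sub>0)) + 2 * \<kappa> * F / ((r\<^sub>0 - r\<^sub>1) / 2)\<^sup>2)"
proof -
 define gap where "gap = (r\<^sub>0 - r\<^sub>1) / 2"
 have gap: "gap >= 2" using r by (simp add: gap_def)
 \<comment> \<open>The cutoff already vanishes where \<open>\<rho> x >= r\<^sub>0 - 1\<close>. As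
   \<open>\<rho>\<close> changes by at most 1 along an edge, both ends of an edge that meets the
   support of \<open>e\<close> satisfy \<open>\<rho> < r\<^sub>0\<close>.\<close>
 define e where "e x = max 0 (min 1 ((r\<^sub>0 - 1 - \<rho> x) / gap))" for x
 have e01: "0 <= e x" "e x <= 1" for x by (auto simp: e_def)
 have e_supp: "\<rho> x < r\<^sub>0 - 1" if "e x ~= 0" for x
  proof -
  have "0 < (r\<^sub>0 - 1 - \<rho> x) / gap" using that unfolding e_def by linarith
  then show ?thesis using gap by (simp add: zero_less_divide_iff)
 qed
 have e_1: "e x = 1" if "\<rho> x < r\<^sub>1" for x
 proof -
  have "1 <= (r\<^sub>0 - 1 - \<rho> x) / gap" using that gap r by (simp add: gap_def field_simps)
  then show ?thesis by (simp add: e_def)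
 qed
 have e_lip: "(e x - e y)\<^sup>2 <= (\<rho> x - \<rho> y)\<^sup>2 / gap\<^sup>2" for x y
 proof -
  have "\<bar>e x - e y\<bar> <= \<bar>(r\<^sub>0 - 1 - \<rho> x) / gap - (r\<^sub>0 - 1 - \<rho> y) / gap\<bar>"
   unfolding e_def by linarith
  also have "... = \<bar>(\<rho> x - \<rho> y) / gap\<bar>" by (simp add: diff_divide_distrib abs_minus_commute)
  finally have "(e x - e y)\<^sup>2 <= ((\<rho> x - \<rho> y) / gap)\<^sup>2" by (simp only: abs_le_square_iff)
  then show ?thesis by (simp add: power_divide)
 qed
 define w where "w \<tau> x = max 0 (u \<tau> x - k\<^sub>1)" for \<tau> x
 have w0: "w \<tau> x >= 0" for \<tau> x by (simp add: w_def)
 have w_off: "w \<tau> x = 0" if "x \<notin> B" for \<tau> x using heat_solD(1)[OF u that] k by (simp add: w_def)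
 define \<Phi> where "\<Phi> \<tau> = (\<Sum>x\<in>B. s x * (w \<tau> x * e x)\<^sup>2)" for \<tau>
 define \<Phi>' where "\<Phi>' \<tau> = - 2 * energy (u \<tau>) (\<lambda>x. w \<tau> x * (e x)\<^sup>2)" for \<tau>
 have \<Phi>: "(\<Phi> has_real_derivative \<Phi>' t) (at t)" for t
 proof -
  have "(\<Phi> has_real_derivative (\<Sum>x\<in>B. 2 * (s x * (w t x * (e x)\<^sup>2 * lap (u t) x)))) (at t)"
   unfolding \<Phi>_def
  proof (rule DERIV_sum)
   fix x assume x: "x \<in> B"
   have d: "((\<lambda>t. (max 0 (u t x - k\<^sub>1))\<^sup>2) has_real_derivative 2 * max 0 (u t x - k\<^sub>1) * lap (u t) x) (at t)"
    by (rule DERIV_chain2[OF pos_part_sq_deriv heat_solD(3)[OF u x]])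
   show "((\<lambda>t. s x * (w t x * e x)\<^sup>2) has_real_derivative 2 * (s x * (w t x * (e x)\<^sup>2 * lap (u t) x))) (at t)"
    unfolding w_def power_mult_distrib by (rule derivative_eq_intros d refl)+ (simp add: power2_eq_square)
  qed
  also have "(\<Sum>x\<in>B. 2 * (s x * (w t x * (e x)\<^sup>2 * lap (u t) x))) = \<Phi>' t"
   unfolding sum_distrib_left[symmetric] \<Phi>'_def using w_off by (subst green) auto
  finally show ?thesis .
 qed
 have \<Phi>'_le: "\<Phi>' t <= - (2 / F) * \<Phi> t + 4 * \<kappa> * A / (4 * gap\<^sup>2)" if t: "\<tau>\<^sub>0 <= t" "t <= T" for t
 proof -
  let ?g = "\<lambda>x. w t x * e x"
  \<comment> \<open>Truncation lowers the form edge by edge: the increments of \<open>w\<close> and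
    \<open>u\<close> agree if both ends lie above \<open>k\<^sub>1\<close>; if only one does, the
    increment of \<open>u\<close> is the larger in modulus and has the sign of the test
    increment.\<close>
  have "energy (w t) (\<lambda>x. w t x * (e x)\<^sup>2) <= energy (u t) (\<lambda>x. w t x * (e x)\<^sup>2)"
   unfolding energy_def
  proof (intro divide_right_mono sum_mono)
   fix x y
   have "(w t x - w t y) * (w t x * (e x)\<^sup>2 - w t y * (e y)\<^sup>2) <= (u t x - u t y) * (w t x * (e x)\<^sup>2 - w t y * (e y)\<^sup>2)"
   proof (cases "u t x > k\<^sub>1"; cases "u t y > k\<^sub>1")
    assume a: "u t x > k\<^sub>1" "\<not> u t y > k\<^sub>1"
    then have "w t y = 0" "w t x <= u t x - u t y" by (auto simp: w_def)
    then show ?thesis using w0[of t x] by (auto intro!: mult_right_mono)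
   next
    assume a: "\<not> u t x > k\<^sub>1" "u t y > k\<^sub>1"
    then have "w t x = 0" "w t y <= u t y - u t x" by (auto simp: w_def)
    then show ?thesis using w0[of t y] mult_right_mono[of "w t y" "u t y - u t x" "w t y * (e y)\<^sup>2"]
     by (simp add: algebra_simps)
   qed (auto simp: w_def)
   then show "c x y * (w t x - w t y) * (w t x * (e x)\<^sup>2 - w t y * (e y)\<^sup>2)
    <= c x y * (u t x - u t y) * (w t x * (e x)\<^sup>2 - w t y * (e y)\<^sup>2)"
    unfolding mult.assoc using c_nonneg by (intro mult_left_mono)
  qed simp
  then have 1: "\<Phi>' t <= - 2 * energy ?g ?g + (\<Sum>x\<in>W. \<Sum>y\<in>W. c x y * w t x * w t y * (e x - e y)\<^sup>2)"
   unfolding \<Phi>'_def by (subst (asm) energy_cutoff) simp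
  define D where "D = {x. x \<in> B \<and> \<rho> x < r\<^sub>0}"
  \<comment> \<open>Restricting to \<open>D\<close> before the Schur test is what lets
    \<open>init\<close> bound the resulting sum.\<close>
  have "(\<Sum>x\<in>W. \<Sum>y\<in>W. c x y * w t x * w t y * (e x - e y)\<^sup>2)
    = (\<Sum>x\<in>W. \<Sum>y\<in>W. (c x y * (e x - e y)\<^sup>2) * (w t x * indicator D x) * (w t y * indicator D y))"
  proof (intro sum.cong refl)
   fix x y assume xy: "x \<in> W" "y \<in> W"
   have "x \<in> D \<and> y \<in> D" if "c x y * w t x * w t y * (e x - e y)\<^sup>2 ~= 0"
   proof -
    from that have "c x y > 0" "x \<in> B" "y \<in> B" "e x ~= 0 \<or> e y ~= 0"
     using c_nonneg[of x y] w_off by (auto simp: less_eq_real_def)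
    moreover have "\<bar>\<rho> x - \<rho> y\<bar> <= 1" using lip xy \<open>c x y > 0\<close> by blast
    ultimately show ?thesis using e_supp[of x] e_supp[of y] unfolding D_def by auto
   qed
   then show "c x y * w t x * w t y * (e x - e y)\<^sup>2
    = (c x y * (e x - e y)\<^sup>2) * (w t x * indicator D x) * (w t y * indicator D y)"
    by (cases "c x y * w t x * w t y * (e x - e y)\<^sup>2 = 0") (auto simp: mult_ac)
  qed
  also have "... <= (\<Sum>x\<in>W. \<Sum>y\<in>W. (c x y * (e x - e y)\<^sup>2) * (w t x * indicator D x)\<^sup>2)"
   using c_nonneg c_sym by (intro sum_product_le) (auto simp: power2_commute)
  also have "... = (\<Sum>x\<in>B. \<Sum>y\<in>W. (c x y * (e x - e y)\<^sup>2) * (w t x * indicator D x)\<^sup>2)"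
   using w_off by (intro sum_B_eq_W[symmetric]) simp
  also have "... <= (\<Sum>x\<in>B. \<kappa> / gap\<^sup>2 * (s x * (w t x * indicator D x)\<^sup>2))"
  proof (rule sum_mono)
   fix x assume x: "x \<in> B"
   have "(\<Sum>y\<in>W. c x y * (e x - e y)\<^sup>2) <= (\<Sum>y\<in>W. c x y * ((\<rho> x - \<rho> y)\<^sup>2 / gap\<^sup>2))"
    using c_nonneg e_lip by (intro sum_mono mult_left_mono)
   also have "... = (\<Sum>y\<in>W. c x y * (\<rho> x - \<rho> y)\<^sup>2) / gap\<^sup>2"
    by (simp add: sum_divide_distrib)
   also have "... <= \<kappa> * s x / gap\<^sup>2" using carre[OF x] by (intro divide_right_mono) auto
   finally have "(\<Sum>y\<in>W. c x y * (e x - e y)\<^sup>2) * (w t x * indicator D x)\<^sup>2 <= \<kappa> * s x / gap\<^sup>2 * (w t x * indicator D x)\<^sup>2"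
    by (intro mult_right_mono) auto
   then show "(\<Sum>y\<in>W. (c x y * (e x - e y)\<^sup>2) * (w t x * indicator D x)\<^sup>2) <= \<kappa> / gap\<^sup>2 * (s x * (w t x * indicator D x)\<^sup>2)"
    by (simp add: sum_distrib_right)
  qed
  also have "... = \<kappa> / gap\<^sup>2 * (\<Sum>x\<in>D. s x * (w t x)\<^sup>2)"
   unfolding sum_distrib_left[symmetric] D_def using finite_B
   by (intro arg_cong[where f="\<lambda>z. _ * z"] sum.mono_neutral_cong_right) (auto simp: indicator_def)
  also have "... <= \<kappa> / gap\<^sup>2 * A"
  proof (rule mult_left_mono)
   have "(\<Sum>x\<in>D. s x * (w t x)\<^sup>2) <= (\<Sum>x\<in>D. s x * (max 0 (u t x - k\<^sub>0))\<^sup>2)"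
    using k s_pos unfolding w_def D_def by (intro sum_mono mult_left_mono power_mono) (auto simp: less_imp_le)
   also have "... <= A" using init[OF t] unfolding D_def .
   finally show "(\<Sum>x\<in>D. s x * (w t x)\<^sup>2) <= A" .
   show "0 <= \<kappa> / gap\<^sup>2" using \<kappa> by simp
  qed
  finally have 2: "(\<Sum>x\<in>W. \<Sum>y\<in>W. c x y * w t x * w t y * (e x - e y)\<^sup>2) <= \<kappa> / gap\<^sup>2 * A" .
  have "\<Phi> t <= F * energy ?g ?g"
   unfolding \<Phi>_def
  proof (rule FK)
   show "0 <= w t x * e x" for x using w0 e01 by simp
   show supp: "x \<in> B \<and> \<rho> x < r\<^sub>0" if "w t x * e x ~= 0" for x
    using that w_off[of x t] e_supp[of x] by auto
   have *: "(k\<^sub>1 - k\<^sub>0)\<^sup>2 * (\<Sum>x | w t x * e x ~= 0. s x) <= A"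
   proof -
    have "(k\<^sub>1 - k\<^sub>0)\<^sup>2 * (\<Sum>x | w t x * e x ~= 0. s x) = (\<Sum>x | w t x * e x ~= 0. s x * (k\<^sub>1 - k\<^sub>0)\<^sup>2)"
     by (simp add: sum_distrib_left mult_ac)
    also have "... <= (\<Sum>x | w t x * e x ~= 0. s x * (max 0 (u t x - k\<^sub>0))\<^sup>2)"
    proof (rule sum_mono)
     fix x assume "x \<in> {x. w t x * e x ~= 0}"
     then have x: "w t x ~= 0" "x \<in> B" using supp[of x] by auto
     then have "k\<^sub>1 - k\<^sub>0 <= max 0 (u t x - k\<^sub>0)" by (auto simp: w_def max_def split: if_splits)
     then show "s x * (k\<^sub>1 - k\<^sub>0)\<^sup>2 <= s x * (max 0 (u t x - k\<^sub>0))\<^sup>2"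
      using k s_pos[OF x(2)] by (intro mult_left_mono power_mono) auto
    qed
    also have "... <= (\<Sum>x\<in>D. s x * (max 0 (u t x - k\<^sub>0))\<^sup>2)"
     using supp finite_B s_pos unfolding D_def by (intro sum_mono2) (auto intro!: mult_nonneg_nonneg simp: less_imp_le)
    also have "... <= A" using init[OF t] unfolding D_def .
    finally show ?thesis .
   qed
   show "(\<Sum>x | w t x * e x ~= 0. s x) <= A / (k\<^sub>1 - k\<^sub>0)\<^sup>2"
    using * k by (simp add: field_simps)
  qed
  then have "2 / F * \<Phi> t <= 2 * energy ?g ?g" using F by (simp add: field_simps)
  then show ?thesis using 1 2 by (simp add: algebra_simps)
 qed
 \<comment> \<open>The equilibrium of the linear differential inequality, so that
   \<open>exp (2 / F * t) * (\<Phi> t - q)\<close> is nonincreasing.\<close>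
 define q where "q = F / 2 * (4 * \<kappa> * A / (4 * gap\<^sup>2))"
 define Z where "Z t = exp (2 / F * t) * (\<Phi> t - q)" for t
 have q: "q >= 0" using F A \<kappa> by (simp add: q_def)
 have "Z \<tau> <= Z \<tau>\<^sub>0"
 proof (rule DERIV_nonpos_imp_nonincreasing[where f=Z])
  show "\<tau>\<^sub>0 <= \<tau>" using tau \<tau> by simp
  fix r assume r: "\<tau>\<^sub>0 <= r" "r <= \<tau>"
  have "(Z has_real_derivative exp (2 / F * r) * (\<Phi>' r + 2 / F * (\<Phi> r - q))) (at r)"
   unfolding Z_def by (rule derivative_eq_intros \<Phi> refl)+ (simp add: algebra_simps)
  moreover have "\<Phi>' r + 2 / F * (\<Phi> r - q) <= 0"
   using \<Phi>'_le[of r] r \<tau> F by (simp add: q_def algebra_simps)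
  then have "exp (2 / F * r) * (\<Phi>' r + 2 / F * (\<Phi> r - q)) <= 0" by (intro mult_nonneg_nonpos) auto
  ultimately show "\<exists>y. (Z has_real_derivative y) (at r) \<and> y <= 0" by blast
 qed
 also have "... <= exp (2 / F * \<tau>\<^sub>0) * \<Phi> \<tau>\<^sub>0"
  unfolding Z_def using q by (intro mult_left_mono) auto
 finally have "\<Phi> \<tau> - q <= exp (2 / F * \<tau>\<^sub>0) * \<Phi> \<tau>\<^sub>0 / exp (2 / F * \<tau>)"
  unfolding Z_def by (simp add: pos_le_divide_eq mult.commute)
 also have "... = exp (2 / F * \<tau>\<^sub>0 - 2 / F * \<tau>) * \<Phi> \<tau>\<^sub>0" by (simp add: exp_diff)
 also have "2 / F * \<tau>\<^sub>0 - 2 / F * \<tau> = - (2 / F * (\<tau> - \<tau>\<^sub>0))" by (simp only: right_diff_distrib)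
 finally have "\<Phi> \<tau> <= q + exp (- (2 / F * (\<tau> - \<tau>\<^sub>0))) * \<Phi> \<tau>\<^sub>0" by linarith
 also have "exp (- (2 / F * (\<tau> - \<tau>\<^sub>0))) * \<Phi> \<tau>\<^sub>0 <= F / (2 * (\<tau>\<^sub>1 - \<tau>\<^sub>0)) * A"
 proof (intro mult_mono)
  \<comment> \<open>The exponential decay enters only through \<open>exp (- z) <= 1 / z\<close>,
    which makes the bound linear in \<open>F\<close>.\<close>
  define z where "z = 2 / F * (\<tau>\<^sub>1 - \<tau>\<^sub>0)"
  have z: "z > 0" using F tau by (simp add: z_def)
  have "exp (- (2 / F * (\<tau> - \<tau>\<^sub>0))) <= exp (- z)"
   using \<tau> F by (simp add: z_def divide_right_mono)
  also have "... <= 1 / z"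
  proof -
   have "z <= exp z" using exp_ge_add_one_self[of z] by linarith
   then show ?thesis using z by (simp add: exp_minus field_simps)
  qed
  also have "1 / z = F / (2 * (\<tau>\<^sub>1 - \<tau>\<^sub>0))" by (simp add: z_def)
  finally show "exp (- (2 / F * (\<tau> - \<tau>\<^sub>0))) <= F / (2 * (\<tau>\<^sub>1 - \<tau>\<^sub>0))" .
  have "\<Phi> \<tau>\<^sub>0 <= (\<Sum>x\<in>B. if \<rho> x < r\<^sub>0 then s x * (max 0 (u \<tau>\<^sub>0 x - k\<^sub>0))\<^sup>2 else 0)"
   unfolding \<Phi>_def
  proof (rule sum_mono)
   fix x assume x: "x \<in> B"
   show "s x * (w \<tau>\<^sub>0 x * e x)\<^sup>2 <= (if \<rho> x < r\<^sub>0 then s x * (max 0 (u \<tau>\<^sub>0 x - k\<^sub>0))\<^sup>2 else 0)"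
   proof (cases "\<rho> x < r\<^sub>0")
    case True
    have "w \<tau>\<^sub>0 x * e x <= w \<tau>\<^sub>0 x * 1" using e01 w0 by (intro mult_left_mono) auto
    also have "... <= max 0 (u \<tau>\<^sub>0 x - k\<^sub>0)" using k by (simp add: w_def)
    finally show ?thesis using True s_pos[OF x] e01 w0 by (auto intro!: mult_left_mono power_mono)
   next
    case False
    then have "e x = 0" using e_supp[of x] by force
    then show ?thesis using False by simp
   qed
  qed
  also have "... = (\<Sum>x | x \<in> B \<and> \<rho> x < r\<^sub>0. s x * (max 0 (u \<tau>\<^sub>0 x - k\<^sub>0))\<^sup>2)"
   using finite_B by (intro sum.mono_neutral_cong_right) auto
  also have "... <= A" using init[of \<tau>\<^sub>0] tau \<tau> by simp
  finally show "\<Phi> \<tau>\<^sub>0 <= A" .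
  show "0 <= \<Phi> \<tau>\<^sub>0" unfolding \<Phi>_def using s_pos by (auto intro!: sum_nonneg mult_nonneg_nonneg simp: less_imp_le)
 qed (use F tau in auto)
 finally have \<Phi>_le: "\<Phi> \<tau> <= q + F / (2 * (\<tau>\<^sub>1 - \<tau>\<^sub>0)) * A" by simp
 have "(\<Sum>x | x \<in> B \<and> \<rho> x < r\<^sub>1. s x * (max 0 (u \<tau> x - k\<^sub>1))\<^sup>2) = (\<Sum>x | x \<in> B \<and> \<rho> x < r\<^sub>1. s x * (w \<tau> x * e x)\<^sup>2)"
  by (intro sum.cong refl) (simp add: w_def e_1)
 also have "... <= \<Phi> \<tau>"
  unfolding \<Phi>_def using finite_B s_pos by (intro sum_mono2) (auto intro!: mult_nonneg_nonneg simp: less_imp_le)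
 also note \<Phi>_le
 also have "q + F / (2 * (\<tau>\<^sub>1 - \<tau>\<^sub>0)) * A <= A * (F / (2 * (\<tau>\<^sub>1 - \<tau>\<^sub>0)) + 2 * \<kappa> * F / gap\<^sup>2)"
 proof -
  have "0 <= \<kappa> * A * F / gap\<^sup>2" using \<kappa> A F by simp
  then show ?thesis unfolding q_def by (simp add: algebra_simps)
 qed
 finally show ?thesis unfolding gap_def .
qed

text \<open>Levels, radii and times approach their limits at rate \<open>2 ^ (- j)\<close>, and the
  bound \<open>A j\<close> drops by the factor \<open>b\<close> per step. A cutoff needs a radius
  gap of 4, so the iteration ends when \<open>2 ^ j\<close> reaches the order of
  \<open>R / 8\<close>. The last bound is compared with the single term at \<open>x\<close>;
  \<open>sx\<close> allows \<open>s x\<close> to be as small as a power of \<open>1 / R\<close>. In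
  \<open>b\<close> the first factor ensures \<open>(4 / b) powr \<epsilon> * 4 <= 1\<close>, which
  offsets the growth \<open>4 ^ j\<close> of the reciprocal squared gaps, and the second produces
  the power \<open>m\<close>.\<close>

lemma mean_value:
 fixes u :: "real => 's => real" and \<rho> :: "'s => real" and m :: nat
  and \<epsilon> \<kappa> CF V S R T y0 :: real
 defines "b \<equiv> 4 powr (1 + 1 / \<epsilon>) * 2 ^ m"
 assumes u: "heat_sol u" and \<kappa>: "\<kappa> >= 0" and \<epsilon>: "\<epsilon> > 0" and CF: "CF > 0" and V: "V > 0" and S: "S > 0"
  and R: "R >= 8" and T: "T >= R\<^sup>2"
  and lip: "\<And>x y. x \<in> W ==> y \<in> W ==> c x y > 0 ==> \<bar>\<rho> x - \<rho> y\<bar> <= 1"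
  and carre: "\<And>x. x \<in> B ==> (\<Sum>y\<in>W. c x y * (\<rho> x - \<rho> y)\<^sup>2) <= \<kappa> * s x"
  and FK: "\<And>g. (\<And>x. g x >= 0) ==> (\<And>x. g x ~= 0 ==> x \<in> B \<and> \<rho> x < R)
   ==> (\<Sum>x\<in>B. s x * (g x)\<^sup>2) <= CF * R\<^sup>2 * ((\<Sum>x | g x ~= 0. s x) / V) powr \<epsilon> * energy g g"
  and init: "\<And>\<tau>. T - R\<^sup>2 <= \<tau> ==> \<tau> <= T ==> (\<Sum>x | x \<in> B \<and> \<rho> x < R. s x * (u \<tau> x)\<^sup>2) <= S"
  and y0: "y0 > 0" "CF * (4 * y0) powr \<epsilon> * (1 + 32 * \<kappa>) * 4 * b <= 1"
  and x: "x \<in> B" "\<rho> x <= R / 2" and sx: "V * y0 * (16 / R) ^ m <= s x"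
 shows "(u T x)\<^sup>2 <= 4 * S / (V * y0)"
proof -
 \<comment> \<open>Then \<open>A 0 = S\<close>, and the argument ends with
   \<open>u T x <= 2 * M\<close>.\<close>
 define M where "M = sqrt (S / (V * y0))"
 have M: "M > 0" using S V y0 by (simp add: M_def)
 have MS: "M\<^sup>2 * V * y0 = S" using S V y0 by (simp add: M_def)
 have b: "b > 0" "b >= 2 ^ m"
 proof -
  have "1 <= (4::real) powr (1 + 1 / \<epsilon>)" using \<epsilon> by (intro ge_one_powr_ge_zero) auto
  then show "b >= 2 ^ m" unfolding b_def by (simp add: mult_le_cancel_right1)
  then show "b > 0" by (smt (verit) zero_less_power)
 qed
 have b4: "(4 / b) powr \<epsilon> * 4 <= 1"
 proof -
  have "(4 / b) powr \<epsilon> <= (4 / 4 powr (1 + 1 / \<epsilon>)) powr \<epsilon>"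
  proof (rule powr_mono2)
   have "4 powr (1 + 1 / \<epsilon>) * 1 <= b" unfolding b_def by (intro mult_left_mono) auto
   then show "4 / b <= 4 / 4 powr (1 + 1 / \<epsilon>)" by (intro divide_left_mono) (use b in auto)
  qed (use \<epsilon> b in auto)
  also have "4 / 4 powr (1 + 1 / \<epsilon>) = (4::real) powr (- (1 / \<epsilon>))"
   using powr_diff[of "4::real" 1 "1 + 1 / \<epsilon>"] by simp
  also have "... powr \<epsilon> = 4 powr (-1)" using \<epsilon> by (simp add: powr_powr)
  finally show ?thesis by (simp add: powr_minus)
 qed
 define k where "k j = M * (1 - 1 / 2 ^ j)" for j :: nat
 define r where "r j = R * (1 / 2 + 1 / 2 ^ (j + 1))" for j :: nat
 define \<tau> where "\<tau> j = T - R\<^sup>2 * (1 / 2 + 1 / 2 ^ (j + 1))" for j :: nat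
 define A where "A j = M\<^sup>2 * V * y0 / b ^ j" for j :: nat
 have A: "A j > 0" for j using M V y0 b by (simp add: A_def)
 have main: "\<tau> j <= t ==> t <= T ==> (\<Sum>x | x \<in> B \<and> \<rho> x < r j. s x * (max 0 (u t x - k j))\<^sup>2) <= A j"
  if "2 ^ j <= R / 8" for j t using that
 proof (induction j arbitrary: t)
  case 0
  have "max 0 (u t x) = u t x" if "x \<in> B" for x
  proof -
   have "T - R\<^sup>2 >= 0" using T by simp
   then have "t >= 0" using 0 by (simp add: \<tau>_def)
   then show ?thesis using heat_solD(2)[OF u] by simp
  qed
  then have "(\<Sum>x | x \<in> B \<and> \<rho> x < r 0. s x * (max 0 (u t x - k 0))\<^sup>2) = (\<Sum>x | x \<in> B \<and> \<rho> x < R. s x * (u t x)\<^sup>2)"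
   by (intro sum.cong) (auto simp: r_def k_def)
  also have "... <= S" using 0 by (intro init) (auto simp: \<tau>_def)
  finally show ?case using MS by (simp add: A_def)
 next
  case (Suc j)
  have pow: "(2::real) ^ j > 0" "(2::real) ^ j * 16 <= R" using Suc.prems(3) by auto
  define F where "F = CF * R\<^sup>2 * (A j / (k (Suc j) - k j)\<^sup>2 / V) powr \<epsilon>"
  have kk: "k (Suc j) - k j = M / 2 ^ (j + 1)" by (simp add: k_def field_simps)
  have rr: "r j - r (Suc j) = R / 2 ^ (j + 2)" by (simp add: r_def field_simps)
  have tt: "\<tau> (Suc j) - \<tau> j = R\<^sup>2 / 2 ^ (j + 2)" by (simp add: \<tau>_def field_simps)
  have F: "F > 0" using CF R A[of j] M V kk by (simp add: F_def)
  have "(\<Sum>x | x \<in> B \<and> \<rho> x < r (Suc j). s x * (max 0 (u t x - k (Suc j)))\<^sup>2)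
   <= A j * (F / (2 * (\<tau> (Suc j) - \<tau> j)) + 2 * \<kappa> * F / ((r j - r (Suc j)) / 2)\<^sup>2)"
  proof -
   have half: "1 / 2 + 1 / 2 ^ (j + 1) <= (1::real)" using one_le_power[of "2::real" j] by (simp add: field_simps)
   then have "R\<^sup>2 * (1 / 2 + 1 / 2 ^ (j + 1)) <= R\<^sup>2 * 1" by (intro mult_left_mono) auto
   then have 1: "0 <= \<tau> j" using T unfolding \<tau>_def by linarith
   have "0 < R\<^sup>2 / 2 ^ (j + 2)" using R by simp
   then have 2: "\<tau> j < \<tau> (Suc j)" using tt by linarith
   have "4 <= R / 2 ^ (j + 2)" using pow by (simp add: field_simps)
   then have 3: "r (Suc j) + 4 <= r j" using rr by simp
   have 4: "0 <= k j" using M by (simp add: k_def)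
   have "0 < M / 2 ^ (j + 1)" using M by simp
   then have 5: "k j < k (Suc j)" using kk by linarith
   have 6: "0 <= A j" by (rule less_imp_le[OF A])
   have 7: "(\<Sum>x | x \<in> B \<and> \<rho> x < r j. s x * (max 0 (u t x - k j))\<^sup>2) <= A j" if "\<tau> j <= t" "t <= T" for t
   proof -
    have "2 ^ j <= R / 8" using pow by linarith
    then show ?thesis using that by (intro Suc.IH) auto
   qed
   have 8: "(\<Sum>x\<in>B. s x * (g x)\<^sup>2) <= F * energy g g"
    if g: "\<And>x. g x >= 0" "\<And>x. g x ~= 0 ==> x \<in> B \<and> \<rho> x < r j" "(\<Sum>x | g x ~= 0. s x) <= A j / (k (Suc j) - k j)\<^sup>2"
    for g :: "'s => real"
   proof -
    have "r j <= R * 1" unfolding r_def using R half by (intro mult_left_mono) auto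
    then have r_le: "r j <= R" by simp
    have "(\<Sum>x\<in>B. s x * (g x)\<^sup>2) <= CF * R\<^sup>2 * ((\<Sum>x | g x ~= 0. s x) / V) powr \<epsilon> * energy g g"
     by (intro FK g(1)) (meson g(2) less_le_trans r_le)
    also have "... <= F * energy g g"
    proof (rule mult_right_mono[OF _ energy_nonneg])
     have "(\<Sum>x | g x ~= 0. s x) / V <= A j / (k (Suc j) - k j)\<^sup>2 / V"
      using g(3) V by (intro divide_right_mono) auto
     moreover have "0 <= (\<Sum>x | g x ~= 0. s x)" using s_pos g(2) by (intro sum_nonneg) (auto simp: less_imp_le)
     ultimately show "CF * R\<^sup>2 * ((\<Sum>x | g x ~= 0. s x) / V) powr \<epsilon> <= F"
      unfolding F_def using CF V \<epsilon> by (intro mult_left_mono powr_mono2) auto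
    qed
    finally show ?thesis .
   qed
   show ?thesis
    by (rule de_giorgi_step[where \<tau>\<^sub>0 = "\<tau> j" and k\<^sub>0 = "k j" and r\<^sub>0 = "r j" and A = "A j" and F = F and \<rho> = \<rho>,
     OF u 1 2 3 4 5 F 6 \<kappa> lip carre 7 8 Suc.prems(1,2)])
  qed
  also have "F / (2 * (\<tau> (Suc j) - \<tau> j)) + 2 * \<kappa> * F / ((r j - r (Suc j)) / 2)\<^sup>2 <= 1 / b"
  proof -
   have "F / (2 * (\<tau> (Suc j) - \<tau> j)) + 2 * \<kappa> * F / ((r j - r (Suc j)) / 2)\<^sup>2 = F / R\<^sup>2 * (2 * 2 ^ j + 128 * \<kappa> * 4 ^ j)"
   proof -
    define p where "p = (2::real) ^ j"
    have p: "p > 0" "(2::real) ^ (j + 2) = 4 * p" "(4::real) ^ j = p * p" "2 ^ j = p"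
     by (simp_all add: p_def power_mult_distrib[symmetric])
    show ?thesis unfolding rr tt p using R p(1) by (simp add: field_simps power2_eq_square)
   qed
   also have "... <= F / R\<^sup>2 * (4 * (1 + 32 * \<kappa>) * 4 ^ j)"
   proof (rule mult_left_mono)
    have "(2::real) ^ j <= 4 ^ j" "0 <= (4::real) ^ j" by (auto intro: power_mono)
    then have "2 * 2 ^ j <= 4 * (4::real) ^ j" by linarith
    then show "2 * 2 ^ j + 128 * \<kappa> * 4 ^ j <= 4 * (1 + 32 * \<kappa>) * 4 ^ j" by (simp add: algebra_simps)
   qed (use F in auto)
   also have "F / R\<^sup>2 = CF * (4 * y0 * (4 / b) ^ j) powr \<epsilon>"
   proof -
    define p where "p = (2::real) ^ j"
    have p: "p > 0" "(2::real) ^ (j + 1) = 2 * p" "(4::real) ^ j = p * p"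
     by (simp_all add: p_def power_mult_distrib[symmetric])
    have "A j / (k (Suc j) - k j)\<^sup>2 / V = 4 * y0 * (4 / b) ^ j"
     unfolding kk A_def power_divide p using M V b p(1) by (simp add: field_simps power2_eq_square)
    then show ?thesis unfolding F_def using R by simp
   qed
   also have "... = CF * (4 * y0) powr \<epsilon> * ((4 / b) powr \<epsilon>) ^ j"
   proof -
    have "((4 / b) ^ j) powr \<epsilon> = ((4 / b) powr \<epsilon>) ^ j"
     using b(1) by (simp add: powr_powr powr_realpow[symmetric] mult.commute del: powr_realpow)
    then show ?thesis using b y0 by (simp add: powr_mult mult_ac)
   qed
   also have "... * (4 * (1 + 32 * \<kappa>) * 4 ^ j) = CF * (4 * y0) powr \<epsilon> * (1 + 32 * \<kappa>) * 4 * ((4 / b) powr \<epsilon> * 4) ^ j"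
    by (simp add: power_mult_distrib mult_ac)
   also have "... <= CF * (4 * y0) powr \<epsilon> * (1 + 32 * \<kappa>) * 4 * 1"
    using b4 CF \<kappa> by (intro mult_left_mono power_le_one) auto
   also have "... <= 1 / b" using y0(2) b(1) by (simp add: field_simps)
   finally show ?thesis .
  qed
  then have "A j * (F / (2 * (\<tau> (Suc j) - \<tau> j)) + 2 * \<kappa> * F / ((r j - r (Suc j)) / 2)\<^sup>2) <= A j * (1 / b)"
   using A[of j] by (intro mult_left_mono) auto
  also have "A j * (1 / b) = A (Suc j)" by (simp add: A_def)
  finally show ?case .
 qed
 \<comment> \<open>The largest number of steps for which \<open>main\<close> is available.\<close>
 have "\<exists>J. 2 ^ J <= R / 8 \<and> R / 8 < 2 ^ (J + 1)"
 proof -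
  obtain n where n: "R / 8 < 2 ^ n" using real_arch_pow[of 2 "R / 8"] by auto
  define N where "N = (LEAST n. R / 8 < 2 ^ n)"
  have N: "R / 8 < 2 ^ N" unfolding N_def using n by (rule LeastI)
  have "N ~= 0" using N R by (intro notI) simp
  then obtain J where J: "N = Suc J" by (cases N) auto
  have "\<not> R / 8 < 2 ^ J" using J unfolding N_def by (intro not_less_Least) simp
  then show ?thesis using N J by (intro exI[of _ J]) auto
 qed
 then obtain J where J: "2 ^ J <= R / 8" "R / 8 < 2 ^ (J + 1)" by blast
 have "s x * (max 0 (u T x - k J))\<^sup>2 <= (\<Sum>x | x \<in> B \<and> \<rho> x < r J. s x * (max 0 (u T x - k J))\<^sup>2)"
 proof (rule member_le_sum)
  have "R / 2 < r J" using R by (simp add: r_def algebra_simps)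
  then show "x \<in> {x. x \<in> B \<and> \<rho> x < r J}" using x by auto
 qed (use finite_B s_pos in \<open>auto intro!: mult_nonneg_nonneg simp: less_imp_le\<close>)
 also have "... <= A J" using J by (intro main) (auto simp: \<tau>_def)
 also have "... = M\<^sup>2 * (V * y0 * (1 / b ^ J))" by (simp add: A_def)
 also have "... <= M\<^sup>2 * (V * y0 * (16 / R) ^ m)"
 proof (intro mult_left_mono)
  have "1 / b ^ J <= 1 / (2 ^ m) ^ J" using b by (intro divide_left_mono power_mono) auto
  also have "... = (1 / 2 ^ J) ^ m" by (simp add: power_mult[symmetric] power_divide mult.commute)
  also have "... <= (16 / R) ^ m"
  proof (rule power_mono)
   show "1 / 2 ^ J <= 16 / R" using J(2) R by (simp add: field_simps)
  qed simp
  finally show "1 / b ^ J <= (16 / R) ^ m" .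
 qed (use V y0 in auto)
 also have "... <= M\<^sup>2 * s x" using sx by (intro mult_left_mono) auto
 finally have "(max 0 (u T x - k J))\<^sup>2 <= M\<^sup>2" using s_pos[OF x(1)] by (simp add: mult.commute)
 then have "max 0 (u T x - k J) <= M" using M by (simp add: power2_le_iff_abs_le)
 moreover have "k J <= M" using M by (simp add: k_def algebra_simps)
 ultimately have "u T x <= 2 * M" by linarith
 moreover have "u T x >= 0" using heat_solD(2)[OF u, of T x] T by (smt (verit) zero_le_power2)
 ultimately have "(u T x)\<^sup>2 <= (2 * M)\<^sup>2" by (intro power_mono)
 also have "... = 4 * S / (V * y0)" using S V y0 by (simp add: M_def power_mult_distrib)
 finally show ?thesis .
qed


section \<open>Existence of the killed flow\<close>

lemma lap_scale: "lap (\<lambda>x. f x * k) x = lap f x * k"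
proof -
 have "(\<Sum>y\<in>W. c x y * (f y * k - f x * k)) = (\<Sum>y\<in>W. c x y * (f y - f x)) * k"
  unfolding sum_distrib_right by (intro sum.cong refl) (simp add: algebra_simps)
 then show ?thesis by (simp add: lap_def)
qed

text \<open>Uniformisation: with \<Lambda> above all jump rates,
  \<open>K = 1 + lap / \<Lambda>\<close> preserves positivity, and the solution is the Poisson
  mixture of the iterates \<open>(K ^^ n) f\<close> with mean \<open>\<Lambda> * t\<close>.
  Positivity is then visible, and the power series converges for every real time.\<close>

lemma heat_sol_exists:
 assumes f: "\<And>x. f x >= 0" "\<And>x. x \<notin> B ==> f x = 0"
 obtains u where "heat_sol u" "u 0 = f"
proof -
 define \<Lambda> where "\<Lambda> = 1 + (\<Sum>x\<in>B. (\<Sum>y\<in>W. c x y) / s x)"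
 have m_nonneg: "(\<Sum>y\<in>W. c x y) >= 0" for x using c_nonneg by (intro sum_nonneg) auto
 have \<Lambda>: "\<Lambda> > 0" unfolding \<Lambda>_def
  using m_nonneg s_pos by (intro add_pos_nonneg sum_nonneg) (auto simp: less_imp_le)
 have m_le: "(\<Sum>y\<in>W. c x y) / (\<Lambda> * s x) <= 1" if x: "x \<in> B" for x
 proof -
  have "(\<Sum>y\<in>W. c x y) / s x <= (\<Sum>x\<in>B. (\<Sum>y\<in>W. c x y) / s x)"
   using finite_B m_nonneg s_pos x by (intro member_le_sum) (auto simp: less_imp_le)
  then have "(\<Sum>y\<in>W. c x y) / s x <= \<Lambda>" by (simp add: \<Lambda>_def)
  then show ?thesis using \<Lambda> s_pos[OF x] by (simp add: field_simps)
 qed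
 define K where "K g x = (if x \<in> B then g x + lap g x / \<Lambda> else 0)" for g x
 have K_eq: "K g x = (1 - (\<Sum>y\<in>W. c x y) / (\<Lambda> * s x)) * g x + (\<Sum>y\<in>W. c x y * g y) / (\<Lambda> * s x)" if "x \<in> B" for g x
 proof -
  have e: "lap g x = (\<Sum>y\<in>W. c x y * g y) / s x - (\<Sum>y\<in>W. c x y) * g x / s x"
   by (simp add: lap_def right_diff_distrib sum_subtractf sum_distrib_right diff_divide_distrib)
  show ?thesis using that \<Lambda> s_pos[OF that] by (simp add: K_def e field_simps)
 qed
 define a where "a n = (K ^^ n) f" for n
 define F where "F = (\<Sum>x\<in>B. f x)"
 have F: "0 <= F" unfolding F_def using f by (intro sum_nonneg) auto
 have a0: "a 0 = f" and aS: "a (Suc n) = K (a n)" for n by (simp_all add: a_def)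
 \<comment> \<open>\<open>K\<close> has nonnegative entries and row sums at most 1, so a nonnegative
   upper bound for \<open>f\<close> is kept by all iterates.\<close>
 have a_bd: "0 <= a n x \<and> a n x <= F" for n x
 proof (induction n arbitrary: x)
  case 0
  show ?case
  proof (cases "x \<in> B")
   case True
   then have "f x <= F" unfolding F_def using finite_B f by (intro member_le_sum) auto
   then show ?thesis using f by (simp add: a0)
  next
   case False
   then show ?thesis using f F by (simp add: a0)
  qed
 next
  case (Suc n)
  show ?case
  proof (cases "x \<in> B")
   case x: True
   let ?m = "(\<Sum>y\<in>W. c x y) / (\<Lambda> * s x)"
   have s: "\<Lambda> * s x > 0" using \<Lambda> s_pos[OF x] by simp
   have "(\<Sum>y\<in>W. c x y * a n y) / (\<Lambda> * s x) <= (\<Sum>y\<in>W. c x y * F) / (\<Lambda> * s x)"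
    using c_nonneg Suc.IH by (intro divide_right_mono sum_mono mult_left_mono less_imp_le[OF s]) auto
   also have "... = ?m * F" by (simp add: sum_distrib_right)
   finally have 1: "(\<Sum>y\<in>W. c x y * a n y) / (\<Lambda> * s x) <= ?m * F" .
   have 2: "(1 - ?m) * a n x <= (1 - ?m) * F" using m_le[OF x] Suc.IH[of x] by (intro mult_left_mono) auto
   have 3: "0 <= (\<Sum>y\<in>W. c x y * a n y) / (\<Lambda> * s x)"
    using c_nonneg Suc.IH by (intro divide_nonneg_nonneg sum_nonneg mult_nonneg_nonneg less_imp_le[OF s]) auto
   have 4: "0 <= (1 - ?m) * a n x" using m_le[OF x] Suc.IH[of x] by (intro mult_nonneg_nonneg) auto
   have "(1 - ?m) * F + ?m * F = F" by (simp add: algebra_simps)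
   then show ?thesis unfolding aS K_eq[OF x] using 1 2 3 4 by linarith
  qed (simp add: aS K_def F)
 qed
 define p where "p x n = a n x * \<Lambda> ^ n / fact n" for x n
 define P where "P t x = (\<Sum>n. p x n * t ^ n)" for t x
 have summable_p: "summable (\<lambda>n. p x n * t ^ n)" for x t
 proof (rule summable_comparison_test')
  show "summable (\<lambda>n. F * (inverse (fact n) * (\<Lambda> * \<bar>t\<bar>) ^ n))"
   by (intro summable_mult summable_exp)
  fix n
  have "norm (p x n * t ^ n) = a n x * (inverse (fact n) * (\<Lambda> * \<bar>t\<bar>) ^ n)"
   using a_bd[of n x] \<Lambda> by (simp add: p_def abs_mult power_abs power_mult_distrib field_simps)
  also have "... <= F * (inverse (fact n) * (\<Lambda> * \<bar>t\<bar>) ^ n)"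
   using a_bd[of n x] \<Lambda> by (intro mult_right_mono) auto
  finally show "norm (p x n * t ^ n) <= F * (inverse (fact n) * (\<Lambda> * \<bar>t\<bar>) ^ n)" .
 qed
 have lap_P: "lap (P t) x = (\<Sum>n. lap (\<lambda>x. p x n * t ^ n) x)" for t x
 proof -
  have "(\<lambda>n. lap (\<lambda>x. p x n * t ^ n) x) sums lap (P t) x"
   unfolding lap_def P_def by (intro sums_divide sums_sum sums_mult sums_diff summable_sums summable_p)
  then show ?thesis by (simp add: sums_iff)
 qed
 have summable_lap: "summable (\<lambda>n. lap (\<lambda>x. p x n * t ^ n) x)" for t x
  unfolding lap_def by (intro summable_divide summable_sum summable_mult summable_diff summable_p)
 have P': "((\<lambda>t. P t x) has_real_derivative \<Lambda> * P t x + lap (P t) x) (at t)" if x: "x \<in> B" for t x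
 proof -
  have "((\<lambda>t. \<Sum>n. p x n * t ^ n) has_real_derivative (\<Sum>n. diffs (p x) n * t ^ n)) (at t)"
   by (rule termdiffs_strong_converges_everywhere[OF summable_p])
  moreover have "diffs (p x) n * t ^ n = \<Lambda> * (p x n * t ^ n) + lap (\<lambda>x. p x n * t ^ n) x" for n
  proof -
   have "diffs (p x) n = a (Suc n) x * \<Lambda> ^ Suc n / fact n"
    by (simp add: diffs_def p_def field_simps del: of_nat_Suc)
   also have "... = \<Lambda> * p x n + lap (a n) x * (\<Lambda> ^ n / fact n)"
    using x \<Lambda> by (simp add: aS K_def p_def field_simps)
   also have "lap (a n) x * (\<Lambda> ^ n / fact n) = lap (\<lambda>x. p x n) x"
    using lap_scale[of "a n" "\<Lambda> ^ n / fact n" x] by (simp add: p_def)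
   finally have "diffs (p x) n * t ^ n = \<Lambda> * (p x n * t ^ n) + lap (\<lambda>x. p x n) x * t ^ n"
    by (simp add: algebra_simps)
   also have "lap (\<lambda>x. p x n) x * t ^ n = lap (\<lambda>x. p x n * t ^ n) x" by (rule lap_scale[symmetric])
   finally show ?thesis .
  qed
  ultimately show ?thesis
   unfolding P_def[symmetric] using suminf_add[OF summable_mult[OF summable_p, of \<Lambda> x t] summable_lap[of t x]]
    suminf_mult[OF summable_p, of \<Lambda> x t] by (simp add: lap_P P_def)
 qed
 define u where "u t x = exp (- \<Lambda> * t) * P t x" for t x
 have "u 0 = f" using powser_zero[of "p _"] by (intro ext) (simp add: u_def P_def p_def a0)
 moreover have "heat_sol u"
  unfolding heat_sol_def
 proof (intro conjI allI impI ballI)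
  fix t x assume "x \<notin> B"
  then have "a n x = 0" for n using f by (cases n) (auto simp: a0 aS K_def)
  then show "u t x = 0" by (simp add: u_def P_def p_def)
 next
  fix t :: real and x assume "0 <= t"
  then show "0 <= u t x" unfolding u_def P_def p_def
   using a_bd \<Lambda> by (intro mult_nonneg_nonneg suminf_nonneg summable_p[unfolded p_def]) auto
 next
  fix t x assume x: "x \<in> B"
  have "((\<lambda>t. u t x) has_real_derivative exp (- \<Lambda> * t) * lap (P t) x) (at t)"
   unfolding u_def by (rule derivative_eq_intros P'[OF x] refl)+ (simp add: algebra_simps)
  also have "exp (- \<Lambda> * t) * lap (P t) x = lap (u t) x"
   by (simp add: lap_def u_def sum_distrib_left algebra_simps)
  finally show "((\<lambda>t. u t x) has_real_derivative lap (u t) x) (at t)" .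
 qed
 ultimately show ?thesis by (intro that)
qed


section \<open>Weighted bounds for the killed kernel\<close>

lemma sum_delta:
 assumes "x \<in> B"
 shows "(\<Sum>z\<in>B. s z * ((if z = x then 1 / s x else 0) * g z)) = g x"
proof -
 have "(\<Sum>z\<in>B. s z * ((if z = x then 1 / s x else 0) * g z)) = (\<Sum>z\<in>B. if z = x then g x else 0)"
  using s_pos[OF assms] by (intro sum.cong) auto
 then show ?thesis using assms finite_B by simp
qed

text \<open>One term of Davies' estimate for a point source. It avoids the mean value inequality at
  the price of the factor \<open>s x * s y\<close>.\<close>

lemma davies_kernel:
 assumes v: "heat_sol v" "v 0 = (\<lambda>z. if z = y then 1 / s y else 0)" and xy: "x \<in> B" "y \<in> B" and t: "t >= 0"
  and h: "\<And>x. x \<in> B ==> (\<Sum>y\<in>W. c x y * (cosh (\<psi> x - \<psi> y) - 1)) <= h * s x"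
 shows "s x * s y * (v t x)\<^sup>2 <= exp (2 * (h * t + \<psi> y - \<psi> x))"
proof -
 have "s x * (v t x * exp (\<psi> x))\<^sup>2 <= (\<Sum>z\<in>B. s z * (v t z * exp (\<psi> z))\<^sup>2)"
  using finite_B s_pos xy by (intro member_le_sum) (auto simp: less_imp_le)
 also have "... <= exp (2 * h * t) * (\<Sum>z\<in>B. s z * (v 0 z * exp (\<psi> z))\<^sup>2)"
  by (rule davies[OF v(1) t h])
 also have "(\<Sum>z\<in>B. s z * (v 0 z * exp (\<psi> z))\<^sup>2) = (\<Sum>z\<in>B. s z * ((if z = y then 1 / s y else 0) * (exp (\<psi> y) ^ 2 / s y)))"
  unfolding v(2) by (intro sum.cong) (auto simp: power2_eq_square)
 also have "... = exp (\<psi> y) ^ 2 / s y" by (rule sum_delta[OF xy(2)])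
 finally have "s x * s y * (v t x)\<^sup>2 * exp (\<psi> x) ^ 2 <= exp (2 * h * t) * exp (\<psi> y) ^ 2"
  using s_pos[OF xy(2)] by (simp add: field_simps power_mult_distrib)
 then have "s x * s y * (v t x)\<^sup>2 <= exp (2 * h * t) * exp (\<psi> y) ^ 2 / exp (\<psi> x) ^ 2"
  by (simp add: pos_le_divide_eq)
 also have "... = exp (2 * (h * t + \<psi> y - \<psi> x))"
  by (simp add: exp_double[symmetric] exp_add[symmetric] exp_diff[symmetric] algebra_simps)
 finally show ?thesis .
qed

text \<open>Run the flow \<open>w\<close> from \<open>u t\<close> times \<open>exp \<psi>\<close>
  squared: by duality \<open>w t x\<close> is the weighted norm \<open>A\<close> of
  \<open>u t\<close>. Davies' estimate with weight \<open>- \<psi>\<close> bounds the norm of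
  \<open>w\<close> in terms of \<open>A\<close>, and the mean value inequality at \<open>x\<close>
  gives a bound for \<open>A * A\<close> that is linear in \<open>A\<close>. The weight is lost only
  through its maximum \<open>q\<close> on the ball around \<open>x\<close>.\<close>

lemma weighted_l2_kernel:
 assumes u: "heat_sol u" "u 0 = (\<lambda>z. if z = x then 1 / s x else 0)" and x: "x \<in> B" and t: "t >= 0"
  and h: "\<And>x. x \<in> B ==> (\<Sum>y\<in>W. c x y * (cosh (\<psi> x - \<psi> y) - 1)) <= h * s x" "h >= 0"
  and \<psi>: "\<And>z. z \<in> B ==> \<rho> z < R ==> \<psi> z <= q"
  and MV: "\<And>w S. heat_sol w ==> S > 0 ==>
    (\<And>\<tau>. 0 <= \<tau> ==> \<tau> <= t ==> (\<Sum>z | z \<in> B \<and> \<rho> z < R. s z * (w \<tau> z)\<^sup>2) <= S) ==> (w t x)\<^sup>2 <= Q * S"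
  and Q: "Q > 0"
 shows "(\<Sum>z\<in>B. s z * (u t z * exp (\<psi> z))\<^sup>2) <= Q * exp (2 * q + 2 * h * t)"
proof -
 define A where "A = (\<Sum>z\<in>B. s z * (u t z * exp (\<psi> z))\<^sup>2)"
 show ?thesis
 proof (cases "A > 0")
  case A: True
  obtain w where w: "heat_sol w" "w 0 = (\<lambda>z. u t z * (exp (\<psi> z))\<^sup>2)"
   using heat_solD(1,2)[OF u(1)] t by (rule_tac heat_sol_exists[of "\<lambda>z. u t z * (exp (\<psi> z))\<^sup>2"]) auto
  have "(\<Sum>z\<in>B. s z * (u 0 z * w (t - 0) z)) = (\<Sum>z\<in>B. s z * (u t z * w (t - t) z))"
   by (rule duality[OF u(1) w(1)])
  then have wA: "w t x = A"
   unfolding u(2) by (simp only: diff_zero sum_delta[OF x]) (simp add: w(2) A_def power2_eq_square mult_ac)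
  have "(w t x)\<^sup>2 <= Q * (exp (2 * q + 2 * h * t) * A)"
  proof (rule MV[OF w(1)])
   show "exp (2 * q + 2 * h * t) * A > 0" using A by simp
   fix \<tau> assume \<tau>: "0 <= \<tau>" "\<tau> <= t"
   have "(\<Sum>z | z \<in> B \<and> \<rho> z < R. s z * (w \<tau> z)\<^sup>2) <= (\<Sum>z | z \<in> B \<and> \<rho> z < R. exp (2 * q) * (s z * (w \<tau> z * exp (- \<psi> z))\<^sup>2))"
   proof (rule sum_mono)
    fix z assume z: "z \<in> {z. z \<in> B \<and> \<rho> z < R}"
    then have "exp (\<psi> z) <= exp q" using \<psi> by simp
    then have "1 <= exp q * exp (- \<psi> z)" by (simp add: exp_minus field_simps)
    then have "1 <= (exp q * exp (- \<psi> z))\<^sup>2" by (rule one_le_power)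
    also have "... = exp (2 * q) * (exp (- \<psi> z))\<^sup>2" by (simp add: power_mult_distrib exp_double)
    finally have "s z * (w \<tau> z)\<^sup>2 * 1 <= s z * (w \<tau> z)\<^sup>2 * (exp (2 * q) * (exp (- \<psi> z))\<^sup>2)"
     using z s_pos[of z] by (intro mult_left_mono) auto
    then show "s z * (w \<tau> z)\<^sup>2 <= exp (2 * q) * (s z * (w \<tau> z * exp (- \<psi> z))\<^sup>2)"
     by (simp add: power_mult_distrib mult_ac)
   qed
   also have "... <= (\<Sum>z\<in>B. exp (2 * q) * (s z * (w \<tau> z * exp (- \<psi> z))\<^sup>2))"
    using finite_B s_pos by (intro sum_mono2) (auto simp: less_imp_le)
   also have "... = exp (2 * q) * (\<Sum>z\<in>B. s z * (w \<tau> z * exp (- \<psi> z))\<^sup>2)"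
    by (simp add: sum_distrib_left)
   also have "... <= exp (2 * q) * (exp (2 * h * \<tau>) * (\<Sum>z\<in>B. s z * (w 0 z * exp (- \<psi> z))\<^sup>2))"
   proof (intro mult_left_mono davies[OF w(1) \<tau>(1)])
    show "(\<Sum>y\<in>W. c x y * (cosh (- \<psi> x - - \<psi> y) - 1)) <= h * s x" if "x \<in> B" for x
    proof -
     have "cosh (- \<psi> x - - \<psi> y) = cosh (\<psi> x - \<psi> y)" for y
      using cosh_minus[of "\<psi> x - \<psi> y"] by (simp add: minus_diff_eq)
     then show ?thesis using h(1)[OF that] by (simp only:)
    qed
   qed simp
   also have "(\<Sum>z\<in>B. s z * (w 0 z * exp (- \<psi> z))\<^sup>2) = A"
    unfolding A_def w(2) by (intro sum.cong) (auto simp: exp_minus power2_eq_square field_simps)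
   also have "exp (2 * q) * (exp (2 * h * \<tau>) * A) <= exp (2 * q) * (exp (2 * h * t) * A)"
    using A \<tau> h(2) by (intro mult_left_mono mult_right_mono) (auto intro: mult_left_mono)
   finally show "(\<Sum>z | z \<in> B \<and> \<rho> z < R. s z * (w \<tau> z)\<^sup>2) <= exp (2 * q + 2 * h * t) * A"
    by (simp add: exp_add mult.assoc)
  qed
  then have "A * A <= Q * exp (2 * q + 2 * h * t) * A" unfolding wA by (simp add: power2_eq_square mult_ac)
  then show ?thesis using A unfolding A_def[symmetric] by simp
 next
  case False
  then have "A <= 0" by simp
  also have "0 <= Q * exp (2 * q + 2 * h * t)" using Q by simp
  finally show ?thesis unfolding A_def .
 qed
qed

text \<open>Half of the time is given to each end point; in the Cauchy--Schwarz inequality the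
  weights \<open>exp \<psi>\<close> and \<open>exp (- \<psi>)\<close> cancel.\<close>

lemma kernel_bound:
 assumes u: "heat_sol u" "u 0 = (\<lambda>z. if z = x then 1 / s x else 0)"
  and v: "heat_sol v" "v 0 = (\<lambda>z. if z = y then 1 / s y else 0)"
  and xy: "x \<in> B" "y \<in> B"
  and A: "(\<Sum>z\<in>B. s z * (u t z * exp (\<psi> z))\<^sup>2) <= A"
  and A': "(\<Sum>z\<in>B. s z * (v t z * exp (- \<psi> z))\<^sup>2) <= A'"
 shows "(v (2 * t) x)\<^sup>2 <= A * A'"
proof -
 have "(\<Sum>z\<in>B. s z * (u 0 z * v (2 * t - 0) z)) = (\<Sum>z\<in>B. s z * (u t z * v (2 * t - t) z))"
  by (rule duality[OF u(1) v(1)])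
 then have "v (2 * t) x = (\<Sum>z\<in>B. s z * (u t z * v t z))"
  unfolding u(2) by (simp only: diff_zero sum_delta[OF xy(1)]) simp
 also have "... = (\<Sum>z\<in>B. (sqrt (s z) * (u t z * exp (\<psi> z))) * (sqrt (s z) * (v t z * exp (- \<psi> z))))"
 proof (intro sum.cong refl)
  fix z assume z: "z \<in> B"
  have "s z * (u t z * v t z) = (sqrt (s z))\<^sup>2 * (u t z * v t z) * (exp (\<psi> z) * exp (- \<psi> z))"
   using s_pos[OF z] by (simp add: exp_minus)
  then show "s z * (u t z * v t z) = (sqrt (s z) * (u t z * exp (\<psi> z))) * (sqrt (s z) * (v t z * exp (- \<psi> z)))"
   by (simp only: power2_eq_square mult_ac)
 qed
 finally have "(v (2 * t) x)\<^sup>2 <= (\<Sum>z\<in>B. (sqrt (s z) * (u t z * exp (\<psi> z)))\<^sup>2) * (\<Sum>z\<in>B. (sqrt (s z) * (v t z * exp (- \<psi> z)))\<^sup>2)"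
  by (simp add: Cauchy_Schwarz_ineq_sum)
 also have "(\<Sum>z\<in>B. (sqrt (s z) * (u t z * exp (\<psi> z)))\<^sup>2) = (\<Sum>z\<in>B. s z * (u t z * exp (\<psi> z))\<^sup>2)"
  using s_pos by (intro sum.cong) (auto simp: power_mult_distrib less_imp_le)
 also have "(\<Sum>z\<in>B. (sqrt (s z) * (v t z * exp (- \<psi> z)))\<^sup>2) = (\<Sum>z\<in>B. s z * (v t z * exp (- \<psi> z))\<^sup>2)"
  using s_pos by (intro sum.cong) (auto simp: power_mult_distrib less_imp_le)
 also have "(\<Sum>z\<in>B. s z * (u t z * exp (\<psi> z))\<^sup>2) * (\<Sum>z\<in>B. s z * (v t z * exp (- \<psi> z))\<^sup>2) <= A * A'"
  using A A' s_pos by (intro mult_mono order_trans[OF _ A]) (auto intro!: sum_nonneg simp: less_imp_le)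
 finally show ?thesis .
qed

end

section \<open>Comparison of the jump chain with the killed flow\<close>

abbreviation Exp1 :: "real measure" where
 "Exp1 \<equiv> density lborel (exponential_density 1)"

lemma prob_space_Exp1: "prob_space Exp1" by (rule prob_space_exponential_density) simp

interpretation Exp1: sequence_space Exp1
proof -
 interpret prob_space Exp1 by (rule prob_space_Exp1)
 show "sequence_space Exp1" by unfold_locales
qed

text \<open>If the states visited have exit rates \<open>ls\<close> in turn, this is the event that
  time \<open>t\<close> falls into the holding period of the last of them.\<close>

definition hold :: "real list => real => (nat => real) => bool" where
 "hold ls t \<eta> \<longleftrightarrow> (\<Sum>k<length ls - 1. ennreal (\<eta> k) / ennreal (ls ! k)) <= ennreal t
   \<and> ennreal t < (\<Sum>k<length ls. ennreal (\<eta> k) / ennreal (ls ! k))"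

definition holdp :: "real list => real => ennreal" where
 "holdp ls t = emeasure Exp1.S {\<eta> \<in> space Exp1.S. hold ls t \<eta>}"

lemma hold_sets [measurable]: "{\<eta> \<in> space Exp1.S. hold ls t \<eta>} \<in> sets Exp1.S"
 unfolding hold_def by measurable

lemma hold_Cons:
 assumes ls: "ls ~= []" and l: "l > 0" and t: "t >= 0" and e: "e >= 0"
 shows "hold (l # ls) t (case_nat e \<eta>) \<longleftrightarrow> e \<in> {0..l * t} \<and> hold ls (t - e / l) \<eta>"
proof -
 obtain m where m: "length ls = Suc m" using ls by (cases ls) auto
 define S where "S n = (\<Sum>k<n. ennreal (\<eta> k) / ennreal (ls ! k))" for n
 have shift: "(\<Sum>k<Suc n. ennreal (case_nat e \<eta> k) / ennreal ((l # ls) ! k)) = ennreal (e / l) + S n" for n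
  unfolding S_def sum.lessThan_Suc_shift using e l by (simp add: divide_ennreal)
 have "hold (l # ls) t (case_nat e \<eta>) \<longleftrightarrow> ennreal (e / l) + S m <= ennreal t \<and> ennreal t < ennreal (e / l) + S (Suc m)"
  unfolding hold_def using m shift[of m] shift[of "Suc m"] by (simp only: list.size diff_Suc_1 add_Suc_right add_0_right)
 also have "... \<longleftrightarrow> e \<in> {0..l * t} \<and> S m <= ennreal (t - e / l) \<and> ennreal (t - e / l) < S (Suc m)"
 proof (cases "e <= l * t")
  case True
  then have le: "e / l <= t" using l by (simp add: field_simps)
  have "ennreal t = ennreal (e / l) + ennreal (t - e / l)" using le e l by (subst ennreal_plus[symmetric]) auto
  then show ?thesis using True e by (simp add: ennreal_add_left_cancel_le ennreal_add_left_cancel_less)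
 next
  case False
  then have "t < e / l" using l by (simp add: field_simps)
  then have "ennreal t < ennreal (e / l)" using t by (simp add: ennreal_lessI)
  also have "... <= ennreal (e / l) + S m" by simp
  finally show ?thesis using False by auto
 qed
 also have "S m <= ennreal (t - e / l) \<and> ennreal (t - e / l) < S (Suc m) \<longleftrightarrow> hold ls (t - e / l) \<eta>"
  unfolding hold_def S_def m by simp
 finally show ?thesis .
qed

text \<open>The holding variables are a first variable followed by an independent copy of the
  sequence. The first one is almost surely nonnegative, and the indicator makes its holding period
  end by time \<open>t\<close>.\<close>

lemma holdp_Cons:
 assumes ls: "ls ~= []" and l: "l > 0" and t: "t >= 0"
 shows "holdp (l # ls) t = (\<integral>\<^sup>+e. indicator {0..l * t} e * holdp ls (t - e / l) \<partial>Exp1)"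
proof -
 have "holdp (l # ls) t = emeasure (distr (Exp1 \<Otimes>\<^sub>M Exp1.S) Exp1.S (\<lambda>(s, \<omega>). case_nat s \<omega>)) {\<eta> \<in> space Exp1.S. hold (l # ls) t \<eta>}"
  unfolding Exp1.PiM_iter holdp_def ..
 also have "... = (\<integral>\<^sup>+z. indicator {\<eta> \<in> space Exp1.S. hold (l # ls) t \<eta>} (case_nat (fst z) (snd z)) \<partial>(Exp1 \<Otimes>\<^sub>M Exp1.S))"
  by (subst nn_integral_indicator[symmetric], simp, subst nn_integral_distr) (auto simp: split_beta')
 also have "... = (\<integral>\<^sup>+e. \<integral>\<^sup>+\<eta>. indicator {\<eta> \<in> space Exp1.S. hold (l # ls) t \<eta>} (case_nat e \<eta>) \<partial>Exp1.S \<partial>Exp1)"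
  by (subst Exp1.P.nn_integral_fst[symmetric]) auto
 also have "... = (\<integral>\<^sup>+e. indicator {0..l * t} e * holdp ls (t - e / l) \<partial>Exp1)"
 proof (rule nn_integral_cong_AE)
  have "AE e in Exp1. 0 <= e" by (subst AE_density) (auto simp: exponential_density_def)
  then show "AE e in Exp1. (\<integral>\<^sup>+\<eta>. indicator {\<eta> \<in> space Exp1.S. hold (l # ls) t \<eta>} (case_nat e \<eta>) \<partial>Exp1.S)
    = indicator {0..l * t} e * holdp ls (t - e / l)"
  proof eventually_elim
   fix e :: real assume e: "0 <= e"
   have "(\<integral>\<^sup>+\<eta>. indicator {\<eta> \<in> space Exp1.S. hold (l # ls) t \<eta>} (case_nat e \<eta>) \<partial>Exp1.S)
    = (\<integral>\<^sup>+\<eta>. indicator {0..l * t} e * indicator {\<eta> \<in> space Exp1.S. hold ls (t - e / l) \<eta>} \<eta> \<partial>Exp1.S)"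
   proof (rule nn_integral_cong)
    fix \<eta> assume "\<eta> \<in> space Exp1.S"
    moreover have "case_nat e \<eta> \<in> space Exp1.S" by (simp add: space_PiM)
    ultimately show "(indicator {\<eta> \<in> space Exp1.S. hold (l # ls) t \<eta>} (case_nat e \<eta>) :: ennreal) = indicator {0..l * t} e * indicator {\<eta> \<in> space Exp1.S. hold ls (t - e / l) \<eta>} \<eta>"
     using hold_Cons[OF ls l t e, of \<eta>] by (auto simp: indicator_def)
   qed
   also have "... = indicator {0..l * t} e * holdp ls (t - e / l)"
    unfolding holdp_def by (subst nn_integral_cmult) auto
   finally show "(\<integral>\<^sup>+\<eta>. indicator {\<eta> \<in> space Exp1.S. hold (l # ls) t \<eta>} (case_nat e \<eta>) \<partial>Exp1.S)
    = indicator {0..l * t} e * holdp ls (t - e / l)" .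
  qed
 qed
 finally show ?thesis .
qed

lemma holdp_single:
 assumes l: "l > 0" and t: "t >= 0"
 shows "holdp [l] t = ennreal (exp (- (l * t)))"
proof -
 interpret prob_space Exp1 by (rule prob_space_Exp1)
 have iff: "hold [l] t \<eta> \<longleftrightarrow> \<eta> 0 \<in> - {..l * t}" for \<eta>
 proof (cases "\<eta> 0 >= 0")
  case True
  then have "hold [l] t \<eta> \<longleftrightarrow> ennreal t < ennreal (\<eta> 0 / l)"
   using l by (simp add: hold_def divide_ennreal)
  also have "... \<longleftrightarrow> t < \<eta> 0 / l" using t True l by (simp add: ennreal_less_iff)
  also have "... \<longleftrightarrow> \<eta> 0 \<in> - {..l * t}" using l by (simp add: field_simps not_le)
  finally show ?thesis .
 next
  case False
  then have "\<eta> 0 <= l * t" using l t by (smt (verit) mult_nonneg_nonneg)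
  then show ?thesis using False by (simp add: hold_def ennreal_neg)
 qed
 have "holdp [l] t = emeasure Exp1 (- {..l * t})"
  unfolding holdp_def iff by (subst Exp1.emeasure_PiM_Collect_single) auto
 also have "- {..l * t} = space Exp1 - {..l * t}" by auto
 also have "emeasure Exp1 ... = 1 - emeasure Exp1 {..l * t}"
  by (subst emeasure_compl) (auto simp: prob_space.emeasure_space_1[OF prob_space_Exp1, simplified])
 also have "emeasure Exp1 {..l * t} = erlang_CDF 0 1 (l * t)" by (rule emeasure_erlang_density) simp
 also have "1 - ennreal (erlang_CDF 0 1 (l * t)) = ennreal (1 - erlang_CDF 0 1 (l * t))"
  by (simp add: ennreal_minus ennreal_1[symmetric] del: ennreal_1)
 also have "1 - erlang_CDF 0 1 (l * t) = exp (- (l * t))" using l t by (simp add: erlang_CDF_0)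
 finally show ?thesis .
qed

lemma holdp_measurable [measurable]:
 "(\<lambda>t. holdp ls t) \<in> borel_measurable borel"
proof -
 have [measurable]: "(\<lambda>z. snd z k) \<in> borel_measurable (borel \<Otimes>\<^sub>M Exp1.S)" for k
  by (rule measurable_compose[OF measurable_snd]) measurable
 have "{z \<in> space (borel \<Otimes>\<^sub>M Exp1.S). hold ls (fst z) (snd z)} \<in> sets (borel \<Otimes>\<^sub>M Exp1.S)"
  unfolding hold_def by measurable
 from Exp1.P.measurable_emeasure_Pair[OF this]
 show ?thesis
  unfolding holdp_def by (simp add: space_pair_measure vimage_def cong: measurable_cong)
qed


section \<open>The law of the chain as a sum over paths\<close>

primrec paths :: "('d::finite vertex => 'd vertex => real) => nat => 'd vertex => 'd vertex list set" where
 "paths c 0 x = {[]}"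
| "paths c (Suc n) x = (\<Union>z\<in>{z. adjacent c x z}. (#) z ` paths c n z)"

text \<open>Guarantees that a walk from \<open>x\<close> cannot leave \<open>B\<close> during its
  first \<open>n\<close> jumps; the recursion matches the induction in \<open>Hm_le\<close>.\<close>

primrec inball :: "('d::finite vertex => 'd vertex => real) => 'd vertex set => nat => 'd vertex => bool" where
 "inball c B 0 x \<longleftrightarrow> x \<in> B"
| "inball c B (Suc n) x \<longleftrightarrow> x \<in> B \<and> (\<forall>z. adjacent c x z --> inball c B n z)"

lemma finite_paths: "finite (paths c n x)" by (induction n arbitrary: x) (auto simp: finite_adjacent)

lemma adjacent_commute: "adjacent c x y \<longleftrightarrow> adjacent c y x"
 by (simp add: adjacent_def insert_commute)

locale walk_env =
 fixes c :: "'d::finite vertex => 'd vertex => real" and s :: "'d vertex => real"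
 assumes sym: "c x y = c y x" and nonneg: "c x y >= 0" and non_edge: "{x, y} \<notin> lattice_edges ==> c x y = 0"
  and s_pos: "s x > 0"
begin

abbreviation "G \<equiv> generator c s"

lemma adjacent_iff: "adjacent c x y \<longleftrightarrow> c x y > 0"
proof
 assume "adjacent c x y"
 then show "c x y > 0" by (rule adjacent_pos[OF sym])
next
 assume *: "c x y > 0"
 then have "{x, y} \<in> lattice_edges" using non_edge[of x y] by force
 with * show "adjacent c x y" unfolding adjacent_def open_edges_def by blast
qed

lemma mu_pos: "adjacent c x z ==> mu c x > 0"
 unfolding mu_def by (intro sum_pos finite_adjacent) (auto simp: adjacent_iff)

lemma exit_rate_eq: "exit_rate G x = mu c x / s x" by (simp add: exit_rate_def rate_matrix_generator)

lemma exit_rate_pos: "adjacent c x z ==> exit_rate G x > 0" using mu_pos s_pos by (simp add: exit_rate_eq)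

lemma pmf_jump: "adjacent c x z ==> pmf (jump_law G x) y = (if adjacent c x y then c x y / mu c x else 0)"
 by (rule pmf_jump_law_generator[OF sym s_pos])

definition rates :: "'d vertex list => real list" where "rates ps = map (exit_rate G) ps"

definition pathw :: "'d vertex => 'd vertex list => ennreal" where
 "pathw x ps = (\<Prod>i<length ps. ennreal (pmf (jump_law G ((x # ps) ! i)) (ps ! i)))"

text \<open>The probability of being at \<open>y\<close> at time \<open>t\<close> after exactly
  \<open>m\<close> jumps. The lists in \<open>paths\<close> omit the starting point, hence
  \<open>x # ps\<close>.\<close>

definition Hm :: "'d vertex => nat => real => 'd vertex => ennreal" where
 "Hm y m t x = (\<Sum>ps\<in>paths c m x. if last (x # ps) = y then pathw x ps * holdp (rates (x # ps)) t else 0)"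

lemma Hm_measurable [measurable]: "(\<lambda>t. Hm y m t x) \<in> borel_measurable borel"
 unfolding Hm_def by measurable

lemma pathw_Cons: "pathw x (z # ps) = ennreal (pmf (jump_law G x) z) * pathw z ps"
 unfolding pathw_def by (simp only: list.size add_Suc_right add_0_right prod.lessThan_Suc_shift) simp

lemma Hm_Suc:
 assumes t: "t >= 0" and x: "adjacent c x w"
 shows "Hm y (Suc m) t x = (\<Sum>z | adjacent c x z. ennreal (pmf (jump_law G x) z) *
  (\<integral>\<^sup>+e. indicator {0..exit_rate G x * t} e * Hm y m (t - e / exit_rate G x) z \<partial>Exp1))"
proof -
 let ?l = "exit_rate G x"
 have "Hm y (Suc m) t x = (\<Sum>z | adjacent c x z. \<Sum>ps\<in>(#) z ` paths c m z. if last (x # ps) = y then pathw x ps * holdp (rates (x # ps)) t else 0)"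
  unfolding Hm_def paths.simps by (intro sum.UNION_disjoint) (auto simp: finite_adjacent finite_paths)
 also have "... = (\<Sum>z | adjacent c x z. \<Sum>ps\<in>paths c m z. ennreal (pmf (jump_law G x) z) *
   (\<integral>\<^sup>+e. indicator {0..?l * t} e * (if last (z # ps) = y then pathw z ps * holdp (rates (z # ps)) (t - e / ?l) else 0) \<partial>Exp1))"
 proof (rule sum.cong[OF refl])
  fix z assume "z \<in> {z. adjacent c x z}"
  have "(\<Sum>ps\<in>(#) z ` paths c m z. if last (x # ps) = y then pathw x ps * holdp (rates (x # ps)) t else 0)
   = (\<Sum>ps\<in>paths c m z. if last (z # ps) = y then pathw x (z # ps) * holdp (rates (x # z # ps)) t else 0)"
   by (subst sum.reindex) (auto simp: inj_on_def)
  also have "... = (\<Sum>ps\<in>paths c m z. ennreal (pmf (jump_law G x) z) *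
   (\<integral>\<^sup>+e. indicator {0..?l * t} e * (if last (z # ps) = y then pathw z ps * holdp (rates (z # ps)) (t - e / ?l) else 0) \<partial>Exp1))"
  proof (rule sum.cong[OF refl])
   fix ps assume "ps \<in> paths c m z"
   have "holdp (rates (x # z # ps)) t = (\<integral>\<^sup>+e. indicator {0..?l * t} e * holdp (rates (z # ps)) (t - e / ?l) \<partial>Exp1)"
    unfolding rates_def list.map by (intro holdp_Cons t exit_rate_pos[OF x]) auto
   moreover have "pathw z ps * (\<integral>\<^sup>+e. indicator {0..?l * t} e * holdp (rates (z # ps)) (t - e / ?l) \<partial>Exp1)
     = (\<integral>\<^sup>+e. indicator {0..?l * t} e * (pathw z ps * holdp (rates (z # ps)) (t - e / ?l)) \<partial>Exp1)"
    by (subst nn_integral_cmult[symmetric]) (auto simp: mult_ac)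
   ultimately show "(if last (z # ps) = y then pathw x (z # ps) * holdp (rates (x # z # ps)) t else 0) = ennreal (pmf (jump_law G x) z) *
   (\<integral>\<^sup>+e. indicator {0..?l * t} e * (if last (z # ps) = y then pathw z ps * holdp (rates (z # ps)) (t - e / ?l) else 0) \<partial>Exp1)"
    by (auto simp: pathw_Cons mult.assoc)
  qed
  finally show "(\<Sum>ps\<in>(#) z ` paths c m z. if last (x # ps) = y then pathw x ps * holdp (rates (x # ps)) t else 0) = (\<Sum>ps\<in>paths c m z. ennreal (pmf (jump_law G x) z) *
   (\<integral>\<^sup>+e. indicator {0..?l * t} e * (if last (z # ps) = y then pathw z ps * holdp (rates (z # ps)) (t - e / ?l) else 0) \<partial>Exp1))" .
 qed
 also have "... = (\<Sum>z | adjacent c x z. ennreal (pmf (jump_law G x) z) *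
  (\<integral>\<^sup>+e. indicator {0..?l * t} e * Hm y m (t - e / ?l) z \<partial>Exp1))"
 proof (rule sum.cong[OF refl])
  fix z
  show "(\<Sum>ps\<in>paths c m z. ennreal (pmf (jump_law G x) z) *
    (\<integral>\<^sup>+e. indicator {0..?l * t} e * (if last (z # ps) = y then pathw z ps * holdp (rates (z # ps)) (t - e / ?l) else 0) \<partial>Exp1))
   = ennreal (pmf (jump_law G x) z) * (\<integral>\<^sup>+e. indicator {0..?l * t} e * Hm y m (t - e / ?l) z \<partial>Exp1)"
   unfolding Hm_def sum_distrib_left[symmetric] by (simp only: sum_distrib_left) (subst nn_integral_sum; simp add: sum_distrib_left)
 qed
 finally show ?thesis .
qed

text \<open>The heat equation at \<open>x\<close> integrated over the first holding period. The
  variable \<open>e\<close> is the standard exponential, \<open>e / l\<close> the real time, and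
  \<open>- exp (- e) * v (t - e / l) x\<close> is a primitive of \<open>exp (- e)\<close> times the
  mean of \<open>v (t - e / l)\<close> under the jump law.\<close>

lemma duhamel:
 assumes kw: "killed_walk W B c s" and v: "killed_walk.heat_sol W B c s v" and x: "x \<in> B" "adjacent c x w" and t: "t >= 0"
  and W: "\<And>z. adjacent c x z ==> z \<in> W"
 shows "ennreal (exp (- (exit_rate G x * t)) * v 0 x) + (\<Sum>z | adjacent c x z. ennreal (pmf (jump_law G x) z) *
  (\<integral>\<^sup>+e. indicator {0..exit_rate G x * t} e * ennreal (v (t - e / exit_rate G x) z) \<partial>Exp1)) = ennreal (v t x)"
proof -
 interpret killed_walk W B c s by fact
 define l where "l = exit_rate G x"
 have l: "l > 0" using exit_rate_pos[OF x(2)] by (simp add: l_def)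
 define f where "f e = exp (- e) * (\<Sum>z | adjacent c x z. pmf (jump_law G x) z * v (t - e / l) z)" for e
 define F where "F e = - exp (- e) * v (t - e / l) x" for e
 have lap_eq: "lap (v r) x = l * ((\<Sum>z | adjacent c x z. pmf (jump_law G x) z * v r z) - v r x)" for r
 proof -
  have "(\<Sum>y\<in>W. c x y * (v r y - v r x)) = (\<Sum>y | adjacent c x y. c x y * (v r y - v r x))"
   using finite_W W nonneg by (intro sum.mono_neutral_right) (auto simp: adjacent_iff less_le)
  also have "... = (\<Sum>y | adjacent c x y. c x y * v r y) - mu c x * v r x"
   by (simp add: right_diff_distrib sum_subtractf mu_def sum_distrib_right)
  also have "(\<Sum>y | adjacent c x y. c x y * v r y) = mu c x * (\<Sum>z | adjacent c x z. pmf (jump_law G x) z * v r z)"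
   unfolding sum_distrib_left using mu_pos[OF x(2)] by (intro sum.cong refl) (simp add: pmf_jump[OF x(2)])
  finally have e: "(\<Sum>y\<in>W. c x y * (v r y - v r x)) = mu c x * ((\<Sum>z | adjacent c x z. pmf (jump_law G x) z * v r z) - v r x)"
   by (simp only: right_diff_distrib)
  show ?thesis unfolding lap_def e l_def exit_rate_eq by simp
 qed
 have F': "(F has_real_derivative f e) (at e)" for e
 proof -
  have d: "((\<lambda>e. v (t - e / l) x) has_real_derivative lap (v (t - e / l)) x * (- 1 / l)) (at e)"
   by (rule DERIV_chain2[where f="\<lambda>t. v t x", OF heat_solD(3)[OF v x(1)]]) (use l in \<open>auto intro!: derivative_eq_intros\<close>)
  have "(F has_real_derivative - exp (- e) * (lap (v (t - e / l)) x * (- 1 / l)) + exp (- e) * v (t - e / l) x) (at e)"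
   unfolding F_def by (rule derivative_eq_intros d refl)+ simp
  then show ?thesis using l by (simp add: f_def lap_eq field_simps)
 qed
 have cont_v: "continuous_on UNIV (\<lambda>r. v r z)" for z
 proof (cases "z \<in> B")
  case True
  then show ?thesis using heat_solD(3)[OF v]
   by (intro continuous_at_imp_continuous_on ballI) (auto intro: DERIV_isCont)
 next
  case False
  then show ?thesis using heat_solD(1)[OF v] by simp
 qed
 have [measurable]: "(\<lambda>r. v r z) \<in> borel_measurable borel" for z
  by (rule borel_measurable_continuous_onI[OF cont_v])
 have [measurable]: "f \<in> borel_measurable borel" unfolding f_def by measurable
 have v_nn: "v (t - e / l) z >= 0" if "e \<in> {0..l * t}" for e z
  using that l by (intro heat_solD(2)[OF v]) (simp add: field_simps)
 have "(\<Sum>z | adjacent c x z. ennreal (pmf (jump_law G x) z) *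
  (\<integral>\<^sup>+e. indicator {0..l * t} e * ennreal (v (t - e / l) z) \<partial>Exp1))
   = (\<integral>\<^sup>+e. (\<Sum>z | adjacent c x z. ennreal (pmf (jump_law G x) z) * (indicator {0..l * t} e * ennreal (v (t - e / l) z))) \<partial>Exp1)"
  by (subst nn_integral_sum) (auto simp: nn_integral_cmult)
 also have "... = (\<integral>\<^sup>+e. exponential_density 1 e * (\<Sum>z | adjacent c x z. ennreal (pmf (jump_law G x) z) * (indicator {0..l * t} e * ennreal (v (t - e / l) z))) \<partial>lborel)"
  by (subst nn_integral_density) auto
 also have "... = (\<integral>\<^sup>+e. ennreal (f e) * indicator {0..l * t} e \<partial>lborel)"
 proof (intro nn_integral_cong)
  fix e :: real
  show "ennreal (exponential_density 1 e) * (\<Sum>z | adjacent c x z. ennreal (pmf (jump_law G x) z) * (indicator {0..l * t} e * ennreal (v (t - e / l) z))) = ennreal (f e) * indicator {0..l * t} e"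
  proof (cases "e \<in> {0..l * t}")
   case True
   have "(\<Sum>z | adjacent c x z. ennreal (pmf (jump_law G x) z) * (indicator {0..l * t} e * ennreal (v (t - e / l) z)))
     = (\<Sum>z | adjacent c x z. ennreal (pmf (jump_law G x) z * v (t - e / l) z))"
    using True v_nn by (intro sum.cong) (auto simp: ennreal_mult)
   also have "... = ennreal (\<Sum>z | adjacent c x z. pmf (jump_law G x) z * v (t - e / l) z)"
    using v_nn[OF True] by (intro sum_ennreal) auto
   finally show ?thesis using True v_nn[OF True] by (simp add: f_def exponential_density_def ennreal_mult sum_nonneg)
  qed simp
 qed
 also have "... = F (l * t) - F 0"
 proof (rule nn_integral_FTC_Icc)
  show "0 <= f e" if "e \<in> {0..l * t}" for e
   using v_nn[OF that] by (auto simp: f_def intro!: mult_nonneg_nonneg sum_nonneg)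
  show "0 <= l * t" using l t by simp
 qed (use F' in auto)
 also have "F (l * t) - F 0 = v t x - exp (- (l * t)) * v 0 x" using l by (simp add: F_def)
 finally have eq: "(\<Sum>z | adjacent c x z. ennreal (pmf (jump_law G x) z) *
  (\<integral>\<^sup>+e. indicator {0..l * t} e * ennreal (v (t - e / l) z) \<partial>Exp1)) = ennreal (v t x - exp (- (l * t)) * v 0 x)" .
 have "exp (- (l * t)) * v 0 x <= v t x"
 proof -
  have "F 0 <= F (l * t)"
  proof (rule DERIV_nonneg_imp_nondecreasing[where f=F])
   show "0 <= l * t" using l t by simp
   show "\<exists>y. (F has_real_derivative y) (at e) \<and> 0 <= y" if "0 <= e" "e <= l * t" for e
    using F'[of e] v_nn[of e] that by (auto simp: f_def intro!: exI[of _ "f e"] mult_nonneg_nonneg sum_nonneg)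
  qed
  then show ?thesis using l by (simp add: F_def)
 qed
 then show ?thesis unfolding l_def[symmetric] eq using heat_solD(2)[OF v] by (subst ennreal_plus[symmetric]) auto
qed

text \<open>Induction on the number of jumps: as long as the walk has not left \<open>B\<close>,
  both sides obey the same first jump equation, and the nonnegative solution \<open>v\<close>
  dominates the partial sums.\<close>

lemma Hm_le:
 assumes kw: "killed_walk W B c s" and v: "killed_walk.heat_sol W B c s v" "v 0 y >= 1"
  and B: "\<And>x. x \<in> B ==> \<exists>w. adjacent c x w" and W: "\<And>x z. x \<in> B ==> adjacent c x z ==> z \<in> W"
  and x: "inball c B n x" and t: "t >= 0"
 shows "(\<Sum>m\<le>n. Hm y m t x) <= ennreal (v t x)"
proof -
 interpret killed_walk W B c s by fact
 have H0: "Hm y 0 t x <= ennreal (exp (- (exit_rate G x * t)) * v 0 x)" if x: "x \<in> B" and t: "t >= 0" for t x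
 proof (cases "x = y")
  case True
  obtain w where "adjacent c x w" using B[OF x] by blast
  then have "Hm y 0 t x = ennreal (exp (- (exit_rate G x * t)))"
   using True t by (simp add: Hm_def pathw_def rates_def holdp_single exit_rate_pos)
  also have "... <= ennreal (exp (- (exit_rate G x * t)) * v 0 x)" using v(2) True by (intro ennreal_leI) simp
  finally show ?thesis .
 qed (simp add: Hm_def)
 show ?thesis using x t
 proof (induction n arbitrary: x t)
  case 0
  obtain w where w: "adjacent c x w" using B[of x] 0 by auto
  have x: "x \<in> B" using 0 by simp
  have "Hm y 0 t x <= ennreal (exp (- (exit_rate G x * t)) * v 0 x)" by (rule H0[OF x 0(2)])
  also have "... <= ennreal (v t x)"
   unfolding le_iff_add using duhamel[OF kw v(1) x w 0(2) W[OF x], symmetric] by blast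
  finally show ?case by simp
 next
  case (Suc n)
  then have x: "x \<in> B" by simp
  obtain w where w: "adjacent c x w" using B[OF x] by auto
  let ?l = "exit_rate G x"
  have l: "?l > 0" using exit_rate_pos[OF w] .
  let ?U = "\<Sum>z | adjacent c x z. ennreal (pmf (jump_law G x) z) *
    (\<integral>\<^sup>+e. indicator {0..?l * t} e * ennreal (v (t - e / ?l) z) \<partial>Exp1)"
  have "(\<Sum>m\<le>n. Hm y (Suc m) t x) = (\<Sum>z | adjacent c x z. ennreal (pmf (jump_law G x) z) *
    (\<integral>\<^sup>+e. indicator {0..?l * t} e * (\<Sum>m\<le>n. Hm y m (t - e / ?l) z) \<partial>Exp1))"
   unfolding Hm_Suc[OF Suc.prems(2) w]
  proof (subst sum.swap, rule sum.cong[OF refl])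
   fix z
   show "(\<Sum>m\<le>n. ennreal (pmf (jump_law G x) z) * (\<integral>\<^sup>+e. indicator {0..?l * t} e * Hm y m (t - e / ?l) z \<partial>Exp1))
    = ennreal (pmf (jump_law G x) z) * (\<integral>\<^sup>+e. indicator {0..?l * t} e * (\<Sum>m\<le>n. Hm y m (t - e / ?l) z) \<partial>Exp1)"
    by (simp only: sum_distrib_left) (subst nn_integral_sum; simp add: sum_distrib_left)
  qed
  also have "... <= ?U"
  proof (rule sum_mono, rule mult_left_mono, rule nn_integral_mono)
   fix z e assume z: "z \<in> {z. adjacent c x z}"
   show "indicator {0..?l * t} e * (\<Sum>m\<le>n. Hm y m (t - e / ?l) z) <= indicator {0..?l * t} e * ennreal (v (t - e / ?l) z)"
   proof (cases "e \<in> {0..?l * t}")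
    case True
    then have "0 <= t - e / ?l" using l by (simp add: field_simps)
    then show ?thesis using True Suc.IH[of z "t - e / ?l"] Suc.prems(1) z by simp
   qed simp
  qed auto
  finally have 1: "(\<Sum>m\<le>n. Hm y (Suc m) t x) <= ?U" .
  have "(\<Sum>m\<le>Suc n. Hm y m t x) = Hm y 0 t x + (\<Sum>m\<le>n. Hm y (Suc m) t x)"
   by (rule sum.atMost_Suc_shift)
  also have "... <= ennreal (exp (- (?l * t)) * v 0 x) + ?U" by (rule add_mono[OF H0[OF x Suc.prems(2)] 1])
  also have "... = ennreal (v t x)" by (rule duhamel[OF kw v(1) x w Suc.prems(2) W[OF x]])
  finally show ?case .
 qed
qed


lemma ball_image_lessThan: "(\<forall>j\<in>f ` {..<n::nat}. P j) \<longleftrightarrow> (\<forall>i<n. P (f i))"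
 by auto

lemma in_paths_iff: "ps \<in> paths c n x \<longleftrightarrow> length ps = n \<and> (\<forall>i<n. adjacent c ((x # ps) ! i) (ps ! i))"
proof (induction n arbitrary: x ps)
 case (Suc n)
 show ?case
 proof (cases ps)
  case (Cons z qs)
  have "ps \<in> paths c (Suc n) x \<longleftrightarrow> adjacent c x z \<and> qs \<in> paths c n z" using Cons by auto
  then show ?thesis unfolding Suc.IH Cons by (auto simp: All_less_Suc2)
 qed auto
qed auto

lemma product_jump: "product_prob_space (\<lambda>(n::nat, z). measure_pmf (jump_law G z))"
 by (rule product_prob_spaceI) (simp add: split_beta measure_pmf.prob_space_axioms)

abbreviation "N\<xi> \<equiv> PiM UNIV (\<lambda>(n::nat, z). measure_pmf (jump_law G z))"

definition follow :: "'d vertex => 'd vertex list => (nat \<times> 'd vertex => 'd vertex) set" where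
 "follow x ps = {\<xi> \<in> space N\<xi>. \<forall>i<length ps. \<xi> (i, (x # ps) ! i) = ps ! i}"

text \<open>The step number keeps the coordinates \<open>(i, (x # ps) ! i)\<close> distinct even if
  the path revisits a state, so independence gives a product.\<close>

lemma follow: "follow x ps \<in> sets N\<xi>" "emeasure N\<xi> (follow x ps) = pathw x ps"
proof -
 interpret product_prob_space "\<lambda>(n::nat, z). measure_pmf (jump_law G z)" UNIV by (rule product_jump)
 define J where "J = (\<lambda>i. (i, (x # ps) ! i)) ` {..<length ps}"
 have eq: "follow x ps = {\<xi> \<in> space N\<xi>. \<forall>j\<in>J. \<xi> j \<in> {ps ! fst j}}"
  unfolding follow_def J_def ball_image_lessThan by simp
 show "follow x ps \<in> sets N\<xi>"
  unfolding eq by (rule sets.sets_Collect_finite_All) (auto simp: J_def intro!: sets_Collect_single')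
 have "emeasure N\<xi> (follow x ps) = (\<Prod>j\<in>J. emeasure (case j of (n, z) => measure_pmf (jump_law G z)) {ps ! fst j})"
  unfolding eq by (rule emeasure_PiM_Collect) (auto simp: J_def split: prod.splits)
 also have "... = pathw x ps"
  unfolding J_def pathw_def by (subst prod.reindex) (auto simp: inj_on_def emeasure_pmf_single)
 finally show "emeasure N\<xi> (follow x ps) = pathw x ps" .
qed

lemma set_pmf_jump: "adjacent c x w ==> z \<in> set_pmf (jump_law G x) ==> adjacent c x z"
 by (auto simp: set_pmf_iff pmf_jump split: if_splits)

text \<open>Almost surely every candidate jump lies in the support of its law, so the jumps made up
  to time \<open>t\<close> follow open edges. The event is then covered by the increasing sets
  \<open>U n\<close>, which allow at most \<open>n\<close> jumps and whose measures are bounded by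
  the partial sums.\<close>

lemma transition_prob_le:
 assumes x: "adjacent c x w" and K: "K >= 0" and le: "\<And>n. (\<Sum>m\<le>n. Hm y m t x) <= ennreal K"
 shows "transition_prob G t x y <= K"
proof -
 interpret P: product_prob_space "\<lambda>(n::nat, z). measure_pmf (jump_law G z)" "UNIV :: (nat \<times> 'd vertex) set"
  by (rule product_jump)
 let ?N = "N\<xi> \<Otimes>\<^sub>M Exp1.S"
 have N: "chain_noise G = ?N" by (simp add: chain_noise_def)
 define H where "H ps = {\<eta> \<in> space Exp1.S. hold (rates (x # ps)) t \<eta>}" for ps
 define Q where "Q m = {ps\<in>paths c m x. last (x # ps) = y}" for m
 have finite_Q: "finite (Q m)" for m unfolding Q_def by (rule finite_subset[OF _ finite_paths[of c m x]]) auto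
 define U where "U n = (\<Union>m\<le>n. \<Union>ps\<in>Q m. follow x ps \<times> H ps)" for n
 have H: "H ps \<in> sets Exp1.S" for ps unfolding H_def by measurable
 have U [measurable]: "U n \<in> sets ?N" for n
  unfolding U_def using finite_Q follow(1) H by (intro sets.finite_UN) auto
 have U_le: "emeasure ?N (U n) <= ennreal K" for n
 proof -
  have "emeasure ?N (U n) <= (\<Sum>m\<le>n. emeasure ?N (\<Union>ps\<in>Q m. follow x ps \<times> H ps))"
   unfolding U_def using finite_Q follow(1) H by (intro emeasure_subadditive_finite) (auto intro!: sets.finite_UN)
  also have "... <= (\<Sum>m\<le>n. Hm y m t x)"
  proof (rule sum_mono)
   fix m
   have "emeasure ?N (\<Union>ps\<in>Q m. follow x ps \<times> H ps)
    <= (\<Sum>ps\<in>Q m. emeasure ?N (follow x ps \<times> H ps))"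
    using finite_Q follow(1) H by (intro emeasure_subadditive_finite) auto
   also have "... = (\<Sum>ps\<in>Q m. pathw x ps * holdp (rates (x # ps)) t)"
    using follow H by (intro sum.cong refl) (simp add: Exp1.P.emeasure_pair_measure_Times H_def holdp_def)
   also have "... = Hm y m t x"
    unfolding Hm_def Q_def using finite_paths by (intro sum.inter_filter)
   finally show "emeasure ?N (\<Union>ps\<in>Q m. follow x ps \<times> H ps) <= Hm y m t x" .
  qed
  also have "... <= ennreal K" by (rule le)
  finally show ?thesis .
 qed
 have "AE \<xi> in N\<xi>. \<forall>j. \<xi> j \<in> set_pmf (jump_law G (snd j))"
  unfolding AE_all_countable
 proof
  fix j :: "nat \<times> 'd vertex"
  show "AE \<xi> in N\<xi>. \<xi> j \<in> set_pmf (jump_law G (snd j))"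
   by (rule P.AE_component[of j]) (auto split: prod.splits simp: AE_measure_pmf)
 qed
 then have "AE z in ?N. \<forall>j. fst z j \<in> set_pmf (jump_law G (snd j))"
  by (intro AE_distrD[of fst ?N N\<xi>] measurable_fst) (simp only: Exp1.P.distr_pair_fst)
 then have "AE z in ?N. z \<in> {(\<xi>, \<eta>) \<in> space ?N. chain_at G x \<xi> \<eta> t y} --> z \<in> (\<Union>n. U n)"
  using AE_space
 proof eventually_elim
  case (elim z)
  show ?case
  proof
   assume "z \<in> {(\<xi>, \<eta>) \<in> space ?N. chain_at G x \<xi> \<eta> t y}"
   then obtain \<xi> \<eta> m where z: "z = (\<xi>, \<eta>)" and jt: "jump_time G x \<xi> \<eta> m <= ennreal t" "ennreal t < jump_time G x \<xi> \<eta> (Suc m)"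
    and y: "jump_chain x \<xi> m = y" by (auto simp: chain_at_def)
   let ?Y = "jump_chain x \<xi>"
   have \<xi>: "\<xi> j \<in> set_pmf (jump_law G (snd j))" for j using elim(1) unfolding z fst_conv by blast
   have adj: "adjacent c (?Y i) (?Y (Suc i))" for i
   proof (induction i)
    case 0
    show ?case using set_pmf_jump[OF x \<xi>[of "(0, x)", simplified]] by simp
   next
    case (Suc i)
    then have "adjacent c (?Y (Suc i)) (?Y i)" by (simp only: adjacent_commute)
    then show ?case using set_pmf_jump[OF _ \<xi>[of "(Suc i, ?Y (Suc i))", simplified]] by simp
   qed
   define ps where "ps = map (\<lambda>i. ?Y (Suc i)) [0..<m]"
   have len: "length ps = m" by (simp add: ps_def)
   have nth: "(x # ps) ! i = ?Y i" if "i <= m" for i using that by (cases i) (auto simp: ps_def)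
   have ps_nth: "ps ! i = ?Y (Suc i)" if "i < m" for i using that by (simp add: ps_def)
   have "ps \<in> paths c m x" unfolding in_paths_iff using len nth ps_nth adj by auto
   moreover have "last (x # ps) = y"
   proof -
    have "last (x # ps) = (x # ps) ! (length (x # ps) - 1)" by (rule last_conv_nth) simp
    also have "length (x # ps) - 1 = m" using len by simp
    finally show ?thesis using nth[of m] y by simp
   qed
   moreover have "\<xi> \<in> follow x ps" using elim z nth ps_nth len by (auto simp: follow_def space_pair_measure)
   moreover have "\<eta> \<in> H ps"
   proof -
    have "(\<Sum>k<n. ennreal (\<eta> k) / ennreal (rates (x # ps) ! k)) = jump_time G x \<xi> \<eta> n" if "n <= Suc m" for n
     unfolding jump_time_def using that len nth
     by (intro sum.cong refl) (simp add: rates_def del: list.map nth_Cons_Suc)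
    then show ?thesis using jt elim z len
     by (simp add: H_def hold_def space_pair_measure rates_def del: sum.lessThan_Suc)
   qed
   ultimately show "z \<in> (\<Union>n. U n)" unfolding U_def Q_def z by blast
  qed
 qed
 then have "emeasure ?N {(\<xi>, \<eta>) \<in> space ?N. chain_at G x \<xi> \<eta> t y} <= emeasure ?N (\<Union>n. U n)"
  by (rule emeasure_mono_AE) auto
 also have "... = (SUP n. emeasure ?N (U n))"
 proof (rule SUP_emeasure_incseq[symmetric])
  show "range U \<subseteq> sets ?N" using U by blast
  show "incseq U" unfolding incseq_def U_def by (intro allI impI UN_mono) auto
 qed
 also have "... <= ennreal K" using U_le by (intro SUP_least)
 finally show ?thesis
  unfolding transition_prob_def N measure_def using K by (simp add: enn2real_leI)
qed

end

section \<open>Potential estimates on the lattice\<close>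

lemma linfnorm_le_iff: "linfnorm (x :: 'd::finite vertex) <= r \<longleftrightarrow> (\<forall>i. \<bar>real_of_int (x $ i)\<bar> <= r)"
 unfolding linfnorm_def by (subst Max_le_iff) auto

lemma linfnorm_component: "\<bar>real_of_int (x $ i)\<bar> <= linfnorm (x :: 'd::finite vertex)"
 using linfnorm_le_iff[of x "linfnorm x"] by simp

lemma linfnorm_nonneg: "0 <= linfnorm (x :: 'd::finite vertex)" using linfnorm_component[of x undefined] by linarith

lemma linfnorm_minus: "linfnorm (x - y) = linfnorm (y - x :: 'd::finite vertex)"
 unfolding linfnorm_def by (simp add: abs_minus_commute)

lemma linfnorm_triangle: "linfnorm (x + y) <= linfnorm x + linfnorm (y :: 'd::finite vertex)"
 unfolding linfnorm_le_iff
 using linfnorm_component[of x] linfnorm_component[of y] by (auto intro: order_trans[OF abs_triangle_ineq] add_mono)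

lemma linfnorm_triangle3: "linfnorm (x - z) <= linfnorm (x - y) + linfnorm (y - z :: 'd::finite vertex)"
 using linfnorm_triangle[of "x - y" "y - z"] by simp

lemma linfnorm_zero [simp]: "linfnorm (0 :: 'd::finite vertex) = 0"
 unfolding linfnorm_def by simp

lemma linfnorm_int: "\<exists>n::nat. linfnorm (x :: 'd::finite vertex) = real n"
proof -
 have "linfnorm x \<in> range (\<lambda>i. \<bar>real_of_int (x $ i)\<bar>)" unfolding linfnorm_def by (rule Max_in) auto
 then obtain i where "linfnorm x = \<bar>real_of_int (x $ i)\<bar>" by auto
 then have "linfnorm x = real (nat \<bar>x $ i\<bar>)" by simp
 then show ?thesis by blast
qed

lemma linfnorm_eq_0: "linfnorm (x :: 'd::finite vertex) < 1 ==> x = 0"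
proof (rule vec_eq_iff[THEN iffD2], rule allI)
 fix i assume "linfnorm x < 1"
 then have "\<bar>real_of_int (x $ i)\<bar> < 1" using linfnorm_component[of x i] by linarith
 then show "x $ i = 0 $ i" by simp
qed

lemma linfnorm_le_l1norm: "linfnorm (x :: 'd::finite vertex) <= l1norm x"
 unfolding linfnorm_le_iff l1norm_def by (auto intro!: member_le_sum)

lemma l1norm_le_linfnorm: "l1norm (x :: 'd::finite vertex) <= real CARD('d) * linfnorm x"
 unfolding l1norm_def using sum_bounded_above[of UNIV "\<lambda>i. \<bar>real_of_int (x $ i)\<bar>" "linfnorm x"] linfnorm_component[of x]
 by simp

lemma box_mem: "y \<in> box x r \<longleftrightarrow> linfnorm (y - x) <= r" by (simp add: box_def linfnorm_minus)

lemma box_mem_sym: "y \<in> box x r \<longleftrightarrow> x \<in> box y r" by (simp add: box_def linfnorm_minus)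

lemma box_subset: "linfnorm (x - y) + r <= r' ==> box x r \<subseteq> box y r'"
 unfolding box_mem subset_iff using linfnorm_triangle3 by (smt (verit, best))

lemma box_eq_image: "box x r = (\<lambda>f. vec_lambda f) ` PiE UNIV (\<lambda>i. {x $ i - \<lfloor>r\<rfloor>..x $ i + \<lfloor>r\<rfloor>})"
proof (rule set_eqI)
 fix y :: "'a vertex"
 have "y \<in> box x r \<longleftrightarrow> (\<forall>i. y $ i \<in> {x $ i - \<lfloor>r\<rfloor>..x $ i + \<lfloor>r\<rfloor>})"
 proof -
  have "\<bar>real_of_int (y $ i - x $ i)\<bar> <= r \<longleftrightarrow> y $ i \<in> {x $ i - \<lfloor>r\<rfloor>..x $ i + \<lfloor>r\<rfloor>}" for i
  proof -
   have "\<bar>real_of_int (y $ i - x $ i)\<bar> <= r \<longleftrightarrow> real_of_int \<bar>y $ i - x $ i\<bar> <= r" by simp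
   also have "... \<longleftrightarrow> \<bar>y $ i - x $ i\<bar> <= \<lfloor>r\<rfloor>" by (simp add: le_floor_iff)
   finally show ?thesis by auto
  qed
  then show ?thesis unfolding box_mem linfnorm_le_iff by simp
 qed
 also have "... \<longleftrightarrow> y \<in> (\<lambda>f. vec_lambda f) ` PiE UNIV (\<lambda>i. {x $ i - \<lfloor>r\<rfloor>..x $ i + \<lfloor>r\<rfloor>})"
  by (auto simp: image_iff PiE_UNIV_domain intro!: bexI[of _ "vec_nth y"])
 finally show "y \<in> box x r \<longleftrightarrow> y \<in> (\<lambda>f. vec_lambda f) ` PiE UNIV (\<lambda>i. {x $ i - \<lfloor>r\<rfloor>..x $ i + \<lfloor>r\<rfloor>})" .
qed

lemma finite_box [simp]: "finite (box x r)"
 unfolding box_eq_image by (intro finite_imageI finite_PiE) auto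

lemma card_box_le: assumes "r >= 0" shows "real (card (box (x :: 'd::finite vertex) r)) <= (2 * r + 1) ^ CARD('d)"
proof -
 have "card (box x r) <= card (PiE UNIV (\<lambda>i. {x $ i - \<lfloor>r\<rfloor>..x $ i + \<lfloor>r\<rfloor>}))"
  unfolding box_eq_image by (intro card_image_le finite_PiE) auto
 also have "... = nat (2 * \<lfloor>r\<rfloor> + 1) ^ CARD('d)" by (simp add: card_PiE)
 finally have "real (card (box x r)) <= real (nat (2 * \<lfloor>r\<rfloor> + 1)) ^ CARD('d)"
  by (metis of_nat_le_iff of_nat_power)
 also have "... <= (2 * r + 1) ^ CARD('d)"
 proof (rule power_mono)
  have "0 <= \<lfloor>r\<rfloor>" using assms by simp
  then show "real (nat (2 * \<lfloor>r\<rfloor> + 1)) <= 2 * r + 1" by simp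
 qed simp
 finally show ?thesis .
qed

section \<open>Averages over dyadic cubes and discrete potentials\<close>

definition cube :: "'d::finite vertex => nat => 'd vertex set" where
 "cube x n = {z. \<forall>i. x $ i <= z $ i \<and> z $ i < x $ i + int n}"

definition grad1 :: "('d::finite vertex => real) => 'd vertex => real" where
 "grad1 f z = (\<Sum>i\<in>UNIV. \<bar>f (z + axis i 1) - f z\<bar>)"

lemma cube_1: "cube x 1 = {x}"
 by (auto simp: cube_def vec_eq_iff) (metis add_0 int_one_le_iff_zero_less less_add_one not_less order_antisym zless_add1_eq)

lemma cube_subset_box:
 assumes z: "z \<in> cube x n" shows "linfnorm (z - x) <= real n"
 unfolding linfnorm_le_iff
proof
 fix i
 have "x $ i <= z $ i \<and> z $ i < x $ i + int n" using z by (simp add: cube_def)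
 then have "\<bar>z $ i - x $ i\<bar> <= int n" by linarith
 then have "real_of_int \<bar>z $ i - x $ i\<bar> <= real_of_int (int n)" by (rule of_int_le_iff[THEN iffD2])
 then show "\<bar>real_of_int ((z - x) $ i)\<bar> <= real n" by simp
qed

lemma finite_cube [simp]: "finite (cube x n)"
 by (rule finite_subset[of _ "box x (real n)"]) (auto simp: box_mem cube_subset_box)

lemma cube_shift: "cube (x + w) n = (\<lambda>z. z + w) ` cube x n"
proof (rule set_eqI)
 fix z
 have "z \<in> cube (x + w) n \<longleftrightarrow> z - w \<in> cube x n" by (simp add: cube_def algebra_simps)
 then show "z \<in> cube (x + w) n \<longleftrightarrow> z \<in> (\<lambda>z. z + w) ` cube x n"
  by (auto simp: image_iff) (metis diff_add_cancel)
qed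

lemma sum_cube_shift: "sum f (cube (x + w) n) = (\<Sum>z\<in>cube x n. f (z + w))"
 unfolding cube_shift by (subst sum.reindex) auto

definition corner :: "nat => 'd::finite set => 'd vertex" where
 "corner n I = (\<chi> i. if i \<in> I then int n else 0)"

lemma cube_double: "cube x (2 * n) = (\<Union>I\<in>UNIV. cube (x + corner n I) n)"
proof (rule set_eqI)
 fix z
 show "z \<in> cube x (2 * n) \<longleftrightarrow> z \<in> (\<Union>I\<in>UNIV. cube (x + corner n I) n)"
 proof
  assume z: "z \<in> cube x (2 * n)"
  have "z \<in> cube (x + corner n {i. z $ i >= x $ i + int n}) n"
   using z by (auto simp: cube_def corner_def) (smt (verit))
  then show "z \<in> (\<Union>I\<in>UNIV. cube (x + corner n I) n)" by blast
 next
  assume "z \<in> (\<Union>I\<in>UNIV. cube (x + corner n I) n)"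
  then obtain I where "z \<in> cube (x + corner n I) n" by blast
  then have "x $ i + (if i \<in> I then int n else 0) <= z $ i \<and> z $ i < x $ i + (if i \<in> I then int n else 0) + int n" for i
   by (simp add: cube_def corner_def)
  then show "z \<in> cube x (2 * n)" unfolding cube_def by (auto split: if_splits) (smt (verit))+
 qed
qed

lemma cube_disjoint: "I ~= J ==> cube (x + corner n I) n \<inter> cube (x + corner n J) n = {}"
proof (rule ccontr)
 assume IJ: "I ~= J" and "cube (x + corner n I) n \<inter> cube (x + corner n J) n ~= {}"
 then obtain z where z: "z \<in> cube (x + corner n I) n" "z \<in> cube (x + corner n J) n" by blast
 have "i \<in> I \<longleftrightarrow> i \<in> J" for i
  using z by (auto simp: cube_def corner_def split: if_splits dest!: spec[of _ i])
 then show False using IJ by blast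
qed

lemma sum_cube_double: "sum f (cube x (2 * n)) = (\<Sum>I\<in>UNIV. sum f (cube (x + corner n I) n))"
 unfolding cube_double by (intro sum.UNION_disjoint) (simp_all add: cube_disjoint)

lemma corner_insert: "i \<notin> I ==> corner n (insert i I) = corner n I + axis i (int n)"
 by (auto simp: corner_def vec_eq_iff axis_def)

text \<open>The cube is moved to its corner by unit translations, one direction of \<open>I\<close>
  after another; each changes the sum by at most the gradient over the doubled cube.\<close>

lemma corner_diff_bound:
 fixes f :: "'d::finite vertex => real"
 shows "\<bar>sum f (cube (x + corner n I) n) - sum f (cube x n)\<bar> <= real (card I) * real n * sum (grad1 f) (cube x (2 * n))"
proof (induction I rule: finite_induct[OF finite])
 case 1
 then show ?case by (simp add: corner_def zero_vec_def[symmetric])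
next
 case (2 i I)
 define y where "y = x + corner n I"
 have step: "\<bar>sum f (cube (y + axis i (int (Suc k))) n) - sum f (cube (y + axis i (int k)) n)\<bar> <= sum (grad1 f) (cube x (2 * n))" if "k < n" for k
 proof -
  have ax: "y + axis i (int (Suc k)) = (y + axis i (int k)) + axis i 1" by (auto simp: vec_eq_iff axis_def)
  have "\<bar>sum f (cube (y + axis i (int (Suc k))) n) - sum f (cube (y + axis i (int k)) n)\<bar>
    = \<bar>\<Sum>z\<in>cube (y + axis i (int k)) n. f (z + axis i 1) - f z\<bar>"
   unfolding ax sum_cube_shift[of f "y + axis i (int k)" "axis i 1"] sum_subtractf ..
  also have "... <= (\<Sum>z\<in>cube (y + axis i (int k)) n. \<bar>f (z + axis i 1) - f z\<bar>)" by (rule sum_abs)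
  also have "... <= (\<Sum>z\<in>cube (y + axis i (int k)) n. grad1 f z)"
   unfolding grad1_def by (intro sum_mono member_le_sum) auto
  also have "... <= sum (grad1 f) (cube x (2 * n))"
  proof (rule sum_mono2)
   show "cube (y + axis i (int k)) n \<subseteq> cube x (2 * n)"
   proof
    fix z assume z: "z \<in> cube (y + axis i (int k)) n"
    show "z \<in> cube x (2 * n)" unfolding cube_def
    proof (intro CollectI allI)
     fix j
     have "y $ j + (if j = i then int k else 0) <= z $ j" "z $ j < y $ j + (if j = i then int k else 0) + int n"
      using z by (auto simp: cube_def axis_def dest: spec[of _ j])
     moreover have "y $ j = x $ j + (if j \<in> I then int n else 0)" by (simp add: y_def corner_def)
     ultimately show "x $ j <= z $ j \<and> z $ j < x $ j + int (2 * n)"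
      using 2(2) that by (cases "j = i"; cases "j \<in> I") auto
    qed
   qed
  qed (auto simp: grad1_def sum_nonneg)
  finally show ?thesis .
 qed
 have tele: "\<bar>sum f (cube (y + axis i (int k)) n) - sum f (cube y n)\<bar> <= real k * sum (grad1 f) (cube x (2 * n))" if "k <= n" for k
  using that
 proof (induction k)
  case 0
  have "y + axis i (int 0) = y" by (simp add: vec_eq_iff axis_def)
  then show ?case by (simp only:)
 next
  case (Suc k)
  then show ?case using step[of k] by (simp add: algebra_simps)
 qed
 have "x + corner n (insert i I) = y + axis i (int n)" using 2 by (simp add: corner_insert y_def add.assoc)
 then show ?case using tele[of n] 2 unfolding y_def by (simp add: algebra_simps)
qed

text \<open>Each of the \<open>2 ^ d\<close> translates that tile the doubled cube is compared with
  the original one. The result is an L1 Poincare inequality with the scaling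
  \<open>n / n ^ d\<close>.\<close>

lemma cube_average_step:
 fixes f :: "'d::finite vertex => real"
 defines "d \<equiv> CARD('d)"
 assumes n: "n > 0"
 shows "\<bar>sum f (cube x (2 * n)) / real (2 * n) ^ d - sum f (cube x n) / real n ^ d\<bar>
  <= real d * (real n / real n ^ d) * sum (grad1 f) (cube x (2 * n))"
proof -
 let ?g = "sum (grad1 f) (cube x (2 * n))"
 have g: "?g >= 0" by (auto simp: grad1_def intro!: sum_nonneg)
 have "card (UNIV :: 'd set set) = 2 ^ d"
  unfolding d_def by (metis Pow_UNIV card_Pow finite)
 then have "sum f (cube x (2 * n)) - 2 ^ d * sum f (cube x n) = (\<Sum>I\<in>UNIV. sum f (cube (x + corner n I) n) - sum f (cube x n))"
  by (simp add: sum_cube_double sum_subtractf)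
 also have "\<bar>...\<bar> <= (\<Sum>I\<in>(UNIV :: 'd set set). real d * real n * ?g)"
 proof (rule order_trans[OF sum_abs], rule sum_mono)
  fix I :: "'d set"
  have "card I <= d" unfolding d_def by (intro card_mono) auto
  then have "real (card I) * real n * ?g <= real d * real n * ?g" using g by (intro mult_right_mono) auto
  then show "\<bar>sum f (cube (x + corner n I) n) - sum f (cube x n)\<bar> <= real d * real n * ?g"
   using corner_diff_bound[of f x n I] by linarith
 qed
 also have "... = 2 ^ d * (real d * real n * ?g)" using \<open>card (UNIV :: 'd set set) = 2 ^ d\<close> by simp
 finally have le: "\<bar>sum f (cube x (2 * n)) - 2 ^ d * sum f (cube x n)\<bar> <= 2 ^ d * (real d * real n * ?g)" .
 have "sum f (cube x (2 * n)) / real (2 * n) ^ d - sum f (cube x n) / real n ^ d = (sum f (cube x (2 * n)) - 2 ^ d * sum f (cube x n)) / real (2 * n) ^ d"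
  using n by (simp add: power_mult_distrib field_simps)
 also have "\<bar>...\<bar> <= 2 ^ d * (real d * real n * ?g) / real (2 * n) ^ d"
  unfolding abs_divide using le by (intro frac_le) (use n in auto)
 also have "... = real d * (real n / real n ^ d) * ?g" using n by (simp add: power_mult_distrib field_simps)
 finally show ?thesis .
qed


text \<open>Cut off at 1 so that negative powers of the distance stay bounded on the
  diagonal.\<close>

definition kern :: "'d::finite vertex => 'd vertex => real" where
 "kern x z = max 1 (linfnorm (x - z))"

lemma kern_ge_1: "1 <= kern x z" by (simp add: kern_def)

lemma kern_pos: "0 < kern x z" using kern_ge_1[of x z] by linarith

lemma geometric_tail_le:
 fixes q :: real
 assumes q: "0 <= q" "q <= 1/2" and A: "finite A" "\<And>j. j \<in> A ==> j\<^sub>0 <= j"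
 shows "(\<Sum>j\<in>A. q ^ j) <= 2 * q ^ j\<^sub>0"
proof -
 obtain n where n: "A \<subseteq> {..<n}" using A(1) finite_nat_iff_bounded by blast
 have "(\<Sum>j\<in>A. q ^ j) <= (\<Sum>j\<in>{j\<^sub>0..<j\<^sub>0 + n}. q ^ j)"
  using A n q by (intro sum_mono2) (auto simp: subset_iff trans_less_add2)
 also have "... = (\<Sum>i<n. q ^ (j\<^sub>0 + i))"
  by (rule sum.reindex_bij_witness[of _ "\<lambda>i. j\<^sub>0 + i" "\<lambda>j. j - j\<^sub>0"]) auto
 also have "... = q ^ j\<^sub>0 * (\<Sum>i<n. q ^ i)" by (simp add: sum_distrib_left power_add)
 finally have 1: "(\<Sum>j\<in>A. q ^ j) <= q ^ j\<^sub>0 * (\<Sum>i<n. q ^ i)" .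
 have "(\<Sum>i<n. q ^ i) = (1 - q ^ n) / (1 - q)" using q by (subst sum_gp_strict) auto
 also have "... <= 1 / (1/2)" using q by (intro frac_le) auto
 finally have "q ^ j\<^sub>0 * (\<Sum>i<n. q ^ i) <= q ^ j\<^sub>0 * 2" using q by (intro mult_left_mono) auto
 then show ?thesis using 1 by linarith
qed

text \<open>The discrete form of the bound of a function by the Riesz potential of its gradient.
  Averages over cubes of side \<open>2 ^ k\<close> at \<open>x\<close> telescope from
  \<open>f x\<close> to 0, and \<open>z\<close> contributes only from the scale at which the cube
  reaches it. The geometric series with ratio \<open>q\<close> is then comparable to its first term,
  of order \<open>1 / kern x z ^ (d - 1)\<close>.\<close>

lemma potential_bound:
 fixes f :: "'d::finite vertex => real"
 defines "d \<equiv> CARD('d)"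
 assumes d: "d >= 2" and f: "\<And>z. f z >= 0" "finite {z. f z ~= 0}"
  and Z: "finite Z" "\<And>z. grad1 f z ~= 0 ==> z \<in> Z"
 shows "f x <= real d * 2 ^ d * (\<Sum>z\<in>Z. grad1 f z / kern x z ^ (d - 1))"
proof -
 define q where "q = (1/2::real) ^ (d - 1)"
 have q: "0 <= q" "q <= 1/2" using d power_decreasing[of 1 "d - 1" "1/2::real"] by (auto simp: q_def)
 have g: "grad1 f z >= 0" for z by (auto simp: grad1_def intro!: sum_nonneg)
 have step: "sum f (cube x (2 ^ k)) / real (2 ^ k) ^ d >= f x - (\<Sum>j<k. real d * q ^ j * sum (grad1 f) (cube x (2 ^ Suc j)))" for k
 proof (induction k)
  case 0
  show ?case using cube_1[of x] by simp
 next
  case (Suc k)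
  have qk: "real (2 ^ k) / real (2 ^ k) ^ d = q ^ k"
  proof -
   have "real (2 ^ k) ^ d = real (2 ^ k) * real (2 ^ k) ^ (d - 1)" using d by (cases d) auto
   also have "real (2 ^ k) ^ (d - 1) = 1 / q ^ k" by (simp add: q_def power_mult[symmetric] mult.commute power_divide)
   finally show ?thesis using q by (cases "q ^ k = 0") (auto simp: q_def)
  qed
  have "\<bar>sum f (cube x (2 * 2 ^ k)) / real (2 * 2 ^ k) ^ d - sum f (cube x (2 ^ k)) / real (2 ^ k) ^ d\<bar> <= real d * q ^ k * sum (grad1 f) (cube x (2 * 2 ^ k))"
   using cube_average_step[of "2 ^ k" f x] unfolding d_def[symmetric] qk by simp
  then show ?case using Suc unfolding power_Suc sum.lessThan_Suc by linarith
 qed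
 define F where "F = sum f {z. f z ~= 0}"
 let ?A = "real d * 2 ^ d * (\<Sum>z\<in>Z. grad1 f z / kern x z ^ (d - 1))"
 have le: "f x <= ?A + F * (1 / 2 ^ d) ^ k" for k
 proof -
  have "sum f (cube x (2 ^ k)) <= F"
  proof -
   have "sum f (cube x (2 ^ k)) = sum f (cube x (2 ^ k) \<inter> {z. f z ~= 0})" by (intro sum.mono_neutral_right) auto
   also have "... <= F" unfolding F_def using f by (intro sum_mono2) auto
   finally show ?thesis .
  qed
  then have 1: "sum f (cube x (2 ^ k)) / real (2 ^ k) ^ d <= F * (1 / 2 ^ d) ^ k"
   by (simp add: power_mult[symmetric] mult.commute power_divide divide_right_mono)
  have "(\<Sum>j<k. real d * q ^ j * sum (grad1 f) (cube x (2 ^ Suc j)))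
    = (\<Sum>j<k. \<Sum>z\<in>Z. if z \<in> cube x (2 ^ Suc j) then real d * q ^ j * grad1 f z else 0)"
  proof (intro sum.cong refl)
   fix j
   have "sum (grad1 f) (cube x (2 ^ Suc j)) = (\<Sum>z\<in>Z. if z \<in> cube x (2 ^ Suc j) then grad1 f z else 0)"
    using Z by (intro sum.mono_neutral_cong) auto
   then show "real d * q ^ j * sum (grad1 f) (cube x (2 ^ Suc j)) = (\<Sum>z\<in>Z. if z \<in> cube x (2 ^ Suc j) then real d * q ^ j * grad1 f z else 0)"
    by (simp only: sum_distrib_left if_distrib[of "\<lambda>a. _ * a"] mult_zero_right)
  qed
  also have "... = (\<Sum>z\<in>Z. real d * grad1 f z * (\<Sum>j | j < k \<and> z \<in> cube x (2 ^ Suc j). q ^ j))"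
  proof (subst sum.swap, rule sum.cong[OF refl])
   fix z
   have "(\<Sum>j<k. if z \<in> cube x (2 ^ Suc j) then real d * q ^ j * grad1 f z else 0) = (\<Sum>j | j < k \<and> z \<in> cube x (2 ^ Suc j). real d * q ^ j * grad1 f z)"
    by (intro sum.mono_neutral_cong_right) auto
   then show "(\<Sum>j<k. if z \<in> cube x (2 ^ Suc j) then real d * q ^ j * grad1 f z else 0) = real d * grad1 f z * (\<Sum>j | j < k \<and> z \<in> cube x (2 ^ Suc j). q ^ j)"
    by (simp only: sum_distrib_left mult_ac)
  qed
  also have "... <= (\<Sum>z\<in>Z. real d * grad1 f z * (2 ^ d / kern x z ^ (d - 1)))"
  proof (intro sum_mono mult_left_mono)
   fix z
   let ?J = "{j. j < k \<and> z \<in> cube x (2 ^ Suc j)}"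
   show "(\<Sum>j\<in>?J. q ^ j) <= 2 ^ d / kern x z ^ (d - 1)"
   proof (cases "?J = {}")
    case True
    show ?thesis unfolding True using kern_pos[of x z] by (simp add: less_imp_le)
   next
    case False
    define j\<^sub>0 where "j\<^sub>0 = Min ?J"
    have fin: "finite ?J" by simp
    have j0: "j\<^sub>0 \<in> ?J" unfolding j\<^sub>0_def by (rule Min_in[OF fin False])
    have 1: "(\<Sum>j\<in>?J. q ^ j) <= 2 * q ^ j\<^sub>0"
     by (rule geometric_tail_le[OF q fin]) (simp add: j\<^sub>0_def)
    have "kern x z <= 2 * 2 ^ j\<^sub>0"
    proof -
     have "linfnorm (z - x) <= real (2 ^ Suc j\<^sub>0)" using j0 by (intro cube_subset_box) auto
     moreover have "(1::real) <= 2 ^ j\<^sub>0" by (rule one_le_power) simp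
     moreover have "real (2 ^ Suc j\<^sub>0) = 2 * 2 ^ j\<^sub>0" by simp
     ultimately have "1 <= 2 * (2::real) ^ j\<^sub>0" "linfnorm (z - x) <= 2 * 2 ^ j\<^sub>0" by linarith+
     then show ?thesis unfolding kern_def linfnorm_minus[of x z] by (rule max.boundedI)
    qed
    then have "kern x z ^ (d - 1) <= (2 * 2 ^ j\<^sub>0) ^ (d - 1)" using kern_pos[of x z] by (intro power_mono) auto
    then have "kern x z ^ (d - 1) * q ^ j\<^sub>0 <= (2 * 2 ^ j\<^sub>0) ^ (d - 1) * q ^ j\<^sub>0"
     using q by (intro mult_right_mono) auto
    also have "... = 2 ^ (d - 1)"
    proof -
     have "((2::real) ^ j\<^sub>0) ^ (d - 1) * q ^ j\<^sub>0 = 1"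
      by (simp add: q_def power_mult[symmetric] power_divide mult.commute)
     then show ?thesis unfolding power_mult_distrib mult.assoc by simp
    qed
    finally have "2 * (kern x z ^ (d - 1) * q ^ j\<^sub>0) <= 2 * 2 ^ (d - 1)" by simp
    also have "2 * 2 ^ (d - 1) = (2::real) ^ d" using d by (cases d) auto
    finally have "2 * q ^ j\<^sub>0 <= 2 ^ d / kern x z ^ (d - 1)" using kern_pos[of x z] by (simp add: field_simps)
    then show ?thesis using 1 by linarith
   qed
  qed (use g in auto)
  also have "... = ?A" by (simp add: sum_distrib_left mult_ac)
  finally show ?thesis using 1 step[of k] by linarith
 qed
 have "(\<lambda>k. ?A + F * (1 / 2 ^ d) ^ k) \<longlonglongrightarrow> ?A + F * 0"
  using d by (intro tendsto_intros LIMSEQ_power_zero) (auto simp: power_gt1_lemma one_less_power)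
 then show ?thesis using LIMSEQ_le_const[of _ "?A + F * 0" "f x"] le by auto
qed

text \<open>Induction over dyadic annuli: as \<open>\<beta>\<close> is below the dimension, volume
  outweighs the kernel and the outermost annulus dominates.\<close>

lemma kernel_sum:
 fixes x :: "'d::finite vertex" and \<beta> :: real
 assumes \<beta>: "0 <= \<beta>" "\<beta> < CARD('d)"
 shows "\<exists>C>0. \<forall>x r. r >= 1 --> (\<Sum>v\<in>box (x :: 'd vertex) r. kern x v powr (- \<beta>)) <= C * r powr (CARD('d) - \<beta>)"
proof -
 define d where "d = real CARD('d)"
 define \<gamma> where "\<gamma> = d - \<beta>"
 have \<gamma>: "\<gamma> > 0" using \<beta> by (simp add: \<gamma>_def d_def)
 \<comment> \<open>Large enough for the induction step
   \<open>C + 5 powr d <= C * 2 powr \<gamma>\<close>; the 5 comes from the count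
   \<open>(5 * 2 ^ k) ^ d\<close> of points in a box of radius \<open>2 ^ Suc k\<close>.\<close>
 define C where "C = 5 powr d * (1 + 1 / (2 powr \<gamma> - 1))"
 have two: "2 powr \<gamma> > 1" using \<gamma> by simp
 have C: "C > 0" "5 powr d <= C" "C + 5 powr d <= C * 2 powr \<gamma>"
 proof -
  have pos: "0 < 1 / (2 powr \<gamma> - 1)" using two by simp
  then show "C > 0" unfolding C_def by (intro mult_pos_pos add_pos_pos) auto
  have "5 powr d * 1 <= C" unfolding C_def using pos by (intro mult_left_mono) auto
  then show "5 powr d <= C" by simp
  have "C * (2 powr \<gamma> - 1) = 5 powr d * ((1 + 1 / (2 powr \<gamma> - 1)) * (2 powr \<gamma> - 1))"
   unfolding C_def by (simp only: mult.assoc)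
  also have "(1 + 1 / (2 powr \<gamma> - 1)) * (2 powr \<gamma> - 1) = 2 powr \<gamma>"
   using two \<gamma> by (simp add: distrib_right)
  finally have "C * (2 powr \<gamma> - 1) = 5 powr d * 2 powr \<gamma>" .
  moreover have "5 powr d * 2 powr \<gamma> >= 5 powr d * 1" using two by (intro mult_left_mono) auto
  ultimately show "C + 5 powr d <= C * 2 powr \<gamma>" by (simp add: algebra_simps)
 qed
 have T: "(\<Sum>v\<in>box x (2 ^ k). kern x v powr (- \<beta>)) <= C * (2 ^ k) powr \<gamma>" for k and x :: "'d vertex"
 proof (induction k)
  case 0
  have "(\<Sum>v\<in>box x 1. kern x v powr (- \<beta>)) <= (\<Sum>v\<in>box x 1. 1)"
  proof (rule sum_mono)
   fix v
   have "kern x v powr (- \<beta>) <= 1 powr (- \<beta>)" using \<beta> kern_ge_1 by (intro powr_mono2') auto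
   then show "kern x v powr (- \<beta>) <= 1" by simp
  qed
  also have "... <= 3 ^ CARD('d)" using card_box_le[of 1 x] by simp
  also have "... <= 5 powr d" by (simp add: d_def powr_realpow power_mono)
  also have "... <= C" by (rule C)
  finally show ?case by simp
 next
  case (Suc k)
  have pos: "(2::real) ^ k > 0" by simp
  have "(\<Sum>v\<in>box x (2 ^ Suc k). kern x v powr (- \<beta>)) = (\<Sum>v\<in>box x (2 ^ k). kern x v powr (- \<beta>)) + (\<Sum>v\<in>box x (2 ^ Suc k) - box x (2 ^ k). kern x v powr (- \<beta>))"
  proof -
   have "box x (2 ^ k) \<subseteq> box x (2 ^ Suc k)" by (rule box_subset) simp
   from sum.subset_diff[OF this finite_box, of "\<lambda>v. kern x v powr (- \<beta>)"] show ?thesis by simp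
  qed
  also have "(\<Sum>v\<in>box x (2 ^ Suc k) - box x (2 ^ k). kern x v powr (- \<beta>)) <= (\<Sum>v\<in>box x (2 ^ Suc k). (2 ^ k) powr (- \<beta>))"
  proof (rule order_trans[OF sum_mono sum_mono2])
   fix v assume "v \<in> box x (2 ^ Suc k) - box x (2 ^ k)"
   then have "2 ^ k <= kern x v" by (auto simp: kern_def box_def)
   then show "kern x v powr (- \<beta>) <= (2 ^ k) powr (- \<beta>)" using \<beta> by (intro powr_mono2') auto
  qed auto
  also have "... = real (card (box x (2 ^ Suc k))) * (2 ^ k) powr (- \<beta>)" by simp
  also have "... <= (5 * 2 ^ k) powr d * (2 ^ k) powr (- \<beta>)"
  proof (rule mult_right_mono)
   have "real (card (box x (2 ^ Suc k))) <= (2 * 2 ^ Suc k + 1) ^ CARD('d)" by (rule card_box_le) simp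
   also have "... <= (5 * 2 ^ k) ^ CARD('d)"
   proof (rule power_mono)
    have "(1::real) <= 2 ^ k" by simp
    then show "2 * 2 ^ Suc k + 1 <= 5 * (2::real) ^ k" by (simp del: one_le_power)
   qed simp
   finally show "real (card (box x (2 ^ Suc k))) <= (5 * 2 ^ k) powr d" by (simp add: d_def powr_realpow)
  qed simp
  also have "... = 5 powr d * (2 ^ k) powr \<gamma>"
   using pos by (simp add: powr_mult \<gamma>_def powr_add[symmetric] mult.assoc)
  finally have "(\<Sum>v\<in>box x (2 ^ Suc k). kern x v powr (- \<beta>)) <= (C + 5 powr d) * (2 ^ k) powr \<gamma>"
   using Suc by (simp add: algebra_simps)
  also have "... <= C * 2 powr \<gamma> * (2 ^ k) powr \<gamma>" using C by (intro mult_right_mono) auto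
  also have "... = C * (2 ^ Suc k) powr \<gamma>" by (simp add: powr_mult)
  finally show ?case .
 qed
 show ?thesis
 proof (intro exI[of _ "C * 2 powr \<gamma>"] conjI allI impI)
  show "0 < C * 2 powr \<gamma>" using C by simp
  fix x :: "'d vertex" and r :: real assume r: "r >= 1"
  obtain n where "r < 2 ^ n" using real_arch_pow[of 2 r] by auto
  define k where "k = (LEAST n. r <= 2 ^ n)"
  have k: "r <= 2 ^ k" unfolding k_def using \<open>r < 2 ^ n\<close> by (rule_tac LeastI[of "\<lambda>n. r <= 2 ^ n" n]) simp
  have "2 ^ k <= 2 * r"
  proof (cases k)
   case (Suc j)
   have "\<not> r <= 2 ^ j" using Suc unfolding k_def by (intro not_less_Least) simp
   then show ?thesis using Suc by simp
  qed (use r in simp)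
  have "(\<Sum>v\<in>box x r. kern x v powr (- \<beta>)) <= (\<Sum>v\<in>box x (2 ^ k). kern x v powr (- \<beta>))"
   using k by (intro sum_mono2 finite_box box_subset) auto
  also have "... <= C * (2 ^ k) powr \<gamma>" by (rule T)
  also have "... <= C * (2 * r) powr \<gamma>" using C \<gamma> \<open>2 ^ k <= 2 * r\<close> by (intro mult_left_mono powr_mono2) auto
  also have "... = C * 2 powr \<gamma> * r powr \<gamma>" using r by (simp add: powr_mult)
  finally show "(\<Sum>v\<in>box x r. kern x v powr (- \<beta>)) <= C * 2 powr \<gamma> * r powr (real CARD('d) - \<beta>)"
   by (simp add: \<gamma>_def d_def)
 qed
qed

lemma holder_sum:
 fixes a b :: "'a => real"
 assumes "finite A" and nn: "\<And>x. x \<in> A ==> a x >= 0" "\<And>x. x \<in> A ==> b x >= 0" and \<theta>: "0 < \<theta>" "\<theta> < 1"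
 shows "(\<Sum>x\<in>A. a x powr \<theta> * b x powr (1 - \<theta>)) <= (\<Sum>x\<in>A. a x) powr \<theta> * (\<Sum>x\<in>A. b x) powr (1 - \<theta>)"
proof -
 let ?a = "\<Sum>x\<in>A. a x" and ?b = "\<Sum>x\<in>A. b x"
 have ab: "?a >= 0" "?b >= 0" using nn by (auto intro!: sum_nonneg)
 show ?thesis
 proof (cases "?a = 0 \<or> ?b = 0")
  case True
  then have "(\<forall>x\<in>A. a x = 0) \<or> (\<forall>x\<in>A. b x = 0)"
   using sum_nonneg_eq_0_iff[OF assms(1)] nn by blast
  then have "(\<Sum>x\<in>A. a x powr \<theta> * b x powr (1 - \<theta>)) = 0" by (intro sum.neutral) auto
  then show ?thesis by simp
 next
  case False
  then have pos: "?a > 0" "?b > 0" using ab by auto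
  have "(\<Sum>x\<in>A. (a x / ?a) powr \<theta> * (b x / ?b) powr (1 - \<theta>)) <= (\<Sum>x\<in>A. \<theta> * (a x / ?a) + (1 - \<theta>) * (b x / ?b))"
  proof (rule sum_mono)
   fix x assume x: "x \<in> A"
   show "(a x / ?a) powr \<theta> * (b x / ?b) powr (1 - \<theta>) <= \<theta> * (a x / ?a) + (1 - \<theta>) * (b x / ?b)"
   proof (cases "a x = 0 \<or> b x = 0")
    case True
    then show ?thesis using nn[OF x] \<theta> pos by auto
   next
    case False
    then show ?thesis using nn[OF x] \<theta> pos by (intro Youngs_inequality_0) auto
   qed
  qed
  also have "... = \<theta> * (?a / ?a) + (1 - \<theta>) * (?b / ?b)"
   by (simp only: sum.distrib sum_distrib_left[symmetric] sum_divide_distrib[symmetric])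
  also have "... = 1" using pos by simp
  finally have "(\<Sum>x\<in>A. (a x / ?a) powr \<theta> * (b x / ?b) powr (1 - \<theta>)) <= 1" .
  also have "(\<Sum>x\<in>A. (a x / ?a) powr \<theta> * (b x / ?b) powr (1 - \<theta>)) = (\<Sum>x\<in>A. (a x powr \<theta> * b x powr (1 - \<theta>)) / (?a powr \<theta> * ?b powr (1 - \<theta>)))"
  proof (rule sum.cong[OF refl])
   fix x assume x: "x \<in> A"
   have "(a x / ?a) powr \<theta> = a x powr \<theta> / ?a powr \<theta>" "(b x / ?b) powr (1 - \<theta>) = b x powr (1 - \<theta>) / ?b powr (1 - \<theta>)"
    by (rule powr_divide; use nn[OF x] ab in blast)+
   then show "(a x / ?a) powr \<theta> * (b x / ?b) powr (1 - \<theta>) = (a x powr \<theta> * b x powr (1 - \<theta>)) / (?a powr \<theta> * ?b powr (1 - \<theta>))"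
    by (simp only: times_divide_times_eq)
  qed
  also have "... = (\<Sum>x\<in>A. a x powr \<theta> * b x powr (1 - \<theta>)) / (?a powr \<theta> * ?b powr (1 - \<theta>))"
   by (rule sum_divide_distrib[symmetric])
  finally have "(\<Sum>x\<in>A. a x powr \<theta> * b x powr (1 - \<theta>)) / (?a powr \<theta> * ?b powr (1 - \<theta>)) <= 1" .
  moreover have "?a powr \<theta> * ?b powr (1 - \<theta>) > 0" using pos by simp
  ultimately show ?thesis by (simp only: pos_divide_le_eq mult_1)
 qed
qed

section \<open>A Faber--Krahn inequality on the cluster\<close>

definition gradc :: "('d::finite vertex => 'd vertex => real) => ('d vertex => real) => 'd vertex => real" where
 "gradc c f v = (\<Sum>w | adjacent c v w. \<bar>f v - f w\<bar>)"

lemma gradc_nonneg: "0 <= gradc c f v" by (auto simp: gradc_def intro!: sum_nonneg)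

text \<open>The path is taken without repetitions, so each of its vertices pays once with its own
  gradient.\<close>

lemma path_gradient_bound:
 fixes f :: "'d::finite vertex => real"
 assumes con: "connected_in B c a b" and fin: "finite B"
  and C: "a \<in> C" "\<And>v w. v \<in> C ==> adjacent c v w ==> w \<in> C"
 shows "\<bar>f a - f b\<bar> <= (\<Sum>v\<in>B \<inter> C. gradc c f v)"
proof -
 let ?r = "\<lambda>v w. v \<in> B \<and> w \<in> B \<and> adjacent c v w"
 have "?r\<^sup>*\<^sup>* a b" using con by (simp add: connected_in_def)
 then obtain xs where "rtrancl_path ?r a xs b" by (auto simp: rtranclp_eq_rtrancl_path)
 then obtain xs where xs: "rtrancl_path ?r a xs b" "distinct (a # xs)" by (rule rtrancl_path_distinct)
 have "\<bar>f a - f b\<bar> <= sum_list (map (gradc c f) xs) \<and> (a \<in> C --> set xs \<subseteq> B \<inter> C)"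
  using xs(1)
 proof (induction rule: rtrancl_path.induct)
  case (base x)
  then show ?case by simp
 next
  case (step x y ys z)
  have "adjacent c y x" using step(1) by (simp add: adjacent_commute)
  then have "\<bar>f y - f x\<bar> <= gradc c f y"
   unfolding gradc_def by (intro member_le_sum finite_adjacent) auto
  moreover have "\<bar>f x - f z\<bar> <= \<bar>f y - f x\<bar> + \<bar>f y - f z\<bar>" by linarith
  ultimately show ?case using step C(2) by auto
 qed
 moreover have "sum_list (map (gradc c f) xs) = sum (gradc c f) (set xs)"
  using xs(2) by (simp add: sum_list_distinct_conv_sum_set)
 moreover have "sum (gradc c f) (set xs) <= sum (gradc c f) (B \<inter> C)" if "set xs \<subseteq> B \<inter> C"
  using fin that gradc_nonneg by (intro sum_mono2) auto
 ultimately show ?thesis using C(1) by linarith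
qed

lemma kern_nonneg: "0 <= kern x z" by (rule less_imp_le[OF kern_pos])

text \<open>
 The point \<open>\<phi> z\<close> will be a point of the cluster \<open>C\<close> nearest to \<open>z\<close>. Functions on \<open>C\<close> are extended to
 the lattice as \<open>f \<circ> \<phi>\<close>, and the increments of the extension are controlled by gradients
 along open paths inside boxes of radius \<open>\<rho> z\<close>. No isoperimetric property of \<open>C\<close> is needed.
\<close>

locale good_cluster = walk_env c s
 for c :: "'d::finite vertex => 'd vertex => real" and s :: "'d vertex => real" +
 fixes C :: "'d vertex set" and \<phi> :: "'d vertex => 'd vertex" and \<rho> :: "'d vertex => nat"
 assumes \<phi>_id: "x \<in> C ==> \<phi> x = x" and \<phi>_mem: "\<phi> z \<in> C"
  and closed: "v \<in> C ==> adjacent c v w ==> w \<in> C"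
  and \<rho>_ge: "\<rho> z >= 1"
  and conn: "connected_in (box z (real (\<rho> z))) c (\<phi> z) (\<phi> (z + axis i 1))"
  and fin: "v \<in> C ==> finite {z. v \<in> box z (real (\<rho> z))}"
begin

text \<open>What \<open>v\<close> pays when a lattice potential is moved to the cluster: each box
  that may carry an open path through \<open>v\<close> counts, with the factor from
  \<open>kern_shift\<close> by which moving from \<open>z\<close> to \<open>v\<close> distorts the
  kernel.\<close>

definition \<kappa> :: "'d vertex => real" where
 "\<kappa> v = (\<Sum>z | v \<in> box z (real (\<rho> z)). (2 * real (\<rho> z)) ^ (CARD('d) - 1))"

lemma \<kappa>_nonneg: "0 <= \<kappa> v" by (auto simp: \<kappa>_def intro!: sum_nonneg)

lemma kern_shift:
 assumes "v \<in> box z (real (\<rho> z))"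
 shows "kern x v <= 2 * real (\<rho> z) * kern x z"
proof -
 have "linfnorm (x - v) <= linfnorm (x - z) + real (\<rho> z)"
  using assms linfnorm_triangle3[of x v z] by (simp add: box_def)
 then have "kern x v <= kern x z + real (\<rho> z)" unfolding kern_def by linarith
 also have "... <= real (\<rho> z) * kern x z + real (\<rho> z) * kern x z"
 proof (intro add_mono)
  show "kern x z <= real (\<rho> z) * kern x z" using \<rho>_ge[of z] kern_pos[of x z] by simp
  show "real (\<rho> z) <= real (\<rho> z) * kern x z" using kern_ge_1[of x z] by (simp add: mult_le_cancel_left1)
 qed
 finally show ?thesis by (simp add: mult_ac)
qed

text \<open>\<open>potential_bound\<close> for \<open>f\<close> composed with \<open>\<phi>\<close>:
  an increment over a lattice edge at \<open>z\<close> is at most the sum of \<open>gradc\<close>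
  over an open path in the box of \<open>z\<close>. Interchanging the sums over \<open>z\<close> and
  \<open>v\<close> produces \<open>\<kappa> v\<close>.\<close>

lemma cluster_potential:
 assumes d: "CARD('d) >= 2" and f: "\<And>z. f z >= 0" "finite {z. f z ~= 0}" "\<And>z. f z ~= 0 ==> z \<in> C"
  and V: "finite V" "V \<subseteq> C" "\<And>v. v \<in> C ==> gradc c f v ~= 0 ==> v \<in> V" and x: "x \<in> C"
 shows "f x <= real CARD('d) ^ 2 * 2 ^ CARD('d) * (\<Sum>v\<in>V. gradc c f v * \<kappa> v / kern x v ^ (CARD('d) - 1))"
proof -
 let ?d = "CARD('d)"
 define g where "g z = f (\<phi> z)" for z
 define H where "H z = (\<Sum>v\<in>box z (real (\<rho> z)) \<inter> C. gradc c f v)" for z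
 define Z where "Z = (\<Union>v\<in>V. {z. v \<in> box z (real (\<rho> z))})"
 have finZ: "finite Z" unfolding Z_def using V fin by blast
 have H_eq: "H z = (\<Sum>v\<in>V. if v \<in> box z (real (\<rho> z)) then gradc c f v else 0)" for z
  unfolding H_def using V by (intro sum.mono_neutral_cong) auto
 have H0: "H z >= 0" for z unfolding H_def by (intro sum_nonneg gradc_nonneg)
 have HZ: "z \<in> Z" if "H z ~= 0" for z
 proof (rule ccontr)
  assume "z \<notin> Z"
  then have "H z = 0" unfolding H_eq Z_def by (intro sum.neutral) auto
  with that show False by simp
 qed
 have grad: "grad1 g z <= real ?d * H z" for z
 proof -
  have "\<bar>g (z + axis i 1) - g z\<bar> <= H z" for i
  proof -
   have "\<bar>f (\<phi> z) - f (\<phi> (z + axis i 1))\<bar> <= H z"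
    unfolding H_def by (rule path_gradient_bound[OF conn finite_box \<phi>_mem closed])
   then show ?thesis by (simp add: g_def abs_minus_commute)
  qed
  then have "grad1 g z <= (\<Sum>i\<in>(UNIV :: 'd set). H z)" unfolding grad1_def by (intro sum_mono)
  then show ?thesis by simp
 qed
 have grad0: "grad1 g z >= 0" for z unfolding grad1_def by (intro sum_nonneg) auto
 have fing: "finite {z. g z ~= 0}"
 proof (rule finite_subset)
  show "{z. g z ~= 0} \<subseteq> (\<Union>v\<in>{z. f z ~= 0}. {z. v \<in> box z (real (\<rho> z))})"
   using conn by (auto simp: g_def connected_in_def)
  show "finite (\<Union>v\<in>{z. f z ~= 0}. {z. v \<in> box z (real (\<rho> z))})" using f fin by auto
 qed
 have "g x <= real ?d * 2 ^ ?d * (\<Sum>z\<in>Z. grad1 g z / kern x z ^ (?d - 1))"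
 proof (rule potential_bound[OF d _ fing finZ])
  show "g z >= 0" for z using f by (simp add: g_def)
  show "z \<in> Z" if "grad1 g z ~= 0" for z
  proof (rule HZ, rule notI)
   assume "H z = 0"
   then show False using grad[of z] grad0[of z] that by simp
  qed
 qed
 also have "(\<Sum>z\<in>Z. grad1 g z / kern x z ^ (?d - 1)) <= (\<Sum>z\<in>Z. real ?d * H z / kern x z ^ (?d - 1))"
  using grad by (intro sum_mono divide_right_mono zero_le_power kern_nonneg) auto
 also have "... = real ?d * (\<Sum>v\<in>V. \<Sum>z\<in>Z. if v \<in> box z (real (\<rho> z)) then gradc c f v / kern x z ^ (?d - 1) else 0)"
  unfolding H_eq sum_distrib_left sum_divide_distrib by (subst sum.swap) (intro sum.cong refl; simp)
 also have "(\<Sum>v\<in>V. \<Sum>z\<in>Z. if v \<in> box z (real (\<rho> z)) then gradc c f v / kern x z ^ (?d - 1) else 0)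
   <= (\<Sum>v\<in>V. gradc c f v * \<kappa> v / kern x v ^ (?d - 1))"
 proof (rule sum_mono)
  fix v assume v: "v \<in> V"
  have "(\<Sum>z\<in>Z. if v \<in> box z (real (\<rho> z)) then gradc c f v / kern x z ^ (?d - 1) else 0)
   = (\<Sum>z | v \<in> box z (real (\<rho> z)). gradc c f v / kern x z ^ (?d - 1))"
   using finZ v by (intro sum.mono_neutral_cong_right) (auto simp: Z_def)
  also have "... <= (\<Sum>z | v \<in> box z (real (\<rho> z)). gradc c f v * ((2 * real (\<rho> z)) ^ (?d - 1) / kern x v ^ (?d - 1)))"
  proof (rule sum_mono)
   fix z assume "z \<in> {z. v \<in> box z (real (\<rho> z))}"
   then have "kern x v ^ (?d - 1) <= (2 * real (\<rho> z) * kern x z) ^ (?d - 1)"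
    using kern_shift kern_pos[of x v] by (intro power_mono) auto
   then have "1 / kern x z ^ (?d - 1) <= (2 * real (\<rho> z)) ^ (?d - 1) / kern x v ^ (?d - 1)"
    using kern_pos[of x v] kern_pos[of x z] by (simp add: field_simps power_mult_distrib)
   then have "gradc c f v * (1 / kern x z ^ (?d - 1)) <= gradc c f v * ((2 * real (\<rho> z)) ^ (?d - 1) / kern x v ^ (?d - 1))"
    using gradc_nonneg by (intro mult_left_mono)
   then show "gradc c f v / kern x z ^ (?d - 1) <= gradc c f v * ((2 * real (\<rho> z)) ^ (?d - 1) / kern x v ^ (?d - 1))" by simp
  qed
  also have "... = gradc c f v * \<kappa> v / kern x v ^ (?d - 1)"
   by (simp add: \<kappa>_def sum_distrib_left sum_divide_distrib)
  finally show "(\<Sum>z\<in>Z. if v \<in> box z (real (\<rho> z)) then gradc c f v / kern x z ^ (?d - 1) else 0) <= gradc c f v * \<kappa> v / kern x v ^ (?d - 1)" .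
 qed
 finally show ?thesis using \<phi>_id[OF x] by (simp add: g_def power2_eq_square mult_ac mult_left_mono)
qed

text \<open>Cauchy--Schwarz with the conductances as weights; this is where \<open>nu\<close>
  enters.\<close>

lemma gradc_sq_le: "(gradc c f v)\<^sup>2 <= nu c v * (\<Sum>w | adjacent c v w. c v w * (f v - f w)\<^sup>2)"
proof -
 have "gradc c f v = (\<Sum>w | adjacent c v w. sqrt (inverse (c v w)) * (sqrt (c v w) * \<bar>f v - f w\<bar>))"
  unfolding gradc_def
 proof (rule sum.cong[OF refl])
  fix w assume "w \<in> {w. adjacent c v w}"
  then have "c v w > 0" by (simp add: adjacent_iff)
  then have "sqrt (inverse (c v w)) * sqrt (c v w) = 1" by (simp add: real_sqrt_inverse)
  then show "\<bar>f v - f w\<bar> = sqrt (inverse (c v w)) * (sqrt (c v w) * \<bar>f v - f w\<bar>)"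
   by (simp only: mult.assoc[symmetric] mult_1_left)
 qed
 then have "(gradc c f v)\<^sup>2 <= (\<Sum>w | adjacent c v w. (sqrt (inverse (c v w)))\<^sup>2) * (\<Sum>w | adjacent c v w. (sqrt (c v w) * \<bar>f v - f w\<bar>)\<^sup>2)"
  by (simp only: Cauchy_Schwarz_ineq_sum)
 also have "... = nu c v * (\<Sum>w | adjacent c v w. c v w * (f v - f w)\<^sup>2)"
  unfolding nu_def using nonneg by (simp add: power_mult_distrib)
 finally show ?thesis .
qed

lemma energy_ge:
 assumes kw: "killed_walk W B c s" and W: "\<And>x z. x \<in> B ==> adjacent c x z ==> z \<in> W"
  and f: "\<And>z. f z ~= 0 ==> z \<in> B" and V: "finite V"
 shows "(\<Sum>v\<in>V. \<Sum>w | adjacent c v w. c v w * (f v - f w)\<^sup>2) <= 2 * killed_walk.energy W c f f"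
proof -
 interpret killed_walk W B c s by fact
 have in_W: "v \<in> W \<and> w \<in> W" if "adjacent c v w" "f v ~= f w" for v w
 proof (cases "f v = 0")
  case True
  then have "w \<in> B" using that f[of w] by auto
  then show ?thesis using W[of w v] that B_sub adjacent_commute[of c v w] by auto
 next
  case False
  then have "v \<in> B" using f by auto
  then show ?thesis using W[of v w] that B_sub by auto
 qed
 have "(\<Sum>v\<in>V. \<Sum>w | adjacent c v w. c v w * (f v - f w)\<^sup>2) = (\<Sum>v\<in>V \<inter> W. \<Sum>w\<in>{w. adjacent c v w} \<inter> W. c v w * (f v - f w)\<^sup>2)"
 proof (rule sum.mono_neutral_cong_right[OF V])
  show "\<forall>v\<in>V - V \<inter> W. (\<Sum>w | adjacent c v w. c v w * (f v - f w)\<^sup>2) = 0"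
   using in_W by (auto intro!: sum.neutral)
  fix v
  show "(\<Sum>w | adjacent c v w. c v w * (f v - f w)\<^sup>2) = (\<Sum>w\<in>{w. adjacent c v w} \<inter> W. c v w * (f v - f w)\<^sup>2)"
   using in_W by (intro sum.mono_neutral_right finite_adjacent) auto
 qed simp
 also have "... <= (\<Sum>v\<in>W. \<Sum>w\<in>W. c v w * (f v - f w)\<^sup>2)"
 proof (rule order_trans[OF sum_mono sum_mono2])
  fix v
  show "(\<Sum>w\<in>{w. adjacent c v w} \<inter> W. c v w * (f v - f w)\<^sup>2) <= (\<Sum>w\<in>W. c v w * (f v - f w)\<^sup>2)"
   using finite_W c_nonneg by (intro sum_mono2) auto
 qed (use finite_W c_nonneg in \<open>auto intro!: sum_nonneg\<close>)
 also have "... = 2 * energy f f" by (simp add: energy_def power2_eq_square mult.assoc)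
 finally show ?thesis .
qed

text \<open>Insert \<open>cluster_potential\<close> into one factor of the squared norm
  \<open>S\<close> of \<open>f\<close> and interchange sums; a first Cauchy--Schwarz inequality
  separates the energy. In the remaining square of a potential a second one splits the kernel
  exponent \<open>2 * (d - 1)\<close> into \<open>\<alpha> * (d - 1)\<close> and
  \<open>(2 - \<alpha>) * (d - 1)\<close>, the first summed against the weights at \<open>v\<close>,
  the second against \<open>s\<close>. A factor \<open>S\<close> reappears on the right and
  cancels.\<close>

lemma spectral_bound:
 assumes d: "CARD('d) >= 2" and kw: "killed_walk W B c s" and W: "\<And>x z. x \<in> B ==> adjacent c x z ==> z \<in> W"
  and f: "\<And>z. f z >= 0" "\<And>z. f z ~= 0 ==> z \<in> B \<and> z \<in> C"
  and V: "finite V" "V \<subseteq> C" "\<And>v. v \<in> C ==> gradc c f v ~= 0 ==> v \<in> V"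
  and D1: "\<And>x. f x ~= 0 ==> (\<Sum>v\<in>V. (\<kappa> v)\<^sup>2 * nu c v * kern x v powr (- (\<alpha> * (real CARD('d) - 1)))) <= D1"
  and D2: "\<And>v. v \<in> V ==> (\<Sum>x | f x ~= 0. kern x v powr (- ((2 - \<alpha>) * (real CARD('d) - 1))) * s x) <= D2"
  and D: "0 <= D1" "0 <= D2"
 shows "(\<Sum>x\<in>B. s x * (f x)\<^sup>2) <= 2 * (real CARD('d) ^ 2 * 2 ^ CARD('d))\<^sup>2 * D1 * D2 * killed_walk.energy W c f f"
proof -
 note s0 = s_pos
 interpret killed_walk W B c s by fact
 let ?d = "CARD('d)"
 define A where "A = real ?d ^ 2 * 2 ^ ?d"
 define U where "U = {x. f x ~= 0}"
 have U: "finite U" "U \<subseteq> B" "U \<subseteq> C"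
  by (rule finite_subset[OF _ finite_B]; use f(2) in \<open>auto simp: U_def\<close>) (use f(2) in \<open>auto simp: U_def\<close>)
 define S where "S = (\<Sum>x\<in>U. s x * (f x)\<^sup>2)"
 have S_eq: "(\<Sum>x\<in>B. s x * (f x)\<^sup>2) = S"
  unfolding S_def using U finite_B by (intro sum.mono_neutral_right) (auto simp: U_def)
 have S0: "S >= 0" unfolding S_def using s0 by (intro sum_nonneg) (auto simp: less_imp_le)
 define T where "T v = (\<Sum>x\<in>U. s x * f x / kern x v ^ (?d - 1))" for v
 have T0: "T v >= 0" for v unfolding T_def using s0 f
  by (intro sum_nonneg divide_nonneg_nonneg mult_nonneg_nonneg zero_le_power kern_nonneg) (auto simp: less_imp_le)
 define \<Gamma> where "\<Gamma> v = (\<Sum>w | adjacent c v w. c v w * (f v - f w)\<^sup>2)" for v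
 have \<Gamma>0: "\<Gamma> v >= 0" for v unfolding \<Gamma>_def using c_nonneg by (intro sum_nonneg) auto
 have nu0: "nu c v >= 0" for v unfolding nu_def using c_nonneg by (intro sum_nonneg) auto
 have "S = (\<Sum>x\<in>U. s x * f x * f x)" by (simp add: S_def power2_eq_square mult.assoc)
 also have "... <= (\<Sum>x\<in>U. s x * f x * (A * (\<Sum>v\<in>V. gradc c f v * \<kappa> v / kern x v ^ (?d - 1))))"
 proof (intro sum_mono mult_left_mono)
  fix x assume x: "x \<in> U"
  show "f x <= A * (\<Sum>v\<in>V. gradc c f v * \<kappa> v / kern x v ^ (?d - 1))"
   unfolding A_def using U x f by (intro cluster_potential[OF d _ _ _ V]) (auto simp: U_def[symmetric])
  show "0 <= s x * f x" using s0 f by (simp add: less_imp_le)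
 qed
 also have "... = A * (\<Sum>v\<in>V. gradc c f v * \<kappa> v * T v)"
  unfolding T_def sum_distrib_left by (subst sum.swap) (intro sum.cong refl; simp add: mult_ac)
 also have "... <= A * (\<Sum>v\<in>V. sqrt (\<Gamma> v) * (sqrt (nu c v) * \<kappa> v * T v))"
 proof (intro mult_left_mono sum_mono)
  fix v
  have "gradc c f v <= sqrt (nu c v * \<Gamma> v)"
   using gradc_sq_le[of f v] unfolding \<Gamma>_def[symmetric] by (rule real_le_rsqrt)
  then have "gradc c f v * (\<kappa> v * T v) <= sqrt (nu c v * \<Gamma> v) * (\<kappa> v * T v)"
   using \<kappa>_nonneg T0 by (intro mult_right_mono) auto
  then show "gradc c f v * \<kappa> v * T v <= sqrt (\<Gamma> v) * (sqrt (nu c v) * \<kappa> v * T v)"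
   by (simp add: real_sqrt_mult mult_ac)
 qed (simp add: A_def)
 finally have "S\<^sup>2 <= (A * (\<Sum>v\<in>V. sqrt (\<Gamma> v) * (sqrt (nu c v) * \<kappa> v * T v)))\<^sup>2"
  using S0 by (intro power_mono)
 also have "... <= A\<^sup>2 * ((\<Sum>v\<in>V. (sqrt (\<Gamma> v))\<^sup>2) * (\<Sum>v\<in>V. (sqrt (nu c v) * \<kappa> v * T v)\<^sup>2))"
  unfolding power_mult_distrib[of A] by (intro mult_left_mono Cauchy_Schwarz_ineq_sum) auto
 also have "(\<Sum>v\<in>V. (sqrt (\<Gamma> v))\<^sup>2) = (\<Sum>v\<in>V. \<Gamma> v)" using \<Gamma>0 by simp
 also have "(\<Sum>v\<in>V. (sqrt (nu c v) * \<kappa> v * T v)\<^sup>2) = (\<Sum>v\<in>V. (\<kappa> v)\<^sup>2 * nu c v * (T v)\<^sup>2)"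
  using nu0 by (intro sum.cong refl) (simp add: power_mult_distrib mult_ac)
 also have "A\<^sup>2 * ((\<Sum>v\<in>V. \<Gamma> v) * (\<Sum>v\<in>V. (\<kappa> v)\<^sup>2 * nu c v * (T v)\<^sup>2)) <= A\<^sup>2 * ((2 * energy f f) * (D2 * (D1 * S)))"
 proof (intro mult_left_mono mult_mono)
  show "(\<Sum>v\<in>V. \<Gamma> v) <= 2 * energy f f"
   unfolding \<Gamma>_def using f(2) by (intro energy_ge[OF kw W _ V(1)]) auto
  show "(\<Sum>v\<in>V. (\<kappa> v)\<^sup>2 * nu c v * (T v)\<^sup>2) <= D2 * (D1 * S)"
  proof -
   have Tsq: "(T v)\<^sup>2 <= D2 * (\<Sum>x\<in>U. kern x v powr (- (\<alpha> * (real ?d - 1))) * (s x * (f x)\<^sup>2))" if v: "v \<in> V" for v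
   proof -
    let ?a = "\<lambda>x. sqrt (kern x v powr (- ((2 - \<alpha>) * (real ?d - 1))) * s x)"
    let ?b = "\<lambda>x. sqrt (kern x v powr (- (\<alpha> * (real ?d - 1))) * s x) * f x"
    have "s x * f x / kern x v ^ (?d - 1) = ?a x * ?b x" for x
    proof -
     have "?a x * ?b x = sqrt ((kern x v powr (- ((2 - \<alpha>) * (real ?d - 1))) * kern x v powr (- (\<alpha> * (real ?d - 1)))) * (s x)\<^sup>2) * f x"
      by (simp add: real_sqrt_mult[symmetric] power2_eq_square mult_ac)
     also have "kern x v powr (- ((2 - \<alpha>) * (real ?d - 1))) * kern x v powr (- (\<alpha> * (real ?d - 1))) = kern x v powr (- 2 * real (?d - 1))"
      using d by (simp add: powr_add[symmetric] of_nat_diff algebra_simps)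
     also have "... = (1 / kern x v ^ (?d - 1))\<^sup>2"
     proof -
      have "(1 / kern x v ^ (?d - 1))\<^sup>2 = (kern x v powr (- real (?d - 1))) * (kern x v powr (- real (?d - 1)))"
       using kern_pos[of x v] by (simp add: powr_minus powr_realpow power2_eq_square divide_inverse del: of_nat_diff)
      then show ?thesis by (simp only: powr_add[symmetric]) simp
     qed
     also have "sqrt ((1 / kern x v ^ (?d - 1))\<^sup>2 * (s x)\<^sup>2) = 1 / kern x v ^ (?d - 1) * s x"
      using kern_pos[of x v] s0[of x] by (simp add: power_mult_distrib[symmetric] less_imp_le)
     finally show ?thesis by simp
    qed
    then have "(T v)\<^sup>2 <= (\<Sum>x\<in>U. (?a x)\<^sup>2) * (\<Sum>x\<in>U. (?b x)\<^sup>2)"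
     unfolding T_def by (simp only: Cauchy_Schwarz_ineq_sum)
    also have "(\<Sum>x\<in>U. (?b x)\<^sup>2) = (\<Sum>x\<in>U. kern x v powr (- (\<alpha> * (real ?d - 1))) * (s x * (f x)\<^sup>2))"
     using s0 by (intro sum.cong refl) (simp add: power_mult_distrib less_imp_le mult_ac)
    also have "(\<Sum>x\<in>U. (?a x)\<^sup>2) = (\<Sum>x\<in>U. kern x v powr (- ((2 - \<alpha>) * (real ?d - 1))) * s x)"
     using s0 by (intro sum.cong refl) (simp add: less_imp_le)
    also have "... * (\<Sum>x\<in>U. kern x v powr (- (\<alpha> * (real ?d - 1))) * (s x * (f x)\<^sup>2)) <= D2 * (\<Sum>x\<in>U. kern x v powr (- (\<alpha> * (real ?d - 1))) * (s x * (f x)\<^sup>2))"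
     using D2[OF v] s0 by (intro mult_right_mono sum_nonneg) (auto simp: U_def less_imp_le)
    finally show ?thesis .
   qed
   have "(\<Sum>v\<in>V. (\<kappa> v)\<^sup>2 * nu c v * (T v)\<^sup>2) <= (\<Sum>v\<in>V. (\<kappa> v)\<^sup>2 * nu c v * (D2 * (\<Sum>x\<in>U. kern x v powr (- (\<alpha> * (real ?d - 1))) * (s x * (f x)\<^sup>2))))"
    using Tsq nu0 by (intro sum_mono mult_left_mono) auto
   also have "... = D2 * (\<Sum>x\<in>U. s x * (f x)\<^sup>2 * (\<Sum>v\<in>V. (\<kappa> v)\<^sup>2 * nu c v * kern x v powr (- (\<alpha> * (real ?d - 1)))))"
    unfolding sum_distrib_left by (subst sum.swap) (intro sum.cong refl; simp add: mult_ac)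
   also have "... <= D2 * (\<Sum>x\<in>U. s x * (f x)\<^sup>2 * D1)"
    using D1 D s0 by (intro mult_left_mono sum_mono) (auto simp: U_def less_imp_le)
   also have "... = D2 * (D1 * S)" by (simp add: S_def sum_distrib_left mult_ac)
   finally show ?thesis .
  qed
  show "0 <= 2 * energy f f" using energy_nonneg[of f] by simp
  show "0 <= (\<Sum>v\<in>V. (\<kappa> v)\<^sup>2 * nu c v * (T v)\<^sup>2)" using nu0 by (intro sum_nonneg) auto
 qed simp
 finally have le: "S * S <= (2 * A\<^sup>2 * D1 * D2 * energy f f) * S" by (simp add: power2_eq_square mult_ac)
 show ?thesis
 proof (cases "S = 0")
  case True
  then show ?thesis unfolding S_eq using D energy_nonneg[of f] by simp
 next
  case False
  then have "S > 0" using S0 by simp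
  then show ?thesis unfolding S_eq using le A_def by simp
 qed
qed

end


text \<open>After Hoelder's inequality with the weights both parts of the split kernel need
  exponents below \<open>d\<close>. A suitable \<open>\<alpha>\<close> exists once
  \<open>d * (1 - p) + d * ((1 - \<epsilon>) * (1 - r)) > 2 * (d - 1)\<close>, which for small
  \<open>\<epsilon>\<close> is the condition on \<open>p + r\<close>.\<close>

lemma exponents:
 fixes d p r :: real
 assumes d: "d >= 2" and p: "0 < p" "p < 1" and r: "0 < r" "r < 1" and pr: "p + r < 2 / d"
 obtains \<alpha> \<epsilon> where "0 < \<epsilon>" "\<epsilon> < 1" "0 < \<alpha>" "\<alpha> < 2" "\<alpha> * (d - 1) / (1 - p) < d" "(2 - \<alpha>) * (d - 1) / ((1 - \<epsilon>) * (1 - r)) < d"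
proof -
 define \<delta> where "\<delta> = 2 - d * (p + r)"
 have \<delta>: "\<delta> > 0" using pr d by (simp add: \<delta>_def field_simps)
 define \<epsilon> where "\<epsilon> = min (1/2) (\<delta> / (2 * d))"
 have \<epsilon>: "0 < \<epsilon>" "\<epsilon> < 1" using \<delta> d by (auto simp: \<epsilon>_def)
 have "\<epsilon> * (d * (1 - r)) <= \<delta> / (2 * d) * (d * 1)"
  using \<delta> d r by (intro mult_mono) (auto simp: \<epsilon>_def)
 then have \<epsilon>\<delta>: "\<epsilon> * (d * (1 - r)) < \<delta>" using \<delta> d by simp
 define A where "A = d * (1 - p) / (d - 1)"
 define A' where "A' = d * ((1 - \<epsilon>) * (1 - r)) / (d - 1)"
 have pos: "A > 0" "A' > 0" using d p r \<epsilon> by (auto simp: A_def A'_def)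
 have "A + A' > 2"
 proof -
  have "d * (1 - p) + d * ((1 - \<epsilon>) * (1 - r)) > 2 * (d - 1)"
   using \<epsilon>\<delta> by (simp add: \<delta>_def algebra_simps)
  then have "(d * (1 - p) + d * ((1 - \<epsilon>) * (1 - r))) / (d - 1) > 2" using d by (simp add: field_simps)
  then show ?thesis by (simp add: A_def A'_def add_divide_distrib)
 qed
 then have "max 0 (2 - A') < min 2 A" using pos by auto
 then obtain \<alpha> where "max 0 (2 - A') < \<alpha>" "\<alpha> < min 2 A" using dense by blast
 then have \<alpha>: "0 < \<alpha>" "\<alpha> < 2" "\<alpha> < A" "2 - \<alpha> < A'" by auto
 have 1: "\<alpha> * (d - 1) / (1 - p) < d" using \<alpha>(3) d p by (simp add: A_def field_simps)
 have "(2 - \<alpha>) * (d - 1) < d * ((1 - \<epsilon>) * (1 - r))" using \<alpha>(4) d by (simp add: A'_def pos_less_divide_eq)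
 moreover have "(1 - \<epsilon>) * (1 - r) > 0" using \<epsilon> r by simp
 ultimately have "(2 - \<alpha>) * (d - 1) / ((1 - \<epsilon>) * (1 - r)) < d" by (simp only: pos_divide_less_eq)
 with 1 \<alpha> \<epsilon> show ?thesis by (intro that[of \<epsilon> \<alpha>])
qed

lemma powr_sum_holder2:
 fixes a k :: "'a => real"
 assumes "finite A" and "\<And>x. x \<in> A ==> a x >= 0" and "\<And>x. x \<in> A ==> k x > 0" and \<theta>: "0 < \<theta>" "\<theta> < 1"
 shows "(\<Sum>x\<in>A. a x * k x powr (- \<beta>)) <= (\<Sum>x\<in>A. a x powr (1 / \<theta>)) powr \<theta> * (\<Sum>x\<in>A. k x powr (- (\<beta> / (1 - \<theta>)))) powr (1 - \<theta>)"
proof -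
 have "(\<Sum>x\<in>A. a x * k x powr (- \<beta>)) = (\<Sum>x\<in>A. (a x powr (1 / \<theta>)) powr \<theta> * (k x powr (- (\<beta> / (1 - \<theta>)))) powr (1 - \<theta>))"
  using assms by (intro sum.cong refl) (simp add: powr_powr)
 also have "... <= (\<Sum>x\<in>A. a x powr (1 / \<theta>)) powr \<theta> * (\<Sum>x\<in>A. k x powr (- (\<beta> / (1 - \<theta>)))) powr (1 - \<theta>)"
  using assms by (intro holder_sum) auto
 finally show ?thesis .
qed

definition killed_domain :: "('d::finite vertex => 'd vertex => real) => ('d vertex => real) => 'd vertex set => 'd vertex set => 'd vertex set => bool" where
 "killed_domain c s C W B \<longleftrightarrow> killed_walk W B c s \<and> B \<subseteq> C \<and> (\<forall>x z. x \<in> B --> adjacent c x z --> z \<in> W)"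

text \<open>Here \<open>p\<close> and \<open>r\<close> are reciprocals of integrability exponents.
  The first box is larger by 1 because the gradient of a function also lives on the neighbours of
  its support.\<close>

definition box_averages :: "('d::finite vertex => 'd vertex => real) => ('d vertex => real) => 'd vertex set => ('d vertex => real)
  => real => real => real => 'd vertex => real => bool" where
 "box_averages c s C k p r M x R \<longleftrightarrow>
  (\<Sum>v\<in>box x (R + 1) \<inter> C. ((k v)\<^sup>2 * nu c v) powr (1 / p)) <= M * R powr real CARD('d) \<and>
  (\<Sum>v\<in>box x R \<inter> C. s v powr (1 / r)) <= M * R powr real CARD('d)"

definition faber_krahn_bound :: "('d::finite vertex => 'd vertex => real) => ('d vertex => real) => 'd vertex set => ('d vertex => real)
  => real => real => real => real => bool" where
 "faber_krahn_bound c s C k p r \<epsilon> C\<^sub>0 \<longleftrightarrow> (\<forall>x\<^sub>0 R M f B W. R >= 1 --> M >= 1 --> box_averages c s C k p r M x\<^sub>0 R -->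
  killed_domain c s C W B --> (\<forall>z. f z >= 0) --> (\<forall>z. f z ~= 0 --> z \<in> B \<and> z \<in> box x\<^sub>0 R) -->
  (\<Sum>x\<in>B. s x * (f x)\<^sup>2) <= C\<^sub>0 * M\<^sup>2 * R\<^sup>2 * ((\<Sum>x | f x ~= 0. s x) / R powr real CARD('d)) powr \<epsilon> * killed_walk.energy W c f f)"

text \<open>\<open>spectral_bound\<close> with both kernel sums estimated by Hoelder's inequality.
  In the second sum \<open>s\<close> is written as
  \<open>s powr \<epsilon> * s powr (1 - \<epsilon>)\<close>; this sets aside the measure of the
  support to the power \<open>\<epsilon>\<close>, the gain that De Giorgi's iteration lives on. The
  environment enters the constant through \<open>M\<close> only.\<close>

theorem faber_krahn:
 fixes p r :: real
 assumes d: "CARD('d::finite) >= 2" and p: "0 < p" "p < 1" and r: "0 < r" "r < 1" and pr: "p + r < 2 / real CARD('d)"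
 shows "\<exists>\<epsilon> C\<^sub>0. 0 < \<epsilon> \<and> C\<^sub>0 > 0 \<and> (\<forall>(c :: 'd vertex => 'd vertex => real) s C \<phi> \<rho>.
  good_cluster c s C \<phi> \<rho> --> faber_krahn_bound c s C (good_cluster.\<kappa> \<rho>) p r \<epsilon> C\<^sub>0)"
proof -
 define D where "D = real CARD('d)"
 have D: "D >= 2" using d by (simp add: D_def)
 have pr': "p + r < 2 / D" using pr by (simp add: D_def)
 obtain \<alpha> \<epsilon> where \<epsilon>: "0 < \<epsilon>" "\<epsilon> < 1" and \<alpha>: "0 < \<alpha>" "\<alpha> < 2" and
  b1: "\<alpha> * (D - 1) / (1 - p) < D" and b2: "(2 - \<alpha>) * (D - 1) / ((1 - \<epsilon>) * (1 - r)) < D"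
  using exponents[OF D p r pr'] by blast
 define \<beta>\<^sub>1 where "\<beta>\<^sub>1 = \<alpha> * (D - 1) / (1 - p)"
 define \<beta>\<^sub>2 where "\<beta>\<^sub>2 = (2 - \<alpha>) * (D - 1) / ((1 - \<epsilon>) * (1 - r))"
 have \<beta>: "0 <= \<beta>\<^sub>1" "0 <= \<beta>\<^sub>2" "\<beta>\<^sub>1 < D" "\<beta>\<^sub>2 < D" using b1 b2 D \<alpha> p r \<epsilon> by (auto simp: \<beta>\<^sub>1_def \<beta>\<^sub>2_def)
 obtain K1 where K1: "K1 > 0" "\<And>(x :: 'd vertex) r. r >= 1 ==> (\<Sum>v\<in>box x r. kern x v powr (- \<beta>\<^sub>1)) <= K1 * r powr (D - \<beta>\<^sub>1)"
  using kernel_sum[of \<beta>\<^sub>1] \<beta> unfolding D_def by blast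
 obtain K2 where K2: "K2 > 0" "\<And>(x :: 'd vertex) r. r >= 1 ==> (\<Sum>v\<in>box x r. kern x v powr (- \<beta>\<^sub>2)) <= K2 * r powr (D - \<beta>\<^sub>2)"
  using kernel_sum[of \<beta>\<^sub>2] \<beta> unfolding D_def by blast
 define K1' where "K1' = (K1 * 3 powr (D - \<beta>\<^sub>1)) powr (1 - p)"
 define K2' where "K2' = ((K2 * 3 powr (D - \<beta>\<^sub>2)) powr (1 - r)) powr (1 - \<epsilon>)"
 define C\<^sub>0 where "C\<^sub>0 = 2 * (D\<^sup>2 * 2 ^ CARD('d))\<^sup>2 * K1' * K2'"
 have K': "K1' > 0" "K2' > 0" using K1 K2 by (auto simp: K1'_def K2'_def)
 have C0: "C\<^sub>0 > 0" using K' D by (simp add: C\<^sub>0_def)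
 show ?thesis
  unfolding faber_krahn_bound_def box_averages_def killed_domain_def
 proof (rule exI[of _ \<epsilon>], rule exI[of _ C\<^sub>0], intro conjI allI impI; (elim conjE)?)
  fix c :: "'d vertex => 'd vertex => real" and s C \<phi> \<rho> x\<^sub>0 R M B W and f :: "'d vertex => real"
  assume gc: "good_cluster c s C \<phi> \<rho>" and R: "R >= 1" and M: "M >= (1::real)"
   and Mb: "(\<Sum>v\<in>box x\<^sub>0 (R + 1) \<inter> C. ((good_cluster.\<kappa> \<rho> v)\<^sup>2 * nu c v) powr (1 / p)) <= M * R powr real CARD('d)"
   and Ms: "(\<Sum>v\<in>box x\<^sub>0 R \<inter> C. s v powr (1 / r)) <= M * R powr real CARD('d)"
   and kw: "killed_walk W B c s" and BC: "B \<subseteq> C" and W: "\<forall>x z. x \<in> B --> adjacent c x z --> z \<in> W"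
   and f0: "\<forall>z. f z >= 0" and f1: "\<forall>z. f z ~= 0 --> z \<in> B \<and> z \<in> box x\<^sub>0 R"
  have f: "\<forall>z. f z >= 0" "\<forall>z. f z ~= 0 --> z \<in> B \<and> z \<in> C \<and> z \<in> box x\<^sub>0 R" using f0 f1 BC by auto
  interpret good_cluster c s C \<phi> \<rho> by (rule gc)
  define U where "U = {x. f x ~= 0}"
  have U: "finite U" "U \<subseteq> box x\<^sub>0 R \<inter> C"
  proof -
   show "U \<subseteq> box x\<^sub>0 R \<inter> C" using f by (auto simp: U_def)
   then show "finite U" by (rule finite_subset) simp
  qed
  define V where "V = box x\<^sub>0 (R + 1) \<inter> C"
  have nu0: "nu c v >= 0" for v unfolding nu_def using nonneg by (intro sum_nonneg) auto
  define \<sigma> where "\<sigma> = (\<Sum>x\<in>U. s x)"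
  have \<sigma>: "\<sigma> >= 0" unfolding \<sigma>_def using s_pos by (intro sum_nonneg) (auto simp: less_imp_le)
  define D1 where "D1 = (M * R powr D) powr p * (K1' * R powr ((D - \<beta>\<^sub>1) * (1 - p)))"
  define D2 where "D2 = \<sigma> powr \<epsilon> * ((M * R powr D) powr (r * (1 - \<epsilon>)) * (K2' * R powr ((D - \<beta>\<^sub>2) * (1 - r) * (1 - \<epsilon>))))"
  have adj_near: "linfnorm (v - w) <= 1" if "adjacent c v w" for v w
  proof -
   have "{v, w} \<in> lattice_edges" using that by (auto simp: adjacent_def open_edges_def)
   then obtain a b where ab: "{v, w} = {a, b}" "l1norm (a - b) = 1" unfolding lattice_edges_def by blast
   then have "(v = a \<and> w = b) \<or> (v = b \<and> w = a)" by (auto simp: doubleton_eq_iff)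
   then have "linfnorm (v - w) = linfnorm (a - b)" using linfnorm_minus by metis
   then show ?thesis using linfnorm_le_l1norm[of "a - b"] ab by simp
  qed
  \<comment> \<open>The radius is \<open>3 * R\<close> because points of the two boxes around
    \<open>x\<^sub>0\<close> are at distance at most \<open>2 * R + 1\<close>.\<close>
  have ker_sum: "(\<Sum>v\<in>A. kern x v powr (- \<beta>)) <= K * 3 powr (D - \<beta>) * R powr (D - \<beta>)"
   if K: "K > 0" "\<And>(x :: 'd vertex) r. r >= 1 ==> (\<Sum>v\<in>box x r. kern x v powr (- \<beta>)) <= K * r powr (D - \<beta>)"
    and A: "A \<subseteq> box x (3 * R)" for A :: "'d vertex set" and x K \<beta>
  proof -
   have "(\<Sum>v\<in>A. kern x v powr (- \<beta>)) <= (\<Sum>v\<in>box x (3 * R). kern x v powr (- \<beta>))"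
    using A by (intro sum_mono2) auto
   also have "... <= K * (3 * R) powr (D - \<beta>)" using R by (intro K(2)) auto
   finally show ?thesis using R by (simp add: powr_mult)
  qed
  have near3: "v \<in> box x (3 * R)" if "x \<in> box x\<^sub>0 R" "v \<in> box x\<^sub>0 (R + 1)" for x v
  proof -
   have "linfnorm (x - v) <= linfnorm (x - x\<^sub>0) + linfnorm (x\<^sub>0 - v)" by (rule linfnorm_triangle3)
   then show ?thesis using that R by (auto simp: box_def linfnorm_minus[of x x\<^sub>0])
  qed
  have "(\<Sum>x\<in>B. s x * (f x)\<^sup>2) <= 2 * (real CARD('d) ^ 2 * 2 ^ CARD('d))\<^sup>2 * D1 * D2 * killed_walk.energy W c f f"
  proof (rule spectral_bound[OF d kw, where V = V and \<alpha> = \<alpha>])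
   show "finite V" "V \<subseteq> C" by (auto simp: V_def)
   show "v \<in> V" if v: "v \<in> C" "gradc c f v ~= 0" for v
   proof -
    have "\<exists>w. adjacent c v w \<and> f v ~= f w"
    proof (rule ccontr)
     assume "\<nexists>w. adjacent c v w \<and> f v ~= f w"
     then have "gradc c f v = 0" unfolding gradc_def by (intro sum.neutral) auto
     then show False using v by simp
    qed
    then obtain w where w: "adjacent c v w" "f v ~= f w" by blast
    have "f v ~= 0 \<or> f w ~= 0" using w by auto
    then obtain u where u: "u \<in> box x\<^sub>0 R" "linfnorm (u - v) <= 1"
    proof
     assume "f v ~= 0" then show ?thesis using f by (intro that[of v]) auto
    next
     assume "f w ~= 0" then show ?thesis using f adj_near[OF w(1)] linfnorm_minus[of v w] by (intro that[of w]) auto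
    qed
    have "linfnorm (x\<^sub>0 - v) <= linfnorm (x\<^sub>0 - u) + linfnorm (u - v)" by (rule linfnorm_triangle3)
    then show ?thesis using u v by (simp add: V_def box_def)
   qed
   show "(\<Sum>v\<in>V. (\<kappa> v)\<^sup>2 * nu c v * kern x v powr (- (\<alpha> * (real CARD('d) - 1)))) <= D1" if "f x ~= 0" for x
   proof -
    have "(\<Sum>v\<in>V. (\<kappa> v)\<^sup>2 * nu c v * kern x v powr (- (\<alpha> * (D - 1)))) <=
     (\<Sum>v\<in>V. ((\<kappa> v)\<^sup>2 * nu c v) powr (1 / p)) powr p * (\<Sum>v\<in>V. kern x v powr (- (\<alpha> * (D - 1) / (1 - p)))) powr (1 - p)"
     using nu0 kern_pos p by (intro powr_sum_holder2) (auto simp: V_def)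
    also have "... <= (M * R powr D) powr p * (K1 * 3 powr (D - \<beta>\<^sub>1) * R powr (D - \<beta>\<^sub>1)) powr (1 - p)"
    proof (intro mult_mono powr_mono2)
     show "(\<Sum>v\<in>V. ((\<kappa> v)\<^sup>2 * nu c v) powr (1 / p)) <= M * R powr D" using Mb by (simp add: V_def D_def)
     have "x \<in> box x\<^sub>0 R" using that f by blast
     then show "(\<Sum>v\<in>V. kern x v powr (- (\<alpha> * (D - 1) / (1 - p)))) <= K1 * 3 powr (D - \<beta>\<^sub>1) * R powr (D - \<beta>\<^sub>1)"
      unfolding \<beta>\<^sub>1_def[symmetric] using near3 by (intro ker_sum K1) (auto simp: V_def)
    qed (use p in \<open>auto intro!: sum_nonneg\<close>)
    also have "... = D1" unfolding D1_def K1'_def using R K1 by (simp add: powr_mult powr_powr)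
    finally show ?thesis by (simp add: D_def)
   qed
   show "(\<Sum>x | f x ~= 0. kern x v powr (- ((2 - \<alpha>) * (real CARD('d) - 1))) * s x) <= D2" if v: "v \<in> V" for v
   proof -
    let ?g = "(2 - \<alpha>) * (D - 1)"
    have "(\<Sum>x\<in>U. kern x v powr (- ?g) * s x) = (\<Sum>x\<in>U. s x powr \<epsilon> * (s x * kern x v powr (- (?g / (1 - \<epsilon>)))) powr (1 - \<epsilon>))"
    proof (rule sum.cong[OF refl])
     fix x
     have "(s x * kern x v powr (- (?g / (1 - \<epsilon>)))) powr (1 - \<epsilon>) = s x powr (1 - \<epsilon>) * kern x v powr (- ?g)"
      using s_pos[of x] \<epsilon> by (simp add: powr_mult powr_powr)
     moreover have "s x powr \<epsilon> * s x powr (1 - \<epsilon>) = s x" using s_pos[of x] by (simp add: powr_add[symmetric])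
     ultimately show "kern x v powr (- ?g) * s x = s x powr \<epsilon> * (s x * kern x v powr (- (?g / (1 - \<epsilon>)))) powr (1 - \<epsilon>)"
      by (simp only: mult.assoc[symmetric]) (simp add: mult.commute)
    qed
    also have "... <= \<sigma> powr \<epsilon> * (\<Sum>x\<in>U. s x * kern x v powr (- (?g / (1 - \<epsilon>)))) powr (1 - \<epsilon>)"
     unfolding \<sigma>_def using U s_pos \<epsilon> by (intro holder_sum) (auto simp: less_imp_le)
    also have "... <= \<sigma> powr \<epsilon> * ((M * R powr D) powr r * (K2 * 3 powr (D - \<beta>\<^sub>2) * R powr (D - \<beta>\<^sub>2)) powr (1 - r)) powr (1 - \<epsilon>)"
    proof (intro mult_left_mono powr_mono2)
     have "(\<Sum>x\<in>U. s x * kern x v powr (- (?g / (1 - \<epsilon>)))) <=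
      (\<Sum>x\<in>U. s x powr (1 / r)) powr r * (\<Sum>x\<in>U. kern x v powr (- (?g / (1 - \<epsilon>) / (1 - r)))) powr (1 - r)"
      using U s_pos kern_pos r by (intro powr_sum_holder2) (auto simp: less_imp_le)
     also have "... <= (M * R powr D) powr r * (K2 * 3 powr (D - \<beta>\<^sub>2) * R powr (D - \<beta>\<^sub>2)) powr (1 - r)"
     proof (intro mult_mono powr_mono2)
      have "(\<Sum>x\<in>U. s x powr (1 / r)) <= (\<Sum>v\<in>box x\<^sub>0 R \<inter> C. s v powr (1 / r))"
       using U by (intro sum_mono2) auto
      then show "(\<Sum>x\<in>U. s x powr (1 / r)) <= M * R powr D" using Ms by (simp add: D_def)
      have "(\<Sum>x\<in>U. kern x v powr (- \<beta>\<^sub>2)) = (\<Sum>x\<in>U. kern v x powr (- \<beta>\<^sub>2))"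
       by (simp add: kern_def linfnorm_minus[of v])
      also have "... <= K2 * 3 powr (D - \<beta>\<^sub>2) * R powr (D - \<beta>\<^sub>2)"
       using near3 U v by (intro ker_sum K2) (auto simp: V_def box_mem_sym[of _ v])
      finally show "(\<Sum>x\<in>U. kern x v powr (- (?g / (1 - \<epsilon>) / (1 - r)))) <= K2 * 3 powr (D - \<beta>\<^sub>2) * R powr (D - \<beta>\<^sub>2)"
       by (simp add: \<beta>\<^sub>2_def mult.commute)
     qed (use r in \<open>auto intro!: sum_nonneg\<close>)
     finally show "(\<Sum>x\<in>U. s x * kern x v powr (- (?g / (1 - \<epsilon>)))) <= (M * R powr D) powr r * (K2 * 3 powr (D - \<beta>\<^sub>2) * R powr (D - \<beta>\<^sub>2)) powr (1 - r)" .
    qed (use \<epsilon> s_pos in \<open>auto intro!: sum_nonneg simp: less_imp_le\<close>)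
    also have "... = D2" unfolding D2_def K2'_def using R M K2 by (simp add: powr_mult powr_powr mult.assoc)
    finally show ?thesis by (simp add: D_def U_def)
   qed
   show "0 <= D1" "0 <= D2" using K' by (auto simp: D1_def D2_def)
  qed (use f W in auto)
  also have "2 * (real CARD('d) ^ 2 * 2 ^ CARD('d))\<^sup>2 * D1 * D2 = C\<^sub>0 * M powr (p + r * (1 - \<epsilon>)) * (R\<^sup>2 * (\<sigma> / R powr D) powr \<epsilon>)"
  proof -
   have "(D - \<beta>\<^sub>1) * (1 - p) = D * (1 - p) - \<alpha> * (D - 1)" using p by (simp add: \<beta>\<^sub>1_def field_simps)
   moreover have "(D - \<beta>\<^sub>2) * (1 - r) * (1 - \<epsilon>) = D * (1 - r) * (1 - \<epsilon>) - (2 - \<alpha>) * (D - 1)"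
   proof -
    have "(1 - \<epsilon>) * (1 - r) ~= 0" using r \<epsilon> by simp
    then have "\<beta>\<^sub>2 * ((1 - \<epsilon>) * (1 - r)) = (2 - \<alpha>) * (D - 1)" by (simp add: \<beta>\<^sub>2_def)
    moreover have "(D - \<beta>\<^sub>2) * (1 - r) * (1 - \<epsilon>) = D * (1 - r) * (1 - \<epsilon>) - \<beta>\<^sub>2 * ((1 - \<epsilon>) * (1 - r))"
     by (simp add: algebra_simps)
    ultimately show ?thesis by simp
   qed
   \<comment> \<open>The powers of \<open>R\<close> add up to the scale invariant exponent:
     \<open>R\<^sup>2\<close> times the volume to the power \<open>- \<epsilon>\<close>.\<close>
   ultimately have ex: "D * p + (D - \<beta>\<^sub>1) * (1 - p) + (D * (r * (1 - \<epsilon>)) + (D - \<beta>\<^sub>2) * (1 - r) * (1 - \<epsilon>)) = 2 - D * \<epsilon>"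
    by (simp add: algebra_simps)
   have "D1 * D2 = K1' * K2' * (M powr p * M powr (r * (1 - \<epsilon>))) * \<sigma> powr \<epsilon> * (R powr (D * p) * R powr ((D - \<beta>\<^sub>1) * (1 - p)) * (R powr (D * (r * (1 - \<epsilon>))) * R powr ((D - \<beta>\<^sub>2) * (1 - r) * (1 - \<epsilon>))))"
    unfolding D1_def D2_def using R M by (simp add: powr_mult powr_powr mult_ac)
   also have "... = K1' * K2' * M powr (p + r * (1 - \<epsilon>)) * \<sigma> powr \<epsilon> * R powr (2 - D * \<epsilon>)"
    by (simp only: powr_add[symmetric] ex)
   finally have DD: "D1 * D2 = K1' * K2' * M powr (p + r * (1 - \<epsilon>)) * \<sigma> powr \<epsilon> * R powr (2 - D * \<epsilon>)" .
   have "\<sigma> powr \<epsilon> * R powr (2 - D * \<epsilon>) = R\<^sup>2 * (\<sigma> / R powr D) powr \<epsilon>"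
    using R \<sigma> by (simp add: powr_diff powr_divide powr_powr powr_numeral)
   then have DD': "D1 * D2 = K1' * K2' * M powr (p + r * (1 - \<epsilon>)) * (R\<^sup>2 * (\<sigma> / R powr D) powr \<epsilon>)"
    unfolding DD by (simp only: mult.assoc)
   have "2 * (real CARD('d) ^ 2 * 2 ^ CARD('d))\<^sup>2 * D1 * D2 = 2 * (D\<^sup>2 * 2 ^ CARD('d))\<^sup>2 * (D1 * D2)"
    by (simp only: D_def mult.assoc)
   then show ?thesis unfolding DD' C\<^sub>0_def by (simp only: mult_ac)
  qed
  also have "... * killed_walk.energy W c f f <= C\<^sub>0 * M\<^sup>2 * (R\<^sup>2 * (\<sigma> / R powr D) powr \<epsilon>) * killed_walk.energy W c f f"
  proof (intro mult_right_mono mult_left_mono)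
   have "p + r * (1 - \<epsilon>) <= 1 + 1 * 1" using p r \<epsilon> by (intro add_mono mult_mono) auto
   then have "M powr (p + r * (1 - \<epsilon>)) <= M powr 2" using M by (intro powr_mono) auto
   then show "M powr (p + r * (1 - \<epsilon>)) <= M\<^sup>2" using M by (simp add: powr_numeral)
   show "0 <= killed_walk.energy W c f f" by (rule killed_walk.energy_nonneg[OF kw])
  qed (use C0 in auto)
  finally show "(\<Sum>x\<in>B. s x * (f x)\<^sup>2) <= C\<^sub>0 * M\<^sup>2 * R\<^sup>2 * ((\<Sum>x | f x ~= 0. s x) / R powr real CARD('d)) powr \<epsilon> * killed_walk.energy W c f f"
   by (simp add: \<sigma>_def U_def D_def mult.assoc)
 qed (use \<epsilon> C0 in auto)
qed

section \<open>The random environment\<close>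

lemma lattice_edges_translate:
 "(\<lambda>v. v + z) ` e \<in> lattice_edges \<longleftrightarrow> e \<in> (lattice_edges :: 'd::finite vertex set set)"
proof -
 have *: "(\<lambda>v. v + z) ` e \<in> lattice_edges" if e: "e \<in> lattice_edges" for z and e :: "'d vertex set"
 proof -
  obtain x y where xy: "e = {x, y}" "l1norm (x - y) = 1" using e unfolding lattice_edges_def by blast
  then have "(\<lambda>v. v + z) ` e = {x + z, y + z}" "l1norm ((x + z) - (y + z)) = 1" by auto
  then show ?thesis unfolding lattice_edges_def by blast
 qed
 have "e = (\<lambda>v. v + (- z)) ` (\<lambda>v. v + z) ` e" by (simp add: image_image)
 then show ?thesis using * by metis
qed

lemma edge_translate: "{x + z, y + z} \<in> lattice_edges \<longleftrightarrow> {x, y} \<in> (lattice_edges :: 'd::finite vertex set set)"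
 using lattice_edges_translate[of z "{x, y}"] by simp

lemma shift_shift: "shift x (shift z \<omega>) = shift (x + z) \<omega>"
 by (auto simp: shift_def fun_eq_iff restrict_def lattice_edges_translate image_image add.assoc)

lemma countable_rtranclp_pred:
 fixes R :: "'a => 's::countable => 's => bool"
 assumes [measurable]: "\<And>v w. Measurable.pred M (\<lambda>\<omega>. R \<omega> v w)"
 shows "Measurable.pred M (\<lambda>\<omega>. (R \<omega>)\<^sup>*\<^sup>* x y)"
proof -
 have [measurable]: "Measurable.pred M (\<lambda>\<omega>. ((R \<omega>) ^^ n) x y)" for n y
 proof (induction n arbitrary: y)
  case (Suc n)
  note Suc[measurable]
  have "((R \<omega>) ^^ Suc n) x y \<longleftrightarrow> (\<exists>z. ((R \<omega>) ^^ n) x z \<and> R \<omega> z y)" for \<omega> by auto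
  then show ?case by simp
 qed simp
 show ?thesis unfolding rtranclp_power by measurable
qed

locale field =
 fixes ME :: "'e measure" and MV :: "'v measure" and N :: "'d::finite region"
  and a :: "('e, 'v, 'd) config \<times> ('e, 'v, 'd) config \<times> 'e => real"
  and \<theta> :: "('e, 'v, 'd) config => real"
 assumes N: "fst N \<subseteq> lattice_edges" "finite (fst N)" "finite (snd N)"
  and a_meas: "a \<in> borel_measurable (region_space ME MV N \<Otimes>\<^sub>M region_space ME MV N \<Otimes>\<^sub>M ME)"
  and a_nonneg: "\<And>z. z \<in> space (region_space ME MV N \<Otimes>\<^sub>M region_space ME MV N \<Otimes>\<^sub>M ME) ==> a z >= 0"
  and a_sym: "\<And>w\<^sub>1 w\<^sub>2 e. w\<^sub>1 \<in> space (region_space ME MV N) ==> w\<^sub>2 \<in> space (region_space ME MV N) ==> e \<in> space ME ==> a (w\<^sub>1, w\<^sub>2, e) = a (w\<^sub>2, w\<^sub>1, e)"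
  and \<theta>_meas: "\<theta> \<in> borel_measurable (region_space ME MV N)"
  and \<theta>_pos: "\<And>w. w \<in> space (region_space ME MV N) ==> \<theta> w > 0"
begin

abbreviation "\<Omega>N \<equiv> region_space ME MV N"
abbreviation "\<Omega> \<equiv> config_space ME MV"
abbreviation "cond \<equiv> conductance N a"
abbreviation "spd \<equiv> speed N \<theta>"

definition translate :: "'d vertex => 'd region => 'd region" where
 "translate x S = ((\<lambda>e. (\<lambda>v. v + x) ` e) ` fst S, (\<lambda>v. v + x) ` snd S)"

definition inside :: "'d region => 'd region => bool" where
 "inside S Q \<longleftrightarrow> fst S \<subseteq> fst Q \<and> snd S \<subseteq> snd Q"

lemma local_config_eq:
 "local_config N x \<omega> = (\<lambda>e\<in>fst N. fst \<omega> ((\<lambda>v. v + x) ` e), \<lambda>v\<in>snd N. snd \<omega> (v + x))"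
 using N(1) by (auto simp: local_config_def restrict_config_def shift_def fun_eq_iff restrict_def)

lemma local_config_measurable:
 assumes "inside (translate x N) Q"
 shows "local_config N x \<in> measurable (region_space ME MV Q) \<Omega>N"
 unfolding local_config_eq[abs_def] region_space_def
 using assms by (intro measurable_Pair measurable_restrict measurable_compose[OF measurable_fst] measurable_compose[OF measurable_snd] measurable_component_singleton)
  (auto simp: inside_def translate_def)

lemma conductance_measurable:
 assumes "inside (translate x N) Q" "inside (translate y N) Q" "{x, y} \<in> lattice_edges ==> {x, y} \<in> fst Q"
 shows "(\<lambda>\<omega>. cond \<omega> x y) \<in> borel_measurable (region_space ME MV Q)"
proof (cases "{x, y} \<in> lattice_edges")
 case True
 have "(\<lambda>\<omega>. fst \<omega> {x, y}) \<in> measurable (region_space ME MV Q) ME"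
  unfolding region_space_def using assms(3)[OF True]
  by (intro measurable_compose[OF measurable_fst] measurable_component_singleton)
 then have "(\<lambda>\<omega>. (local_config N x \<omega>, local_config N y \<omega>, fst \<omega> {x, y})) \<in> measurable (region_space ME MV Q) (\<Omega>N \<Otimes>\<^sub>M \<Omega>N \<Otimes>\<^sub>M ME)"
  using assms by (intro measurable_Pair local_config_measurable) auto
 from measurable_compose[OF this a_meas] True show ?thesis by (simp add: conductance_def)
qed (simp add: conductance_def)

lemma speed_measurable:
 assumes "inside (translate x N) Q"
 shows "(\<lambda>\<omega>. spd \<omega> x) \<in> borel_measurable (region_space ME MV Q)"
 unfolding speed_def using measurable_compose[OF local_config_measurable[OF assms] \<theta>_meas] .

lemma inside_full: "inside (translate x N) (lattice_edges, UNIV)"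
 using N(1) lattice_edges_translate by (auto simp: inside_def translate_def)

lemma cond_measurable [measurable]: "(\<lambda>\<omega>. cond \<omega> x y) \<in> borel_measurable \<Omega>"
 unfolding config_space_def by (intro conductance_measurable inside_full) simp

lemma spd_measurable [measurable]: "(\<lambda>\<omega>. spd \<omega> x) \<in> borel_measurable \<Omega>"
 unfolding config_space_def by (intro speed_measurable inside_full)

lemma local_in_space:
 assumes "inside (translate x N) Q" "\<omega> \<in> space (region_space ME MV Q)" shows "local_config N x \<omega> \<in> space \<Omega>N"
 using measurable_space[OF local_config_measurable] assms by blast

lemma edge_in_space: "e \<in> fst Q ==> \<omega> \<in> space (region_space ME MV Q) ==> fst \<omega> e \<in> space ME"
 by (auto simp: region_space_def space_pair_measure space_PiM PiE_iff)

lemma walk_env: assumes \<omega>: "\<omega> \<in> space \<Omega>" shows "walk_env (cond \<omega>) (spd \<omega>)"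
proof
 fix x y
 have loc: "local_config N z \<omega> \<in> space \<Omega>N" for z
  using local_in_space[OF inside_full] \<omega> by (simp add: config_space_def)
 have e: "{x, y} \<in> lattice_edges ==> fst \<omega> {x, y} \<in> space ME"
  using edge_in_space[of _ "(lattice_edges, UNIV)"] \<omega> by (simp add: config_space_def)
 show "cond \<omega> x y = cond \<omega> y x" using a_sym[OF loc loc e] by (simp add: conductance_def insert_commute)
 show "0 <= cond \<omega> x y" using a_nonneg loc e by (simp add: conductance_def space_pair_measure)
 show "{x, y} \<notin> lattice_edges ==> cond \<omega> x y = 0" by (simp add: conductance_def)
 show "0 < spd \<omega> x" using \<theta>_pos loc by (simp add: speed_def)
qed

lemma adjacent_pred [measurable]: "Measurable.pred \<Omega> (\<lambda>\<omega>. adjacent (cond \<omega>) x y)"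
proof -
 have "Measurable.pred \<Omega> (\<lambda>\<omega>. cond \<omega> x y > 0)" by measurable
 then show ?thesis by (rule measurable_cong[THEN iffD1, rotated]) (simp add: walk_env.adjacent_iff[OF walk_env])
qed

lemma connected_pred [measurable]: "Measurable.pred \<Omega> (\<lambda>\<omega>. connected_in B (cond \<omega>) x y)"
 unfolding connected_in_def by (intro pred_intros_logic countable_rtranclp_pred) measurable

text \<open>The suprema now run over index sets independent of the environment, which gives
  measurability. The default 0 is harmless because \<open>x\<close> belongs to its own
  component.\<close>

lemma l1diam_eq: "l1diam (component c x) = (SUP y. SUP z. if connected_in UNIV c x y \<and> connected_in UNIV c x z then ereal (l1norm (y - z)) else 0)"
proof (rule antisym)
 let ?F = "\<lambda>y z. if connected_in UNIV c x y \<and> connected_in UNIV c x z then ereal (l1norm (y - z)) else 0"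
 have F: "?F y z <= (SUP y. SUP z. ?F y z)" for y z by (intro SUP_upper2[of y] SUP_upper2[of z]) auto
 show "l1diam (component c x) <= (SUP y. SUP z. ?F y z)"
  unfolding l1diam_def
 proof (intro SUP_least)
  fix y z assume "y \<in> component c x" "z \<in> component c x"
  then have "ereal (l1norm (y - z)) = ?F y z" by (simp add: component_def)
  also have "... <= (SUP y. SUP z. ?F y z)" by (rule F)
  finally show "ereal (l1norm (y - z)) <= (SUP y. SUP z. ?F y z)" .
 qed
 have xx: "x \<in> component c x" by (simp add: component_def connected_in_def)
 have "ereal (l1norm (x - x)) <= l1diam (component c x)"
  unfolding l1diam_def by (intro SUP_upper2[OF xx] SUP_upper2[OF xx]) auto
 then have "0 <= l1diam (component c x)" by (simp add: l1norm_def zero_ereal_def)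
 moreover have "ereal (l1norm (y - z)) <= l1diam (component c x)" if "y \<in> component c x" "z \<in> component c x" for y z
  unfolding l1diam_def by (intro SUP_upper2[OF that(1)] SUP_upper2[OF that(2)]) auto
 ultimately show "(SUP y. SUP z. ?F y z) <= l1diam (component c x)" by (intro SUP_least) (auto simp: component_def)
qed

lemma clusters_pred [measurable]: "Measurable.pred \<Omega> (\<lambda>\<omega>. x \<in> clusters (cond \<omega>) r)"
proof -
 have "(\<lambda>\<omega>. l1diam (component (cond \<omega>) x)) \<in> borel_measurable \<Omega>"
  unfolding l1diam_eq by measurable
 then show ?thesis unfolding clusters_def by measurable
qed

lemma nu_measurable [measurable]: "(\<lambda>\<omega>. nu (cond \<omega>) x) \<in> borel_measurable \<Omega>"
proof -
 let ?A = "{y. linfnorm (y - x) <= 1}"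
 have fin: "finite ?A" using finite_box[of x 1] by (simp add: box_def linfnorm_minus)
 have sub: "{y. adjacent c x y} \<subseteq> ?A" for c
 proof
  fix y assume "y \<in> {y. adjacent c x y}"
  then have "{x, y} \<in> lattice_edges" by (auto simp: adjacent_def open_edges_def)
  then obtain v w where vw: "{x, y} = {v, w}" "l1norm (v - w) = 1" unfolding lattice_edges_def by blast
  then have "linfnorm (y - x) = linfnorm (v - w)" using linfnorm_minus[of y x] by (auto simp: doubleton_eq_iff)
  then show "y \<in> ?A" using linfnorm_le_l1norm[of "v - w"] vw by simp
 qed
 have eq: "(\<Sum>y | adjacent c x y. f y) = (\<Sum>y\<in>?A. if adjacent c x y then f y else 0)" for c and f :: "'d vertex => real"
  using sub[of c] fin by (intro sum.mono_neutral_cong_left) auto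
 show ?thesis
  unfolding nu_def eq by measurable
qed

lemma shift_measurable [measurable]: "shift x \<in> measurable \<Omega> \<Omega>"
 unfolding shift_def[abs_def] config_space_def region_space_def fst_conv snd_conv
proof (rule measurable_Pair)
 show "(\<lambda>\<omega>. \<lambda>e\<in>lattice_edges. fst \<omega> ((\<lambda>v. v + x) ` e)) \<in> measurable (PiM lattice_edges (\<lambda>_. ME) \<Otimes>\<^sub>M PiM UNIV (\<lambda>_. MV)) (PiM lattice_edges (\<lambda>_. ME))"
  by (intro measurable_restrict measurable_compose[OF measurable_fst] measurable_component_singleton) (simp add: lattice_edges_translate)
 show "(\<lambda>\<omega> v. snd \<omega> (v + x)) \<in> measurable (PiM lattice_edges (\<lambda>_. ME) \<Otimes>\<^sub>M PiM UNIV (\<lambda>_. MV)) (PiM UNIV (\<lambda>_. MV))"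
  by (rule measurable_PiM_single') (auto intro!: measurable_compose[OF measurable_snd] measurable_component_singleton simp: space_pair_measure space_PiM)
qed

lemma local_config_shift: "local_config N x (shift z \<omega>) = local_config N (x + z) \<omega>"
 by (simp add: local_config_def shift_shift)

lemma cond_shift: "cond (shift z \<omega>) = (\<lambda>x y. cond \<omega> (x + z) (y + z))"
proof (intro ext)
 fix x y
 have "fst (shift z \<omega>) {x, y} = fst \<omega> {x + z, y + z}" if "{x, y} \<in> lattice_edges"
  using that by (simp add: shift_def)
 then show "cond (shift z \<omega>) x y = cond \<omega> (x + z) (y + z)"
  by (simp add: conductance_def local_config_shift edge_translate)
qed

lemma spd_shift: "spd (shift z \<omega>) x = spd \<omega> (x + z)" by (simp add: speed_def local_config_shift)

end

lemma adjacent_translate: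
 fixes z :: "'d::finite vertex" and c :: "'d vertex => 'd vertex => real"
 defines "c' \<equiv> (\<lambda>x y. c (x + z) (y + z))"
 shows "adjacent c' x y \<longleftrightarrow> adjacent c (x + z) (y + z)"
proof
 assume "adjacent c' x y"
 then obtain v w where "{x, y} = {v, w}" "{v, w} \<in> lattice_edges" "c' v w > 0" by (auto simp: adjacent_def open_edges_def)
 then have "{x + z, y + z} = {v + z, w + z}" "{v + z, w + z} \<in> lattice_edges" "c (v + z) (w + z) > 0"
  using edge_translate[of v z w] by (auto simp: doubleton_eq_iff c'_def)
 then show "adjacent c (x + z) (y + z)" unfolding adjacent_def open_edges_def by blast
next
 assume "adjacent c (x + z) (y + z)"
 then obtain v w where vw: "{x + z, y + z} = {v, w}" "{v, w} \<in> lattice_edges" "c v w > 0" by (auto simp: adjacent_def open_edges_def)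
 then have "{x, y} = {v - z, w - z}" by (auto simp: doubleton_eq_iff algebra_simps)
 moreover have "{v - z, w - z} \<in> lattice_edges" "c' (v - z) (w - z) > 0"
  using vw edge_translate[of "v - z" z "w - z"] by (auto simp: c'_def)
 ultimately show "adjacent c' x y" unfolding adjacent_def open_edges_def by blast
qed

lemma connected_in_translate:
 fixes z :: "'d::finite vertex" and c :: "'d vertex => 'd vertex => real"
 defines "c' \<equiv> (\<lambda>x y. c (x + z) (y + z))"
 shows "connected_in B c' x y \<longleftrightarrow> connected_in ((\<lambda>v. v + z) ` B) c (x + z) (y + z)"
proof -
 have inB: "v + z \<in> (\<lambda>v. v + z) ` B \<longleftrightarrow> v \<in> B" for v by auto
 have 1: "(\<lambda>v w. v \<in> (\<lambda>v. v + z) ` B \<and> w \<in> (\<lambda>v. v + z) ` B \<and> adjacent c v w)\<^sup>*\<^sup>* (x + z) (y + z)"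
  if "(\<lambda>v w. v \<in> B \<and> w \<in> B \<and> adjacent c' v w)\<^sup>*\<^sup>* x y" using that
 proof (induction rule: rtranclp_induct)
  case (step v w)
  show ?case by (rule rtranclp.rtrancl_into_rtrancl[OF step.IH]) (use step.hyps inB adjacent_translate[of c z, folded c'_def] in auto)
 qed simp
 have 2: "(\<lambda>v w. v \<in> B \<and> w \<in> B \<and> adjacent c' v w)\<^sup>*\<^sup>* x (w - z)"
  if "(\<lambda>v w. v \<in> (\<lambda>v. v + z) ` B \<and> w \<in> (\<lambda>v. v + z) ` B \<and> adjacent c v w)\<^sup>*\<^sup>* (x + z) w" for w using that
 proof (induction rule: rtranclp_induct)
  case (step v w)
  then show ?case
   by (intro rtranclp.rtrancl_into_rtrancl[OF step.IH]) (auto simp: adjacent_translate[of c z, folded c'_def])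
 qed simp
 show ?thesis unfolding connected_in_def using 1 2[of "y + z"] inB by auto
qed

lemma component_translate:
 fixes z :: "'d::finite vertex" and c :: "'d vertex => 'd vertex => real"
 defines "c' \<equiv> (\<lambda>x y. c (x + z) (y + z))"
 shows "component c (x + z) = (\<lambda>v. v + z) ` component c' x"
proof -
 have "surj (\<lambda>v. v + z)" by (rule surjI[of _ "\<lambda>v. v - z"]) simp
 then have "v + z \<in> component c (x + z) \<longleftrightarrow> v \<in> component c' x" for v
  unfolding component_def using connected_in_translate[of UNIV c z x v, folded c'_def] by simp
 then show ?thesis by (auto simp: image_iff) (metis diff_add_cancel)
qed

lemma clusters_translate:
 fixes z :: "'d::finite vertex" and c :: "'d vertex => 'd vertex => real"
 defines "c' \<equiv> (\<lambda>x y. c (x + z) (y + z))"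
 shows "x \<in> clusters c' r \<longleftrightarrow> x + z \<in> clusters c r"
proof -
 have eq: "component c (x + z) = (\<lambda>v. v + z) ` component c' x"
  unfolding c'_def by (rule component_translate)
 show ?thesis unfolding clusters_def l1diam_def mem_Collect_eq eq by (simp add: image_image)
qed

lemma nu_translate:
 fixes z :: "'d::finite vertex" and c :: "'d vertex => 'd vertex => real"
 defines "c' \<equiv> (\<lambda>x y. c (x + z) (y + z))"
 shows "nu c' x = nu c (x + z)"
proof -
 have "{y. adjacent c (x + z) y} = (\<lambda>v. v + z) ` {y. adjacent c' x y}"
  unfolding adjacent_translate[of c z, folded c'_def] by (auto simp: image_iff) (metis diff_add_cancel)
 then show ?thesis unfolding nu_def by (simp add: sum.reindex c'_def)
qed

section \<open>Spatial averages\<close>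

locale field_prob = field ME MV N a \<theta> + prob_space \<mu>
 for ME :: "'e measure" and MV :: "'v measure" and N :: "'d::finite region"
  and a :: "('e, 'v, 'd) config \<times> ('e, 'v, 'd) config \<times> 'e => real"
  and \<theta> :: "('e, 'v, 'd) config => real" and \<mu> :: "('e, 'v, 'd) config measure" +
 assumes sets_\<mu>: "sets \<mu> = sets (config_space ME MV)"
  and stationary: "\<And>x. distr \<mu> (config_space ME MV) (shift x) = \<mu>"
  and ergodic: "\<And>x A. x ~= 0 ==> A \<in> sets (config_space ME MV) ==> shift x ` A = A ==> measure \<mu> A \<in> {0, 1}"
begin

lemma space_\<mu>: "space \<mu> = space \<Omega>" using sets_\<mu> by (rule sets_eq_imp_space_eq)

lemma meas_\<mu>: "measurable \<mu> K = measurable \<Omega> K" using sets_\<mu> by (rule measurable_cong_sets) simp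

lemma shift_in_space: "\<omega> \<in> space \<Omega> ==> shift x \<omega> \<in> space \<Omega>"
 using measurable_space[OF shift_measurable] .

lemma nn_integral_shift:
 assumes [measurable]: "g \<in> borel_measurable \<Omega>"
 shows "(\<integral>\<^sup>+\<omega>. g (shift z \<omega>) \<partial>\<mu>) = (\<integral>\<^sup>+\<omega>. g \<omega> \<partial>\<mu>)"
proof -
 have "(\<integral>\<^sup>+\<omega>. g \<omega> \<partial>distr \<mu> \<Omega> (shift z)) = (\<integral>\<^sup>+\<omega>. g (shift z \<omega>) \<partial>\<mu>)"
  by (rule nn_integral_distr) (auto simp: meas_\<mu>)
 then show ?thesis by (simp add: stationary)
qed

lemma shift_zero: "\<omega> \<in> space \<Omega> ==> shift 0 \<omega> = \<omega>"
 by (auto simp: shift_def config_space_def region_space_def space_pair_measure space_PiM PiE_iff extensional_def fun_eq_iff restrict_def)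

text \<open>Shifts are invertible, so a property preserved by all of them defines a set that each
  shift maps onto itself; ergodicity is applied in the direction \<open>(1, ..., 1)\<close>.\<close>

lemma invariant_prob:
 assumes [measurable]: "Measurable.pred \<Omega> Q" and inv: "\<And>\<omega> x. \<omega> \<in> space \<Omega> ==> Q \<omega> ==> Q (shift x \<omega>)"
 shows "prob {\<omega> \<in> space \<Omega>. Q \<omega>} \<in> {0, 1}"
proof (rule ergodic)
 define x :: "'d vertex" where "x = (\<chi> i. 1)"
 show "x ~= 0" by (simp add: x_def vec_eq_iff)
 show "{\<omega> \<in> space \<Omega>. Q \<omega>} \<in> sets (config_space ME MV)" by measurable
 show "shift x ` {\<omega> \<in> space \<Omega>. Q \<omega>} = {\<omega> \<in> space \<Omega>. Q \<omega>}"
 proof (intro equalityI subsetI)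
  fix \<omega> assume "\<omega> \<in> shift x ` {\<omega> \<in> space \<Omega>. Q \<omega>}"
  then show "\<omega> \<in> {\<omega> \<in> space \<Omega>. Q \<omega>}" using inv shift_in_space by auto
 next
  fix \<omega> assume \<omega>: "\<omega> \<in> {\<omega> \<in> space \<Omega>. Q \<omega>}"
  then have "\<omega> = shift x (shift (- x) \<omega>)" by (simp add: shift_shift shift_zero)
  moreover have "shift (- x) \<omega> \<in> {\<omega> \<in> space \<Omega>. Q \<omega>}"
   using \<omega> inv[of \<omega> "- x"] shift_in_space[of \<omega> "- x"] by simp
  ultimately show "\<omega> \<in> shift x ` {\<omega> \<in> space \<Omega>. Q \<omega>}" by blast
 qed
qed

end

text \<open>Greedy choice of a box of largest radius. Only the centres have to be covered, which is
  why the factor is 2 instead of 3.\<close>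

lemma vitali_boxes:
 fixes S :: "'d::finite vertex set" and n :: "'d vertex => nat"
 assumes "finite S"
 shows "\<exists>T\<subseteq>S. (\<forall>x\<in>T. \<forall>y\<in>T. x ~= y --> box x (real (n x)) \<inter> box y (real (n y)) = {}) \<and> S \<subseteq> (\<Union>t\<in>T. box t (2 * real (n t)))"
 using assms
proof (induction S rule: finite_psubset_induct)
 case (psubset S)
 show ?case
 proof (cases "S = {}")
  case False
  then obtain x where x: "x \<in> S" "\<And>y. y \<in> S ==> n y <= n x"
   using finite_has_maximal[of "n ` S"] psubset(1) by (metis (no_types, lifting) finite_imageI image_iff image_is_empty linorder_linear order_antisym_conv)
  define S' where "S' = {y \<in> S. box y (real (n y)) \<inter> box x (real (n x)) = {}}"
  have xx: "x \<in> box x (real (n x))" by (simp add: box_def)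
  then have "S' \<subset> S" using x by (auto simp: S'_def)
  from psubset(2)[OF this]
  obtain T where T: "T \<subseteq> S'" "\<forall>x\<in>T. \<forall>y\<in>T. x ~= y --> box x (real (n x)) \<inter> box y (real (n y)) = {}"
   "S' \<subseteq> (\<Union>t\<in>T. box t (2 * real (n t)))" by (elim exE conjE) (rule that)
  have "y \<in> box x (2 * real (n x))" if "y \<in> S - S'" for y
  proof -
   obtain z where z: "z \<in> box y (real (n y))" "z \<in> box x (real (n x))" using \<open>y \<in> S - S'\<close> by (auto simp: S'_def)
   have "linfnorm (x - y) <= linfnorm (x - z) + linfnorm (z - y)" by (rule linfnorm_triangle3)
   then show ?thesis using z x(2)[of y] that by (auto simp: box_def linfnorm_minus[of z y])
  qed
  then have "S \<subseteq> (\<Union>t\<in>insert x T. box t (2 * real (n t)))" using T(3) by auto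
  moreover have "insert x T \<subseteq> S" using T(1) x by (auto simp: S'_def)
  moreover have "\<forall>v\<in>insert x T. \<forall>w\<in>insert x T. v ~= w --> box v (real (n v)) \<inter> box w (real (n w)) = {}"
   using T(1,2) by (auto simp: S'_def)
  ultimately show ?thesis by blast
 qed auto
qed

lemma card_box_nat: "card (box (x :: 'd::finite vertex) (real n)) = (2 * n + 1) ^ CARD('d)"
proof -
 have "inj_on (\<lambda>f. vec_lambda f :: 'd vertex) A" for A by (auto simp: inj_on_def vec_lambda_inject)
 then have "card (box x (real n)) = card (PiE UNIV (\<lambda>i. {x $ i - int n..x $ i + int n}))"
  unfolding box_eq_image floor_of_nat by (intro card_image)
 then show ?thesis by (simp add: card_PiE nat_add_distrib nat_mult_distrib)
qed

context field_prob
begin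

definition boxsum :: "(('e, 'v, 'd) config => ennreal) => 'd vertex => real => ('e, 'v, 'd) config => ennreal" where
 "boxsum g x r \<omega> = (\<Sum>y\<in>box x r. g (shift y \<omega>))"

lemma boxsum_measurable [measurable]: "g \<in> borel_measurable \<Omega> ==> boxsum g x r \<in> borel_measurable \<Omega>"
 unfolding boxsum_def[abs_def] by (intro borel_measurable_sum measurable_compose[OF shift_measurable])

lemma boxsum_shift: "boxsum g x r (shift z \<omega>) = boxsum g (x + z) r \<omega>"
proof -
 have "box (x + z) r = (\<lambda>y. y + z) ` box x r"
  by (auto simp: box_def image_iff algebra_simps intro!: exI[of _ "_ - z"])
 then show ?thesis by (simp add: boxsum_def shift_shift sum.reindex)
qed

lemma boxsum_mono: "box x r \<subseteq> box y r' ==> boxsum g x r \<omega> <= boxsum g y r' \<omega>"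
 unfolding boxsum_def by (intro sum_mono2) auto

text \<open>For fixed \<omega>, Vitali's covering bounds the number of bad centres in the box of
  radius \<open>L\<close>; integration and stationarity turn this number into the probability of
  \<open>E L\<close>. One factor \<open>2 ^ d\<close> comes from the covering, the other from
  comparing the boxes of radius \<open>2 * L\<close> and \<open>L\<close>.\<close>

lemma maximal_inequality:
 assumes g [measurable]: "g \<in> borel_measurable \<Omega>" and m: "m > 0"
 defines "E L \<equiv> {\<omega> \<in> space \<Omega>. \<exists>n\<le>L. boxsum g 0 (real n) \<omega> > ennreal (m * (2 * real n + 1) ^ CARD('d))}"
 shows "ennreal m * emeasure \<mu> (E L) <= 4 ^ CARD('d) * (\<integral>\<^sup>+\<omega>. g \<omega> \<partial>\<mu>)"
proof -
 let ?d = "CARD('d)"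
 have [measurable]: "E L \<in> sets \<Omega>" unfolding E_def by measurable
 have EL: "E L \<in> sets \<mu>" by (simp add: sets_\<mu>)
 have pt: "ennreal m * (\<Sum>x\<in>box 0 (real L). indicator (E L) (shift x \<omega>)) <= 2 ^ ?d * boxsum g 0 (real (2 * L)) \<omega>" if \<omega>: "\<omega> \<in> space \<Omega>" for \<omega>
 proof -
  define S where "S = {x \<in> box 0 (real L). shift x \<omega> \<in> E L}"
  have finS: "finite S" by (simp add: S_def)
  have "\<forall>x\<in>S. \<exists>n\<le>L. boxsum g x (real n) \<omega> > ennreal (m * (2 * real n + 1) ^ ?d)"
   by (auto simp: S_def E_def boxsum_shift)
  then obtain n where n: "\<And>x. x \<in> S ==> n x <= L" "\<And>x. x \<in> S ==> boxsum g x (real (n x)) \<omega> > ennreal (m * (2 * real (n x) + 1) ^ ?d)"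
   by metis
  obtain T where T: "T \<subseteq> S" "\<forall>x\<in>T. \<forall>y\<in>T. x ~= y --> box x (real (n x)) \<inter> box y (real (n y)) = {}" "S \<subseteq> (\<Union>t\<in>T. box t (2 * real (n t)))"
   using vitali_boxes[OF finS, of n] by blast
  have finT: "finite T" using T(1) finS finite_subset by blast
  have "real (card S) <= (\<Sum>t\<in>T. 2 ^ ?d * (2 * real (n t) + 1) ^ ?d)"
  proof -
   have "card S <= card (\<Union>t\<in>T. box t (2 * real (n t)))" using finT T(3) by (intro card_mono) auto
   also have "... <= (\<Sum>t\<in>T. card (box t (2 * real (n t))))" by (rule card_UN_le[OF finT])
   finally have "real (card S) <= (\<Sum>t\<in>T. real (card (box t (2 * real (n t)))))" by (simp flip: of_nat_sum)
   also have "... <= (\<Sum>t\<in>T. 2 ^ ?d * (2 * real (n t) + 1) ^ ?d)"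
   proof (rule sum_mono)
    fix t
    have "real (card (box t (2 * real (n t)))) <= (2 * (2 * real (n t)) + 1) ^ ?d" by (rule card_box_le) simp
    also have "... <= (2 * (2 * real (n t) + 1)) ^ ?d" by (intro power_mono) auto
    finally show "real (card (box t (2 * real (n t)))) <= 2 ^ ?d * (2 * real (n t) + 1) ^ ?d" by (simp only: power_mult_distrib)
   qed
   finally show ?thesis .
  qed
  then have "m * real (card S) <= m * (\<Sum>t\<in>T. 2 ^ ?d * (2 * real (n t) + 1) ^ ?d)"
   using m by (intro mult_left_mono) auto
  also have "... = 2 ^ ?d * (\<Sum>t\<in>T. m * (2 * real (n t) + 1) ^ ?d)" by (simp add: sum_distrib_left mult_ac)
  finally have "ennreal (m * real (card S)) <= ennreal (2 ^ ?d * (\<Sum>t\<in>T. m * (2 * real (n t) + 1) ^ ?d))"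
   by (rule ennreal_leI)
  also have "... = 2 ^ ?d * (\<Sum>t\<in>T. ennreal (m * (2 * real (n t) + 1) ^ ?d))"
  proof -
   have "(\<Sum>t\<in>T. ennreal (m * (2 * real (n t) + 1) ^ ?d)) = ennreal (\<Sum>t\<in>T. m * (2 * real (n t) + 1) ^ ?d)"
    using m by (intro sum_ennreal) auto
   moreover have "ennreal (2 ^ ?d * X) = 2 ^ ?d * ennreal X" if "X >= 0" for X
    using that by (simp add: ennreal_mult ennreal_power[symmetric])
   ultimately show ?thesis using m by (simp add: sum_nonneg)
  qed
  also have "... <= 2 ^ ?d * (\<Sum>t\<in>T. boxsum g t (real (n t)) \<omega>)"
   using n T(1) by (intro mult_left_mono sum_mono) (auto simp: less_imp_le subset_iff)
  also have "(\<Sum>t\<in>T. boxsum g t (real (n t)) \<omega>) = (\<Sum>y\<in>(\<Union>t\<in>T. box t (real (n t))). g (shift y \<omega>))"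
   unfolding boxsum_def using T(2) finT by (intro sum.UNION_disjoint[symmetric]) auto
  also have "... <= boxsum g 0 (real (2 * L)) \<omega>"
   unfolding boxsum_def
  proof (rule sum_mono2)
   show "(\<Union>t\<in>T. box t (real (n t))) \<subseteq> box 0 (real (2 * L))"
   proof (rule UN_least, rule box_subset)
    fix t assume t: "t \<in> T"
    then have "t \<in> box 0 (real L)" "n t <= L" using T(1) n(1) by (auto simp: S_def)
    then show "linfnorm (t - 0) + real (n t) <= real (2 * L)" by (simp add: box_mem)
   qed
  qed auto
  finally have "ennreal (m * real (card S)) <= 2 ^ ?d * boxsum g 0 (real (2 * L)) \<omega>" by (simp add: mult_left_mono)
  moreover have "(\<Sum>x\<in>box 0 (real L). indicator (E L) (shift x \<omega>)) = (of_nat (card S) :: ennreal)"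
   by (simp add: S_def indicator_def sum.If_cases Int_def)
  moreover have "ennreal (m * real (card S)) = ennreal m * of_nat (card S)"
   using m by (simp add: ennreal_mult ennreal_of_nat_eq_real_of_nat)
  ultimately show ?thesis by simp
 qed
 have card_L: "(of_nat (card (box (0 :: 'd vertex) (real n))) :: ennreal) = ennreal ((2 * real n + 1) ^ ?d)" for n
  unfolding card_box_nat by (simp add: ennreal_of_nat_eq_real_of_nat add.commute)
 have "ennreal m * (ennreal ((2 * real L + 1) ^ ?d) * emeasure \<mu> (E L)) = (\<integral>\<^sup>+\<omega>. ennreal m * (\<Sum>x\<in>box 0 (real L). indicator (E L) (shift x \<omega>)) \<partial>\<mu>)"
 proof -
  have "(\<integral>\<^sup>+\<omega>. (\<Sum>x\<in>box 0 (real L). indicator (E L) (shift x \<omega>)) \<partial>\<mu>) = (\<Sum>x\<in>box (0 :: 'd vertex) (real L). \<integral>\<^sup>+\<omega>. indicator (E L) (shift x \<omega>) \<partial>\<mu>)"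
   by (rule nn_integral_sum) (simp add: meas_\<mu>)
  also have "... = (\<Sum>x\<in>box (0 :: 'd vertex) (real L). emeasure \<mu> (E L))"
   using EL by (intro sum.cong refl, subst nn_integral_shift) auto
  finally show ?thesis by (simp add: nn_integral_cmult meas_\<mu> card_L)
 qed
 also have "... <= (\<integral>\<^sup>+\<omega>. 2 ^ ?d * boxsum g 0 (real (2 * L)) \<omega> \<partial>\<mu>)"
  by (rule nn_integral_mono) (use pt in \<open>auto simp: space_\<mu>\<close>)
 also have "... = 2 ^ ?d * (ennreal ((2 * real (2 * L) + 1) ^ ?d) * (\<integral>\<^sup>+\<omega>. g \<omega> \<partial>\<mu>))"
 proof -
  have "(\<integral>\<^sup>+\<omega>. boxsum g 0 (real (2 * L)) \<omega> \<partial>\<mu>) = (\<Sum>x\<in>box (0 :: 'd vertex) (real (2 * L)). \<integral>\<^sup>+\<omega>. g (shift x \<omega>) \<partial>\<mu>)"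
   unfolding boxsum_def by (rule nn_integral_sum) (simp add: meas_\<mu>)
  also have "... = ennreal ((2 * real (2 * L) + 1) ^ ?d) * (\<integral>\<^sup>+\<omega>. g \<omega> \<partial>\<mu>)"
   by (simp add: nn_integral_shift card_L del: of_nat_mult)
  finally show ?thesis by (simp add: nn_integral_cmult meas_\<mu>)
 qed
 also have "... <= 2 ^ ?d * (ennreal (2 ^ ?d * (2 * real L + 1) ^ ?d) * (\<integral>\<^sup>+\<omega>. g \<omega> \<partial>\<mu>))"
 proof (intro mult_left_mono mult_right_mono ennreal_leI)
  have "(2 * real (2 * L) + 1) ^ ?d <= (2 * (2 * real L + 1)) ^ ?d" by (intro power_mono) auto
  then show "(2 * real (2 * L) + 1) ^ ?d <= 2 ^ ?d * (2 * real L + 1) ^ ?d" by (simp only: power_mult_distrib)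
 qed auto
 also have "... = ennreal ((2 * real L + 1) ^ ?d) * (4 ^ ?d * (\<integral>\<^sup>+\<omega>. g \<omega> \<partial>\<mu>))"
 proof -
  have "(4 :: ennreal) ^ ?d = 2 ^ ?d * 2 ^ ?d" by (simp add: power_mult_distrib[symmetric])
  then show ?thesis by (simp add: ennreal_mult ennreal_power[symmetric] mult_ac)
 qed
 finally have "ennreal ((2 * real L + 1) ^ ?d) * (ennreal m * emeasure \<mu> (E L)) <= ennreal ((2 * real L + 1) ^ ?d) * (4 ^ ?d * (\<integral>\<^sup>+\<omega>. g \<omega> \<partial>\<mu>))"
  by (simp add: mult_ac)
 then show ?thesis by (subst (asm) ennreal_mult_le_mult_iff) auto
qed

text \<open>Only an upper bound on averages is wanted. The maximal inequality gives it with
  probability at least 1/2, and the zero-one law for invariant properties does the rest.\<close>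

theorem spatial_average:
 assumes g [measurable]: "g \<in> borel_measurable \<Omega>" and fin: "(\<integral>\<^sup>+\<omega>. g \<omega> \<partial>\<mu>) < \<infinity>"
 shows "\<exists>m>0. AE \<omega> in \<mu>. \<forall>x. \<exists>R\<^sub>0. \<forall>R\<ge>R\<^sub>0. boxsum g x R \<omega> <= ennreal (m * R ^ CARD('d))"
proof -
 let ?d = "CARD('d)"
 define G where "G = enn2real (\<integral>\<^sup>+\<omega>. g \<omega> \<partial>\<mu>)"
 have G: "(\<integral>\<^sup>+\<omega>. g \<omega> \<partial>\<mu>) = ennreal G" "G >= 0" using fin by (auto simp: G_def)
 \<comment> \<open>Makes the maximal inequality yield probability at most 1/2; adding 1 keeps
   \<open>m\<close> positive.\<close>
 define m where "m = 2 * 4 ^ ?d * (G + 1)"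
 have m: "m > 0" using G by (simp add: m_def)
 define E where "E L = {\<omega> \<in> space \<Omega>. \<exists>n\<le>L. boxsum g 0 (real n) \<omega> > ennreal (m * (2 * real n + 1) ^ ?d)}" for L
 have [measurable]: "E L \<in> sets \<Omega>" for L unfolding E_def by measurable
 have EL: "emeasure \<mu> (E L) <= ennreal (1/2)" for L
 proof -
  have "ennreal m * emeasure \<mu> (E L) <= 4 ^ ?d * ennreal G"
   using maximal_inequality[OF g m, of L] unfolding E_def G(1) .
  also have "... <= ennreal m * ennreal (1/2)"
  proof -
   have "4 ^ ?d * ennreal G = ennreal (4 ^ ?d * G)" using G by (simp add: ennreal_mult ennreal_power[symmetric])
   also have "... <= ennreal (m * (1/2))" by (intro ennreal_leI) (simp add: m_def)
   also have "ennreal (m * (1/2)) = ennreal m * ennreal (1/2)" using m by (intro ennreal_mult) auto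
   finally show ?thesis .
  qed
  finally show ?thesis using m by (subst (asm) ennreal_mult_le_mult_iff) auto
 qed
 \<comment> \<open>The centre is quantified existentially so that shifts preserve the property; it
   is moved to an arbitrary \<open>x\<close> afterwards at the cost of the factor
   \<open>5 ^ d\<close>.\<close>
 define Q where "Q \<omega> \<longleftrightarrow> (\<exists>x n\<^sub>0. \<forall>n\<ge>n\<^sub>0. boxsum g x (real n) \<omega> <= ennreal (m * (2 * real n + 1) ^ ?d))" for \<omega>
 have [measurable]: "Measurable.pred \<Omega> Q" unfolding Q_def by measurable
 have "emeasure \<mu> (\<Union>L. E L) = (SUP L. emeasure \<mu> (E L))"
 proof (rule SUP_emeasure_incseq[symmetric])
  show "range E \<subseteq> sets \<mu>" by (auto simp: sets_\<mu>)
  show "incseq E" unfolding incseq_def E_def by (auto intro: order_trans)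
 qed
 also have "... <= ennreal (1/2)" using EL by (intro SUP_least)
 finally have "ennreal (prob (\<Union>L. E L)) <= ennreal (1/2)" by (simp only: emeasure_eq_measure)
 then have "prob (\<Union>L. E L) <= 1/2" by (subst (asm) ennreal_le_iff) auto
 moreover have "prob (space \<mu> - (\<Union>L. E L)) = 1 - prob (\<Union>L. E L)"
  by (rule prob_compl) (auto simp: sets_\<mu>)
 moreover have "prob (space \<mu> - (\<Union>L. E L)) <= prob {\<omega> \<in> space \<Omega>. Q \<omega>}"
 proof (rule finite_measure_mono)
  show "space \<mu> - (\<Union>L. E L) \<subseteq> {\<omega> \<in> space \<Omega>. Q \<omega>}"
  proof
   fix \<omega> assume "\<omega> \<in> space \<mu> - (\<Union>L. E L)"
   then have \<omega>: "\<omega> \<in> space \<Omega>" "\<And>L. \<omega> \<notin> E L" by (auto simp: space_\<mu>)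
   have "boxsum g 0 (real n) \<omega> <= ennreal (m * (2 * real n + 1) ^ ?d)" for n
    using \<omega>(2)[of n] \<omega>(1) by (auto simp: E_def not_less)
   then show "\<omega> \<in> {\<omega> \<in> space \<Omega>. Q \<omega>}" using \<omega> unfolding Q_def by blast
  qed
  show "{\<omega> \<in> space \<Omega>. Q \<omega>} \<in> events" unfolding sets_\<mu> by measurable
 qed
 ultimately have "prob {\<omega> \<in> space \<Omega>. Q \<omega>} >= 1/2" by linarith
 moreover have "prob {\<omega> \<in> space \<Omega>. Q \<omega>} \<in> {0, 1}"
 proof (rule invariant_prob)
  fix \<omega> x assume "\<omega> \<in> space \<Omega>" "Q \<omega>"
  then obtain y n\<^sub>0 where "\<forall>n\<ge>n\<^sub>0. boxsum g y (real n) \<omega> <= ennreal (m * (2 * real n + 1) ^ ?d)" unfolding Q_def by blast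
  then show "Q (shift x \<omega>)" unfolding Q_def by (intro exI[of _ "y - x"] exI[of _ n\<^sub>0]) (simp add: boxsum_shift)
 qed simp
 ultimately have "prob {\<omega> \<in> space \<Omega>. Q \<omega>} = 1" by auto
 then have "AE \<omega> in \<mu>. \<omega> \<in> {\<omega> \<in> space \<Omega>. Q \<omega>}" by (intro AE_prob_1)
 then have "AE \<omega> in \<mu>. \<forall>x. \<exists>R\<^sub>0. \<forall>R\<ge>R\<^sub>0. boxsum g x R \<omega> <= ennreal (m * 5 ^ ?d * R ^ ?d)"
 proof eventually_elim
  case (elim \<omega>)
  then obtain y n\<^sub>0 where y: "\<And>n. n >= n\<^sub>0 ==> boxsum g y (real n) \<omega> <= ennreal (m * (2 * real n + 1) ^ ?d)" unfolding Q_def by blast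
  show ?case
  proof
   fix x
   define D where "D = linfnorm (x - y)"
   have D: "D >= 0" by (simp add: D_def linfnorm_nonneg)
   show "\<exists>R\<^sub>0. \<forall>R\<ge>R\<^sub>0. boxsum g x R \<omega> <= ennreal (m * 5 ^ ?d * R ^ ?d)"
   proof (intro exI[of _ "real n\<^sub>0 + 2 * D + 3"] allI impI)
    fix R assume R: "R >= real n\<^sub>0 + 2 * D + 3"
    define n where "n = nat \<lceil>R + D\<rceil>"
    have n: "R + D <= real n" "real n <= R + D + 1" using R D by (auto simp: n_def)
    have "boxsum g x R \<omega> <= boxsum g y (real n) \<omega>"
     using n by (intro boxsum_mono box_subset) (simp add: D_def)
    also have "... <= ennreal (m * (2 * real n + 1) ^ ?d)" using n R D by (intro y) linarith
    also have "... <= ennreal (m * (5 * R) ^ ?d)" using n R D m by (intro ennreal_leI mult_left_mono power_mono) auto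
    finally show "boxsum g x R \<omega> <= ennreal (m * 5 ^ ?d * R ^ ?d)" by (simp add: power_mult_distrib mult_ac)
   qed
  qed
 qed
 then show ?thesis using m by (intro exI[of _ "m * 5 ^ ?d"]) auto
qed

end

section \<open>The structure of the infinite cluster\<close>

lemma connected_in_sym: "connected_in B c x y ==> connected_in B c y x"
proof -
 assume *: "connected_in B c x y"
 let ?r = "\<lambda>v w. v \<in> B \<and> w \<in> B \<and> adjacent c v w"
 have "?r\<^sup>*\<^sup>* y x"
 proof -
  have "symp ?r" by (auto simp: symp_def adjacent_commute)
  then have "symp ?r\<^sup>*\<^sup>*" by (rule symp_rtranclp)
  then show ?thesis using * by (auto simp: connected_in_def dest: sympD)
 qed
 moreover have "y \<in> B" using * unfolding connected_in_def by (auto elim: rtranclp.cases)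
 ultimately show ?thesis by (simp add: connected_in_def)
qed

lemma connected_in_trans: "connected_in B c x y ==> connected_in B c y z ==> connected_in B c x z"
 by (auto simp: connected_in_def)

lemma connected_in_mono:
 assumes "B \<subseteq> B'" "connected_in B c x y" shows "connected_in B' c x y"
proof -
 have "(\<lambda>v w. v \<in> B \<and> w \<in> B \<and> adjacent c v w)\<^sup>*\<^sup>* <= (\<lambda>v w. v \<in> B' \<and> w \<in> B' \<and> adjacent c v w)\<^sup>*\<^sup>*"
  using assms(1) by (intro rtranclp_mono) auto
 then show ?thesis using assms by (auto simp: connected_in_def)
qed

lemma component_eq: "connected_in UNIV c x y ==> component c x = component c y"
 unfolding component_def using connected_in_sym connected_in_trans by blast

lemma clusters_connected: "connected_in UNIV c x y ==> x \<in> clusters c r \<longleftrightarrow> y \<in> clusters c r"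
 by (simp add: clusters_def component_eq)

lemma clusters_adjacent: "adjacent c x y ==> x \<in> clusters c r ==> y \<in> clusters c r"
 using clusters_connected[of c x y r] by (auto simp: connected_in_def)

lemma clusters_antimono: "r <= r' ==> clusters c r' \<subseteq> clusters c r" by (auto simp: clusters_def)

text \<open>The two events of (S1) at radius \<open>2 ^ j\<close>, centred at
  \<open>z\<close>.\<close>

definition well_connected :: "('d::finite vertex => 'd vertex => real) => 'd vertex => nat => bool" where
 "well_connected c z j \<longleftrightarrow> clusters c (ereal (2 ^ j)) \<inter> box z (2 ^ j) ~= {} \<and>
  (\<forall>x \<in> clusters c (ereal (2 ^ j / 10)) \<inter> box z (2 ^ j). \<forall>y \<in> clusters c (ereal (2 ^ j / 10)) \<inter> box z (2 ^ j).
   connected_in (box z (2 * 2 ^ j)) c x y)"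

text \<open>Large clusters at consecutive good scales are linked, since diameter at least
  \<open>2 ^ j\<close> exceeds the threshold \<open>2 ^ Suc j / 10\<close> of the next scale. The
  chain of links is one component of infinite diameter.\<close>

lemma infinite_cluster_near:
 assumes good: "\<And>j. j >= k ==> well_connected c z j"
 shows "clusters c \<infinity> \<inter> box z (2 ^ k) ~= {}"
proof -
 have "\<forall>j. \<exists>v. j >= k --> v \<in> clusters c (ereal (2 ^ j)) \<inter> box z (2 ^ j)"
  using good unfolding well_connected_def by blast
 then have "\<exists>v. \<forall>j. j >= k --> v j \<in> clusters c (ereal (2 ^ j)) \<inter> box z (2 ^ j)" by (rule choice)
 then obtain v where v: "\<And>j. j >= k ==> v j \<in> clusters c (ereal (2 ^ j)) \<inter> box z (2 ^ j)" by blast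
 have step: "connected_in UNIV c (v j) (v (Suc j))" if j: "j >= k" for j
 proof -
  have "clusters c (ereal (2 ^ j)) \<subseteq> clusters c (ereal (2 ^ Suc j / 10))" by (rule clusters_antimono) simp
  moreover have "clusters c (ereal (2 ^ Suc j)) \<subseteq> clusters c (ereal (2 ^ Suc j / 10))"
   by (rule clusters_antimono) simp
  moreover have "box z (2 ^ j) \<subseteq> box z (2 ^ Suc j)" by (rule box_subset) simp
  ultimately have "v j \<in> clusters c (ereal (2 ^ Suc j / 10)) \<inter> box z (2 ^ Suc j)" "v (Suc j) \<in> clusters c (ereal (2 ^ Suc j / 10)) \<inter> box z (2 ^ Suc j)"
   using v[of j] v[of "Suc j"] j by auto
  then have "connected_in (box z (2 * 2 ^ Suc j)) c (v j) (v (Suc j))"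
   using good[of "Suc j"] j unfolding well_connected_def by auto
  then show ?thesis by (rule connected_in_mono[rotated]) simp
 qed
 have con: "connected_in UNIV c (v k) (v (k + n))" for n
 proof (induction n)
  case 0
  show ?case by (simp add: connected_in_def)
 next
  case (Suc n)
  then show ?case using step[of "k + n"] connected_in_trans by fastforce
 qed
 have "ereal (2 ^ (k + n)) <= l1diam (component c (v k))" for n
  using v[of "k + n"] component_eq[OF con[of n]] by (simp add: clusters_def)
 then have le: "ereal (real n) <= l1diam (component c (v k))" for n
 proof -
  have "real n <= 2 ^ n" by (simp add: of_nat_less_two_power less_imp_le)
  also have "... <= (2::real) ^ (k + n)" by (intro power_increasing) auto
  finally have "ereal (real n) <= ereal (2 ^ (k + n))" by simp
  then show ?thesis using \<open>\<And>n. ereal (2 ^ (k + n)) <= l1diam (component c (v k))\<close> order_trans by blast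
 qed
 have "l1diam (component c (v k)) = \<infinity>"
 proof (rule ccontr)
  assume "l1diam (component c (v k)) ~= \<infinity>"
  moreover have "l1diam (component c (v k)) >= 0" using le[of 0] by (simp add: zero_ereal_def)
  ultimately obtain r where r: "l1diam (component c (v k)) = ereal r" by (cases "l1diam (component c (v k))") auto
  obtain n where "r < real n" using reals_Archimedean2 by blast
  then show False using le[of n] r by simp
 qed
 then have "v k \<in> clusters c \<infinity>" by (simp add: clusters_def)
 then show ?thesis using v[of k] by blast
qed

lemma clusters_infinity_subset: "clusters c \<infinity> \<subseteq> clusters c r" by (rule clusters_antimono) simp

definition nearest :: "'d::finite vertex set => 'd vertex => 'd vertex" where
 "nearest C z = (SOME v. v \<in> C \<and> (\<forall>w\<in>C. linfnorm (v - z) <= linfnorm (w - z)))"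

lemma nearest:
 assumes "C ~= {}"
 shows "nearest C z \<in> C" "w \<in> C ==> linfnorm (nearest C z - z) <= linfnorm (w - z)" "z \<in> C ==> nearest C z = z"
proof -
 define f where "f v = nat \<lfloor>linfnorm (v - z)\<rfloor>" for v
 have f: "linfnorm (v - z) = real (f v)" for v using linfnorm_int[of "v - z"] by (auto simp: f_def)
 obtain v where "v \<in> C" using assms by blast
 then have "\<exists>v. v \<in> C \<and> (\<forall>w. w \<in> C --> f v <= f w)" by (rule ex_has_least_nat)
 then have "\<exists>v. v \<in> C \<and> (\<forall>w\<in>C. linfnorm (v - z) <= linfnorm (w - z))" by (simp add: f Ball_def)
 then have *: "nearest C z \<in> C \<and> (\<forall>w\<in>C. linfnorm (nearest C z - z) <= linfnorm (w - z))"
  unfolding nearest_def by (rule someI_ex)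
 then show "nearest C z \<in> C" "w \<in> C ==> linfnorm (nearest C z - z) <= linfnorm (w - z)" by auto
 show "nearest C z = z" if "z \<in> C"
 proof -
  have "linfnorm (nearest C z - z) < 1" using *[THEN conjunct2, rule_format, OF that] by simp
  then show ?thesis using linfnorm_eq_0[of "nearest C z - z"] by simp
 qed
qed

lemma linfnorm_axis: "linfnorm (axis i 1 :: 'd::finite vertex) <= 1"
 unfolding linfnorm_le_iff by (simp add: axis_def)

text \<open>The cluster points nearest to \<open>z\<close> and to \<open>z + axis i 1\<close> are
  within \<open>2 ^ T z + 2 <= 2 ^ Suc (T z)\<close> of \<open>z\<close>. Good connection at scale
  \<open>Suc (T z)\<close> joins them in a box of twice that radius, whence the exponent
  \<open>T z + 2\<close>.\<close>

lemma cluster_structure: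
 assumes we: "walk_env c s" and T: "\<And>z. T z >= 1" "\<And>z j. j >= T z ==> well_connected c z j"
  and fin: "\<And>v. finite {z. v \<in> box z (2 ^ (T z + 2))}"
 shows "good_cluster c s (clusters c \<infinity>) (nearest (clusters c \<infinity>)) (\<lambda>z. 2 ^ (T z + 2))"
proof -
 let ?C = "clusters c \<infinity>"
 have ne: "?C ~= {}" using infinite_cluster_near[where k="T 0" and z=0 and c=c, OF T(2)] by blast
 interpret walk_env c s by (rule we)
 show ?thesis
 proof
  show "x \<in> ?C ==> nearest ?C x = x" for x by (rule nearest(3)[OF ne])
  show "nearest ?C z \<in> ?C" for z by (rule nearest(1)[OF ne])
  show "v \<in> ?C ==> adjacent c v w ==> w \<in> ?C" for v w using clusters_adjacent by blast
  show "1 <= (2::nat) ^ (T z + 2)" for z by simp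
  show "v \<in> ?C ==> finite {z. v \<in> box z (real (2 ^ (T z + 2)))}" for v using fin[of v] by simp
  fix z i
  obtain w where w: "w \<in> ?C" "linfnorm (w - z) <= 2 ^ T z"
   using infinite_cluster_near[where k="T z" and z=z and c=c, OF T(2)] by (auto simp: box_mem)
  let ?a = "nearest ?C z" and ?b = "nearest ?C (z + axis i 1)"
  have two: "(2::real) ^ T z >= 2" using power_increasing[OF T(1)[of z], of "2::real"] by simp
  have "linfnorm (?a - z) <= 2 ^ T z" using nearest(2)[OF ne w(1), of z] w(2) by linarith
  then have a: "?a \<in> box z (2 ^ Suc (T z))" using two by (simp add: box_mem)
  have "linfnorm (?b - (z + axis i 1)) <= linfnorm (w - (z + axis i 1))" by (rule nearest(2)[OF ne w(1)])
  also have "... <= linfnorm (w - z) + linfnorm (z - (z + axis i 1))" by (rule linfnorm_triangle3)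
  also have "... <= 2 ^ T z + 1" using w(2) linfnorm_axis[of i] linfnorm_minus[of z "z + axis i 1"] by simp
  finally have "linfnorm (?b - (z + axis i 1)) <= 2 ^ T z + 1" .
  moreover have "linfnorm (?b - z) <= linfnorm (?b - (z + axis i 1)) + linfnorm ((z + axis i 1) - z)" by (rule linfnorm_triangle3)
  ultimately have "linfnorm (?b - z) <= 2 ^ T z + 2" using linfnorm_axis[of i] by simp
  then have b: "?b \<in> box z (2 ^ Suc (T z))" using two by (simp add: box_mem)
  have "connected_in (box z (2 * 2 ^ Suc (T z))) c ?a ?b"
   by (rule T(2)[of z "Suc (T z)", unfolded well_connected_def, THEN conjunct2, rule_format])
     (use a b nearest(1)[OF ne] clusters_infinity_subset[of c "ereal (2 ^ Suc (T z) / 10)"] in \<open>auto simp del: power_Suc\<close>)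
  then show "connected_in (box z (real (2 ^ (T z + 2)))) c ?a ?b" by simp
 qed
qed

section \<open>Moments of the first good scale\<close>

context field
begin

definition badev :: "nat => ('e, 'v, 'd) config => bool" where
 "badev j \<omega> \<longleftrightarrow> \<not> well_connected (cond \<omega>) 0 j"

lemma badev_pred [measurable]: "Measurable.pred \<Omega> (badev j)"
proof -
 have eq: "badev j = (\<lambda>\<omega>. \<not> ((\<exists>x\<in>box 0 (2 ^ j). x \<in> clusters (cond \<omega>) (ereal (2 ^ j))) \<and>
  (\<forall>x\<in>box 0 (2 ^ j). \<forall>y\<in>box 0 (2 ^ j). x \<in> clusters (cond \<omega>) (ereal (2 ^ j / 10)) --> y \<in> clusters (cond \<omega>) (ereal (2 ^ j / 10)) -->
   connected_in (box 0 (2 * 2 ^ j)) (cond \<omega>) x y)))"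
  unfolding badev_def well_connected_def by (rule ext, unfold ex_in_conv[symmetric] Int_iff Bex_def Ball_def) meson
 show ?thesis unfolding eq by (intro pred_intros_logic pred_intros_finite finite_box pred_intros_conj1' clusters_pred connected_pred)
qed

lemma box_translate: "(\<lambda>v. v + z) ` box x r = box (x + z) r"
proof (rule set_eqI)
 fix y
 have "y \<in> (\<lambda>v. v + z) ` box x r \<longleftrightarrow> y - z \<in> box x r"
  by (metis (no_types, lifting) add_diff_cancel_right' diff_add_cancel image_iff)
 also have "... \<longleftrightarrow> y \<in> box (x + z) r" by (simp add: box_def algebra_simps)
 finally show "y \<in> (\<lambda>v. v + z) ` box x r \<longleftrightarrow> y \<in> box (x + z) r" .
qed

lemma badev_shift: "badev j (shift z \<omega>) \<longleftrightarrow> \<not> well_connected (cond \<omega>) z j"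
proof -
 let ?K = "\<lambda>r x. x \<in> clusters (cond \<omega>) r \<and> x \<in> box z (2 ^ j)"
 have wc: "well_connected c y j \<longleftrightarrow> (\<exists>x. x \<in> clusters c (ereal (2 ^ j)) \<and> x \<in> box y (2 ^ j)) \<and>
  (\<forall>x x'. (x \<in> clusters c (ereal (2 ^ j / 10)) \<and> x \<in> box y (2 ^ j)) -->
   (x' \<in> clusters c (ereal (2 ^ j / 10)) \<and> x' \<in> box y (2 ^ j)) --> connected_in (box y (2 * 2 ^ j)) c x x')" for y c
  unfolding well_connected_def by (auto simp del: times_ereal.simps)
 have mem: "x \<in> box 0 r \<longleftrightarrow> x + z \<in> box z r" for x r by (simp add: box_mem)
 have ex: "(\<exists>x. Q (x + z)) \<longleftrightarrow> (\<exists>x. Q x)" for Q :: "'d vertex => bool"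
  by (metis diff_add_cancel)
 have all: "(\<forall>x y. Q (x + z) (y + z)) \<longleftrightarrow> (\<forall>x y. Q x y)" for Q :: "'d vertex => 'd vertex => bool"
  by (metis diff_add_cancel)
 have "well_connected (cond (shift z \<omega>)) 0 j \<longleftrightarrow>
  (\<exists>x. ?K (ereal (2 ^ j)) (x + z)) \<and>
  (\<forall>x y. ?K (ereal (2 ^ j / 10)) (x + z) --> ?K (ereal (2 ^ j / 10)) (y + z) -->
    connected_in (box z (2 * 2 ^ j)) (cond \<omega>) (x + z) (y + z))"
  unfolding wc cond_shift clusters_translate connected_in_translate box_translate add_0_left by (simp only: mem)
 also have "... \<longleftrightarrow> well_connected (cond \<omega>) z j"
  unfolding ex[of "?K (ereal (2 ^ j))"]
   all[of "\<lambda>x y. ?K (ereal (2 ^ j / 10)) x --> ?K (ereal (2 ^ j / 10)) y --> connected_in (box z (2 * 2 ^ j)) (cond \<omega>) x y"]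
  unfolding wc ..
 finally show ?thesis by (simp add: badev_def)
qed

text \<open>
 \<open>badsum M\<close> dominates the \<open>M\<close>-th power of the first scale at the origin beyond which all scales are
 good; the decay in (S1) is superpolynomial in the scale, so all these moments are finite.
\<close>

definition badsum :: "nat => ('e, 'v, 'd) config => ennreal" where
 "badsum M \<omega> = 1 + (\<Sum>j. ennreal ((2 ^ j) ^ M) * indicator {\<omega>. badev j \<omega>} \<omega>)"

lemma badsum_measurable [measurable]: "badsum M \<in> borel_measurable \<Omega>"
 unfolding badsum_def[abs_def] indicator_def by measurable

text \<open>Sums over the points \<open>z\<close> whose box of radius \<open>2 ^ k\<close> contains
  \<open>v\<close>, for all \<open>k\<close> at once. The weight
  \<open>1 / (2 ^ k) ^ (d + 1)\<close> outweighs their number, of order \<open>(2 ^ k) ^ d\<close>,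
  and keeps the expectation finite.\<close>

definition bigsum :: "nat => 'd vertex => ('e, 'v, 'd) config => ennreal" where
 "bigsum M v \<omega> = (\<Sum>k. ennreal (1 / (2 ^ k) ^ (CARD('d) + 1)) * (\<Sum>z\<in>box v (2 ^ k). badsum M (shift z \<omega>)))"

lemma bigsum_measurable [measurable]: "bigsum M v \<in> borel_measurable \<Omega>"
 unfolding bigsum_def[abs_def]
 by (intro borel_measurable_suminf_order borel_measurable_times_ennreal borel_measurable_const borel_measurable_sum measurable_compose[OF shift_measurable badsum_measurable])

lemma bigsum_shift: "bigsum M v (shift z \<omega>) = bigsum M (v + z) \<omega>"
proof -
 show ?thesis by (simp add: bigsum_def shift_shift sum.reindex box_translate[symmetric])
qed

text \<open>\<open>T z\<close> is the first scale, at least 1, from which all scales are good. If it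
  exceeds 1 the scale before it is bad, so \<open>badsum M\<close> at \<open>z\<close> is at least
  the \<open>M\<close>-th power of \<open>2 ^ (T z - 1)\<close>, of which
  \<open>2 ^ (T z + 2)\<close> is 8 times. Raising the exponent from \<open>L\<close> to
  \<open>L + d + 1\<close> pays for the weights in \<open>bigsum\<close>; the case
  \<open>L = 0\<close> counts the boxes that contain \<open>v\<close>.\<close>

lemma structure_bounds:
 assumes \<omega>: "\<omega> \<in> space \<Omega>" and fin: "\<And>z. badsum 0 (shift z \<omega>) < \<infinity>" "\<And>v. bigsum (CARD('d) + 1) v \<omega> < \<infinity>"
 obtains T where "\<And>z. T z >= 1" "\<And>z j. j >= T z ==> well_connected (cond \<omega>) z j"
  "\<And>v. finite {z. v \<in> box z (2 ^ (T z + 2))}"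
  "\<And>v L F. finite F ==> F \<subseteq> {z. v \<in> box z (2 ^ (T z + 2))} ==>
   (\<Sum>z\<in>F. ennreal ((2 ^ (T z + 2)) ^ L)) <= ennreal (8 ^ (L + CARD('d) + 1)) * bigsum (L + CARD('d) + 1) v \<omega>"
proof -
 let ?d = "CARD('d)"
 have finbad: "finite {j. badev j (shift z \<omega>)}" for z
 proof (rule ccontr)
  assume inf: "infinite {j. badev j (shift z \<omega>)}"
  have "ennreal (real n) <= badsum 0 (shift z \<omega>)" for n
  proof -
   obtain F where F: "F \<subseteq> {j. badev j (shift z \<omega>)}" "finite F" "card F = n"
    using infinite_arbitrarily_large[OF inf] by metis
   have "ennreal (real n) = (\<Sum>j\<in>F. ennreal ((2 ^ j) ^ 0) * indicator {\<omega>. badev j \<omega>} (shift z \<omega>))"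
    using F by (subst sum.cong[OF refl, of _ _ "\<lambda>_. 1"]) (auto simp: ennreal_of_nat_eq_real_of_nat)
   also have "... <= (\<Sum>j. ennreal ((2 ^ j) ^ 0) * indicator {\<omega>. badev j \<omega>} (shift z \<omega>))"
    using F by (intro sum_le_suminf) auto
   also have "... <= badsum 0 (shift z \<omega>)" by (simp add: badsum_def add_increasing)
   finally show ?thesis .
  qed
  then have "badsum 0 (shift z \<omega>) = \<infinity>"
   by (metis ennreal_of_nat_eq_real_of_nat ennreal_Ex_less_of_nat infinity_ennreal_def leD less_top)
  then show False using fin(1)[of z] by simp
 qed
 define T where "T z = (LEAST k. k >= 1 \<and> (\<forall>j\<ge>k. well_connected (cond \<omega>) z j))" for z
 have ex: "\<exists>k. k >= 1 \<and> (\<forall>j\<ge>k. well_connected (cond \<omega>) z j)" for z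
 proof -
  obtain k where k: "\<forall>j\<in>{j. badev j (shift z \<omega>)}. j < k" using finbad[of z] finite_nat_set_iff_bounded by blast
  have "well_connected (cond \<omega>) z j" if "j >= k" for j
  proof (rule ccontr)
   assume "\<not> well_connected (cond \<omega>) z j"
   then have "j \<in> {j. badev j (shift z \<omega>)}" by (simp add: badev_shift)
   then show False using k that by fastforce
  qed
  then show ?thesis by (intro exI[of _ "max 1 k"]) auto
 qed
 have T: "T z >= 1 \<and> (\<forall>j\<ge>T z. well_connected (cond \<omega>) z j)" for z
  unfolding T_def by (rule LeastI_ex[OF ex])
 have T_le: "T z <= k" if "k >= 1" "\<And>j. j >= k ==> well_connected (cond \<omega>) z j" for z k
  unfolding T_def using that by (intro Least_le) simp
 have T_bad: "badev (T z - 1) (shift z \<omega>)" if "T z ~= 1" for z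
 proof (rule ccontr)
  assume "\<not> badev (T z - 1) (shift z \<omega>)"
  then have w: "well_connected (cond \<omega>) z (T z - 1)" by (simp add: badev_shift)
  have "well_connected (cond \<omega>) z j" if j: "j >= T z - 1" for j
  proof (cases "j = T z - 1")
   case True
   then show ?thesis using w by simp
  next
   case False
   then show ?thesis using T[of z] j by simp
  qed
  moreover have "T z - 1 >= 1" using T[of z, THEN conjunct1] that by linarith
  ultimately have "T z <= T z - 1" by (intro T_le)
  then show False using T[of z, THEN conjunct1] by simp
 qed
 have pow_le: "ennreal ((2 ^ (T z + 2)) ^ M) <= ennreal (8 ^ M) * badsum M (shift z \<omega>)" for z M
 proof (cases "T z = 1")
  case True
  have "ennreal ((2 ^ (T z + 2)) ^ M) = ennreal (8 ^ M) * 1" using True by simp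
  also have "... <= ennreal (8 ^ M) * badsum M (shift z \<omega>)" by (intro mult_left_mono) (auto simp: badsum_def)
  finally show ?thesis .
 next
  case False
  then obtain t where t: "T z = Suc t" using T[of z] by (cases "T z") auto
  have "ennreal ((2 ^ t) ^ M) = ennreal ((2 ^ t) ^ M) * indicator {\<omega>. badev t \<omega>} (shift z \<omega>)"
   using T_bad[OF False] t by simp
  also have "... = (\<Sum>j\<in>{t}. ennreal ((2 ^ j) ^ M) * indicator {\<omega>. badev j \<omega>} (shift z \<omega>))"
   by (simp only: sum.insert[OF finite.emptyI] sum.empty empty_iff not_False_eq_True add_0_right)
  also have "... <= (\<Sum>j. ennreal ((2 ^ j) ^ M) * indicator {\<omega>. badev j \<omega>} (shift z \<omega>))"
   by (rule sum_le_suminf) simp_all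
  also have "... <= badsum M (shift z \<omega>)" by (simp add: badsum_def add_increasing)
  finally have 1: "ennreal ((2 ^ t) ^ M) <= badsum M (shift z \<omega>)" .
  have "(2::real) ^ (T z + 2) = 8 * 2 ^ t" by (simp add: t)
  then have "((2::real) ^ (T z + 2)) ^ M = 8 ^ M * (2 ^ t) ^ M" by (simp only: power_mult_distrib)
  then have "ennreal ((2 ^ (T z + 2)) ^ M) = ennreal (8 ^ M) * ennreal ((2 ^ t) ^ M)" by (simp only:) (rule ennreal_mult; simp)
  also have "... <= ennreal (8 ^ M) * badsum M (shift z \<omega>)" using 1 by (intro mult_left_mono) auto
  finally show ?thesis .
 qed
 have main: "(\<Sum>z\<in>F. ennreal ((2 ^ (T z + 2)) ^ L)) <= ennreal (8 ^ (L + ?d + 1)) * bigsum (L + ?d + 1) v \<omega>"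
  if F: "finite F" "F \<subseteq> {z. v \<in> box z (2 ^ (T z + 2))}" for v L F
 proof -
  let ?M = "L + ?d + 1"
  have pw: "x ^ L = 1 / x ^ (?d + 1) * x ^ ?M" if "x ~= 0" for x :: real using that by (simp add: power_add)
  define A where "A k z = ennreal (1 / (2 ^ k) ^ (?d + 1)) * badsum ?M (shift z \<omega>)" for k z
  have "ennreal ((2 ^ (T z + 2)) ^ L) <= ennreal (8 ^ ?M) * A (T z + 2) z" for z
  proof -
   have "((2::real) ^ (T z + 2)) ^ L = 1 / (2 ^ (T z + 2)) ^ (?d + 1) * (2 ^ (T z + 2)) ^ ?M" by (rule pw) simp
   then have "ennreal ((2 ^ (T z + 2)) ^ L) = ennreal (1 / (2 ^ (T z + 2)) ^ (?d + 1)) * ennreal ((2 ^ (T z + 2)) ^ ?M)"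
    by (simp only:) (intro ennreal_mult; simp)
   also have "... <= ennreal (1 / (2 ^ (T z + 2)) ^ (?d + 1)) * (ennreal (8 ^ ?M) * badsum ?M (shift z \<omega>))"
    by (intro mult_left_mono pow_le) simp
   also have "... = ennreal (8 ^ ?M) * A (T z + 2) z" by (simp only: A_def mult_ac)
   finally show ?thesis .
  qed
  then have "(\<Sum>z\<in>F. ennreal ((2 ^ (T z + 2)) ^ L)) <= (\<Sum>z\<in>F. ennreal (8 ^ ?M) * A (T z + 2) z)"
   by (intro sum_mono)
  also have "... = ennreal (8 ^ ?M) * (\<Sum>z\<in>F. A (T z + 2) z)" by (simp add: sum_distrib_left)
  also have "(\<Sum>z\<in>F. A (T z + 2) z) <= bigsum ?M v \<omega>"
  proof -
   define K where "K = (\<lambda>z. T z + 2) ` F"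
   have finK: "finite K" using F by (simp add: K_def)
   have "(\<Sum>z\<in>F. A (T z + 2) z) = (\<Sum>k\<in>K. \<Sum>z\<in>{z \<in> F. T z + 2 = k}. A (T z + 2) z)"
    unfolding K_def using F by (intro sum.image_gen)
   also have "... <= (\<Sum>k\<in>K. \<Sum>z\<in>box v (2 ^ k). A k z)"
   proof (rule sum_mono)
    fix k
    have "(\<Sum>z\<in>{z \<in> F. T z + 2 = k}. A (T z + 2) z) = (\<Sum>z\<in>{z \<in> F. T z + 2 = k}. A k z)" by (intro sum.cong) auto
    also have "... <= (\<Sum>z\<in>box v (2 ^ k). A k z)"
     using F(2) by (intro sum_mono2) (auto simp: box_mem_sym[of v])
    finally show "(\<Sum>z\<in>{z \<in> F. T z + 2 = k}. A (T z + 2) z) <= (\<Sum>z\<in>box v (2 ^ k). A k z)" .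
   qed
   also have "... <= (\<Sum>k. \<Sum>z\<in>box v (2 ^ k). A k z)" using finK by (intro sum_le_suminf) auto
   also have "... = bigsum ?M v \<omega>" unfolding bigsum_def A_def by (simp only: sum_distrib_left)
   finally show ?thesis .
  qed
  finally show ?thesis by (simp add: mult_left_mono)
 qed
 have fin_v: "finite {z. v \<in> box z (2 ^ (T z + 2))}" for v
 proof (rule ccontr)
  assume inf: "infinite {z. v \<in> box z (2 ^ (T z + 2))}"
  let ?B = "ennreal (8 ^ (0 + ?d + 1)) * bigsum (0 + ?d + 1) v \<omega>"
  have "of_nat n <= ?B" for n
  proof -
   obtain F where F: "F \<subseteq> {z. v \<in> box z (2 ^ (T z + 2))}" "finite F" "card F = n"
    using infinite_arbitrarily_large[OF inf] by metis
   then show ?thesis using main[of F v 0] by simp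
  qed
  moreover have "?B < \<infinity>" using fin(2)[of v] by (simp add: ennreal_mult_less_top)
  ultimately show False by (metis ennreal_Ex_less_of_nat infinity_ennreal_def leD)
 qed
 show ?thesis using T fin_v main by (intro that[of T]) blast+
qed

end

lemma powr_le_one_plus:
 fixes x :: real
 assumes "0 <= x" "0 < a" "a <= b" shows "x powr a <= 1 + x powr b"
proof (cases "x <= 1")
 case True
 then have "x powr a <= 1" using assms by (intro powr_le1) auto
 moreover have "x powr b >= 0" by simp
 ultimately show ?thesis by linarith
next
 case False
 then have "x powr a <= x powr b" using assms by (intro powr_mono) auto
 then show ?thesis by simp
qed

text \<open>Passes from the conditioned measure to an integral over \<open>C\<close>, and from
  \<open>q\<close>, possibly infinite, to a finite exponent below it.\<close>

lemma finite_moment_lower: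
 assumes M: "prob_space M" and C: "C \<in> sets M" "measure M C > 0" and f [measurable]: "f \<in> borel_measurable M" and f0: "\<And>x. x \<in> space M ==> f x >= 0"
  and fm: "finite_moment (uniform_measure M C) q f (\<lambda>_. 1)" and q0: "0 < q0" "ereal q0 <= q"
 shows "(\<integral>\<^sup>+x. indicator C x * ennreal (f x powr q0) \<partial>M) < \<infinity>"
proof -
 interpret prob_space M by (rule M)
 have eC: "emeasure M C ~= 0" "emeasure M C ~= \<infinity>" using C(2) by (auto simp: emeasure_eq_measure)
 interpret U: prob_space "uniform_measure M C" using eC by (rule prob_space_uniform_measure)
 have U1: "emeasure (uniform_measure M C) (space M) = 1" using U.emeasure_space_1 by simp
 have fU [measurable]: "f \<in> borel_measurable (uniform_measure M C)" by simp
 have fin: "(\<integral>\<^sup>+x. ennreal (f x powr q0) \<partial>uniform_measure M C) < \<infinity>"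
 proof (cases "q = \<infinity>")
  case True
  define K where "K = real_of_ereal (max 0 (esssup (uniform_measure M C) (\<lambda>x. ereal (f x))))"
  have top: "esssup (uniform_measure M C) (\<lambda>x. ereal (f x)) < \<infinity>" using fm True by (simp add: finite_moment_def)
  have "AE x in uniform_measure M C. ereal (f x) <= esssup (uniform_measure M C) (\<lambda>x. ereal (f x))"
   by (rule esssup_AE)
  then have "AE x in uniform_measure M C. ennreal (f x powr q0) <= ennreal (K powr q0)"
  proof (rule AE_mp, intro AE_I2 impI)
   fix x assume x: "x \<in> space (uniform_measure M C)" and *: "ereal (f x) <= esssup (uniform_measure M C) (\<lambda>x. ereal (f x))"
   have "f x <= K" using * top f0[of x] x unfolding K_def
    by (cases "esssup (uniform_measure M C) (\<lambda>x. ereal (f x))") (auto simp: max_def)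
   then show "ennreal (f x powr q0) <= ennreal (K powr q0)" using f0[of x] x q0 by (intro ennreal_leI powr_mono2) auto
  qed
  then have "(\<integral>\<^sup>+x. ennreal (f x powr q0) \<partial>uniform_measure M C) <= (\<integral>\<^sup>+x. ennreal (K powr q0) \<partial>uniform_measure M C)"
   by (rule nn_integral_mono_AE)
  also have "... < \<infinity>" by (simp add: U1)
  finally show ?thesis .
 next
  case False
  then obtain r where r: "q = ereal r" using q0 by (cases q) auto
  have "(\<integral>\<^sup>+x. ennreal (f x powr q0) \<partial>uniform_measure M C) <= (\<integral>\<^sup>+x. 1 + ennreal (f x powr r) \<partial>uniform_measure M C)"
  proof (rule nn_integral_mono)
   fix x assume "x \<in> space (uniform_measure M C)"
   then have "f x powr q0 <= 1 + f x powr r" using q0 r f0[of x] by (intro powr_le_one_plus) auto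
   then show "ennreal (f x powr q0) <= 1 + ennreal (f x powr r)"
    by (metis ennreal_1 ennreal_leI ennreal_plus powr_ge_zero zero_le_one)
  qed
  also have "... = 1 + (\<integral>\<^sup>+x. ennreal (f x powr r) \<partial>uniform_measure M C)"
   by (subst nn_integral_add) (auto simp: U1)
  also have "... < \<infinity>" using fm r by (simp add: finite_moment_def)
  finally show ?thesis .
 qed
 have "(\<integral>\<^sup>+x. ennreal (f x powr q0) \<partial>uniform_measure M C) = (\<integral>\<^sup>+x. ennreal (f x powr q0) * indicator C x \<partial>M) / emeasure M C"
  using C(1) by (intro nn_integral_uniform_measure) auto
 then have "(\<integral>\<^sup>+x. ennreal (f x powr q0) * indicator C x \<partial>M) ~= \<infinity>"
  using fin eC by (auto simp: ennreal_top_divide)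
 then show ?thesis by (simp add: mult.commute less_top)
qed

context field_prob
begin

lemma infinite_shift: "0 \<in> clusters (cond (shift y \<omega>)) r \<longleftrightarrow> y \<in> clusters (cond \<omega>) r"
 by (simp add: cond_shift clusters_translate)

text \<open>\<open>spatial_average\<close> for the variable set to zero off the event that 0 lies in
  the infinite cluster; its shift by \<open>y\<close> tests whether \<open>y\<close> does.\<close>

lemma cluster_average:
 assumes G [measurable]: "G \<in> borel_measurable \<Omega>" and G0: "\<And>\<omega>. G \<omega> >= (0::real)"
  and fin: "(\<integral>\<^sup>+\<omega>. indicator {\<omega> \<in> space \<mu>. 0 \<in> clusters (cond \<omega>) \<infinity>} \<omega> * ennreal (G \<omega>) \<partial>\<mu>) < \<infinity>"
 shows "\<exists>m>0. AE \<omega> in \<mu>. \<forall>x. \<exists>R\<^sub>0. \<forall>R\<ge>R\<^sub>0. (\<Sum>y\<in>box x R \<inter> clusters (cond \<omega>) \<infinity>. G (shift y \<omega>)) <= m * R ^ CARD('d)"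
proof -
 define g where "g \<omega> = (if 0 \<in> clusters (cond \<omega>) \<infinity> then ennreal (G \<omega>) else 0)" for \<omega>
 have [measurable]: "g \<in> borel_measurable \<Omega>" unfolding g_def[abs_def] by measurable
 have "(\<integral>\<^sup>+\<omega>. g \<omega> \<partial>\<mu>) = (\<integral>\<^sup>+\<omega>. indicator {\<omega> \<in> space \<mu>. 0 \<in> clusters (cond \<omega>) \<infinity>} \<omega> * ennreal (G \<omega>) \<partial>\<mu>)"
  by (intro nn_integral_cong) (auto simp: g_def)
 then have "(\<integral>\<^sup>+\<omega>. g \<omega> \<partial>\<mu>) < \<infinity>" using fin by simp
 then obtain m where m: "m > 0" and ae: "AE \<omega> in \<mu>. \<forall>x. \<exists>R\<^sub>0. \<forall>R\<ge>R\<^sub>0. boxsum g x R \<omega> <= ennreal (m * R ^ CARD('d))"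
  using spatial_average[of g] by auto
 have "AE \<omega> in \<mu>. \<forall>x. \<exists>R\<^sub>0. \<forall>R\<ge>R\<^sub>0. (\<Sum>y\<in>box x R \<inter> clusters (cond \<omega>) \<infinity>. G (shift y \<omega>)) <= m * R ^ CARD('d)"
 proof (rule AE_mp[OF ae], intro AE_I2 impI allI)
  fix \<omega> x assume *: "\<forall>x. \<exists>R\<^sub>0. \<forall>R\<ge>R\<^sub>0. boxsum g x R \<omega> <= ennreal (m * R ^ CARD('d))"
  obtain R0 where R0: "\<And>R. R >= R0 ==> boxsum g x R \<omega> <= ennreal (m * R ^ CARD('d))" using *[rule_format, of x] by blast
  show "\<exists>R\<^sub>0. \<forall>R\<ge>R\<^sub>0. (\<Sum>y\<in>box x R \<inter> clusters (cond \<omega>) \<infinity>. G (shift y \<omega>)) <= m * R ^ CARD('d)"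
  proof (intro exI[of _ "max 0 R0"] allI impI)
   fix R assume R: "max 0 R0 <= R"
   have "ennreal (\<Sum>y\<in>box x R \<inter> clusters (cond \<omega>) \<infinity>. G (shift y \<omega>)) = (\<Sum>y\<in>box x R \<inter> clusters (cond \<omega>) \<infinity>. g (shift y \<omega>))"
    by (subst sum_ennreal[symmetric]) (auto simp: g_def infinite_shift G0 intro!: sum.cong)
   also have "... <= boxsum g x R \<omega>" unfolding boxsum_def by (intro sum_mono2 finite_box) auto
   also have "... <= ennreal (m * R ^ CARD('d))" using R by (intro R0) auto
   finally show "(\<Sum>y\<in>box x R \<inter> clusters (cond \<omega>) \<infinity>. G (shift y \<omega>)) <= m * R ^ CARD('d)"
    using R m by (subst (asm) ennreal_le_iff) auto
  qed
 qed
 then show ?thesis using m by blast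
qed

lemma badev_prob:
 assumes R: "R = 2 ^ j"
  and a: "prob {\<omega> \<in> space \<mu>. clusters (cond \<omega>) (ereal (real R)) \<inter> box 0 (real R) ~= {}} >= 1 - e"
  and b: "prob {\<omega> \<in> space \<mu>. \<forall>x \<in> clusters (cond \<omega>) (ereal (real R / 10)) \<inter> box 0 (real R).
        \<forall>y \<in> clusters (cond \<omega>) (ereal (real R / 10)) \<inter> box 0 (real R). connected_in (box 0 (2 * real R)) (cond \<omega>) x y} >= 1 - e"
 shows "prob {\<omega> \<in> space \<mu>. badev j \<omega>} <= 2 * e"
proof -
 let ?A = "{\<omega> \<in> space \<mu>. clusters (cond \<omega>) (ereal (real R)) \<inter> box 0 (real R) ~= {}}"
 let ?B = "{\<omega> \<in> space \<mu>. \<forall>x \<in> clusters (cond \<omega>) (ereal (real R / 10)) \<inter> box 0 (real R).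
        \<forall>y \<in> clusters (cond \<omega>) (ereal (real R / 10)) \<inter> box 0 (real R). connected_in (box 0 (2 * real R)) (cond \<omega>) x y}"
 have eqA: "?A = {\<omega> \<in> space \<mu>. \<exists>x\<in>box 0 (real R). x \<in> clusters (cond \<omega>) (ereal (real R))}" by blast
 have eqB: "?B = {\<omega> \<in> space \<mu>. \<forall>x\<in>box 0 (real R). \<forall>y\<in>box 0 (real R). x \<in> clusters (cond \<omega>) (ereal (real R / 10)) -->
  y \<in> clusters (cond \<omega>) (ereal (real R / 10)) --> connected_in (box 0 (2 * real R)) (cond \<omega>) x y}" by blast
 have [measurable]: "Measurable.pred \<Omega> (\<lambda>\<omega>. x \<in> clusters (cond \<omega>) r)" "Measurable.pred \<Omega> (\<lambda>\<omega>. connected_in B (cond \<omega>) x y)" for x y r B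
  by (rule clusters_pred connected_pred)+
 have pA: "Measurable.pred \<Omega> (\<lambda>\<omega>. \<exists>x\<in>box 0 (real R). x \<in> clusters (cond \<omega>) (ereal (real R)))"
  by (intro pred_intros_finite finite_box clusters_pred)
 have A: "?A \<in> events" unfolding eqA using pA by (simp add: pred_def space_\<mu> sets_\<mu>)
 have pB: "Measurable.pred \<Omega> (\<lambda>\<omega>. \<forall>x\<in>box 0 (real R). \<forall>y\<in>box 0 (real R). x \<in> clusters (cond \<omega>) (ereal (real R / 10)) -->
  y \<in> clusters (cond \<omega>) (ereal (real R / 10)) --> connected_in (box 0 (2 * real R)) (cond \<omega>) x y)"
  by (intro pred_intros_finite pred_intros_logic finite_box clusters_pred connected_pred)
 have B: "?B \<in> events" unfolding eqB using pB by (simp add: pred_def space_\<mu> sets_\<mu>)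
 have "{\<omega> \<in> space \<mu>. badev j \<omega>} \<subseteq> (space \<mu> - ?A) \<union> (space \<mu> - ?B)"
  unfolding badev_def well_connected_def R of_nat_power of_nat_numeral by blast
 then have "prob {\<omega> \<in> space \<mu>. badev j \<omega>} <= prob ((space \<mu> - ?A) \<union> (space \<mu> - ?B))"
  using A B by (intro finite_measure_mono) auto
 also have "... <= prob (space \<mu> - ?A) + prob (space \<mu> - ?B)" using A B by (intro measure_subadditive) (auto simp: emeasure_eq_measure)
 also have "... <= 2 * e" using a b prob_compl[OF A] prob_compl[OF B] by linarith
 finally show ?thesis .
qed

end

section \<open>Weighted averages over the infinite cluster\<close>

locale percolating = field_prob ME MV N a \<theta> \<mu>
 for ME :: "'e measure" and MV :: "'v measure" and N :: "'d::finite region"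
  and a :: "('e, 'v, 'd) config \<times> ('e, 'v, 'd) config \<times> 'e => real"
  and \<theta> :: "('e, 'v, 'd) config => real" and \<mu> :: "('e, 'v, 'd) config measure" +
 fixes F :: "nat => real" and \<Delta> R\<^sub>S :: real
 assumes \<Delta>: "\<Delta> > 0"
  and F: "\<And>R. R >= 1 ==> real R >= R\<^sub>S ==> F R >= (ln (real R)) powr (1 + \<Delta>)"
  and S1a: "\<And>R. R >= 1 ==> prob {\<omega> \<in> space \<mu>. clusters (cond \<omega>) (ereal (real R)) \<inter> box 0 (real R) ~= {}} >= 1 - exp (- F R)"
  and S1b: "\<And>R. R >= 1 ==> prob {\<omega> \<in> space \<mu>. \<forall>x \<in> clusters (cond \<omega>) (ereal (real R / 10)) \<inter> box 0 (real R).
        \<forall>y \<in> clusters (cond \<omega>) (ereal (real R / 10)) \<inter> box 0 (real R). connected_in (box 0 (2 * real R)) (cond \<omega>) x y} >= 1 - exp (- F R)"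
begin

text \<open>The lower bound \<open>(j * ln 2) powr (1 + \<Delta>)\<close> for the exponent in (S1)
  eventually exceeds every multiple of \<open>j * ln 2\<close>, so bad scales are less likely than
  any power of \<open>1 / 2 ^ j\<close>.\<close>

lemma badev_summable: "summable (\<lambda>j. (2 ^ j) ^ M * prob {\<omega> \<in> space \<mu>. badev j \<omega>})"
proof (rule summable_comparison_test_ev)
 have "filterlim (\<lambda>j. (real j * ln 2) powr \<Delta>) at_top sequentially" using \<Delta> by real_asymp
 then have 1: "eventually (\<lambda>j. (real j * ln 2) powr \<Delta> >= real M + 1) sequentially" by (simp add: filterlim_at_top)
 have "filterlim (\<lambda>j. (2::real) ^ j) at_top sequentially" by real_asymp
 then have 2: "eventually (\<lambda>j. (2::real) ^ j >= R\<^sub>S) sequentially" by (simp add: filterlim_at_top)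
 show "eventually (\<lambda>j. norm ((2 ^ j) ^ M * prob {\<omega> \<in> space \<mu>. badev j \<omega>}) <= 2 * (1 / 2) ^ j) sequentially"
  using 1 2 eventually_gt_at_top[of 0]
 proof eventually_elim
  case (elim j)
  let ?L = "real j * ln 2"
  have L: "?L > 0" using elim by simp
  have "(real M + 1) * ?L <= ?L powr \<Delta> * ?L" using elim L by (intro mult_right_mono) auto
  also have "... = ?L powr (1 + \<Delta>)" using L by (simp add: powr_add)
  also have "... <= F (2 ^ j)" using F[of "2 ^ j"] elim by (simp add: ln_realpow)
  finally have le: "(real M + 1) * ?L <= F (2 ^ j)" .
  have "prob {\<omega> \<in> space \<mu>. badev j \<omega>} <= 2 * exp (- F (2 ^ j))"
   by (rule badev_prob[OF refl S1a S1b]) auto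
  also have "... <= 2 * exp (- ((real M + 1) * ?L))" using le by simp
  also have "exp (- ((real M + 1) * ?L)) = inverse ((2 ^ j) ^ M) * (1 / 2) ^ j"
  proof -
   have e: "exp ?L = 2 ^ j" by (simp add: exp_of_nat_mult)
   have "(real M + 1) * ?L = of_nat (Suc M) * ?L" by simp
   then have "exp (- ((real M + 1) * ?L)) = inverse (exp (of_nat (Suc M) * ?L))" by (simp only: exp_minus)
   also have "exp (of_nat (Suc M) * ?L) = (2 ^ j) ^ Suc M" unfolding exp_of_nat_mult[of "Suc M"] e ..
   finally show ?thesis by (simp add: power_one_over field_simps)
  qed
  finally have "(2 ^ j) ^ M * prob {\<omega> \<in> space \<mu>. badev j \<omega>} <= (2 ^ j) ^ M * (2 * (inverse ((2 ^ j) ^ M) * (1 / 2) ^ j))"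
   by (intro mult_left_mono) auto
  also have "... = 2 * (1 / 2) ^ j" by simp
  finally show ?case by (simp only: real_norm_def abs_of_nonneg[OF mult_nonneg_nonneg] measure_nonneg zero_le_power zero_le_numeral)
 qed
 show "summable (\<lambda>j. 2 * (1 / 2) ^ j :: real)" by (intro summable_mult summable_geometric) simp
qed

lemma badev_event: "{\<omega> \<in> space \<mu>. badev j \<omega>} \<in> events"
 using badev_pred[of j] by (simp add: pred_def space_\<mu> sets_\<mu>)

lemma badsum_finite: "(\<integral>\<^sup>+\<omega>. badsum M \<omega> \<partial>\<mu>) < \<infinity>"
proof -
 have [measurable]: "Measurable.pred \<mu> (badev j)" for j using badev_event by (simp add: pred_def)
 have "(\<integral>\<^sup>+\<omega>. badsum M \<omega> \<partial>\<mu>) = 1 + (\<Sum>j. \<integral>\<^sup>+\<omega>. ennreal ((2 ^ j) ^ M) * indicator {\<omega>. badev j \<omega>} \<omega> \<partial>\<mu>)"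
  unfolding badsum_def by (subst nn_integral_add; (subst nn_integral_suminf)?; simp add: emeasure_space_1)
 also have "(\<lambda>j. \<integral>\<^sup>+\<omega>. ennreal ((2 ^ j) ^ M) * indicator {\<omega>. badev j \<omega>} \<omega> \<partial>\<mu>) = (\<lambda>j. ennreal ((2 ^ j) ^ M * prob {\<omega> \<in> space \<mu>. badev j \<omega>}))"
 proof (rule ext)
  fix j
  have "(\<integral>\<^sup>+\<omega>. ennreal ((2 ^ j) ^ M) * indicator {\<omega>. badev j \<omega>} \<omega> \<partial>\<mu>) = (\<integral>\<^sup>+\<omega>. ennreal ((2 ^ j) ^ M) * indicator {\<omega> \<in> space \<mu>. badev j \<omega>} \<omega> \<partial>\<mu>)"
   by (intro nn_integral_cong) (auto simp: indicator_def)
  also have "... = ennreal ((2 ^ j) ^ M) * emeasure \<mu> {\<omega> \<in> space \<mu>. badev j \<omega>}"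
   by (rule nn_integral_cmult_indicator[OF badev_event])
  also have "... = ennreal ((2 ^ j) ^ M * prob {\<omega> \<in> space \<mu>. badev j \<omega>})"
   by (simp add: emeasure_eq_measure ennreal_mult)
  finally show "(\<integral>\<^sup>+\<omega>. ennreal ((2 ^ j) ^ M) * indicator {\<omega>. badev j \<omega>} \<omega> \<partial>\<mu>) = ennreal ((2 ^ j) ^ M * prob {\<omega> \<in> space \<mu>. badev j \<omega>})" .
 qed
 also have "(\<Sum>j. ennreal ((2 ^ j) ^ M * prob {\<omega> \<in> space \<mu>. badev j \<omega>})) = ennreal (\<Sum>j. (2 ^ j) ^ M * prob {\<omega> \<in> space \<mu>. badev j \<omega>})"
  using badev_summable by (intro suminf_ennreal2) auto
 finally show ?thesis by simp
qed

lemma bigsum_finite: "(\<integral>\<^sup>+\<omega>. bigsum M v \<omega> \<partial>\<mu>) < \<infinity>"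
proof -
 define E where "E = (\<integral>\<^sup>+\<omega>. badsum M \<omega> \<partial>\<mu>)"
 have m1: "(\<lambda>\<omega>. badsum M (shift z \<omega>)) \<in> borel_measurable \<mu>" for z
  unfolding meas_\<mu> by (rule measurable_compose[OF shift_measurable badsum_measurable])
 have "(\<integral>\<^sup>+\<omega>. bigsum M v \<omega> \<partial>\<mu>) = (\<Sum>k. ennreal (1 / (2 ^ k) ^ (CARD('d) + 1)) * (\<Sum>z\<in>box v (2 ^ k). \<integral>\<^sup>+\<omega>. badsum M (shift z \<omega>) \<partial>\<mu>))"
  unfolding bigsum_def using m1 by (simp add: nn_integral_suminf nn_integral_cmult nn_integral_sum)
 also have "... = (\<Sum>k. ennreal (1 / (2 ^ k) ^ (CARD('d) + 1)) * (of_nat (card (box v (2 ^ k) :: 'd vertex set)) * E))"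
  unfolding nn_integral_shift[OF badsum_measurable] E_def by simp
 also have "... <= (\<Sum>k. ennreal (3 ^ CARD('d) * (1 / 2) ^ k) * E)"
 proof (intro suminf_le summableI)
  fix k
  have "real (card (box v (2 ^ k))) <= (2 * 2 ^ k + 1) ^ CARD('d)" by (rule card_box_le) simp
  also have "... <= (3 * 2 ^ k) ^ CARD('d)" by (intro power_mono) (simp_all add: one_le_power)
  finally have "1 / (2 ^ k) ^ (CARD('d) + 1) * real (card (box v (2 ^ k))) <= 1 / (2 ^ k) ^ (CARD('d) + 1) * (3 * 2 ^ k) ^ CARD('d)"
   by (intro mult_left_mono) auto
  also have "... = 3 ^ CARD('d) * (1 / 2) ^ k" by (simp add: power_mult_distrib power_one_over)
  finally have "ennreal (1 / (2 ^ k) ^ (CARD('d) + 1)) * ennreal (real (card (box v (2 ^ k)))) <= ennreal (3 ^ CARD('d) * (1 / 2) ^ k)"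
   by (subst ennreal_mult[symmetric]) (auto intro: ennreal_leI)
  then show "ennreal (1 / (2 ^ k) ^ (CARD('d) + 1)) * (of_nat (card (box v (2 ^ k))) * E) <= ennreal (3 ^ CARD('d) * (1 / 2) ^ k) * E"
   by (simp add: mult.assoc[symmetric] ennreal_of_nat_eq_real_of_nat mult_right_mono)
 qed
 also have "... = (\<Sum>k. ennreal (3 ^ CARD('d) * (1 / 2) ^ k)) * E" by simp
 also have "(\<Sum>k. ennreal (3 ^ CARD('d) * (1 / 2) ^ k)) = ennreal (\<Sum>k. 3 ^ CARD('d) * (1 / 2) ^ k)"
  by (intro suminf_ennreal2 summable_mult summable_geometric) auto
 also have "ennreal (\<Sum>k. 3 ^ CARD('d) * (1 / 2) ^ k) * E < \<infinity>"
  using badsum_finite[of M] by (simp add: E_def ennreal_mult_less_top)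
 finally show ?thesis .
qed

lemma AE_structure_finite: "AE \<omega> in \<mu>. (\<forall>z. badsum 0 (shift z \<omega>) < \<infinity>) \<and> (\<forall>v. bigsum (CARD('d) + 1) v \<omega> < \<infinity>)"
proof -
 have 1: "AE \<omega> in \<mu>. badsum 0 (shift z \<omega>) ~= \<infinity>" for z
  using badsum_finite[of 0] nn_integral_shift[OF badsum_measurable, of 0 z]
  by (intro nn_integral_noteq_infinite) (auto simp: meas_\<mu> intro!: measurable_compose[OF shift_measurable badsum_measurable])
 have 2: "AE \<omega> in \<mu>. bigsum (CARD('d) + 1) v \<omega> ~= \<infinity>" for v
  using bigsum_finite[of "CARD('d) + 1" v] by (intro nn_integral_noteq_infinite) (auto simp: meas_\<mu>)
 show ?thesis using 1 2 by (auto simp: AE_all_countable less_top)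
qed

text \<open>All powers of \<open>\<kappa>\<close> have bounded averages. As
  \<open>q\<^sub>0 * p > 1\<close>, an inequality of Young type separates the weight
  \<open>(\<kappa>\<^sup>2 * nu) powr (1 / p)\<close> into a high power of \<open>\<kappa>\<close>
  and \<open>nu powr q\<^sub>0\<close>, which are averaged separately. Exponents and constants are
  fixed before \<omega>, so that \<open>M\<close> is deterministic.\<close>

theorem good_env:
 assumes pq: "0 < p" "0 < q\<^sub>0" "q\<^sub>0 * p > 1"
  and nu_int: "(\<integral>\<^sup>+\<omega>. indicator {\<omega> \<in> space \<mu>. 0 \<in> clusters (cond \<omega>) \<infinity>} \<omega> * ennreal (nu (cond \<omega>) 0 powr q\<^sub>0) \<partial>\<mu>) < \<infinity>"
  and s_int: "(\<integral>\<^sup>+\<omega>. indicator {\<omega> \<in> space \<mu>. 0 \<in> clusters (cond \<omega>) \<infinity>} \<omega> * ennreal (spd \<omega> 0 powr (1 / r)) \<partial>\<mu>) < \<infinity>"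
  and inv_int: "(\<integral>\<^sup>+\<omega>. indicator {\<omega> \<in> space \<mu>. 0 \<in> clusters (cond \<omega>) \<infinity>} \<omega> * ennreal (inverse (spd \<omega> 0) powr 1) \<partial>\<mu>) < \<infinity>"
 shows "\<exists>M\<ge>1. AE \<omega> in \<mu>. \<exists>\<phi> \<rho>. good_cluster (cond \<omega>) (spd \<omega>) (clusters (cond \<omega>) \<infinity>) \<phi> \<rho> \<and>
  (\<forall>x. \<exists>R\<^sub>0. \<forall>R\<ge>R\<^sub>0. box_averages (cond \<omega>) (spd \<omega>) (clusters (cond \<omega>) \<infinity>) (good_cluster.\<kappa> \<rho>) p r M x R \<and>
   (\<Sum>v\<in>box x R \<inter> clusters (cond \<omega>) \<infinity>. inverse (spd \<omega> v) powr 1) <= M * R powr real CARD('d))"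
proof -
 let ?d = "CARD('d)"
 define \<theta>' where "\<theta>' = q\<^sub>0 * p - 1"
 have \<theta>': "\<theta>' > 0" using pq by (simp add: \<theta>'_def)
 \<comment> \<open>High enough that \<open>A * B <= \<kappa> v ^ m\<close> whenever
   \<open>B <= A powr (1 / \<theta>')\<close>, in the notation of \<open>young\<close>.\<close>
 define m where "m = nat \<lceil>2 / p * (1 + 1 / \<theta>')\<rceil>"
 have m: "2 / p * (1 + 1 / \<theta>') <= real m" unfolding m_def by linarith
 define L where "L = 2 * ?d * m"
 define C1 where "C1 = 9 ^ (?d * m) * 8 ^ (L + ?d + 1 :: nat) + (0::real)"
 have C1: "C1 > 0" by (simp add: C1_def)
 obtain m1 where m1: "m1 > 0" "AE \<omega> in \<mu>. \<forall>x. \<exists>R\<^sub>0. \<forall>R\<ge>R\<^sub>0. boxsum (bigsum (L + ?d + 1) 0) x R \<omega> <= ennreal (m1 * R ^ ?d)"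
  using spatial_average[OF bigsum_measurable bigsum_finite] by blast
 obtain m2 where m2: "m2 > 0" "AE \<omega> in \<mu>. \<forall>x. \<exists>R\<^sub>0. \<forall>R\<ge>R\<^sub>0. (\<Sum>y\<in>box x R \<inter> clusters (cond \<omega>) \<infinity>. nu (cond (shift y \<omega>)) 0 powr q\<^sub>0) <= m2 * R ^ ?d"
  using cluster_average[OF _ _ nu_int] by (auto simp: mult_ac)
 obtain m3 where m3: "m3 > 0" "AE \<omega> in \<mu>. \<forall>x. \<exists>R\<^sub>0. \<forall>R\<ge>R\<^sub>0. (\<Sum>y\<in>box x R \<inter> clusters (cond \<omega>) \<infinity>. spd (shift y \<omega>) 0 powr (1 / r)) <= m3 * R ^ ?d"
  using cluster_average[OF _ _ s_int] by (auto simp: mult_ac)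
 obtain m4 where m4: "m4 > 0" "AE \<omega> in \<mu>. \<forall>x. \<exists>R\<^sub>0. \<forall>R\<ge>R\<^sub>0. (\<Sum>y\<in>box x R \<inter> clusters (cond \<omega>) \<infinity>. inverse (spd (shift y \<omega>) 0) powr 1) <= m4 * R ^ ?d"
  using cluster_average[OF _ _ inv_int] by (auto simp: mult_ac)
 define M where "M = 1 + (C1 * m1 + m2) * 2 ^ ?d + m3 + m4"
 have Mpos: "(C1 * m1 + m2) * 2 ^ ?d >= 0" using C1 m1(1) m2(1) by simp
 have M: "M >= 1" "(C1 * m1 + m2) * 2 ^ ?d <= M" "m3 <= M" "m4 <= M" using Mpos m3(1) m4(1) unfolding M_def by linarith+
 show ?thesis
 proof (rule exI[of _ M], rule conjI[OF M(1)])
  show "AE \<omega> in \<mu>. \<exists>\<phi> \<rho>. good_cluster (cond \<omega>) (spd \<omega>) (clusters (cond \<omega>) \<infinity>) \<phi> \<rho> \<and>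
   (\<forall>x. \<exists>R\<^sub>0. \<forall>R\<ge>R\<^sub>0. box_averages (cond \<omega>) (spd \<omega>) (clusters (cond \<omega>) \<infinity>) (good_cluster.\<kappa> \<rho>) p r M x R \<and>
    (\<Sum>v\<in>box x R \<inter> clusters (cond \<omega>) \<infinity>. inverse (spd \<omega> v) powr 1) <= M * R powr real ?d)"
  using m1(2) m2(2) m3(2) m4(2) AE_structure_finite AE_space
 proof eventually_elim
  case (elim \<omega>)
  have \<omega>: "\<omega> \<in> space \<Omega>" using elim(6) by (simp add: space_\<mu>)
  obtain T where T: "\<And>z. T z >= 1" "\<And>z j. j >= T z ==> well_connected (cond \<omega>) z j"
   and finT: "\<And>v. finite {z. v \<in> box z (2 ^ (T z + 2))}"
   and sumT: "\<And>v L F. finite F ==> F \<subseteq> {z. v \<in> box z (2 ^ (T z + 2))} ==>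
    (\<Sum>z\<in>F. ennreal ((2 ^ (T z + 2)) ^ L)) <= ennreal (8 ^ (L + CARD('d) + 1)) * bigsum (L + CARD('d) + 1) v \<omega>"
  proof (rule structure_bounds[OF \<omega> elim(5)[THEN conjunct1, rule_format] elim(5)[THEN conjunct2, rule_format]], goal_cases)
   case prems: (1 T)
   show ?case by (rule prems(1)[OF prems(2-5)])
  qed
  let ?C = "clusters (cond \<omega>) \<infinity>"
  define \<rho> :: "'d vertex => nat" where "\<rho> = (\<lambda>z. 2 ^ (T z + 2))"
  have gc: "good_cluster (cond \<omega>) (spd \<omega>) ?C (nearest ?C) \<rho>"
   unfolding \<rho>_def by (rule cluster_structure[OF walk_env[OF \<omega>] T finT])
  interpret gc: good_cluster "cond \<omega>" "spd \<omega>" ?C "nearest ?C" \<rho> by (rule gc)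
  have kap: "ennreal (gc.\<kappa> v ^ m) <= ennreal C1 * bigsum (L + ?d + 1) v \<omega>" and kap1: "gc.\<kappa> v >= 1" for v
  proof -
   let ?S = "{z. v \<in> box z (real (\<rho> z))}"
   have finS: "finite ?S" using finT[of v] by (simp add: \<rho>_def)
   have \<rho>1: "\<rho> z >= 1" for z by (simp add: \<rho>_def)
   have vS: "v \<in> ?S" by (simp add: box_mem)
   \<comment> \<open>The boxes containing \<open>v\<close> have their centres within the largest of
     their radii, so \<open>\<kappa> v\<close> is at most a power of this one radius.\<close>
   define r where "r = Max (\<rho> ` ?S)"
   have rge: "\<rho> z <= r" if "z \<in> ?S" for z unfolding r_def using finS that by (intro Max_ge) auto
   have "r \<in> \<rho> ` ?S" unfolding r_def using finS vS by (intro Max_in) auto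
   then obtain z\<^sub>0 where z0: "z\<^sub>0 \<in> ?S" "r = \<rho> z\<^sub>0" by blast
   have r1: "real r >= 1" using \<rho>1[of z\<^sub>0] z0(2) by simp
   have "gc.\<kappa> v = (\<Sum>z\<in>?S. (2 * real (\<rho> z)) ^ (?d - 1))" by (simp add: gc.\<kappa>_def)
   have "(2 * real (\<rho> v)) ^ (?d - 1) <= gc.\<kappa> v" unfolding gc.\<kappa>_def using finS vS by (intro member_le_sum) auto
   moreover have "1 <= (2 * real (\<rho> v)) ^ (?d - 1)" using \<rho>1[of v] by (intro one_le_power) linarith
   ultimately show "gc.\<kappa> v >= 1" by linarith
   have "gc.\<kappa> v <= (\<Sum>z\<in>?S. (2 * real r) ^ (?d - 1))"
    unfolding gc.\<kappa>_def by (intro sum_mono power_mono) (use rge in auto)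
   also have "... = real (card ?S) * (2 * real r) ^ (?d - 1)" by simp
   also have "... <= (3 * real r) ^ ?d * (3 * real r) ^ ?d"
   proof (rule mult_mono)
    have "?S \<subseteq> box v (real r)"
    proof
     fix z assume z: "z \<in> ?S"
     then have "z \<in> box v (real (\<rho> z))" by (simp add: box_mem_sym[of v])
     then show "z \<in> box v (real r)" using rge[OF z] by (simp add: box_mem)
    qed
    then have "real (card ?S) <= real (card (box v (real r)))" using finite_box by (simp add: card_mono)
    also have "... <= (2 * real r + 1) ^ ?d" by (rule card_box_le) simp
    also have "... <= (3 * real r) ^ ?d" using r1 by (intro power_mono) auto
    finally show "real (card ?S) <= (3 * real r) ^ ?d" .
    have "(2 * real r) ^ (?d - 1) <= (3 * real r) ^ (?d - 1)" using r1 by (intro power_mono) auto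
    also have "... <= (3 * real r) ^ ?d" using r1 by (intro power_increasing) auto
    finally show "(2 * real r) ^ (?d - 1) <= (3 * real r) ^ ?d" .
   qed auto
   also have "... = 9 ^ ?d * real r ^ (2 * ?d)"
   proof -
    have "(3 * real r) ^ ?d * (3 * real r) ^ ?d = ((3 * real r) * (3 * real r)) ^ ?d" by (rule power_mult_distrib[symmetric])
    also have "(3 * real r) * (3 * real r) = 9 * (real r)\<^sup>2" by (simp add: power2_eq_square)
    finally show ?thesis by (simp only: power_mult_distrib power_mult)
   qed
   finally have "gc.\<kappa> v ^ m <= (9 ^ ?d * real r ^ (2 * ?d)) ^ m" by (intro power_mono gc.\<kappa>_nonneg)
   also have "... = 9 ^ (?d * m) * real r ^ L" by (simp only: power_mult_distrib power_mult[symmetric] L_def)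
   finally have "ennreal (gc.\<kappa> v ^ m) <= ennreal (9 ^ (?d * m)) * ennreal (real r ^ L)"
    by (subst ennreal_mult[symmetric]) (auto intro: ennreal_leI)
   also have "ennreal (real r ^ L) <= ennreal (8 ^ (L + ?d + 1)) * bigsum (L + ?d + 1) v \<omega>"
    using sumT[of "{z\<^sub>0}" v L] z0 by (simp add: \<rho>_def)
   finally have "ennreal (gc.\<kappa> v ^ m) <= ennreal (9 ^ (?d * m)) * (ennreal (8 ^ (L + ?d + 1)) * bigsum (L + ?d + 1) v \<omega>)"
    by (simp add: mult_left_mono)
   also have "... = ennreal C1 * bigsum (L + ?d + 1) v \<omega>"
    unfolding C1_def add_0_right by (subst ennreal_mult) (simp_all only: mult.assoc zero_le_power zero_le_numeral)
   finally show "ennreal (gc.\<kappa> v ^ m) <= ennreal C1 * bigsum (L + ?d + 1) v \<omega>" .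
  qed
  have nu0: "nu (cond \<omega>) v >= 0" for v
   unfolding nu_def by (intro sum_nonneg) (simp add: gc.nonneg)
  have young: "((gc.\<kappa> v)\<^sup>2 * nu (cond \<omega>) v) powr (1 / p) <= gc.\<kappa> v ^ m + nu (cond \<omega>) v powr q\<^sub>0" for v
  proof -
   let ?k = "gc.\<kappa> v" and ?n = "nu (cond \<omega>) v"
   define A where "A = ?k powr (2 / p)"
   define B where "B = ?n powr (1 / p)"
   have A1: "A >= 1" using kap1[of v] pq by (simp add: A_def ge_one_powr_ge_zero)
   have B0: "B >= 0" by (simp add: B_def)
   have "(?k\<^sup>2 * ?n) powr (1 / p) = (?k\<^sup>2) powr (1 / p) * B" using nu0[of v] by (simp add: B_def powr_mult)
   also have "(?k\<^sup>2) powr (1 / p) = A" using kap1[of v] by (simp add: A_def powr_powr flip: powr_numeral)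
   also have "A * B <= ?k ^ m + ?n powr q\<^sub>0"
   \<comment> \<open>Either \<open>B\<close> is dominated by a power of \<open>A\<close>, hence of
     \<open>\<kappa>\<close>, or \<open>A\<close> is dominated by the small power
     \<open>\<theta>'\<close> of \<open>B\<close> that \<open>q\<^sub>0\<close> has in excess of
     \<open>1 / p\<close>.\<close>
   proof (cases "B <= A powr (1 / \<theta>')")
    case True
    have "A * B <= A powr 1 * A powr (1 / \<theta>')" using True A1 by (simp add: mult_left_mono)
    also have "... = A powr (1 + 1 / \<theta>')" by (rule powr_add[symmetric])
    also have "... = ?k powr (2 / p * (1 + 1 / \<theta>'))" by (simp add: A_def powr_powr)
    also have "... <= ?k powr real m" using m kap1[of v] by (intro powr_mono)
    also have "... = ?k ^ m" using kap1[of v] by (simp add: powr_realpow)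
    finally show ?thesis by (simp add: add_increasing2)
   next
    case False
    then have "(A powr (1 / \<theta>')) powr \<theta>' <= B powr \<theta>'" using \<theta>' by (intro powr_mono2) auto
    then have "A <= B powr \<theta>'" using A1 \<theta>' by (simp add: powr_powr)
    then have "A * B <= B powr \<theta>' * B powr 1" using B0 by (simp add: mult_right_mono)
    also have "... = B powr (\<theta>' + 1)" by (rule powr_add[symmetric])
    also have "... = ?n powr q\<^sub>0" using pq by (simp add: B_def powr_powr \<theta>'_def)
    finally show ?thesis using kap1[of v] by (simp add: add_increasing)
   qed
   finally show ?thesis .
  qed
  have sh: "nu (cond (shift y \<omega>)) 0 = nu (cond \<omega>) y" "spd (shift y \<omega>) 0 = spd \<omega> y" for y
   by (simp_all add: cond_shift nu_translate spd_shift)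
  have "\<exists>R\<^sub>0. \<forall>R\<ge>R\<^sub>0. box_averages (cond \<omega>) (spd \<omega>) ?C gc.\<kappa> p r M x R \<and>
   (\<Sum>v\<in>box x R \<inter> ?C. inverse (spd \<omega> v) powr 1) <= M * R powr real ?d" for x
  proof -
   obtain R1 where R1: "\<And>R. R >= R1 ==> boxsum (bigsum (L + ?d + 1) 0) x R \<omega> <= ennreal (m1 * R ^ ?d)" using elim(1) by blast
   obtain R2 where R2: "\<And>R. R >= R2 ==> (\<Sum>y\<in>box x R \<inter> ?C. nu (cond \<omega>) y powr q\<^sub>0) <= m2 * R ^ ?d" using elim(2) unfolding sh by blast
   obtain R3 where R3: "\<And>R. R >= R3 ==> (\<Sum>y\<in>box x R \<inter> ?C. spd \<omega> y powr (1 / r)) <= m3 * R ^ ?d" using elim(3) unfolding sh by blast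
   obtain R4 where R4: "\<And>R. R >= R4 ==> (\<Sum>y\<in>box x R \<inter> ?C. inverse (spd \<omega> y) powr 1) <= m4 * R ^ ?d" using elim(4) unfolding sh by blast
   show ?thesis
   proof (intro exI[of _ "max 1 (max (max R1 R2) (max R3 R4))"] allI impI)
    fix R assume "max 1 (max (max R1 R2) (max R3 R4)) <= R"
    then have R: "R >= 1" "R >= R1" "R >= R2" "R >= R3" "R >= R4" by auto
    have Rd: "R powr real ?d = R ^ ?d" using R(1) by (simp add: powr_realpow)
    have Rd0: "R ^ ?d >= 0" using R by simp
    let ?S = "box x (R + 1) \<inter> ?C"
    have fS: "finite ?S" using finite_box by blast
    have "ennreal (\<Sum>v\<in>?S. gc.\<kappa> v ^ m) = (\<Sum>v\<in>?S. ennreal (gc.\<kappa> v ^ m))"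
     by (subst sum_ennreal) (auto simp: gc.\<kappa>_nonneg)
    also have "... <= (\<Sum>v\<in>?S. ennreal C1 * bigsum (L + ?d + 1) v \<omega>)" by (intro sum_mono kap)
    also have "... <= (\<Sum>v\<in>box x (R + 1). ennreal C1 * bigsum (L + ?d + 1) v \<omega>)" by (intro sum_mono2 finite_box) auto
    also have "... = ennreal C1 * boxsum (bigsum (L + ?d + 1) 0) x (R + 1) \<omega>"
     by (simp only: boxsum_def bigsum_shift add_0_left sum_distrib_left)
    also have "... <= ennreal C1 * ennreal (m1 * (R + 1) ^ ?d)" using R by (intro mult_left_mono R1) auto
    also have "... = ennreal (C1 * (m1 * (R + 1) ^ ?d))" using C1 m1(1) R by (simp add: ennreal_mult)
    finally have k: "(\<Sum>v\<in>?S. gc.\<kappa> v ^ m) <= C1 * (m1 * (R + 1) ^ ?d)"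
     using C1 m1(1) R by (subst (asm) ennreal_le_iff) auto
    have "(\<Sum>v\<in>?S. ((gc.\<kappa> v)\<^sup>2 * nu (cond \<omega>) v) powr (1 / p)) <= (\<Sum>v\<in>?S. gc.\<kappa> v ^ m + nu (cond \<omega>) v powr q\<^sub>0)"
     by (intro sum_mono young)
    also have "... <= C1 * (m1 * (R + 1) ^ ?d) + m2 * (R + 1) ^ ?d"
     unfolding sum.distrib using k R2[of "R + 1"] R by (intro add_mono) auto
    also have "... = (C1 * m1 + m2) * (R + 1) ^ ?d" by (simp add: algebra_simps)
    also have "... <= (C1 * m1 + m2) * (2 * R) ^ ?d" using C1 m1(1) m2(1) R by (intro mult_left_mono power_mono) auto
    also have "... = (C1 * m1 + m2) * 2 ^ ?d * R ^ ?d" by (simp add: power_mult_distrib)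
    also have "... <= M * R ^ ?d" using M Rd0 by (intro mult_right_mono) auto
    finally have 1: "(\<Sum>v\<in>?S. ((gc.\<kappa> v)\<^sup>2 * nu (cond \<omega>) v) powr (1 / p)) <= M * R powr real ?d" unfolding Rd .
    have 2: "(\<Sum>y\<in>box x R \<inter> ?C. spd \<omega> y powr (1 / r)) <= M * R powr real ?d"
     using R3[OF R(4)] mult_right_mono[OF M(3) Rd0] unfolding Rd by linarith
    have 3: "(\<Sum>y\<in>box x R \<inter> ?C. inverse (spd \<omega> y) powr 1) <= M * R powr real ?d"
     using R4[OF R(5)] mult_right_mono[OF M(4) Rd0] unfolding Rd by linarith
    show "box_averages (cond \<omega>) (spd \<omega>) ?C gc.\<kappa> p r M x R \<and>
     (\<Sum>v\<in>box x R \<inter> ?C. inverse (spd \<omega> v) powr 1) <= M * R powr real ?d"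
     using 1 2 3 by (simp add: box_averages_def)
   qed
  qed
  then show ?case using gc by blast
 qed
 qed
qed

end

section \<open>First passage percolation\<close>

fun pcost :: "('s => 's => ennreal) => 's list => ennreal" where
 "pcost \<tau> (x # y # xs) = \<tau> x y + pcost \<tau> (y # xs)"
| "pcost \<tau> _ = 0"

lemma pcost_append: "pcost \<tau> (xs @ x # ys) = pcost \<tau> (xs @ [x]) + pcost \<tau> (x # ys)"
proof (induction xs)
 case Nil
 show ?case by simp
next
 case (Cons a xs)
 then show ?case by (cases xs) (auto simp: add.assoc)
qed

lemma pcost_Cons_le: "pcost \<tau> xs <= pcost \<tau> (x # xs)" by (cases xs) (auto simp: add_increasing)

lemma pcost_append_le: "pcost \<tau> ys <= pcost \<tau> (xs @ ys)"
proof (induction xs)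
 case (Cons a xs)
 then show ?case using pcost_Cons_le[of \<tau> "xs @ ys" a] by (simp add: order_trans)
qed simp

text \<open>A crossing of the box centred at its own starting point in time less than
  \<open>b\<close>. Single paths appear instead of an infimum of passage times, which suits cutting
  paths into pieces.\<close>

definition exits :: "('d::finite vertex => 'd vertex => ennreal) => real => real => 'd vertex => bool" where
 "exits \<tau> L b z \<longleftrightarrow> (\<exists>xs. xs ~= [] \<and> hd xs = z \<and> set (butlast xs) \<subseteq> box z L \<and> last xs \<notin> box z L \<and> pcost \<tau> xs < ennreal b)"

lemma exitsI:
 assumes "us ~= []" "hd us = z" "set us \<subseteq> box z L" "v \<notin> box z L" "pcost \<tau> (us @ [v]) < ennreal b"
 shows "exits \<tau> L b z"
 unfolding exits_def using assms by (intro exI[of _ "us @ [v]"]) auto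

locale local_time =
 fixes \<tau> :: "'d::finite vertex => 'd vertex => ennreal"
 assumes step: "\<tau> x y < \<infinity> ==> linfnorm (x - y) <= 1"
begin

lemma exit_prefix:
 assumes "hd xs = z" "xs ~= []" "last xs \<notin> box z L" "L >= 0"
 obtains us v vs where "xs = us @ v # vs" "us ~= []" "hd us = z" "set us \<subseteq> box z L" "v \<notin> box z L"
proof -
 have "\<exists>x\<in>set xs. x \<notin> box z L" using assms by (intro bexI[of _ "last xs"]) auto
 from split_list_first_prop[OF this] obtain us v vs where *: "xs = us @ v # vs" "v \<notin> box z L" "\<forall>u\<in>set us. \<not> u \<notin> box z L" by blast
 have "us ~= []"
 proof
  assume "us = []"
  then have "v = z" using * assms by simp
  then show False using *(2) assms(4) by (simp add: box_mem)
 qed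
 then show ?thesis using * assms by (intro that[of us v vs]) auto
qed

lemma last_step:
 assumes "us ~= []" "set us \<subseteq> box z L" "pcost \<tau> (us @ [v]) < \<infinity>"
 shows "linfnorm (z - v) <= L + 1"
proof -
 have eq: "us @ [v] = butlast us @ last us # [v]" using assms by simp
 have "pcost \<tau> [last us, v] <= pcost \<tau> (us @ [v])" unfolding eq by (rule pcost_append_le)
 then have "\<tau> (last us) v < \<infinity>" using assms(3) by (simp add: order.strict_trans1)
 then have "linfnorm (last us - v) <= 1" by (rule step)
 moreover have "linfnorm (z - last us) <= L" using subsetD[OF assms(2) last_in_set[OF assms(1)]] by (simp add: box_def)
 ultimately show ?thesis using linfnorm_triangle3[of z v "last us"] by linarith
qed

text \<open>A path through points without a fast exit pays \<open>b\<close> for each box it leaves.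
  Finite cost forces steps of length at most 1, so leaving a box of radius \<open>L\<close> advances
  by at most \<open>L + 1\<close>. The last vertex starts no crossing, hence
  \<open>butlast\<close>.\<close>

lemma travel_nat:
 assumes L: "L >= 0" and b: "b >= 0"
 shows "xs ~= [] ==> \<forall>w\<in>set (butlast xs). \<not> exits \<tau> L b w ==> pcost \<tau> xs < \<infinity> ==> linfnorm (hd xs - last xs) >= real k * (L + 1)
  ==> ennreal (real k * b) <= pcost \<tau> xs"
proof (induction k arbitrary: xs)
 case 0
 then show ?case by simp
next
 case (Suc k)
 let ?z = "hd xs"
 have far: "linfnorm (?z - last xs) >= real k * (L + 1) + (L + 1)" using Suc.prems(4) by (simp add: algebra_simps)
 have "real k * (L + 1) >= 0" using L by simp
 then have "last xs \<notin> box ?z L" using far by (auto simp: box_def)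
 from exit_prefix[OF refl Suc.prems(1) this L] obtain us v vs where
  xs: "xs = us @ v # vs" "us ~= []" "hd us = ?z" "set us \<subseteq> box ?z L" "v \<notin> box ?z L" by blast
 have cost: "pcost \<tau> xs = pcost \<tau> (us @ [v]) + pcost \<tau> (v # vs)" unfolding xs(1) by (rule pcost_append)
 have fin: "pcost \<tau> (us @ [v]) < \<infinity>" "pcost \<tau> (v # vs) < \<infinity>" using Suc.prems(3) unfolding cost by auto
 have "?z \<in> set (butlast xs)" using xs by (cases us) (auto simp: butlast_append)
 then have "\<not> exits \<tau> L b ?z" using Suc.prems(2) by blast
 then have 1: "ennreal b <= pcost \<tau> (us @ [v])" using exitsI[OF xs(2-5), of \<tau> b] by (meson not_le)
 have "linfnorm (?z - v) <= L + 1" by (rule last_step[OF xs(2,4) fin(1)])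
 then have "linfnorm (v - last xs) >= real k * (L + 1)" using far linfnorm_triangle3[of ?z "last xs" v] by linarith
 moreover have "set (butlast (v # vs)) \<subseteq> set (butlast xs)" unfolding xs(1) by (auto simp: butlast_append)
 ultimately have 2: "ennreal (real k * b) <= pcost \<tau> (v # vs)"
  using Suc.prems(2) fin(2) xs(1) by (intro Suc.IH) auto
 have "ennreal (real (Suc k) * b) = ennreal b + ennreal (real k * b)"
  using b by (subst ennreal_plus[symmetric]) (auto simp: algebra_simps)
 also have "... <= pcost \<tau> xs" unfolding cost by (intro add_mono 1 2)
 finally show ?case .
qed

lemma travel:
 assumes L: "L >= 0" and b: "b >= 0" and xs: "xs ~= []" "\<And>w. w \<in> set (butlast xs) ==> \<not> exits \<tau> L b w" and cost: "pcost \<tau> xs <= ennreal C" "C >= 0"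
 shows "b * (linfnorm (hd xs - last xs) / (L + 1) - 1) <= C"
proof -
 define k where "k = nat \<lfloor>linfnorm (hd xs - last xs) / (L + 1)\<rfloor>"
 have q: "linfnorm (hd xs - last xs) / (L + 1) >= 0" using L by (simp add: linfnorm_nonneg)
 have k: "real k <= linfnorm (hd xs - last xs) / (L + 1)" "linfnorm (hd xs - last xs) / (L + 1) - 1 <= real k"
  using q unfolding k_def by linarith+
 have "real k * (L + 1) <= linfnorm (hd xs - last xs)" using k(1) L by (simp add: pos_le_divide_eq)
 moreover have "pcost \<tau> xs < \<infinity>" using cost(1) by (simp add: order.strict_trans1)
 ultimately have "ennreal (real k * b) <= pcost \<tau> xs" using xs L b by (intro travel_nat) auto
 also have "... <= ennreal C" by (rule cost)
 finally have "real k * b <= C" using cost(2) by simp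
 moreover have "b * (linfnorm (hd xs - last xs) / (L + 1) - 1) <= b * real k" using k(2) b by (rule mult_left_mono)
 ultimately show ?thesis by (simp add: mult.commute)
qed

text \<open>
 The multiscale step: if all bad points are within distance \<open>10 * L\<close> of each other, the path
 travels at normal speed before it meets the first and after it leaves the last of them.
\<close>

lemma bad_pair:
 assumes L: "L >= 3" and b: "b > 0" and b': "b' * (L + 1) <= b * (L' - 13 * L)" and L': "L' >= 0"
  and ex: "exits \<tau> L' b' z"
 shows "\<exists>w\<in>box z L'. \<exists>w'\<in>box z L'. exits \<tau> L b w \<and> exits \<tau> L b w' \<and> linfnorm (w - w') >= 10 * L"
proof (rule ccontr)
 assume "\<not> ?thesis"
 then have close: "linfnorm (w - w') < 10 * L" if "w \<in> box z L'" "w' \<in> box z L'" "exits \<tau> L b w" "exits \<tau> L b w'" for w w'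
  using that by (meson not_le)
 obtain xs where xs: "xs ~= []" "hd xs = z" "set (butlast xs) \<subseteq> box z L'" "last xs \<notin> box z L'" "pcost \<tau> xs < ennreal b'"
  using ex by (auto simp: exits_def)
 have fin: "pcost \<tau> xs < \<infinity>" using xs(5) by (simp add: order.strict_trans)
 define C where "C = enn2real (pcost \<tau> xs)"
 have C: "pcost \<tau> xs = ennreal C" "C >= 0" "C < b'" using fin xs(5)
  by (auto simp: C_def ennreal_less_iff[symmetric])
 define e where "e = last xs"
 define ys where "ys = butlast xs"
 have xs': "xs = ys @ [e]" using xs(1) by (simp add: ys_def e_def)
 have far: "linfnorm (z - e) > L'" using xs(4) by (simp add: e_def box_def)
 have ys0: "ys ~= []"
 proof
  assume "ys = []"
  then have "z = e" using xs(2) xs' by simp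
  then show False using far L' by simp
 qed
 have "b * (linfnorm (z - e) - 13 * L) < b * (L' - 13 * L)"
 proof (cases "\<exists>w\<in>set ys. exits \<tau> L b w")
  case False
  then have "b * (linfnorm (hd xs - last xs) / (L + 1) - 1) <= C"
   using L b C xs(1) by (intro travel) (auto simp: ys_def)
  then have "b * (linfnorm (z - e) / (L + 1) - 1) * (L + 1) <= C * (L + 1)"
   using L by (intro mult_right_mono) (auto simp: xs(2) e_def)
  then have "b * (linfnorm (z - e) - (L + 1)) <= C * (L + 1)"
   using L by (simp add: left_diff_distrib right_diff_distrib mult.assoc)
  also have "... < b' * (L + 1)" using C L by simp
  also note b'
  finally have "b * (linfnorm (z - e) - (L + 1)) < b * (L' - 13 * L)" .
  moreover have "b * (linfnorm (z - e) - 13 * L) <= b * (linfnorm (z - e) - (L + 1))"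
   using L b by (intro mult_left_mono) auto
  ultimately show ?thesis by linarith
 next
  case True
  from split_list_first_prop[OF this] obtain us w vs where
   us: "ys = us @ w # vs" "exits \<tau> L b w" "\<forall>u\<in>set us. \<not> exits \<tau> L b u" by blast
  have "\<exists>u\<in>set (w # vs). exits \<tau> L b u" using us(2) by auto
  from split_list_last_prop[OF this] obtain us' w' ts where
   ts: "w # vs = us' @ w' # ts" "exits \<tau> L b w'" "\<forall>u\<in>set ts. \<not> exits \<tau> L b u" by blast
  define C1 where "C1 = enn2real (pcost \<tau> (us @ [w]))"
  define C2 where "C2 = enn2real (pcost \<tau> (ts @ [e]))"
  have split: "pcost \<tau> xs = pcost \<tau> (us @ [w]) + pcost \<tau> (w # vs @ [e])" unfolding xs' us(1) using pcost_append[of \<tau> us w "vs @ [e]"] by simp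
  have eq: "w # vs @ [e] = us' @ w' # ts @ [e]" using ts(1) by (metis append_Cons append_assoc)
  have le1: "pcost \<tau> (w' # ts @ [e]) <= pcost \<tau> (w # vs @ [e])" unfolding eq by (rule pcost_append_le)
  have le2: "pcost \<tau> (ts @ [e]) <= pcost \<tau> (w # vs @ [e])"
   using pcost_Cons_le[of \<tau> "ts @ [e]" w'] le1 by (rule order_trans)
  have sum: "pcost \<tau> (us @ [w]) + pcost \<tau> (ts @ [e]) <= pcost \<tau> xs"
   unfolding split using le2 by (rule add_left_mono)
  have "pcost \<tau> (w # vs @ [e]) < \<infinity>" using fin unfolding split by simp
  then have fin': "pcost \<tau> (w' # ts @ [e]) < \<infinity>" by (rule order.strict_trans1[OF le1])
  have fins: "pcost \<tau> (us @ [w]) < \<infinity>" "pcost \<tau> (ts @ [e]) < \<infinity>" using order.strict_trans1[OF sum fin] by simp_all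
  have C12: "pcost \<tau> (us @ [w]) = ennreal C1" "pcost \<tau> (ts @ [e]) = ennreal C2" "C1 >= 0" "C2 >= 0"
   using fins by (auto simp: C1_def C2_def)
  have "C1 + C2 <= C" using sum C(1,2) C12(3,4) unfolding C12(1,2) C(1) by (simp add: ennreal_plus[symmetric] del: ennreal_plus)
  define t where "t = hd (ts @ [e])"
  have t: "linfnorm (w' - t) <= 1"
  proof (rule step)
   have "\<tau> w' t <= pcost \<tau> (w' # ts @ [e])" unfolding t_def by (cases ts) (auto simp: add_increasing2)
   then show "\<tau> w' t < \<infinity>" using fin' by (rule order.strict_trans1)
  qed
  have hd1: "hd (us @ [w]) = z" using xs(2) unfolding xs' us(1) by (cases us) auto
  have "b * (linfnorm (hd (us @ [w]) - last (us @ [w])) / (L + 1) - 1) <= C1"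
   using L b us(3) C12 by (intro travel) auto
  then have "b * (linfnorm (z - w) / (L + 1) - 1) * (L + 1) <= C1 * (L + 1)"
   using L unfolding hd1 by (intro mult_right_mono) auto
  then have 1: "b * (linfnorm (z - w) - (L + 1)) <= C1 * (L + 1)"
   using L by (simp add: left_diff_distrib right_diff_distrib mult.assoc)
  have "b * (linfnorm (hd (ts @ [e]) - last (ts @ [e])) / (L + 1) - 1) <= C2"
   using L b ts(3) C12 by (intro travel) auto
  then have "b * (linfnorm (t - e) / (L + 1) - 1) * (L + 1) <= C2 * (L + 1)"
   using L unfolding t_def by (intro mult_right_mono) auto
  then have 2: "b * (linfnorm (t - e) - (L + 1)) <= C2 * (L + 1)"
   using L by (simp add: left_diff_distrib right_diff_distrib mult.assoc)
  have inb: "w \<in> box z L'" "w' \<in> box z L'"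
  proof -
   have "set (w # vs) \<subseteq> box z L'" using xs(3) us(1) unfolding ys_def by auto
   moreover have "w' \<in> set (w # vs)" unfolding ts(1) by simp
   ultimately show "w \<in> box z L'" "w' \<in> box z L'" by auto
  qed
  have ww: "linfnorm (w - w') < 10 * L" by (rule close[OF inb us(2) ts(2)])
  have tri: "linfnorm (z - e) <= linfnorm (z - w) + linfnorm (w - w') + linfnorm (w' - t) + linfnorm (t - e)"
   using linfnorm_triangle3[of z e w] linfnorm_triangle3[of w e w'] linfnorm_triangle3[of w' e t] by linarith
  \<comment> \<open>The stretch between the bad points and the step after the second amount to at
    most \<open>10 * L + 1\<close>, the rounding in \<open>travel\<close> to twice
    \<open>L + 1\<close>; together at most \<open>13 * L\<close>, since
    \<open>L >= 3\<close>.\<close>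
  have "linfnorm (z - e) - 13 * L <= (linfnorm (z - w) - (L + 1)) + (linfnorm (t - e) - (L + 1))"
   using tri ww t L by linarith
  then have "b * (linfnorm (z - e) - 13 * L) <= b * ((linfnorm (z - w) - (L + 1)) + (linfnorm (t - e) - (L + 1)))"
   using b by (intro mult_left_mono) auto
  also have "... <= C1 * (L + 1) + C2 * (L + 1)" unfolding distrib_left[of b] using 1 2 by (rule add_mono)
  also have "... = (C1 + C2) * (L + 1)" by (simp add: distrib_right)
  also have "... <= C * (L + 1)" using \<open>C1 + C2 <= C\<close> L by (intro mult_right_mono) auto
  also have "... < b' * (L + 1)" using C L by simp
  also note b'
  finally show ?thesis .
 qed
 then show False using far b by simp
qed

end

lemma lattice_edge_dist: "{x, y} \<in> lattice_edges ==> l1norm (x - y :: 'd::finite vertex) = 1"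
proof -
 assume "{x, y} \<in> lattice_edges"
 then obtain v w where "{x, y} = {v, w}" "l1norm (v - w) = 1" unfolding lattice_edges_def by blast
 moreover have "l1norm (w - v) = l1norm (v - w)" by (simp add: l1norm_def abs_minus_commute)
 ultimately show ?thesis by (auto simp: doubleton_eq_iff)
qed

lemma pcost_cong: "(\<And>x y. x \<in> set xs ==> y \<in> set xs ==> \<tau> x y = \<tau>' x y) ==> pcost \<tau> xs = pcost \<tau>' xs"
 by (induction \<tau> xs rule: pcost.induct) auto

lemma pcost_mono: "(\<And>x y. x \<in> set xs ==> y \<in> set xs ==> \<tau> x y <= \<tau>' x y) ==> pcost \<tau> xs <= pcost \<tau>' xs"
 by (induction \<tau> xs rule: pcost.induct) (auto intro: add_mono)

text \<open>Finite cost keeps the last vertex within \<open>L + 1\<close>, so only paths in a finite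
  box matter. This gives measurability, as a countable union, and dependence on the coordinates near
  the box.\<close>

lemma (in local_time) exits_iff:
 assumes L: "L >= 0"
 shows "exits \<tau> L b z \<longleftrightarrow> (\<exists>xs\<in>{xs. xs ~= [] \<and> hd xs = z \<and> set (butlast xs) \<subseteq> box z L \<and> last xs \<notin> box z L \<and> set xs \<subseteq> box z (L + 1)}. pcost \<tau> xs < ennreal b)"
 (is "_ \<longleftrightarrow> ?R")
proof
 assume "exits \<tau> L b z"
 then obtain xs where xs: "xs ~= []" "hd xs = z" "set (butlast xs) \<subseteq> box z L" "last xs \<notin> box z L" "pcost \<tau> xs < ennreal b"
  unfolding exits_def by blast
 have "set xs \<subseteq> box z (L + 1)"
 proof (cases "butlast xs = []")
  case True
  have "z \<in> box z L" using L by (simp add: box_mem)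
  moreover have "last xs = z" using True xs(1,2) by (cases xs) (auto split: if_splits)
  ultimately show ?thesis using xs(4) by simp
 next
  case False
  have fin: "pcost \<tau> (butlast xs @ [last xs]) < \<infinity>" using xs by (simp add: order.strict_trans)
  have "linfnorm (z - last xs) <= L + 1" by (rule last_step[OF False xs(3) fin])
  then have "last xs \<in> box z (L + 1)" by (simp add: box_def)
  moreover have "box z L \<subseteq> box z (L + 1)" by (auto simp: box_def)
  moreover have "set xs = insert (last xs) (set (butlast xs))" using xs(1) by (metis append_butlast_last_id list.simps(15) rotate1.simps(2) set_rotate1)
  ultimately show ?thesis using xs(3) by auto
 qed
 then show ?R using xs by blast
next
 assume ?R
 then show "exits \<tau> L b z" unfolding exits_def by blast
qed

lemma box_region_dist:
 assumes "r >= 0"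
 shows "linfnorm (x - y) - 2 * r <= region_dist (box_region x r) (box_region y r)"
proof -
 have v: "region_vertices (box_region z r) = box z r" for z :: "'a vertex" by (auto simp: region_vertices_def box_region_def)
 have "x \<in> box x r" "y \<in> box y r" using assms by (simp_all add: box_mem)
 then show ?thesis unfolding region_dist_def v
 proof (intro cInf_greatest)
  fix l assume "l \<in> {linfnorm (v - w) |v w. v \<in> box x r \<and> w \<in> box y r}"
  then obtain v w where l: "l = linfnorm (v - w)" and "linfnorm (x - v) <= r" "linfnorm (w - y) <= r"
   by (auto simp: box_def linfnorm_minus[of y])
  then show "linfnorm (x - y) - 2 * r <= l"
   using linfnorm_triangle3[of x y v] linfnorm_triangle3[of v y w] by linarith
 qed blast
qed

section \<open>Passage times of the random environment\<close>

context field
begin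

definition etime :: "('e, 'v, 'd) config => 'd vertex => 'd vertex => ennreal" where
 "etime \<omega> x y = (if cond \<omega> x y ~= 0 then ennreal (sqrt (min 1 (min (spd \<omega> x) (spd \<omega> y) / cond \<omega> x y))) else \<infinity>)"

lemma etime_passage:
 "{x, y} \<in> lattice_edges ==> etime \<omega> x y = passage_time a \<theta> (local_config N x \<omega>, local_config N y \<omega>, fst \<omega> {x, y})"
 by (simp add: etime_def passage_time_def conductance_def speed_def)

lemma etime_non_edge: "{x, y} \<notin> lattice_edges ==> etime \<omega> x y = \<infinity>"
 by (simp add: etime_def conductance_def)

sublocale local_time "etime \<omega>" for \<omega>
proof
 fix x y assume "etime \<omega> x y < \<infinity>"
 then have "{x, y} \<in> lattice_edges" using etime_non_edge[of x y \<omega>] by (metis less_irrefl)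
 then show "linfnorm (x - y) <= 1" using lattice_edge_dist linfnorm_le_l1norm[of "x - y"] by metis
qed

lemma etime_shift: "etime (shift z \<omega>) x y = etime \<omega> (x + z) (y + z)"
 by (simp add: etime_def cond_shift spd_shift)

text \<open>Ensures that the coordinates in \<open>Q\<close> determine every passage time between
  points of \<open>S\<close>.\<close>

definition covers :: "'d region => 'd vertex set => bool" where
 "covers Q S \<longleftrightarrow> fst Q \<subseteq> lattice_edges \<and> (\<forall>x\<in>S. inside (translate x N) Q) \<and> (\<forall>x\<in>S. \<forall>y\<in>S. {x, y} \<in> lattice_edges --> {x, y} \<in> fst Q)"

lemma covers_exists: "\<exists>K\<ge>0. \<forall>z L r. L >= 0 --> L + K <= r --> covers (box_region z r) (box z L)"
proof -
 define V where "V = region_vertices N"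
 have "finite e" if "e \<in> fst N" for e using that N(1) unfolding lattice_edges_def by auto
 then have finV: "finite V" unfolding V_def region_vertices_def using N by auto
 define K where "K = (\<Sum>v\<in>V. linfnorm v)"
 have K: "linfnorm v <= K" if "v \<in> V" for v unfolding K_def using finV that by (intro member_le_sum linfnorm_nonneg)
 have K0: "K >= 0" unfolding K_def by (intro sum_nonneg linfnorm_nonneg)
 have "covers (box_region z r) (box z L)" if "L >= 0" "L + K <= r" for z L r
  unfolding covers_def
 proof (intro conjI ballI impI)
  show "fst (box_region z r) \<subseteq> lattice_edges" by (auto simp: box_region_def)
  fix x assume x: "x \<in> box z L"
  have mem: "v + x \<in> box z r" if "v \<in> V" for v
  proof -
   have "linfnorm (v + x - z) <= linfnorm v + linfnorm (x - z)" using linfnorm_triangle[of v "x - z"] by (simp add: add_diff_eq)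
   then show ?thesis using K[OF that] x \<open>L + K <= r\<close> by (simp add: box_mem)
  qed
  show "inside (translate x N) (box_region z r)"
   unfolding inside_def translate_def
  proof (intro conjI subsetI)
   fix e assume "e \<in> fst ((`) ((`) (\<lambda>v. v + x)) (fst N), (\<lambda>v. v + x) ` snd N)"
   then obtain e' where e': "e' \<in> fst N" "e = (\<lambda>v. v + x) ` e'" by auto
   have "e \<in> lattice_edges" using e' N(1) lattice_edges_translate by auto
   moreover have "e \<subseteq> box z r" using mem e' by (auto simp: V_def region_vertices_def)
   ultimately show "e \<in> fst (box_region z r)" by (simp add: box_region_def)
  next
   fix v assume "v \<in> snd ((`) ((`) (\<lambda>v. v + x)) (fst N), (\<lambda>v. v + x) ` snd N)"
   then show "v \<in> snd (box_region z r)" using mem by (auto simp: box_region_def V_def region_vertices_def)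
  qed
  fix y assume "y \<in> box z L" "{x, y} \<in> lattice_edges"
  then show "{x, y} \<in> fst (box_region z r)" using x K0 \<open>L + K <= r\<close> by (auto simp: box_region_def box_mem)
 qed
 then show ?thesis using K0 by blast
qed

lemma etime_measurable:
 assumes "covers Q S" "x \<in> S" "y \<in> S"
 shows "(\<lambda>\<omega>. etime \<omega> x y) \<in> borel_measurable (region_space ME MV Q)"
proof -
 have [measurable]: "(\<lambda>\<omega>. cond \<omega> x y) \<in> borel_measurable (region_space ME MV Q)"
  "(\<lambda>\<omega>. spd \<omega> x) \<in> borel_measurable (region_space ME MV Q)" "(\<lambda>\<omega>. spd \<omega> y) \<in> borel_measurable (region_space ME MV Q)"
  using assms by (auto simp: covers_def intro!: conductance_measurable speed_measurable)
 show ?thesis unfolding etime_def by measurable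
qed

lemma pcost_measurable:
 "covers Q S ==> set xs \<subseteq> S ==> (\<lambda>\<omega>. pcost (etime \<omega>) xs) \<in> borel_measurable (region_space ME MV Q)"
proof (induction xs)
 case (Cons x xs)
 then show ?case
 proof (cases xs)
  case (Cons y ys)
  then have [measurable]: "(\<lambda>\<omega>. etime \<omega> x y) \<in> borel_measurable (region_space ME MV Q)"
   "(\<lambda>\<omega>. pcost (etime \<omega>) (y # ys)) \<in> borel_measurable (region_space ME MV Q)"
   using Cons.prems Cons.IH by (auto intro: etime_measurable)
  show ?thesis unfolding Cons by simp
 qed simp
qed simp

lemma exits_pred:
 assumes "L >= 0" "covers Q (box z (L + 1))"
 shows "Measurable.pred (region_space ME MV Q) (\<lambda>\<omega>. exits (etime \<omega>) L b z)"
proof -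
 have "Measurable.pred (region_space ME MV Q) (\<lambda>\<omega>. pcost (etime \<omega>) xs < ennreal b)" if "set xs \<subseteq> box z (L + 1)" for xs
  using pcost_measurable[OF assms(2) that] by measurable
 then show ?thesis unfolding exits_iff[OF assms(1)] by (intro pred_intros_countable_bounded) auto
qed

lemma covers_full: "covers (lattice_edges, UNIV) S"
 unfolding covers_def using inside_full by auto

lemma exits_pred_full [measurable]: "L >= 0 ==> Measurable.pred \<Omega> (\<lambda>\<omega>. exits (etime \<omega>) L b z)"
 unfolding config_space_def by (intro exits_pred covers_full)

lemma etime_restrict:
 assumes "covers Q S" "x \<in> S" "y \<in> S"
 shows "etime (restrict_config Q \<omega>) x y = etime \<omega> x y"
proof -
 have loc: "local_config N v (restrict_config Q \<omega>) = local_config N v \<omega>" if "v \<in> S" for v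
 proof -
  have "inside (translate v N) Q" using assms(1) that by (simp add: covers_def)
  then show ?thesis unfolding local_config_eq inside_def translate_def restrict_config_def
   by (auto simp: fun_eq_iff restrict_def)
 qed
 have "{x, y} \<in> lattice_edges ==> fst (restrict_config Q \<omega>) {x, y} = fst \<omega> {x, y}"
  using assms by (auto simp: covers_def restrict_config_def)
 then show ?thesis using assms by (simp add: etime_def conductance_def speed_def loc)
qed

lemma exits_restrict:
 assumes "L >= 0" "covers Q (box z (L + 1))"
 shows "exits (etime (restrict_config Q \<omega>)) L b z \<longleftrightarrow> exits (etime \<omega>) L b z"
proof -
 have "pcost (etime (restrict_config Q \<omega>)) xs = pcost (etime \<omega>) xs" if "set xs \<subseteq> box z (L + 1)" for xs
  using that by (intro pcost_cong etime_restrict[OF assms(2)]) auto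
 then show ?thesis unfolding exits_iff[OF assms(1)] by (intro bex_cong) auto
qed

lemma restrict_measurable:
 assumes "fst Q \<subseteq> lattice_edges"
 shows "restrict_config Q \<in> measurable \<Omega> (region_space ME MV Q)"
 unfolding restrict_config_def[abs_def] region_space_def config_space_def fst_conv snd_conv
 using assms by (intro measurable_Pair measurable_restrict measurable_compose[OF measurable_fst] measurable_compose[OF measurable_snd] measurable_component_singleton)
  auto

lemma exits_shift: "exits (etime (shift z \<omega>)) L b x \<longleftrightarrow> exits (etime \<omega>) L b (x + z)"
proof -
 have pc: "pcost (etime (shift z \<omega>)) xs = pcost (etime \<omega>) (map (\<lambda>v. v + z) xs)" for xs
  by (induction xs rule: induct_list012) (auto simp: etime_shift)
 have bx: "v + z \<in> box (y + z) L \<longleftrightarrow> v \<in> box y L" for v y by (simp add: box_mem)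
 have P: "(xs ~= [] \<and> hd xs = x \<and> set (butlast xs) \<subseteq> box x L \<and> last xs \<notin> box x L) \<longleftrightarrow>
  (map (\<lambda>v. v + z) xs ~= [] \<and> hd (map (\<lambda>v. v + z) xs) = x + z \<and> set (butlast (map (\<lambda>v. v + z) xs)) \<subseteq> box (x + z) L \<and> last (map (\<lambda>v. v + z) xs) \<notin> box (x + z) L)" for xs
  by (cases "xs = []") (auto simp: hd_map last_map map_butlast[symmetric] bx)
 have sur: "\<exists>xs. ys = map (\<lambda>v. v + z) xs" for ys :: "'d vertex list"
  by (intro exI[of _ "map (\<lambda>v. v - z) ys"]) (simp add: comp_def)
 show ?thesis
 proof
  assume "exits (etime (shift z \<omega>)) L b x"
  then obtain xs where "xs ~= [] \<and> hd xs = x \<and> set (butlast xs) \<subseteq> box x L \<and> last xs \<notin> box x L" "pcost (etime (shift z \<omega>)) xs < ennreal b"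
   unfolding exits_def by blast
  then show "exits (etime \<omega>) L b (x + z)" unfolding exits_def P pc by (intro exI[of _ "map (\<lambda>v. v + z) xs"]) simp
 next
  assume "exits (etime \<omega>) L b (x + z)"
  then obtain ys where ys: "ys ~= [] \<and> hd ys = x + z \<and> set (butlast ys) \<subseteq> box (x + z) L \<and> last ys \<notin> box (x + z) L" "pcost (etime \<omega>) ys < ennreal b"
   unfolding exits_def by blast
  obtain xs where xs: "ys = map (\<lambda>v. v + z) xs" using sur by blast
  show "exits (etime (shift z \<omega>)) L b x" unfolding exits_def
   using ys P[of xs] pc[of xs] unfolding xs by (intro exI[of _ xs]) simp
 qed
qed

end

lemma extension_bound:
 assumes ext: "extension_of M M'" and B: "B \<in> sets M'" and e: "measure M' (space M' - B) <= e" and H: "H \<in> sets M"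
 shows "measure M H <= e + measure M' {(\<omega>, s) \<in> B. \<omega> \<in> H}"
proof -
 interpret M': prob_space M' using ext by (simp add: extension_of_def)
 have fst: "fst \<in> measurable M' M"
  using ext measurable_cong_sets[of M' "M \<Otimes>\<^sub>M borel" M M] measurable_fst by (auto simp: extension_of_def)
 have "measure M H = measure (distr M' M fst) H" using ext by (simp add: extension_of_def)
 also have "... = measure M' (fst -` H \<inter> space M')" by (rule measure_distr[OF fst H])
 also have "... <= measure M' ((space M' - B) \<union> {(\<omega>, s) \<in> B. \<omega> \<in> H})"
 proof (rule M'.finite_measure_mono)
  have "{(\<omega>, s) \<in> B. \<omega> \<in> H} = B \<inter> (fst -` H \<inter> space M')" using B sets.sets_into_space[OF B] by auto
  then show *: "(space M' - B) \<union> {(\<omega>, s) \<in> B. \<omega> \<in> H} \<in> M'.events"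
   using B measurable_sets[OF fst H] by auto
 qed auto
 also have "... <= measure M' (space M' - B) + measure M' {(\<omega>, s) \<in> B. \<omega> \<in> H}"
 proof (rule measure_subadditive)
  have "{(\<omega>, s) \<in> B. \<omega> \<in> H} = B \<inter> (fst -` H \<inter> space M')" using B sets.sets_into_space[OF B] by auto
  then show "{(\<omega>, s) \<in> B. \<omega> \<in> H} \<in> M'.events" using B measurable_sets[OF fst H] by auto
 qed (use B in \<open>auto simp: M'.emeasure_eq_measure\<close>)
 finally show ?thesis using e by linarith
qed

section \<open>Monotone events and decoupling\<close>

locale ordered_family = field ME MV N a \<theta>
 for ME :: "'e::order measure" and MV :: "'v::order measure" and N :: "'d::finite region"
  and a :: "('e, 'v, 'd) config \<times> ('e, 'v, 'd) config \<times> 'e => real" and \<theta> :: "('e, 'v, 'd) config => real" +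
 fixes I :: "real set" and P :: "real => ('e, 'v, 'd) config measure"
 assumes prob_P: "u \<in> I ==> prob_space (P u)" and sets_P: "u \<in> I ==> sets (P u) = sets (config_space ME MV)"
  and P1: "cond_P1 ME MV I P" and P3: "cond_P3 ME MV I P"
  and pass_mono: "monotone_fun_on (space (region_space ME MV N \<Otimes>\<^sub>M region_space ME MV N \<Otimes>\<^sub>M ME)) (passage_time a \<theta>)"
begin

abbreviation "passage_space \<equiv> space (\<Omega>N \<Otimes>\<^sub>M \<Omega>N \<Otimes>\<^sub>M ME)"

lemma field_prob_P: "u \<in> I ==> field_prob ME MV N a \<theta> (P u)"
 using prob_P[of u] sets_P[of u] P1 field_axioms by (auto simp: field_prob_def field_prob_axioms_def cond_P1_def)

lemma space_P: "u \<in> I ==> space (P u) = space \<Omega>" using sets_P by (rule sets_eq_imp_space_eq)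

lemma exits_event: "u \<in> I ==> L >= 0 ==> {\<omega> \<in> space \<Omega>. exits (etime \<omega>) L b z} \<in> sets (P u)"
 using exits_pred_full[of L b z] by (simp add: pred_def sets_P)

lemma exits_prob_translate:
 assumes u: "u \<in> I" and L: "L >= 0"
 shows "measure (P u) {\<omega> \<in> space \<Omega>. exits (etime \<omega>) L b z} = measure (P u) {\<omega> \<in> space \<Omega>. exits (etime \<omega>) L b 0}"
proof -
 interpret field_prob ME MV N a \<theta> "P u" using u by (rule field_prob_P)
 have E: "{\<omega> \<in> space \<Omega>. exits (etime \<omega>) L b 0} \<in> sets \<Omega>" using exits_event[OF u L] by (simp add: sets_\<mu>)
 have "measure (P u) {\<omega> \<in> space \<Omega>. exits (etime \<omega>) L b 0} = measure (distr (P u) \<Omega> (shift z)) {\<omega> \<in> space \<Omega>. exits (etime \<omega>) L b 0}"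
  by (simp add: stationary)
 also have "... = measure (P u) (shift z -` {\<omega> \<in> space \<Omega>. exits (etime \<omega>) L b 0} \<inter> space (P u))"
  by (rule measure_distr) (use E in \<open>auto simp: meas_\<mu>\<close>)
 also have "shift z -` {\<omega> \<in> space \<Omega>. exits (etime \<omega>) L b 0} \<inter> space (P u) = {\<omega> \<in> space \<Omega>. exits (etime \<omega>) L b z}"
  using shift_in_space by (auto simp: space_\<mu> exits_shift)
 finally show ?thesis ..
qed

lemma restrict_le:
 fixes \<omega> \<omega>' :: "('e, 'v, 'd) config"
 shows "\<omega> <= \<omega>' ==> local_config N x \<omega> <= local_config N x \<omega>'"
 unfolding local_config_eq by (auto simp: less_eq_prod_def le_fun_def restrict_def)

lemma etime_le:
 assumes cov: "covers Q S" and xy: "x \<in> S" "y \<in> S"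
  and sp: "\<omega> \<in> space (region_space ME MV Q)" "\<omega>' \<in> space (region_space ME MV Q)" and le: "\<omega> <= \<omega>'"
 shows "mono_on passage_space (passage_time a \<theta>) ==> etime \<omega> x y <= etime \<omega>' x y"
  and "antimono_on passage_space (passage_time a \<theta>) ==> etime \<omega>' x y <= etime \<omega> x y"
proof -
 have ins: "inside (translate x N) Q" "inside (translate y N) Q" using cov xy by (auto simp: covers_def)
 have space: "(local_config N x v, local_config N y v, fst v {x, y}) \<in> space (\<Omega>N \<Otimes>\<^sub>M \<Omega>N \<Otimes>\<^sub>M ME)"
  if "v \<in> space (region_space ME MV Q)" "{x, y} \<in> lattice_edges" for v
  using local_in_space[OF ins(1) that(1)] local_in_space[OF ins(2) that(1)] edge_in_space[of "{x, y}" Q v] that cov xy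
  by (auto simp: space_pair_measure covers_def)
 have le': "(local_config N x \<omega>, local_config N y \<omega>, fst \<omega> {x, y}) <= (local_config N x \<omega>', local_config N y \<omega>', fst \<omega>' {x, y})"
  using restrict_le[OF le] le by (simp add: less_eq_prod_def le_fun_def)
 show "etime \<omega> x y <= etime \<omega>' x y" if m: "mono_on passage_space (passage_time a \<theta>)"
 proof (cases "{x, y} \<in> lattice_edges")
  case True
  then show ?thesis unfolding etime_passage[OF True] by (intro monotone_onD[OF m] space sp le')
 qed (simp add: etime_non_edge)
 show "etime \<omega>' x y <= etime \<omega> x y" if m: "antimono_on passage_space (passage_time a \<theta>)"
 proof (cases "{x, y} \<in> lattice_edges")
  case True
  then show ?thesis unfolding etime_passage[OF True] by (intro monotone_onD[OF m] space sp le')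
 qed (simp add: etime_non_edge)
qed

lemma exits_le:
 assumes L: "L >= 0" and cov: "covers Q (box z (L + 1))"
  and sp: "\<omega> \<in> space (region_space ME MV Q)" "\<omega>' \<in> space (region_space ME MV Q)" and le: "\<omega> <= \<omega>'"
 shows "mono_on passage_space (passage_time a \<theta>) ==> exits (etime \<omega>') L b z ==> exits (etime \<omega>) L b z"
  and "antimono_on passage_space (passage_time a \<theta>) ==> exits (etime \<omega>) L b z ==> exits (etime \<omega>') L b z"
proof -
 show "exits (etime \<omega>) L b z" if m: "mono_on passage_space (passage_time a \<theta>)" and ex: "exits (etime \<omega>') L b z"
 proof -
  have "pcost (etime \<omega>) xs <= pcost (etime \<omega>') xs" if "set xs \<subseteq> box z (L + 1)" for xs
   using that by (intro pcost_mono etime_le(1)[OF cov _ _ sp le m]) auto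
  then show ?thesis using ex unfolding exits_iff[OF L] by (fastforce intro: order.strict_trans1)
 qed
 show "exits (etime \<omega>') L b z" if m: "antimono_on passage_space (passage_time a \<theta>)" and ex: "exits (etime \<omega>) L b z"
 proof -
  have "pcost (etime \<omega>') xs <= pcost (etime \<omega>) xs" if "set xs \<subseteq> box z (L + 1)" for xs
   using that by (intro pcost_mono etime_le(2)[OF cov _ _ sp le m]) auto
  then show ?thesis using ex unfolding exits_iff[OF L] by (fastforce intro: order.strict_trans1)
 qed
qed

definition pair_event :: "'d region => 'd region => 'd vertex => 'd vertex => real => real => (('e, 'v, 'd) config \<times> ('e, 'v, 'd) config) set" where
 "pair_event Q Q' x y L b = {z \<in> space (region_space ME MV Q \<Otimes>\<^sub>M region_space ME MV Q'). exits (etime (fst z)) L b x \<and> exits (etime (snd z)) L b y}"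

lemma pair_event:
 assumes L: "L >= 0" and cov: "covers Q (box x (L + 1))" "covers Q' (box y (L + 1))"
 shows "mono_on passage_space (passage_time a \<theta>) ==>
   decreasing_event (region_space ME MV Q \<Otimes>\<^sub>M region_space ME MV Q') (pair_event Q Q' x y L b)"
  and "antimono_on passage_space (passage_time a \<theta>) ==>
   increasing_event (region_space ME MV Q \<Otimes>\<^sub>M region_space ME MV Q') (pair_event Q Q' x y L b)"
proof -
 have [measurable]: "Measurable.pred (region_space ME MV Q) (\<lambda>\<omega>. exits (etime \<omega>) L b x)"
  "Measurable.pred (region_space ME MV Q') (\<lambda>\<omega>. exits (etime \<omega>) L b y)"
  by (intro exits_pred L cov)+
 have m: "pair_event Q Q' x y L b \<in> sets (region_space ME MV Q \<Otimes>\<^sub>M region_space ME MV Q')"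
  unfolding pair_event_def by measurable
 show "decreasing_event (region_space ME MV Q \<Otimes>\<^sub>M region_space ME MV Q') (pair_event Q Q' x y L b)"
  if mm: "mono_on passage_space (passage_time a \<theta>)"
  unfolding decreasing_event_def
 proof (intro conjI m monotone_onI)
  fix z z' assume *: "z \<in> space (region_space ME MV Q \<Otimes>\<^sub>M region_space ME MV Q')" "z' \<in> space (region_space ME MV Q \<Otimes>\<^sub>M region_space ME MV Q')" "z <= z'"
  have "z \<in> pair_event Q Q' x y L b" if "z' \<in> pair_event Q Q' x y L b"
   using that * exits_le(1)[OF L cov(1) _ _ _ mm, of "fst z" "fst z'" b] exits_le(1)[OF L cov(2) _ _ _ mm, of "snd z" "snd z'" b]
   by (auto simp: pair_event_def space_pair_measure less_eq_prod_def)
  then show "indicator (pair_event Q Q' x y L b) z' <= (indicator (pair_event Q Q' x y L b) z :: real)"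
   by (auto simp: indicator_def)
 qed
 show "increasing_event (region_space ME MV Q \<Otimes>\<^sub>M region_space ME MV Q') (pair_event Q Q' x y L b)"
  if mm: "antimono_on passage_space (passage_time a \<theta>)"
  unfolding increasing_event_def
 proof (intro conjI m monotone_onI)
  fix z z' assume *: "z \<in> space (region_space ME MV Q \<Otimes>\<^sub>M region_space ME MV Q')" "z' \<in> space (region_space ME MV Q \<Otimes>\<^sub>M region_space ME MV Q')" "z <= z'"
  have "z' \<in> pair_event Q Q' x y L b" if "z \<in> pair_event Q Q' x y L b"
   using that * exits_le(2)[OF L cov(1) _ _ _ mm, of "fst z" "fst z'" b] exits_le(2)[OF L cov(2) _ _ _ mm, of "snd z" "snd z'" b]
   by (auto simp: pair_event_def space_pair_measure less_eq_prod_def)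
  then show "indicator (pair_event Q Q' x y L b) z <= (indicator (pair_event Q Q' x y L b) z' :: real)"
   by (auto simp: indicator_def)
 qed
qed

text \<open>Under the product measure the two exits are independent, and stationarity recentres both
  at 0; the complement of the coupling event \<open>B\<close> contributes \<open>e\<close>.\<close>

lemma decouple_step:
 assumes uv: "u \<in> I" "v \<in> I" and L: "L >= 0" and cov: "covers Q (box x (L + 1))" "covers Q' (box y (L + 1))"
  and ext: "extension_of (P u) M'" "B \<in> sets M'" "measure M' (space M' - B) <= e"
  and le: "measure M' {(\<omega>, s) \<in> B. (restrict_config Q \<omega>, restrict_config Q' \<omega>) \<in> pair_event Q Q' x y L b}
    <= measure (P v \<Otimes>\<^sub>M P v) {(\<omega>\<^sub>1, \<omega>\<^sub>2) \<in> space (P v \<Otimes>\<^sub>M P v). (restrict_config Q \<omega>\<^sub>1, restrict_config Q' \<omega>\<^sub>2) \<in> pair_event Q Q' x y L b}"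
 shows "measure (P u) {\<omega> \<in> space \<Omega>. exits (etime \<omega>) L b x \<and> exits (etime \<omega>) L b y}
  <= e + (measure (P v) {\<omega> \<in> space \<Omega>. exits (etime \<omega>) L b 0})\<^sup>2"
proof -
 interpret v: prob_space "P v" by (rule prob_P[OF uv(2)])
 interpret pv: pair_prob_space "P v" "P v" ..
 let ?H = "\<lambda>z. {\<omega> \<in> space \<Omega>. exits (etime \<omega>) L b z}"
 have Q: "fst Q \<subseteq> lattice_edges" "fst Q' \<subseteq> lattice_edges" using cov by (auto simp: covers_def)
 have mem: "(restrict_config Q \<omega>\<^sub>1, restrict_config Q' \<omega>\<^sub>2) \<in> pair_event Q Q' x y L b \<longleftrightarrow> exits (etime \<omega>\<^sub>1) L b x \<and> exits (etime \<omega>\<^sub>2) L b y"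
  if "\<omega>\<^sub>1 \<in> space \<Omega>" "\<omega>\<^sub>2 \<in> space \<Omega>" for \<omega>\<^sub>1 \<omega>\<^sub>2
  using measurable_space[OF restrict_measurable[OF Q(1)] that(1)] measurable_space[OF restrict_measurable[OF Q(2)] that(2)]
  by (simp add: pair_event_def space_pair_measure exits_restrict[OF L cov(1)] exits_restrict[OF L cov(2)])
 have sM': "fst z \<in> space \<Omega>" if "z \<in> B" for z
 proof -
  have "z \<in> space M'" using sets.sets_into_space[OF ext(2)] that by blast
  moreover have "space M' = space (P u \<Otimes>\<^sub>M (borel :: real measure))" using ext(1) by (intro sets_eq_imp_space_eq) (simp add: extension_of_def)
  ultimately show ?thesis using uv by (auto simp: space_pair_measure space_P)
 qed
 have H2: "{\<omega> \<in> space \<Omega>. exits (etime \<omega>) L b x \<and> exits (etime \<omega>) L b y} \<in> sets (P u)"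
 proof -
  have "{\<omega> \<in> space \<Omega>. exits (etime \<omega>) L b x \<and> exits (etime \<omega>) L b y} = ?H x \<inter> ?H y" by blast
  then show ?thesis using exits_event[OF uv(1) L] by simp
 qed
 have "{(\<omega>, s) \<in> B. \<omega> \<in> {\<omega> \<in> space \<Omega>. exits (etime \<omega>) L b x \<and> exits (etime \<omega>) L b y}}
  = {(\<omega>, s) \<in> B. (restrict_config Q \<omega>, restrict_config Q' \<omega>) \<in> pair_event Q Q' x y L b}"
  using sM' mem by fastforce
 then have "measure (P u) {\<omega> \<in> space \<Omega>. exits (etime \<omega>) L b x \<and> exits (etime \<omega>) L b y}
  <= e + measure M' {(\<omega>, s) \<in> B. (restrict_config Q \<omega>, restrict_config Q' \<omega>) \<in> pair_event Q Q' x y L b}"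
  using extension_bound[OF ext H2] by simp
 also note le
 also have "{(\<omega>\<^sub>1, \<omega>\<^sub>2) \<in> space (P v \<Otimes>\<^sub>M P v). (restrict_config Q \<omega>\<^sub>1, restrict_config Q' \<omega>\<^sub>2) \<in> pair_event Q Q' x y L b} = ?H x \<times> ?H y"
  using mem uv by (auto simp: space_pair_measure space_P)
 also have "measure (P v \<Otimes>\<^sub>M P v) (?H x \<times> ?H y) = measure (P v) (?H x) * measure (P v) (?H y)"
  using exits_event[OF uv(2) L] by (simp add: measure_def v.emeasure_pair_measure_Times enn2real_mult)
 also have "... = (measure (P v) (?H 0))\<^sup>2"
  unfolding exits_prob_translate[OF uv(2) L, of b x] exits_prob_translate[OF uv(2) L, of b y] by (simp add: power2_eq_square)
 finally show ?thesis by simp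
qed

text \<open>The sign \<open>\<sigma>\<close> records the direction of sprinkling. If passage times
  decrease in the configuration, fast exits are increasing events and are compared with a larger
  parameter, \<open>\<sigma> = 1\<close>; otherwise with a smaller one. \<open>K\<close> is the
  range of the local dependence.\<close>

lemma decouple:
 obtains \<sigma> Rp Lp \<xi> C \<eta> \<epsilon> a\<^sub>P K :: real where "\<sigma> = 1 \<or> \<sigma> = -1" "Rp > 0" "Lp > 0" "\<xi> > 1" "C > 0" "\<eta> > 0" "\<epsilon> > 0" "a\<^sub>P > 0" "K >= 0"
  "\<And>R l x y L b u v. R >= Rp ==> l >= Lp ==> l >= 1 ==> u \<in> I ==> v \<in> I ==> \<sigma> * (v - u) >= R powr (- \<eta>) ==> L >= 0 ==> L + 1 + K <= l powr \<xi> ==>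
   R * l + 2 * l powr \<xi> <= linfnorm (x - y) ==>
   measure (P u) {\<omega> \<in> space \<Omega>. exits (etime \<omega>) L b x \<and> exits (etime \<omega>) L b y}
    <= exp (- C * exp (a\<^sub>P * (ln l) powr \<epsilon>)) + (measure (P v) {\<omega> \<in> space \<Omega>. exits (etime \<omega>) L b 0})\<^sup>2"
proof -
 obtain K where K: "K >= 0" "\<And>z L r. L >= 0 ==> L + K <= r ==> covers (box_region z r) (box z L)"
  using covers_exists by blast
 define \<sigma> :: real where "\<sigma> = (if antimono_on passage_space (passage_time a \<theta>) then 1 else -1)"
 show ?thesis using P3 unfolding cond_P3_def
 proof (elim exE conjE, goal_cases)
  case (1 Rp Lp \<xi> \<epsilon> aP C \<eta> f)
  note pos = 1(1-7) and f0 = 1(9) and main0 = 1(10)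
 have f: "f L >= exp (aP * (ln L) powr \<epsilon>)" if "L >= Lp" "L >= 1" for L using f0 that by blast
 have step: "measure (P u) {\<omega> \<in> space \<Omega>. exits (etime \<omega>) L b x \<and> exits (etime \<omega>) L b y}
    <= exp (- C * exp (aP * (ln l) powr \<epsilon>)) + (measure (P v) {\<omega> \<in> space \<Omega>. exits (etime \<omega>) L b 0})\<^sup>2"
  if R: "R >= Rp" and l: "l >= Lp" "l >= 1" and uv: "u \<in> I" "v \<in> I" and s: "\<sigma> * (v - u) >= R powr (- \<eta>)" and L: "L >= 0" "L + 1 + K <= l powr \<xi>"
   and dist: "R * l + 2 * l powr \<xi> <= linfnorm (x - y)" for R l x y L b u v
 proof -
  let ?Q = "box_region x (l powr \<xi>)" and ?Q' = "box_region y (l powr \<xi>)"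
  have cov: "covers ?Q (box x (L + 1))" "covers ?Q' (box y (L + 1))" using L by (intro K; simp)+
  have rd: "region_dist ?Q ?Q' >= R * l" using box_region_dist[of "l powr \<xi>" x y] dist by simp
  have e: "exp (- C * f l) <= exp (- C * exp (aP * (ln l) powr \<epsilon>))" using f[OF l] pos by simp
  note m = main0[rule_format, OF R l(1), of x y, unfolded Let_def, rule_format, OF rd]
  have "measure (P u) {\<omega> \<in> space \<Omega>. exits (etime \<omega>) L b x \<and> exits (etime \<omega>) L b y}
    <= exp (- C * f l) + (measure (P v) {\<omega> \<in> space \<Omega>. exits (etime \<omega>) L b 0})\<^sup>2"
  proof (cases "antimono_on passage_space (passage_time a \<theta>)")
   case True
   then have "v >= u + R powr (- \<eta>)" using s by (simp add: \<sigma>_def)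
   from m[OF uv(2,1) this, THEN conjunct1] obtain M' B where
    MB: "extension_of (P u) M'" "B \<in> sets M'" "measure M' (space M' - B) <= exp (- C * f l)"
    and le: "\<And>A. increasing_event (region_space ME MV ?Q \<Otimes>\<^sub>M region_space ME MV ?Q') A ==>
           measure M' {(\<omega>, s) \<in> B. (restrict_config ?Q \<omega>, restrict_config ?Q' \<omega>) \<in> A}
           <= measure (P v \<Otimes>\<^sub>M P v) {(\<omega>\<^sub>1, \<omega>\<^sub>2) \<in> space (P v \<Otimes>\<^sub>M P v). (restrict_config ?Q \<omega>\<^sub>1, restrict_config ?Q' \<omega>\<^sub>2) \<in> A}"
    by blast
   show ?thesis by (rule decouple_step[OF uv L(1) cov MB le[OF pair_event(2)[OF L(1) cov True]]])
  next
   case False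
   then have "u >= v + R powr (- \<eta>)" using s by (simp add: \<sigma>_def)
   from m[OF uv this, THEN conjunct2] obtain M' B where
    MB: "extension_of (P u) M'" "B \<in> sets M'" "measure M' (space M' - B) <= exp (- C * f l)"
    and le: "\<And>A. decreasing_event (region_space ME MV ?Q \<Otimes>\<^sub>M region_space ME MV ?Q') A ==>
           measure M' {(\<omega>, s) \<in> B. (restrict_config ?Q \<omega>, restrict_config ?Q' \<omega>) \<in> A}
           <= measure (P v \<Otimes>\<^sub>M P v) {(\<omega>\<^sub>1, \<omega>\<^sub>2) \<in> space (P v \<Otimes>\<^sub>M P v). (restrict_config ?Q \<omega>\<^sub>1, restrict_config ?Q' \<omega>\<^sub>2) \<in> A}"
    by blast
   have mono: "mono_on passage_space (passage_time a \<theta>)" using False pass_mono by (simp add: monotone_fun_on_def)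
   show ?thesis by (rule decouple_step[OF uv L(1) cov MB le[OF pair_event(1)[OF L(1) cov mono]]])
  qed
  then show ?thesis using e by linarith
 qed
 have "\<sigma> = 1 \<or> \<sigma> = -1" by (simp add: \<sigma>_def)
 from that[OF this pos(1,2,3,6,7,4,5) K(1) step] show ?case .
 qed
qed

end

text \<open>The hypothesis on \<open>b'\<close> in \<open>bad_pair\<close> for
  \<open>L = s ^ 4\<close> and \<open>L' = s ^ 6\<close>. The relative loss of speed, about
  \<open>13 / s\<^sup>2\<close>, is covered by the difference of \<open>28 / s\<^sup>2\<close> and
  \<open>28 / s ^ 3\<close>.\<close>

lemma scale_arith:
 fixes s :: real assumes s: "s >= 100" and c: "c > 0"
 shows "c * (1 + 28 / s ^ 3) * s ^ 6 * (s ^ 4 + 1) <= c * (1 + 28 / s\<^sup>2) * s ^ 4 * (s ^ 6 - 13 * s ^ 4)"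
proof -
 have s3: "s ^ 3 > 0" using s by simp
 have frac: "(1 + 28 / x) * x = x + 28" if "x ~= 0" for x :: real using that by (simp add: distrib_right)
 have "28 * s ^ 4 + s ^ 3 + 28 <= 15 * s ^ 5 - 364 * s ^ 3"
 proof -
  have a: "100 * s ^ 4 <= s ^ 5" using s mult_right_mono[of 100 s "s ^ 4"] by (simp add: power_numeral_reduce)
  have b: "100 * s ^ 3 <= s ^ 4" using s mult_right_mono[of 100 s "s ^ 3"] by (simp add: power_numeral_reduce)
  have "100 ^ 3 <= s ^ 3" using s by (intro power_mono) auto
  then show ?thesis using a b by simp
 qed
 then have "(s ^ 3 + 28) * (s ^ 4 + 1) <= (s\<^sup>2 + 28) * s ^ 3 * (s\<^sup>2 - 13)"
  by (simp add: algebra_simps power_numeral_reduce)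
 then have *: "(s ^ 3 + 28) * (s ^ 4 + 1) * s ^ 3 <= (s\<^sup>2 + 28) * s ^ 3 * (s\<^sup>2 - 13) * s ^ 3"
  using s3 by (intro mult_right_mono) auto
 have X: "(1 + 28 / s ^ 3) * s ^ 6 * (s ^ 4 + 1) = (s ^ 3 + 28) * (s ^ 4 + 1) * s ^ 3"
 proof -
  have a: "(1 + 28 / s ^ 3) * s ^ 3 = s ^ 3 + 28" by (rule frac) (use s in auto)
  have b: "s ^ 6 = s ^ 3 * s ^ 3" by (simp add: power_add[symmetric])
  have "(1 + 28 / s ^ 3) * s ^ 6 * (s ^ 4 + 1) = (1 + 28 / s ^ 3) * s ^ 3 * (s ^ 4 + 1) * s ^ 3" unfolding b by (simp only: mult_ac)
  then show ?thesis unfolding a .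
 qed
 have Y: "(1 + 28 / s\<^sup>2) * s ^ 4 * (s ^ 6 - 13 * s ^ 4) = (s\<^sup>2 + 28) * s ^ 3 * (s\<^sup>2 - 13) * s ^ 3"
 proof -
  have "(1 + 28 / s\<^sup>2) * s\<^sup>2 = s\<^sup>2 + 28" by (rule frac) (use s in auto)
  moreover have "s ^ 4 = s\<^sup>2 * s\<^sup>2" by (simp add: power_add[symmetric])
  ultimately have a: "(1 + 28 / s\<^sup>2) * s ^ 4 = (s\<^sup>2 + 28) * s\<^sup>2" by (simp only: mult.assoc[symmetric])
  have b: "s\<^sup>2 * (s ^ 6 - 13 * s ^ 4) = s ^ 3 * (s\<^sup>2 - 13) * s ^ 3" by (simp add: algebra_simps power_numeral_reduce)
  have "(1 + 28 / s\<^sup>2) * s ^ 4 * (s ^ 6 - 13 * s ^ 4) = (s\<^sup>2 + 28) * (s\<^sup>2 * (s ^ 6 - 13 * s ^ 4))" unfolding a by (simp only: mult.assoc)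
  then show ?thesis unfolding b by (simp only: mult.assoc)
 qed
 have "c * ((1 + 28 / s ^ 3) * s ^ 6 * (s ^ 4 + 1)) <= c * ((1 + 28 / s\<^sup>2) * s ^ 4 * (s ^ 6 - 13 * s ^ 4))"
  unfolding X Y using * c by (intro mult_left_mono) auto
 then show ?thesis by (simp only: mult.assoc)
qed

text \<open>The union bound over pairs of points loses \<open>s ^ (12 * d)\<close> up to constants.
  From \<open>64 * d\<close> this leaves \<open>52 * d\<close>, of which \<open>4 * d\<close> absorb
  the constants; the remaining \<open>48 * d\<close> is the exponent \<open>32 * d\<close> at the
  next scale \<open>s powr (3 / 2)\<close>.\<close>

lemma prob_arith:
 fixes s :: real assumes s: "s >= 100" and d: "d >= (1::nat)"
 shows "((3 * s ^ 6) ^ d)\<^sup>2 * (1 / s ^ (64 * d) + (1 / s ^ (32 * d))\<^sup>2) <= 1 / s ^ (48 * d)"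
proof -
 have s0: "s > 0" using s by simp
 have "2 * 9 ^ d <= (18::real) ^ d"
 proof -
  have "(2::real) ^ 1 <= 2 ^ d" using d by (intro power_increasing) auto
  then have "2 * 9 ^ d <= 2 ^ d * (9::real) ^ d" by (intro mult_right_mono) auto
  also have "... = 18 ^ d" by (simp add: power_mult_distrib[symmetric])
  finally show ?thesis .
 qed
 also have "... <= s ^ d" using s by (intro power_mono) auto
 also have "... <= s ^ (4 * d)" using s by (intro power_increasing) auto
 finally have le: "2 * 9 ^ d <= s ^ (4 * d)" .
 have "((3 * s ^ 6) ^ d)\<^sup>2 * (1 / s ^ (64 * d) + (1 / s ^ (32 * d))\<^sup>2) = 2 * 9 ^ d * s ^ (12 * d) / s ^ (64 * d)"
 proof -
  have a: "((3 * s ^ 6) ^ d)\<^sup>2 = 9 ^ d * s ^ (12 * d)"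
  proof -
   have "((3 * s ^ 6) ^ d)\<^sup>2 = ((3 * s ^ 6)\<^sup>2) ^ d" by (simp only: power_mult[symmetric] mult.commute)
   also have "(3 * s ^ 6)\<^sup>2 = 9 * s ^ 12" by (simp add: power_mult_distrib power_mult[symmetric])
   finally show ?thesis by (simp only: power_mult_distrib power_mult)
  qed
  have b: "(1 / s ^ (32 * d))\<^sup>2 = 1 / s ^ (64 * d)"
  proof -
   have "(1 / s ^ (32 * d))\<^sup>2 = 1 / (s ^ (32 * d) * s ^ (32 * d))" by (simp add: power2_eq_square)
   also have "s ^ (32 * d) * s ^ (32 * d) = s ^ (64 * d)" by (simp add: power_add[symmetric])
   finally show ?thesis .
  qed
  show ?thesis unfolding a b by simp
 qed
 also have "... <= s ^ (4 * d) * s ^ (12 * d) / s ^ (64 * d)"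
  using le s0 by (intro divide_right_mono mult_right_mono) auto
 also have "... = 1 / s ^ (48 * d)"
 proof -
  have "s ^ (64 * d) = s ^ (4 * d) * s ^ (12 * d) * s ^ (48 * d)" by (simp add: power_add[symmetric])
  then show ?thesis using s0 by simp
 qed
 finally show ?thesis .
qed

section \<open>The multiscale recursion\<close>

context ordered_family
begin

definition pexit :: "real => real => real => real" where
 "pexit v L b = measure (P v) {\<omega> \<in> space \<Omega>. exits (etime \<omega>) L b 0}"

lemma exits_mono_cost: "b <= b' ==> exits \<tau> L b z ==> exits \<tau> L b' z"
 unfolding exits_def using ennreal_leI order.strict_trans2 by blast

lemma pexit_mono: "v \<in> I ==> L >= 0 ==> b <= b' ==> pexit v L b <= pexit v L b'"
 unfolding pexit_def using prob_P[of v]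
 by (intro finite_measure.finite_measure_mono exits_event prob_space.finite_measure) (auto intro: exits_mono_cost)

lemma exit_cheap_edge:
 assumes L: "L >= 0" and ex: "exits (etime \<omega>) L b z"
 shows "\<exists>y. etime \<omega> z y < ennreal b"
proof -
 obtain xs where xs: "xs ~= []" "hd xs = z" "last xs \<notin> box z L" "pcost (etime \<omega>) xs < ennreal b"
  using ex unfolding exits_def by blast
 have "z \<in> box z L" using L by (simp add: box_mem)
 then obtain y ys where "xs = z # y # ys" using xs by (cases xs; cases "tl xs") auto
 then have "etime \<omega> z y <= pcost (etime \<omega>) xs" by (simp add: add_increasing2)
 then show ?thesis using xs(4) order.strict_trans1 by blast
qed

lemma etime_pos: "\<omega> \<in> space \<Omega> ==> etime \<omega> x y > 0"
proof -
 assume "\<omega> \<in> space \<Omega>"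
 then interpret walk_env "cond \<omega>" "spd \<omega>" by (rule walk_env)
 show ?thesis using s_pos nonneg[of x y] by (auto simp: etime_def ennreal_zero_less_top)
qed

text \<open>The start of the recursion. An exit at arbitrarily small cost would use arbitrarily fast
  edges at the origin, but only finitely many edges there have finite time, and all times are
  positive; so the events decrease to the empty set.\<close>

lemma pexit_small:
 assumes v: "v \<in> I" and L: "L >= 0" and q: "q > 0"
 shows "\<exists>b>0. pexit v L b <= q"
proof -
 interpret field_prob ME MV N a \<theta> "P v" using v by (rule field_prob_P)
 define A where "A n = {\<omega> \<in> space \<Omega>. exits (etime \<omega>) L (1 / real (Suc n)) 0}" for n
 have A: "A n \<in> events" for n unfolding A_def by (rule exits_event[OF v L])
 have dec: "decseq A" unfolding decseq_def
 proof (intro allI impI subsetI)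
  fix m n \<omega> assume mn: "m <= n" and w: "\<omega> \<in> A n"
  have "1 / real (Suc n) <= 1 / real (Suc m)" using mn by (intro divide_left_mono) auto
  then show "\<omega> \<in> A m" using w exits_mono_cost[of "1 / real (Suc n)" "1 / real (Suc m)" "etime \<omega>" L 0] by (simp add: A_def)
 qed
 have "(\<Inter>n. A n) = {}"
 proof (rule ccontr)
  assume "(\<Inter>n. A n) ~= {}"
  then obtain \<omega> where "\<omega> \<in> (\<Inter>n. A n)" by (auto simp del: INT_iff)
  then have \<omega>: "\<omega> \<in> A n" for n by (rule INT_D) simp
  have sp: "\<omega> \<in> space \<Omega>" using \<omega>[of 0] by (simp add: A_def)
  define F where "F = {y. etime \<omega> 0 y < \<infinity>}"
  have "F \<subseteq> box 0 1" using step[of \<omega> 0] by (auto simp: F_def box_def)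
  then have finF: "finite F" using finite_box finite_subset by blast
  have "\<exists>y\<in>F. etime \<omega> 0 y < ennreal (1 / real (Suc n))" for n
  proof -
   obtain y where y: "etime \<omega> 0 y < ennreal (1 / real (Suc n))"
    using exit_cheap_edge[OF L] \<omega>[of n] unfolding A_def by blast
   then have "y \<in> F" unfolding F_def using order.strict_trans[OF y] by simp
   then show ?thesis using y by blast
  qed
  then have neF: "F ~= {}" by blast
  define m where "m = Min (etime \<omega> 0 ` F)"
  have m: "m > 0" "m < \<infinity>"
  proof -
   have "m \<in> etime \<omega> 0 ` F" unfolding m_def using finF neF by (intro Min_in) auto
   then show "m > 0" "m < \<infinity>" using etime_pos[OF sp] by (auto simp: F_def)
  qed
  then obtain r where r: "m = ennreal r" "r > 0" by (cases m) auto
  obtain n where n: "1 / real (Suc n) < r" using r(2) reals_Archimedean by (auto simp: inverse_eq_divide)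
  obtain y where y: "y \<in> F" "etime \<omega> 0 y < ennreal (1 / real (Suc n))" using \<open>\<And>n. \<exists>y\<in>F. etime \<omega> 0 y < ennreal (1 / real (Suc n))\<close> by blast
  have "m <= etime \<omega> 0 y" unfolding m_def using finF y(1) by (intro Min_le) auto
  also note y(2)
  finally have "r < 1 / real (Suc n)" using r by (simp add: ennreal_less_iff)
  then show False using n by simp
 qed
 then have "(\<lambda>n. prob (A n)) \<longlonglongrightarrow> 0"
  using finite_Lim_measure_decseq[OF _ dec] A by (auto simp: image_subset_iff)
 then have "eventually (\<lambda>n. prob (A n) < q) sequentially" using q by (rule order_tendstoD)
 then obtain n where "prob (A n) < q" by (auto simp: eventually_sequentially)
 then show ?thesis by (intro exI[of _ "1 / real (Suc n)"]) (auto simp: pexit_def A_def)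
qed

lemma prob_exits_box:
 assumes u: "u \<in> I" and L: "L >= 0" and r: "r >= 1"
 shows "measure (P u) {\<omega> \<in> space \<Omega>. \<exists>w\<in>box 0 r. exits (etime \<omega>) L b w} <= (3 * r) ^ CARD('d) * pexit u L b"
proof -
 interpret prob_space "P u" by (rule prob_P[OF u])
 have "{\<omega> \<in> space \<Omega>. \<exists>w\<in>box 0 r. exits (etime \<omega>) L b w} = (\<Union>w\<in>box 0 r. {\<omega> \<in> space \<Omega>. exits (etime \<omega>) L b w})" by blast
 also have "prob ... <= (\<Sum>w\<in>box 0 r. prob {\<omega> \<in> space \<Omega>. exits (etime \<omega>) L b w})"
  by (intro measure_UNION_le finite_box exits_event[OF u L])
 also have "... = (\<Sum>w\<in>box (0 :: 'd vertex) r. pexit u L b)"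
  unfolding pexit_def by (rule sum.cong[OF refl exits_prob_translate[OF u L]])
 also have "... = real (card (box (0 :: 'd vertex) r)) * pexit u L b" by simp
 also have "... <= (3 * r) ^ CARD('d) * pexit u L b"
 proof (rule mult_right_mono)
  have "real (card (box (0 :: 'd vertex) r)) <= (2 * r + 1) ^ CARD('d)" using r by (intro card_box_le) auto
  also have "... <= (3 * r) ^ CARD('d)" using r by (intro power_mono) auto
  finally show "real (card (box (0 :: 'd vertex) r)) <= (3 * r) ^ CARD('d)" .
 qed (simp add: pexit_def)
 finally show ?thesis .
qed

text \<open>\<open>bad_pair\<close> and a union bound over pairs of points of the large box at
  distance at least \<open>10 * L\<close>.\<close>

lemma bad_rec:
 assumes u: "u \<in> I" and L: "L >= 3" "b > 0" "b' * (L + 1) <= b * (L' - 13 * L)" "L' >= 1"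
  and pair: "\<And>x y. linfnorm (x - y) >= 10 * L ==> measure (P u) {\<omega> \<in> space \<Omega>. exits (etime \<omega>) L b x \<and> exits (etime \<omega>) L b y} <= Q"
  and Q: "Q >= 0"
 shows "pexit u L' b' <= ((3 * L') ^ CARD('d))\<^sup>2 * Q"
proof -
 interpret prob_space "P u" by (rule prob_P[OF u])
 define S where "S = {z \<in> box (0 :: 'd vertex) L' \<times> box 0 L'. linfnorm (fst z - snd z) >= 10 * L}"
 have S: "S \<subseteq> box 0 L' \<times> box 0 L'" by (auto simp: S_def)
 then have finS: "finite S" using finite_box finite_subset by blast
 define E where "E z = {\<omega> \<in> space \<Omega>. exits (etime \<omega>) L b (fst z) \<and> exits (etime \<omega>) L b (snd z)}" for z
 have E: "E z \<in> events" for z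
 proof -
  have "E z = {\<omega> \<in> space \<Omega>. exits (etime \<omega>) L b (fst z)} \<inter> {\<omega> \<in> space \<Omega>. exits (etime \<omega>) L b (snd z)}" by (auto simp: E_def)
  then show ?thesis using exits_event[OF u] L by simp
 qed
 have "{\<omega> \<in> space \<Omega>. exits (etime \<omega>) L' b' 0} \<subseteq> (\<Union>z\<in>S. E z)"
 proof
  fix \<omega> assume "\<omega> \<in> {\<omega> \<in> space \<Omega>. exits (etime \<omega>) L' b' 0}"
  then have \<omega>: "\<omega> \<in> space \<Omega>" "exits (etime \<omega>) L' b' 0" by auto
  obtain w w' where "w \<in> box 0 L'" "w' \<in> box 0 L'" "exits (etime \<omega>) L b w" "exits (etime \<omega>) L b w'" "linfnorm (w - w') >= 10 * L"
   using bad_pair[OF L(1-3) _ \<omega>(2)] L(4) by auto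
  then have "(w, w') \<in> S" "\<omega> \<in> E (w, w')" using \<omega> by (auto simp: S_def E_def)
  then show "\<omega> \<in> (\<Union>z\<in>S. E z)" by blast
 qed
 then have "pexit u L' b' <= prob (\<Union>z\<in>S. E z)"
  unfolding pexit_def using E finS by (intro finite_measure_mono) auto
 also have "... <= (\<Sum>z\<in>S. prob (E z))" using finS E by (intro measure_UNION_le)
 also have "... <= (\<Sum>z\<in>S. Q)" unfolding E_def by (intro sum_mono pair) (auto simp: S_def)
 also have "... = real (card S) * Q" by simp
 also have "... <= ((3 * L') ^ CARD('d))\<^sup>2 * Q"
 proof (rule mult_right_mono[OF _ Q])
  have "real (card (box (0 :: 'd vertex) L')) <= (2 * L' + 1) ^ CARD('d)" using L by (intro card_box_le) auto
  also have "... <= (3 * L') ^ CARD('d)" using L by (intro power_mono) auto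
  finally have c: "real (card (box (0 :: 'd vertex) L')) <= (3 * L') ^ CARD('d)" .
  have "card S <= card (box (0 :: 'd vertex) L' \<times> box (0 :: 'd vertex) L')" by (intro card_mono S) simp
  then have "real (card S) <= real (card (box (0 :: 'd vertex) L')) * real (card (box (0 :: 'd vertex) L'))"
   by (simp add: card_cartesian_product flip: of_nat_mult)
  also have "... <= (3 * L') ^ CARD('d) * (3 * L') ^ CARD('d)" using c L by (intro mult_mono) auto
  finally show "real (card S) <= ((3 * L') ^ CARD('d))\<^sup>2" by (simp add: power2_eq_square)
 qed
 finally show ?thesis .
qed

end

text \<open>Even for small \<open>e\<close>, \<open>exp (a * (ln l) powr e)\<close> outgrows every
  multiple of \<open>ln l\<close>; the limit is taken in the variable \<open>ln s\<close>.\<close>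

lemma stretched_exp_dominates:
 fixes C a e \<xi> :: real and m :: nat
 assumes "C > 0" "a > 0" "e > 0" "\<xi> > 0"
 shows "eventually (\<lambda>s. exp (- C * exp (a * (ln ((3 * s ^ 4) powr (1 / \<xi>))) powr e)) <= 1 / s ^ m) at_top"
proof -
 have "filterlim (\<lambda>x. C * exp (a * ((ln 3 + 4 * x) / \<xi>) powr e) - real m * x) at_top at_top"
  using assms by real_asymp
 then have "eventually (\<lambda>x. C * exp (a * ((ln 3 + 4 * x) / \<xi>) powr e) - real m * x >= 0) at_top"
  by (simp only: filterlim_at_top)
 then have "eventually (\<lambda>s. C * exp (a * ((ln 3 + 4 * ln s) / \<xi>) powr e) - real m * ln s >= 0) at_top"
  using ln_at_top by (rule eventually_compose_filterlim)
 then show ?thesis using eventually_gt_at_top[of 0]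
 proof eventually_elim
  case (elim s)
  have lnx: "ln ((3 * s ^ 4) powr (1 / \<xi>)) = (ln 3 + 4 * ln s) / \<xi>" using elim assms(4) by (simp add: ln_mult ln_realpow)
  have "exp (- C * exp (a * (ln ((3 * s ^ 4) powr (1 / \<xi>))) powr e)) <= exp (- (real m * ln s))" unfolding lnx using elim(1) by simp
  also have "... = 1 / s ^ m" using elim by (simp add: exp_minus exp_of_nat_mult inverse_eq_divide)
  finally show ?case .
 qed
qed

text \<open>The recursion involves \<open>s'\<close> only through even powers, and these are integer
  powers of \<open>s\<close>.\<close>

lemma scale_powers:
 fixes s s' :: real
 assumes "s' = s powr (3 / 2)" "s > 0"
 shows "s'\<^sup>2 = s ^ 3" "s' ^ 4 = s ^ 6" "s' ^ (32 * n) = s ^ (48 * n)"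
proof -
 have "s'\<^sup>2 = s powr 3" by (simp add: assms(1) power2_eq_square powr_add[symmetric])
 then show sq: "s'\<^sup>2 = s ^ 3" using assms(2) by simp
 have "s' ^ 4 = (s'\<^sup>2)\<^sup>2" "s' ^ (32 * n) = (s'\<^sup>2) ^ (16 * n)" by (simp_all add: power_mult[symmetric])
 then show "s' ^ 4 = s ^ 6" "s' ^ (32 * n) = s ^ (48 * n)" unfolding sq by (simp_all add: power_mult[symmetric])
qed

context ordered_family
begin

text \<open>
 Sprinkling: the parameters \<open>v n\<close> approach \<open>u\<close> from the side on which (P3) applies to the event
 \<open>exits\<close>, the gaps being powers of the scales \<open>s n ^ 4\<close>. The speed loses only a summable
 amount per scale, which the factor \<open>1 + 28 / (s n) ^ 2\<close> makes explicit.
\<close>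

lemma exit_prob_scales:
 assumes "open I" and u: "u \<in> I"
 obtains s :: "nat => real" and c where "c > 0" "\<And>n. s n >= 100" "\<And>n. s (Suc n) = s n powr (3 / 2)"
  "\<And>n. pexit u (s (Suc n) ^ 4) (c * s (Suc n) ^ 4) <= 1 / s (Suc n) ^ (32 * CARD('d))"
proof -
 let ?d = "CARD('d)"
 obtain \<sigma> Rp Lp \<xi> C \<eta> \<epsilon> aP K :: real where sg: "\<sigma> = 1 \<or> \<sigma> = -1" and pos: "Rp > 0" "Lp > 0" "\<xi> > 1" "C > 0" "\<eta> > 0" "\<epsilon> > 0" "aP > 0" "K >= 0"
  and dec: "\<And>R l x y L b u v. R >= Rp ==> l >= Lp ==> l >= 1 ==> u \<in> I ==> v \<in> I ==> \<sigma> * (v - u) >= R powr (- \<eta>) ==> L >= 0 ==> L + 1 + K <= l powr \<xi> ==>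
   R * l + 2 * l powr \<xi> <= linfnorm (x - y) ==>
   measure (P u) {\<omega> \<in> space \<Omega>. exits (etime \<omega>) L b x \<and> exits (etime \<omega>) L b y}
    <= exp (- C * exp (aP * (ln l) powr \<epsilon>)) + (measure (P v) {\<omega> \<in> space \<Omega>. exits (etime \<omega>) L b 0})\<^sup>2"
  by (rule decouple) (rule that)
 \<comment> \<open>With \<open>R = (s ^ 4) powr (1 - 1 / \<xi>)\<close> the sprinkling
   \<open>R powr (- \<eta>)\<close> is \<open>(s ^ 4) powr (- h)\<close>.\<close>
 define h where "h = \<eta> * (1 - 1 / \<xi>)"
 have x1: "1 - 1 / \<xi> > 0" "1 / \<xi> > 0" "1 / \<xi> <= 1" using pos(3) by auto
 have h: "h > 0" using x1 pos by (simp add: h_def)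
 obtain \<rho> where \<rho>: "\<rho> > 0" "\<And>v. dist v u < \<rho> ==> v \<in> I" using \<open>open I\<close> u unfolding open_dist by blast
 \<comment> \<open>All requirements on a scale hold for every large \<open>s\<close>; the first
   scale is taken beyond the threshold, and the scales increase.\<close>
 have "eventually (\<lambda>s. s >= 100 \<and> (s ^ 4) powr (1 - 1 / \<xi>) >= Rp \<and> (3 * s ^ 4) powr (1 / \<xi>) >= max Lp 1 \<and> s ^ 4 + 1 + K <= 3 * s ^ 4 \<and>
  exp (- C * exp (aP * (ln ((3 * s ^ 4) powr (1 / \<xi>))) powr \<epsilon>)) <= 1 / s ^ (64 * ?d) \<and> (s\<^sup>2) powr (- h) <= 1 / 2 \<and> 2 * (s ^ 4) powr (- h) < \<rho>) at_top"
 proof (intro eventually_conj eventually_ge_at_top)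
  show "eventually (\<lambda>s. exp (- C * exp (aP * (ln ((3 * s ^ 4) powr (1 / \<xi>))) powr \<epsilon>)) <= 1 / s ^ (64 * ?d)) at_top"
   using pos by (intro stretched_exp_dominates) auto
  have "filterlim (\<lambda>s::real. (s ^ 4) powr y) at_top at_top" if "y > 0" for y :: real using that by real_asymp
  from this[OF x1(1)] have "filterlim (\<lambda>s::real. (s ^ 4) powr (1 - 1 / \<xi>)) at_top at_top" .
  then show "eventually (\<lambda>s. Rp <= (s ^ 4) powr (1 - 1 / \<xi>)) at_top" by (simp add: filterlim_at_top)
  have "filterlim (\<lambda>s::real. (3 * s ^ 4) powr (1 / \<xi>)) at_top at_top" using x1 by real_asymp
  then show "eventually (\<lambda>s. max Lp 1 <= (3 * s ^ 4) powr (1 / \<xi>)) at_top" by (simp only: filterlim_at_top)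
  have "filterlim (\<lambda>s::real. 2 * s ^ 4 - 1) at_top at_top" by real_asymp
  then have "eventually (\<lambda>s::real. K <= 2 * s ^ 4 - 1) at_top" by (simp only: filterlim_at_top)
  then show "eventually (\<lambda>s. s ^ 4 + 1 + K <= 3 * s ^ 4) at_top" by eventually_elim simp
  have "((\<lambda>s::real. (s\<^sup>2) powr (- h)) \<longlongrightarrow> 0) at_top" using h by real_asymp
  then have "eventually (\<lambda>s. (s\<^sup>2) powr (- h) < 1 / 2) at_top" by (rule order_tendstoD) simp
  then show "eventually (\<lambda>s. (s\<^sup>2) powr (- h) <= 1 / 2) at_top" by eventually_elim simp
  have "((\<lambda>s::real. 2 * (s ^ 4) powr (- h)) \<longlongrightarrow> 0) at_top" using h by real_asymp
  then show "eventually (\<lambda>s. 2 * (s ^ 4) powr (- h) < \<rho>) at_top" using \<rho>(1) by (rule order_tendstoD)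
 qed
 then obtain S where S: "\<And>s. s >= S ==> s >= 100 \<and> (s ^ 4) powr (1 - 1 / \<xi>) >= Rp \<and> (3 * s ^ 4) powr (1 / \<xi>) >= max Lp 1 \<and> s ^ 4 + 1 + K <= 3 * s ^ 4 \<and>
  exp (- C * exp (aP * (ln ((3 * s ^ 4) powr (1 / \<xi>))) powr \<epsilon>)) <= 1 / s ^ (64 * ?d) \<and> (s\<^sup>2) powr (- h) <= 1 / 2 \<and> 2 * (s ^ 4) powr (- h) < \<rho>"
  unfolding eventually_at_top_linorder by blast
 define s :: "nat => real" where "s = rec_nat S (\<lambda>_ s. s powr (3 / 2))"
 have s0: "s 0 = S" and sSuc: "s (Suc n) = s n powr (3 / 2)" for n by (simp_all add: s_def)
 have sS: "s n >= S" for n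
 proof (induction n)
  case (Suc n)
  have "s n >= 100" using S[OF Suc] by blast
  then have "s n powr 1 <= s n powr (3 / 2)" by (intro powr_mono) auto
  then show ?case using Suc \<open>s n >= 100\<close> by (simp add: sSuc)
 qed (simp add: s0)
 have s100: "s n >= 100" for n using S[OF sS] by blast
 have "s n > 0" for n using s100[of n] by simp
 note sq = scale_powers(1)[OF sSuc this] and s4 = scale_powers(2)[OF sSuc this] and s32 = scale_powers(3)[OF sSuc this]
 \<comment> \<open>Twice the sprinkling at scale \<open>n\<close>. Since
   \<open>\<delta> (Suc n)\<close> is at most half of \<open>\<delta> n\<close>, the step from
   \<open>v n\<close> to \<open>v (Suc n)\<close> and the step from \<open>v n\<close> to
   \<open>u\<close> are both long enough.\<close>
 define \<delta> where "\<delta> n = 2 * (s n ^ 4) powr (- h)" for n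
 define v where "v n = u + \<sigma> * \<delta> n" for n
 have vI: "v n \<in> I" for n
 proof (rule \<rho>(2))
  have "dist (v n) u = \<delta> n" using sg by (auto simp: v_def dist_real_def \<delta>_def)
  then show "dist (v n) u < \<rho>" using S[OF sS, of n] by (simp add: \<delta>_def)
 qed
 have gap0: "\<sigma> * (v n - u) >= (s n ^ 4) powr (- h)" for n using sg by (auto simp: v_def \<delta>_def)
 have gap: "\<sigma> * (v n - v (Suc n)) >= (s n ^ 4) powr (- h)" for n
 proof -
  have "s n ^ 6 = s n ^ 4 * (s n)\<^sup>2" by (simp add: power_add[symmetric])
  then have "(s n ^ 6) powr (- h) = (s n ^ 4) powr (- h) * ((s n)\<^sup>2) powr (- h)" using s100[of n] by (simp only: powr_mult)
  also have "... <= (s n ^ 4) powr (- h) * (1 / 2)" using S[OF sS, of n] by (intro mult_left_mono) auto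
  finally have "\<delta> (Suc n) <= (s n ^ 4) powr (- h)" by (simp add: \<delta>_def s4)
  then have "\<delta> n - \<delta> (Suc n) >= (s n ^ 4) powr (- h)" by (simp add: \<delta>_def)
  moreover have "\<sigma> * (v n - v (Suc n)) = \<delta> n - \<delta> (Suc n)" using sg by (auto simp: v_def)
  ultimately show ?thesis by simp
 qed
 have rec: "pexit u' (s (Suc n) ^ 4) (c * (1 + 28 / (s (Suc n))\<^sup>2) * s (Suc n) ^ 4) <= 1 / s (Suc n) ^ (32 * ?d)"
  if u': "u' \<in> I" and gp: "\<sigma> * (v n - u') >= (s n ^ 4) powr (- h)" and c: "c > 0"
   and IH: "pexit (v n) (s n ^ 4) (c * (1 + 28 / (s n)\<^sup>2) * s n ^ 4) <= 1 / s n ^ (32 * ?d)" for u' n c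
 proof -
  let ?s = "s n"
  define L where "L = ?s ^ 4"
  define b where "b = c * (1 + 28 / ?s\<^sup>2) * ?s ^ 4"
  have sn: "?s >= 100" by (rule s100)
  note Sn = S[OF sS, of n]
  \<comment> \<open>This choice gives \<open>l powr \<xi> = 3 * L\<close>, room for all coordinates
    on which an exit depends, and \<open>R * l <= 3 * L\<close>. Hence
    \<open>R * l + 2 * l powr \<xi> <= 9 * L\<close>, below the distance \<open>10 * L\<close> of
    the bad points.\<close>
  define R where "R = L powr (1 - 1 / \<xi>)"
  define l where "l = (3 * L) powr (1 / \<xi>)"
  have "100 ^ 4 <= L" unfolding L_def using sn by (intro power_mono) auto
  then have L: "L >= 100" by simp
  have lx: "l powr \<xi> = 3 * L" using L pos(3) by (simp add: l_def powr_powr)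
  have Rl: "R * l <= 3 * L"
  proof -
   have "R * l = L powr (1 - 1 / \<xi>) * (3 powr (1 / \<xi>) * L powr (1 / \<xi>))" using L by (simp add: R_def l_def powr_mult)
   also have "... = 3 powr (1 / \<xi>) * (L powr (1 - 1 / \<xi>) * L powr (1 / \<xi>))" by simp
   also have "L powr (1 - 1 / \<xi>) * L powr (1 / \<xi>) = L" using L by (simp add: powr_add[symmetric])
   also have "3 powr (1 / \<xi>) * L <= 3 powr 1 * L" using L x1 by (intro mult_right_mono powr_mono) auto
   finally show ?thesis by simp
  qed
  have Rh: "R powr (- \<eta>) = (?s ^ 4) powr (- h)" by (simp add: R_def L_def h_def powr_powr mult.commute)
  have q: "pexit (v n) L b >= 0" by (simp add: pexit_def)
  have pair: "measure (P u') {\<omega> \<in> space \<Omega>. exits (etime \<omega>) L b x \<and> exits (etime \<omega>) L b y} <= 1 / ?s ^ (64 * ?d) + (1 / ?s ^ (32 * ?d))\<^sup>2"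
   if xy: "linfnorm (x - y) >= 10 * L" for x y
  proof -
   have "measure (P u') {\<omega> \<in> space \<Omega>. exits (etime \<omega>) L b x \<and> exits (etime \<omega>) L b y} <=
    exp (- C * exp (aP * (ln l) powr \<epsilon>)) + (measure (P (v n)) {\<omega> \<in> space \<Omega>. exits (etime \<omega>) L b 0})\<^sup>2"
   proof (rule dec[OF _ _ _ u' vI])
    show "Rp <= R" using Sn by (simp add: R_def L_def)
    show "Lp <= l" "1 <= l" using Sn by (simp_all add: l_def L_def)
    show "R powr (- \<eta>) <= \<sigma> * (v n - u')" using gp by (simp add: Rh)
    show "0 <= L" using L by simp
    show "L + 1 + K <= l powr \<xi>" unfolding lx using Sn by (simp add: L_def)
    show "R * l + 2 * l powr \<xi> <= linfnorm (x - y)" unfolding lx using Rl xy L by linarith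
   qed
   also have "... <= 1 / ?s ^ (64 * ?d) + (1 / ?s ^ (32 * ?d))\<^sup>2"
   proof (intro add_mono power_mono)
    show "exp (- C * exp (aP * (ln l) powr \<epsilon>)) <= 1 / ?s ^ (64 * ?d)" using Sn unfolding l_def L_def by blast
    show "measure (P (v n)) {\<omega> \<in> space \<Omega>. exits (etime \<omega>) L b 0} <= 1 / ?s ^ (32 * ?d)"
     using IH unfolding pexit_def L_def b_def .
   qed simp
   finally show ?thesis .
  qed
  have "pexit u' (?s ^ 6) (c * (1 + 28 / ?s ^ 3) * ?s ^ 6) <= ((3 * ?s ^ 6) ^ ?d)\<^sup>2 * (1 / ?s ^ (64 * ?d) + (1 / ?s ^ (32 * ?d))\<^sup>2)"
  proof (rule bad_rec[OF u' _ _ _ _ pair])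
   show "3 <= L" using L by simp
   have "1 + 28 / ?s\<^sup>2 > 0" by (intro add_pos_nonneg) auto
   then show "b > 0" unfolding b_def using c sn by simp
   show "c * (1 + 28 / ?s ^ 3) * ?s ^ 6 * (L + 1) <= b * (?s ^ 6 - 13 * L)"
    unfolding L_def b_def by (rule scale_arith[OF sn c])
   show "1 <= ?s ^ 6" using sn by (intro one_le_power) auto
   show "0 <= 1 / ?s ^ (64 * ?d) + (1 / ?s ^ (32 * ?d))\<^sup>2" using sn by (intro add_nonneg_nonneg) auto
  qed
  also have "... <= 1 / ?s ^ (48 * ?d)" using sn by (rule prob_arith) simp
  finally show ?thesis unfolding s4 sq s32 .
 qed
 obtain b where b: "b > 0" "pexit (v 0) (s 0 ^ 4) b <= 1 / s 0 ^ (32 * ?d)"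
  using pexit_small[OF vI, of "s 0 ^ 4" "1 / s 0 ^ (32 * ?d)" 0] s100[of 0] by auto
 \<comment> \<open>Normalised so that the cost at scale 0 is \<open>b\<close>.\<close>
 define c where "c = b / ((1 + 28 / (s 0)\<^sup>2) * s 0 ^ 4)"
 have den: "(1 + 28 / (s 0)\<^sup>2) * s 0 ^ 4 > 0" using s100[of 0] by (intro mult_pos_pos add_pos_nonneg) auto
 have c: "c > 0" using b den by (simp add: c_def)
 have cb: "c * (1 + 28 / (s 0)\<^sup>2) * s 0 ^ 4 = b"
 proof -
  have "c * ((1 + 28 / (s 0)\<^sup>2) * s 0 ^ 4) = b" unfolding c_def by (rule nonzero_eq_divide_eq[THEN iffD1, OF _ refl]) (use den in linarith)
  then show ?thesis by (simp only: mult.assoc)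
 qed
 have all: "pexit (v n) (s n ^ 4) (c * (1 + 28 / (s n)\<^sup>2) * s n ^ 4) <= 1 / s n ^ (32 * ?d)" for n
 proof (induction n)
  case 0
  show ?case unfolding cb by (rule b)
 next
  case (Suc n)
  show ?case by (rule rec[OF vI gap c Suc])
 qed
 \<comment> \<open>One last sprinkling leads from \<open>v n\<close> directly to \<open>u\<close>,
   separately at every scale, so no limit in the parameter is taken.\<close>
 have fin: "pexit u (s (Suc n) ^ 4) (c * s (Suc n) ^ 4) <= 1 / s (Suc n) ^ (32 * ?d)" for n
 proof -
  have s1: "s (Suc n) ^ 4 >= 0" using s100[of "Suc n"] by simp
  have "c * 1 * s (Suc n) ^ 4 <= c * (1 + 28 / (s (Suc n))\<^sup>2) * s (Suc n) ^ 4"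
   using c s1 by (intro mult_right_mono mult_left_mono) auto
  then have "pexit u (s (Suc n) ^ 4) (c * s (Suc n) ^ 4) <= pexit u (s (Suc n) ^ 4) (c * (1 + 28 / (s (Suc n))\<^sup>2) * s (Suc n) ^ 4)"
   using s1 by (intro pexit_mono[OF u]) auto
  also have "... <= 1 / s (Suc n) ^ (32 * ?d)" by (rule rec[OF u gap0 c all])
  finally show ?thesis .
 qed
 show ?thesis by (rule that[of c s, OF c s100 sSuc fin])
qed

text \<open>Borel--Cantelli over the scales: eventually no point within \<open>s ^ 20\<close> of the
  origin has a fast exit at scale \<open>s\<close>. The restriction
  \<open>linfnorm y <= linfnorm (y - z) ^ 3\<close> keeps the relevant piece of the path in that
  region, which makes the bound uniform in the starting point \<open>y\<close>.\<close>

theorem first_passage_lower_bound: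
 assumes "open I" and u: "u \<in> I"
 shows "\<exists>c>0. AE \<omega> in P u. \<exists>D\<^sub>0. \<forall>y z xs. linfnorm (y - z) >= D\<^sub>0 --> linfnorm y <= linfnorm (y - z) ^ 3 --> xs ~= [] --> hd xs = y --> last xs = z -->
  ennreal (c * linfnorm (y - z)) <= pcost (etime \<omega>) xs"
proof -
 let ?d = "CARD('d)"
 obtain s :: "nat => real" and c where c: "c > 0" and s100: "\<And>n. s n >= 100" and sSuc: "\<And>n. s (Suc n) = s n powr (3 / 2)"
  and pe: "\<And>n. pexit u (s (Suc n) ^ 4) (c * s (Suc n) ^ 4) <= 1 / s (Suc n) ^ (32 * CARD('d))"
  by (rule exit_prob_scales[OF assms]) (rule that)
 interpret prob_space "P u" by (rule prob_P[OF u])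
 have spos: "s n > 0" for n using s100[of n] by simp
 have grow: "s (Suc n) >= 10 * s n" for n
 proof -
  have "s (Suc n) = s n powr (1 / 2) * s n powr 1" unfolding sSuc by (simp only: powr_add[symmetric]) simp
  also have "s n powr (1 / 2) >= 100 powr (1 / 2)" using s100[of n] by (intro powr_mono2) auto
  then have "s n powr (1 / 2) * s n powr 1 >= 10 * s n" using spos[of n] powr_half_sqrt[of 100] real_sqrt_unique[of 10 100] by (simp add: mult_right_mono)
  finally show ?thesis .
 qed
 have s10: "s n >= 10 ^ n" for n
 proof (induction n)
  case (Suc n)
  then show ?case using grow[of n] by simp
 qed (use s100[of 0] in simp)
 note s4 = scale_powers(2)[OF sSuc spos]
 have mono: "s m <= s n" if "m <= n" for m n using that
 proof (induction n rule: dec_induct)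
  case (step k)
  then show ?case using grow[of k] spos[of k] by linarith
 qed simp
 \<comment> \<open>About \<open>s ^ (20 * d)\<close> starting points are affordable, as a fast exit
   has probability at most \<open>1 / s ^ (32 * d)\<close>; the power 20 also exceeds what
   \<open>D ^ 3 + D\<close> needs when \<open>D < 4 * s ^ 6\<close>.\<close>
 define G where "G n = {\<omega> \<in> space \<Omega>. \<exists>w\<in>box 0 (s (Suc n) ^ 20). exits (etime \<omega>) (s (Suc n) ^ 4) (c * s (Suc n) ^ 4) w}" for n
 have Gm: "G n \<in> events" for n
 proof -
  have "G n = (\<Union>w\<in>box 0 (s (Suc n) ^ 20). {\<omega> \<in> space \<Omega>. exits (etime \<omega>) (s (Suc n) ^ 4) (c * s (Suc n) ^ 4) w})" by (auto simp: G_def)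
  then show ?thesis using exits_event[OF u, of "s (Suc n) ^ 4"] spos[of "Suc n"] by (auto intro!: sets.finite_UN)
 qed
 have Gp: "prob (G n) <= (1 / 10) ^ n" for n
 proof -
  let ?s = "s (Suc n)"
  have s: "?s >= 100" by (rule s100)
  have "prob (G n) <= (3 * ?s ^ 20) ^ ?d * pexit u (?s ^ 4) (c * ?s ^ 4)"
   unfolding G_def using s by (intro prob_exits_box[OF u]) (auto simp: one_le_power)
  also have "... <= (3 * ?s ^ 20) ^ ?d * (1 / ?s ^ (32 * ?d))" using s by (intro mult_left_mono pe) auto
  also have "... <= (?s ^ 21) ^ ?d * (1 / ?s ^ (32 * ?d))"
  proof (intro mult_right_mono power_mono)
   show "3 * ?s ^ 20 <= ?s ^ 21" using s by (simp add: power_Suc[of _ 20, simplified])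
  qed (use s in auto)
  also have "... = 1 / (?s ^ 11) ^ ?d"
  proof -
   have "?s ^ (32 * ?d) = (?s ^ 21) ^ ?d * (?s ^ 11) ^ ?d" by (simp add: power_mult[symmetric] power_add[symmetric])
   then show ?thesis using s by simp
  qed
  also have "... <= 1 / ?s"
  proof -
   have "?s ^ 1 <= ?s ^ (11 * ?d)" using s by (intro power_increasing) (auto simp: Suc_le_eq)
   then show ?thesis using s by (simp add: power_mult frac_le)
  qed
  also have "... <= 1 / 10 ^ n" using s10[of n] mono[of n "Suc n"] spos[of "Suc n"] by (intro divide_left_mono mult_pos_pos) auto
  finally show ?thesis by (simp add: power_one_over)
 qed
 have "AE \<omega> in P u. eventually (\<lambda>n. \<omega> \<in> space (P u) - G n) sequentially"
 proof (rule borel_cantelli_AE1)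
  show "summable (\<lambda>n. prob (G n))"
  proof (rule summable_comparison_test)
   show "summable (\<lambda>n. (1 / 10 :: real) ^ n)" by (intro summable_geometric) simp
  qed (use Gp in \<open>auto intro!: exI[of _ 0]\<close>)
 qed (auto simp: Gm less_top[symmetric] emeasure_eq_measure)
 then have "AE \<omega> in P u. \<exists>D\<^sub>0. \<forall>y z xs. linfnorm (y - z) >= D\<^sub>0 --> linfnorm y <= linfnorm (y - z) ^ 3 --> xs ~= [] --> hd xs = y --> last xs = z -->
  ennreal (c / 8 * linfnorm (y - z)) <= pcost (etime \<omega>) xs"
 proof (rule AE_mp, intro AE_I2 impI)
  fix \<omega> assume \<omega>: "\<omega> \<in> space (P u)" and "eventually (\<lambda>n. \<omega> \<in> space (P u) - G n) sequentially"
  then obtain n0 where n0: "\<And>n. n >= n0 ==> \<omega> \<notin> G n" unfolding eventually_sequentially by blast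
  have good: "\<not> exits (etime \<omega>) (s (Suc n) ^ 4) (c * s (Suc n) ^ 4) w" if "n >= n0" "w \<in> box 0 (s (Suc n) ^ 20)" for n w
   using n0[OF that(1)] \<omega> that(2) by (auto simp: G_def space_P[OF u])
  show "\<exists>D\<^sub>0. \<forall>y z xs. linfnorm (y - z) >= D\<^sub>0 --> linfnorm y <= linfnorm (y - z) ^ 3 --> xs ~= [] --> hd xs = y --> last xs = z -->
   ennreal (c / 8 * linfnorm (y - z)) <= pcost (etime \<omega>) xs"
  proof (intro exI[of _ "4 * s (Suc n0) ^ 4"] allI impI)
   fix y z :: "'d vertex" and xs :: "'d vertex list"
   define D where "D = linfnorm (y - z)"
   assume "4 * s (Suc n0) ^ 4 <= linfnorm (y - z)" "linfnorm y <= linfnorm (y - z) ^ 3" and xs: "xs ~= []" "hd xs = y" "last xs = z"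
   then have D: "4 * s (Suc n0) ^ 4 <= D" "linfnorm y <= D ^ 3" by (simp_all add: D_def)
   have ex: "\<exists>n. D < 4 * s n ^ 4"
   proof -
    obtain n where n: "D < (10::real) ^ n" using real_arch_pow[of 10 D] by auto
    have "(10::real) ^ n <= s n" by (rule s10)
    also have "s n <= s n ^ 4" using s100[of n] by (intro self_le_power) auto
    also have "... <= 4 * s n ^ 4" using spos[of n] by simp
    finally show ?thesis using n by (meson less_le_trans)
   qed
   \<comment> \<open>The scale just before this one is used: its \<open>L\<close> satisfies
     \<open>4 * L <= D\<close>, while \<open>D\<close> is still bounded by a fixed power of the
     scale.\<close>
   define m where "m = (LEAST n. D < 4 * s n ^ 4)"
   have m1: "D < 4 * s m ^ 4" unfolding m_def using ex by (rule LeastI_ex)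
   have m2: "m > Suc n0"
   proof (rule ccontr)
    assume "\<not> m > Suc n0"
    then have "s m <= s (Suc n0)" by (intro mono) simp
    then have "s m ^ 4 <= s (Suc n0) ^ 4" using spos[of m] by (intro power_mono) auto
    then show False using m1 D(1) by simp
   qed
   then obtain n where n: "m = Suc (Suc n)" "n >= n0" by (cases m; cases "m - 1") auto
   let ?s = "s (Suc n)"
   define L where "L = ?s ^ 4"
   have s: "?s >= 100" by (rule s100)
   have L1: "L >= 100 ^ 4" unfolding L_def using s by (intro power_mono) auto
   have DL: "4 * L <= D"
    using not_less_Least[of "Suc n" "\<lambda>n. D < 4 * s n ^ 4"] n(1) unfolding m_def[symmetric] L_def by simp
   have DU: "D < 4 * ?s ^ 6" using m1 unfolding n(1) s4 .
   have D1: "D >= 1" using DL L1 by simp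
   have "D ^ 3 + D <= ?s ^ 20"
   proof -
    have "D ^ 1 <= D ^ 3" using D1 by (intro power_increasing) auto
    then have "D ^ 3 + D <= 2 * D ^ 3" by simp
    also have "... <= 2 * (4 * ?s ^ 6) ^ 3" using DU D1 by (intro mult_left_mono power_mono) auto
    also have "... = 128 * ?s ^ 18" by (simp add: power_mult_distrib power_mult[symmetric])
    also have "... <= ?s\<^sup>2 * ?s ^ 18"
    proof (rule mult_right_mono)
     have "100\<^sup>2 <= ?s\<^sup>2" using s by (intro power_mono) auto
     then show "128 <= ?s\<^sup>2" by simp
    qed (use s in simp)
    also have "... = ?s ^ 20" by (simp add: power_add[symmetric])
    finally show ?thesis .
   qed
   then have gd: "\<not> exits (etime \<omega>) L (c * L) w" if "w \<in> box y (D - 1 / 2)" for w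
   proof -
    assume le: "D ^ 3 + D <= ?s ^ 20"
    have "linfnorm w <= linfnorm (w - y) + linfnorm y" using linfnorm_triangle[of "w - y" y] by simp
    also have "... <= D + D ^ 3" using that D(2) by (simp add: box_mem)
    also have "... <= ?s ^ 20" using le by simp
    finally show ?thesis unfolding L_def using good[OF n(2), of w] by (simp add: box_mem)
   qed
   \<comment> \<open>Subtracting 1/2 leaves \<open>z\<close> outside the box. The path is cut where
     it first leaves the box, so all earlier points lie in the controlled region.\<close>
   have "z \<notin> box y (D - 1 / 2)" by (simp add: box_def D_def)
   then have "last xs \<notin> box y (D - 1 / 2)" using xs(3) by simp
   moreover have "D - 1 / 2 >= 0" using D1 by simp
   ultimately obtain us v vs where us: "xs = us @ v # vs" "us ~= []" "hd us = y" "set us \<subseteq> box y (D - 1 / 2)" "v \<notin> box y (D - 1 / 2)"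
    by (rule exit_prefix[OF xs(2,1)]) (rule that)
   show "ennreal (c / 8 * linfnorm (y - z)) <= pcost (etime \<omega>) xs"
   proof (rule ccontr)
    assume "\<not> ?thesis"
    then have "pcost (etime \<omega>) xs < ennreal (c / 8 * D)" by (simp add: D_def)
    moreover have "pcost (etime \<omega>) (us @ [v]) <= pcost (etime \<omega>) xs" unfolding us(1) pcost_append[of _ us v vs] by simp
    ultimately have lt: "pcost (etime \<omega>) (us @ [v]) < ennreal (c / 8 * D)" by (rule order.strict_trans1[rotated])
    define C where "C = enn2real (pcost (etime \<omega>) (us @ [v]))"
    have C: "pcost (etime \<omega>) (us @ [v]) = ennreal C" "C >= 0" using lt by (auto simp: C_def order.strict_trans)
    have Clt: "C < c / 8 * D" using lt C by (simp add: ennreal_less_iff)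
    have "c * L * (linfnorm (hd (us @ [v]) - last (us @ [v])) / (L + 1) - 1) <= C"
     using c L1 us(4) gd C by (intro travel) auto
    then have t: "c * L * (linfnorm (y - v) / (L + 1) - 1) <= C" using us(2,3) by simp
    have yv: "linfnorm (y - v) > D - 1 / 2" using us(5) by (simp add: box_def)
    have "D / 4 / (2 * L) <= (D - 1 / 2 - (L + 1)) / (L + 1)" using DL L1 D1 by (intro frac_le) auto
    also have "... = (D - 1 / 2) / (L + 1) - 1"
    proof -
     have "(L + 1) / (L + 1) = 1" using L1 by simp
     then show ?thesis by (simp only: diff_divide_distrib)
    qed
    also have "... <= linfnorm (y - v) / (L + 1) - 1" using yv L1 by (intro diff_right_mono divide_right_mono) auto
    finally have "c * L * (D / 4 / (2 * L)) <= c * L * (linfnorm (y - v) / (L + 1) - 1)"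
     using c L1 by (intro mult_left_mono) auto
    then have "c * L * (D / 4 / (2 * L)) <= C" using t by linarith
    moreover have "c * L * (D / 4 / (2 * L)) = c / 8 * D" using L1 by simp
    ultimately show False using Clt by simp
   qed
  qed
 qed
 then show ?thesis using c by (intro exI[of _ "c / 8"]) simp
qed

end

section \<open>Heat kernel bounds\<close>

text \<open>
 The truncation at \<open>K\<close> keeps the first passage distance finite between points that are not joined by
 an open path, so that uniqueness of the infinite cluster is not required.
\<close>

definition tdist :: "('s => 's => ennreal) => real => 's => 's => real" where
 "tdist \<tau> K x z = Inf (insert K {r. r >= 0 \<and> (\<exists>xs. xs ~= [] \<and> hd xs = x \<and> last xs = z \<and> pcost \<tau> xs <= ennreal r)})"

lemma pcost_rev:
 assumes sym: "\<And>x y. \<tau> x y = \<tau> y x"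
 shows "pcost \<tau> (rev xs) = pcost \<tau> xs"
proof (induction xs)
 case (Cons x xs)
 show ?case
 proof (cases xs)
  case (Cons y ys)
  have "pcost \<tau> (rev (x # xs)) = pcost \<tau> (rev ys @ y # [x])" by (simp add: Cons)
  also have "... = pcost \<tau> (rev xs) + \<tau> y x" unfolding pcost_append[of \<tau> "rev ys" y "[x]"] by (simp add: Cons)
  finally show ?thesis using Cons.IH sym[of x y] by (simp add: Cons add.commute)
 qed simp
qed simp

context
 fixes \<tau> :: "'s => 's => ennreal" and K :: real
 assumes K: "K >= 0"
begin

lemma tdist_bdd: "bdd_below (insert K {r. r >= 0 \<and> (\<exists>xs. xs ~= [] \<and> hd xs = x \<and> last xs = z \<and> pcost \<tau> xs <= ennreal r)})"
 using K by (intro bdd_belowI[of _ 0]) auto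

lemma tdist_nonneg: "tdist \<tau> K x z >= 0"
 unfolding tdist_def using K by (intro cInf_greatest) auto

lemma tdist_le_K: "tdist \<tau> K x z <= K"
 unfolding tdist_def by (intro cInf_lower tdist_bdd) simp

lemma tdist_le_path: "xs ~= [] ==> pcost \<tau> xs <= ennreal r ==> r >= 0 ==> tdist \<tau> K (hd xs) (last xs) <= r"
 unfolding tdist_def by (intro cInf_lower tdist_bdd) auto

lemma tdist_greatest:
 "b <= K ==> (\<And>xs r. xs ~= [] ==> hd xs = x ==> last xs = z ==> r >= 0 ==> pcost \<tau> xs <= ennreal r ==> b <= r) ==> b <= tdist \<tau> K x z"
 unfolding tdist_def by (intro cInf_greatest) auto

lemma tdist_self: "tdist \<tau> K x x = 0" using tdist_le_path[of "[x]" 0] tdist_nonneg[of x x] by simp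

lemma tdist_step:
 assumes t: "\<tau> v w <= ennreal t" "t >= 0"
 shows "tdist \<tau> K x w <= tdist \<tau> K x v + t"
proof -
 have "tdist \<tau> K x w - t <= tdist \<tau> K x v"
 proof (rule tdist_greatest)
  show "tdist \<tau> K x w - t <= K" using tdist_le_K[of x w] t by linarith
  fix xs r assume xs: "xs ~= []" "hd xs = x" "last xs = v" "r >= 0" "pcost \<tau> xs <= ennreal r"
  obtain bs where eq: "xs = bs @ [v]" using xs by (metis append_butlast_last_id)
  have "pcost \<tau> (xs @ [w]) = pcost \<tau> xs + \<tau> v w" unfolding eq using pcost_append[of \<tau> bs v "[w]"] by simp
  also have "... <= ennreal r + ennreal t" using xs(5) t by (intro add_mono)
  also have "... = ennreal (r + t)" using xs(4) t by simp
  finally have "tdist \<tau> K (hd (xs @ [w])) (last (xs @ [w])) <= r + t" using xs(4) t by (intro tdist_le_path) auto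
  then show "tdist \<tau> K x w - t <= r" using xs by simp
 qed
 then show ?thesis by simp
qed

lemma tdist_triangle:
 assumes sym: "\<And>x y. \<tau> x y = \<tau> y x"
 shows "tdist \<tau> K x y <= tdist \<tau> K x z + tdist \<tau> K y z"
proof -
 have "tdist \<tau> K x y - tdist \<tau> K x z <= tdist \<tau> K y z"
 proof (rule tdist_greatest)
  show "tdist \<tau> K x y - tdist \<tau> K x z <= K" using tdist_le_K[of x y] tdist_nonneg[of x z] by linarith
  fix ys r assume ys: "ys ~= []" "hd ys = y" "last ys = z" "r >= 0" "pcost \<tau> ys <= ennreal r"
  have "tdist \<tau> K x y - r <= tdist \<tau> K x z"
  proof (rule tdist_greatest)
   show "tdist \<tau> K x y - r <= K" using tdist_le_K[of x y] ys(4) by linarith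
   fix xs r' assume xs: "xs ~= []" "hd xs = x" "last xs = z" "r' >= 0" "pcost \<tau> xs <= ennreal r'"
   obtain bs where e1: "xs = bs @ [z]" using xs by (metis append_butlast_last_id)
   have "rev ys ~= []" "hd (rev ys) = z" using ys by (simp_all add: hd_rev)
   then have e2: "rev ys = z # tl (rev ys)" using list.collapse[of "rev ys"] by metis
   obtain zs where e2: "rev ys = z # zs" using e2 by blast
   have "pcost \<tau> (bs @ rev ys) = pcost \<tau> xs + pcost \<tau> (rev ys)" unfolding e1 e2 by (rule pcost_append)
   also have "... <= ennreal r' + ennreal r" unfolding pcost_rev[of \<tau>, OF sym] using xs(5) ys(5) by (rule add_mono)
   also have "... = ennreal (r' + r)" using xs(4) ys(4) by simp
   finally have "tdist \<tau> K (hd (bs @ rev ys)) (last (bs @ rev ys)) <= r' + r"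
    using xs ys by (intro tdist_le_path) auto
   moreover have "hd (bs @ rev ys) = x" using xs(2) unfolding e1 e2 by (cases bs) auto
   moreover have "last (bs @ rev ys) = y" using ys by (simp add: last_rev)
   ultimately show "tdist \<tau> K x y - r <= r'" by simp
  qed
  then show "tdist \<tau> K x y - tdist \<tau> K x z <= r" by simp
 qed
 then show ?thesis by simp
qed

end

lemma sinh_scale:
 fixes a t :: real assumes a: "a >= 0" and t: "0 <= t" "t <= 1"
 shows "sinh (t * a) <= t * sinh a"
proof -
 have "convex_on {0..} (sinh :: real => real)"
 proof (rule f''_ge0_imp_convex)
  show "(sinh has_real_derivative cosh x) (at x)" for x :: real by (auto intro!: derivative_eq_intros)
  show "(cosh has_real_derivative sinh x) (at x)" for x :: real by (auto intro!: derivative_eq_intros)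
 qed (auto simp: convex_real_interval)
 from convex_onD[OF this t, of 0 a] a show ?thesis by simp
qed

text \<open>By \<open>cosh z - 1 = 2 * (sinh (z / 2))\<^sup>2\<close> and convexity of
  \<open>sinh\<close>. Edge times are at most 1 so that this applies: the factor
  \<open>t\<^sup>2\<close> meets the bound of \<open>c * t\<^sup>2\<close> by the speed, while
  \<open>l\<close> may be large.\<close>

lemma cosh_scale:
 fixes l t :: real assumes t: "\<bar>t\<bar> <= 1"
 shows "cosh (l * t) - 1 <= t\<^sup>2 * (cosh l - 1)"
proof -
 have half: "cosh z - 1 = 2 * (sinh (\<bar>z\<bar> / 2))\<^sup>2" for z :: real
  using cosh_double[of "\<bar>z\<bar> / 2"] cosh_square_eq[of "\<bar>z\<bar> / 2"] by simp
 have "sinh (\<bar>l * t\<bar> / 2) <= \<bar>t\<bar> * sinh (\<bar>l\<bar> / 2)"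
  using sinh_scale[of "\<bar>l\<bar> / 2" "\<bar>t\<bar>"] t by (simp add: abs_mult mult.commute)
 then have "(sinh (\<bar>l * t\<bar> / 2))\<^sup>2 <= (\<bar>t\<bar> * sinh (\<bar>l\<bar> / 2))\<^sup>2" by (intro power_mono) auto
 then show ?thesis unfolding half by (simp add: power_mult_distrib)
qed

lemma cosh_le_quadratic: "\<bar>l :: real\<bar> <= 1 ==> cosh l - 1 <= l\<^sup>2"
proof -
 assume l: "\<bar>l\<bar> <= 1"
 have "cosh (1 * l) - 1 <= l\<^sup>2 * (cosh 1 - 1)" by (rule cosh_scale[OF l])
 also have "... <= l\<^sup>2 * 1"
 proof (rule mult_left_mono)
  have "exp (1::real) <= 3" by (rule exp_le)
  moreover have "exp (- (1::real)) <= 1" by simp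
  ultimately have "exp 1 + exp (- 1) <= (4::real)" by linarith
  then show "cosh (1::real) - 1 <= 1" by (simp add: cosh_def)
 qed simp
 finally show ?thesis by simp
qed

definition edge_time :: "('d::finite vertex => 'd vertex => real) => ('d vertex => real) => 'd vertex => 'd vertex => ennreal" where
 "edge_time c s x y = (if c x y ~= 0 then ennreal (sqrt (min 1 (min (s x) (s y) / c x y))) else \<infinity>)"

lemma (in killed_walk) heat_sol_scale: "heat_sol u ==> k >= 0 ==> heat_sol (\<lambda>t x. k * u t x)"
proof -
 assume u: "heat_sol u" and k: "k >= 0"
 have "lap (\<lambda>x. k * f x) x = k * lap f x" for f x
  unfolding lap_def by (simp add: sum_distrib_left mult_ac right_diff_distrib)
 then show ?thesis using u k unfolding heat_sol_def by (auto intro!: DERIV_cmult)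
qed

section \<open>First passage distance and reduction to killed walks\<close>

context walk_env
begin

lemma edge_time_sym: "edge_time c s x y = edge_time c s y x" by (simp add: edge_time_def sym[of x y] min.commute)

text \<open>Both estimates are built into the edge times, whose squares are at most
  \<open>s v / c v w\<close> and at most 1.\<close>

lemma tdist_lip:
 assumes K: "K >= 0" and c: "c v w > 0"
 shows "c v w * (tdist (edge_time c s) K x v - tdist (edge_time c s) K x w)\<^sup>2 <= s v"
  and "\<bar>tdist (edge_time c s) K x v - tdist (edge_time c s) K x w\<bar> <= 1"
proof -
 define t where "t = sqrt (min 1 (min (s v) (s w) / c v w))"
 have t0: "t >= 0" using c s_pos[of v] s_pos[of w] by (simp add: t_def)
 have e: "edge_time c s v w = ennreal t" "edge_time c s w v = ennreal t" using c edge_time_sym[of v w] by (auto simp: edge_time_def t_def)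
 let ?D = "tdist (edge_time c s) K x v - tdist (edge_time c s) K x w"
 have D: "\<bar>?D\<bar> <= t"
  using tdist_step[OF K, of "edge_time c s" v w t x] tdist_step[OF K, of "edge_time c s" w v t x] e t0 by simp
 have t1: "t <= 1" by (simp add: t_def)
 show "\<bar>?D\<bar> <= 1" using D t1 by simp
 have "?D\<^sup>2 <= t\<^sup>2" using D t0 by (simp add: abs_le_square_iff[symmetric])
 also have "t\<^sup>2 <= s v / c v w" using c s_pos[of v] s_pos[of w] by (simp add: t_def min_def divide_right_mono)
 finally show "c v w * ?D\<^sup>2 <= s v" using c by (simp add: field_simps)
qed

lemma neighbour_sum:
 assumes W: "finite W" and f: "\<And>w. c v w > 0 ==> f w <= k" and f0: "\<And>w. c v w = 0 ==> f w = 0" and k: "k >= 0"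
 shows "(\<Sum>w\<in>W. f w) <= 3 ^ CARD('d) * (k :: real)"
proof -
 have "(\<Sum>w\<in>W. f w) <= (\<Sum>w\<in>W. if w \<in> box v 1 then k else 0)"
 proof (rule sum_mono)
  fix w
  show "f w <= (if w \<in> box v 1 then k else 0)"
  proof (cases "c v w > 0")
   case True
   then have "{v, w} \<in> lattice_edges" using non_edge[of v w] by force
   then have "linfnorm (v - w) <= 1" using lattice_edge_dist linfnorm_le_l1norm[of "v - w"] by metis
   then show ?thesis using f[OF True] by (simp add: box_def)
  next
   case False
   then show ?thesis using f0[of w] nonneg[of v w] k by auto
  qed
 qed
 also have "... = real (card (W \<inter> box v 1)) * k" using W by (simp add: sum.If_cases)
 also have "... <= 3 ^ CARD('d) * k"
 proof (rule mult_right_mono[OF _ k])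
  have "real (card (W \<inter> box v 1)) <= real (card (box v 1))" using finite_box by (intro of_nat_mono card_mono) auto
  also have "... <= (2 * 1 + 1) ^ CARD('d)" by (rule card_box_le) simp
  finally show "real (card (W \<inter> box v 1)) <= 3 ^ CARD('d)" by simp
 qed
 finally show ?thesis .
qed

lemma tdist_carre:
 assumes K: "K >= 0" and W: "finite W"
 shows "(\<Sum>w\<in>W. c v w * (tdist (edge_time c s) K x v - tdist (edge_time c s) K x w)\<^sup>2) <= 3 ^ CARD('d) * s v"
 using tdist_lip(1)[OF K] s_pos[of v] by (intro neighbour_sum[OF W]) auto

lemma tdist_cosh:
 assumes K: "K >= 0" and W: "finite W"
 shows "(\<Sum>w\<in>W. c v w * (cosh (l * tdist (edge_time c s) K x v - l * tdist (edge_time c s) K x w) - 1)) <= 3 ^ CARD('d) * (cosh l - 1) * s v"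
proof -
 let ?r = "tdist (edge_time c s) K x"
 have "(\<Sum>w\<in>W. c v w * (cosh (l * ?r v - l * ?r w) - 1)) <= 3 ^ CARD('d) * ((cosh l - 1) * s v)"
 proof (rule neighbour_sum[OF W])
  show "(cosh l - 1) * s v >= 0" using s_pos[of v] cosh_real_ge_1[of l] by simp
  fix w assume c: "c v w > 0"
  have "cosh (l * ?r v - l * ?r w) - 1 <= (?r v - ?r w)\<^sup>2 * (cosh l - 1)"
   using cosh_scale[OF tdist_lip(2)[OF K c], of l] by (simp add: right_diff_distrib)
  then have "c v w * (cosh (l * ?r v - l * ?r w) - 1) <= c v w * ((?r v - ?r w)\<^sup>2 * (cosh l - 1))" using c by (intro mult_left_mono) auto
  also have "... = (c v w * (?r v - ?r w)\<^sup>2) * (cosh l - 1)" by simp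
  also have "... <= s v * (cosh l - 1)" using tdist_lip(1)[OF K c] cosh_real_ge_1[of l] by (intro mult_right_mono) auto
  finally show "c v w * (cosh (l * ?r v - l * ?r w) - 1) <= (cosh l - 1) * s v" by (simp add: mult.commute)
 qed simp
 then show ?thesis by (simp add: mult.assoc)
qed

text \<open>During \<open>n\<close> jumps the walk stays in the box of radius \<open>n\<close>, so
  the walk killed outside that part of the cluster dominates the partial sum over at most
  \<open>n\<close> jumps, and the bound is uniform in \<open>n\<close>. \<open>y\<close> is added to
  the domain so that it can carry the point source.\<close>

lemma heat_kernel_le:
 assumes C: "x \<in> C" "y \<in> C" and closed: "\<And>v w. v \<in> C ==> adjacent c v w ==> w \<in> C"
  and nb: "\<And>v. v \<in> C ==> \<exists>w. adjacent c v w" and t: "t >= 0" and K: "K >= 0"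
  and bound: "\<And>W B v. killed_domain c s C W B ==> x \<in> B ==> y \<in> B ==>
   killed_walk.heat_sol W B c s v ==> v 0 = (\<lambda>z. if z = y then 1 / s y else 0) ==> v t x <= K"
 shows "heat_kernel c s t x y <= K"
proof -
 note s0 = s_pos
 obtain w0 where w0: "adjacent c x w0" using nb C by blast
 have "(\<Sum>m\<le>n. Hm y m t x) <= ennreal (s y * K)" for n
 proof -
  define B where "B = insert y (C \<inter> box x (real n))"
  define W where "W = B \<union> (\<Union>v\<in>B. {z. adjacent c v z})"
  have finB: "finite B" using finite_box by (auto simp: B_def)
  have kw: "killed_walk W B c s"
   by standard (use finB finite_adjacent sym nonneg s0 in \<open>auto simp: W_def\<close>)
  have BC: "B \<subseteq> C" using C by (auto simp: B_def)
  have nbW: "x \<in> B ==> adjacent c x z ==> z \<in> W" for x z by (auto simp: W_def)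
  have xB: "x \<in> B" "y \<in> B" using C by (auto simp: B_def box_mem)
  obtain v where v: "killed_walk.heat_sol W B c s v" "v 0 = (\<lambda>z. if z = y then 1 / s y else 0)"
  proof (rule killed_walk.heat_sol_exists[OF kw, of "\<lambda>z. if z = y then 1 / s y else 0"])
   show "0 <= (if z = y then 1 / s y else 0)" for z using s0[of y] by simp
   show "z \<notin> B ==> (if z = y then 1 / s y else 0) = 0" for z using xB by auto
  qed (rule that)
  have inb: "inball c B k z" if "z \<in> C" "linfnorm (z - x) + real k <= real n" for k z using that
  proof (induction k arbitrary: z)
   case 0
   then show ?case by (simp add: B_def box_mem)
  next
   case (Suc k)
   have "z \<in> B" using Suc.prems by (simp add: B_def box_mem)
   moreover have "inball c B k w" if w: "adjacent c z w" for w
   proof (rule Suc.IH)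
    show "w \<in> C" using closed Suc.prems(1) w by blast
    have "c z w > 0" using w adjacent_iff by blast
    then have "{z, w} \<in> lattice_edges" using non_edge[of z w] by force
    then have "linfnorm (w - z) <= 1" using lattice_edge_dist[of z w] linfnorm_le_l1norm[of "z - w"] linfnorm_minus[of w z] by simp
    then show "linfnorm (w - x) + real k <= real n" using Suc.prems(2) linfnorm_triangle3[of w x z] by simp
   qed
   ultimately show ?case by simp
  qed
  have sv: "killed_walk.heat_sol W B c s (\<lambda>t z. s y * v t z)"
   using killed_walk.heat_sol_scale[OF kw v(1), of "s y"] s0[of y] by simp
  have "(\<Sum>m\<le>n. Hm y m t x) <= ennreal (s y * v t x)"
  proof (rule Hm_le[OF kw sv])
   show "1 <= s y * v 0 y" using v(2) s0[of y] by simp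
   show "inball c B n x" using C by (intro inb) auto
  qed (use t nb BC nbW in auto)
  also have "... <= ennreal (s y * K)"
   using bound[OF _ xB v] kw BC nbW s0[of y] by (intro ennreal_leI mult_left_mono) (auto simp: killed_domain_def)
  finally show ?thesis .
 qed
 then have "transition_prob (generator c s) t x y <= s y * K"
  using K s0[of y] by (intro transition_prob_le[OF w0]) auto
 then show ?thesis using s0[of y] by (simp add: heat_kernel_def field_simps)
qed

end

lemma infinite_cluster_neighbour:
 assumes "x \<in> clusters c \<infinity>" shows "\<exists>w. adjacent c x w"
proof (rule ccontr)
 assume no: "\<not> ?thesis"
 have "y = x" if "connected_in UNIV c x y" for y
  using that no unfolding connected_in_def by (auto elim: converse_rtranclpE)
 then have "component c x = {x}" by (auto simp: component_def connected_in_def)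
 then show False using assms by (simp add: clusters_def l1diam_def)
qed

text \<open>The constants are given by formulas because they must not depend on the environment.\<close>

definition level_base :: "nat => real => real" where
 "level_base d eps = 4 powr (1 + 1 / eps) * 2 ^ (3 * d + 1)"

text \<open>The value of \<open>y0\<close> for which the smallness condition in
  \<open>mean_value\<close>, with \<open>\<kappa> = 3 ^ d\<close> and \<open>CF = A\<close>, is an
  equality.\<close>

definition level_const :: "nat => real => real => real" where
 "level_const d eps A = (1 / (A * (1 + 32 * 3 ^ d) * 4 * level_base d eps)) powr (1 / eps) / 4"

lemma level_const:
 assumes "eps > 0" "A > 0"
 shows "level_const d eps A > 0" "A * (4 * level_const d eps A) powr eps * (1 + 32 * 3 ^ d) * 4 * level_base d eps = 1"
proof -
 have b: "level_base d eps > 0" by (simp add: level_base_def)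
 have three: "(1 + 32 * 3 ^ d :: real) > 0" by (intro add_pos_nonneg) auto
 define Z where "Z = A * (1 + 32 * 3 ^ d) * 4 * level_base d eps"
 have Z: "Z > 0" unfolding Z_def using assms b three by simp
 have lc: "level_const d eps A = (1 / Z) powr (1 / eps) / 4" by (simp add: level_const_def Z_def)
 show "level_const d eps A > 0" unfolding lc using Z by simp
 have "(4 * level_const d eps A) powr eps = 1 / Z" unfolding lc using Z assms by (simp add: powr_powr)
 then have "A * (4 * level_const d eps A) powr eps * (1 + 32 * 3 ^ d) * 4 * level_base d eps = Z * (1 / Z)" unfolding Z_def by (simp add: mult_ac)
 then show "A * (4 * level_const d eps A) powr eps * (1 + 32 * 3 ^ d) * 4 * level_base d eps = 1" using Z by simp
qed

text \<open>In the Gaussian regime \<lambda> is this number times \<open>D / T\<close>, where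
  \<open>D\<close> is the distance and \<open>T\<close> the time. Then
  \<open>3 ^ d * gauss_rate d cf\<close> is a quarter of \<open>cf / d\<close>, which keeps the
  Davies error a fraction of the gain.\<close>

definition gauss_rate :: "nat => real => real" where
 "gauss_rate d cf = cf / real d / (4 * 3 ^ d)"

text \<open>The exponential is the constant term that \<open>gauss_arith\<close> leaves when the
  terms linear in \<open>D / sqrt T\<close> are absorbed into the quadratic one.\<close>

definition gauss_const :: "nat => real => real => real => real" where
 "gauss_const d cf eps l = (let a = real d / eps; g = gauss_rate d cf * (cf / real d) in
  4 * 2 ^ d / l * exp ((4 * a + 4 * gauss_rate d cf)\<^sup>2 / (4 * (g / 2))))"

text \<open>A square because \<open>q = sqrt (D / T)\<close>, with \<lambda> equal to
  \<open>ln q\<close>, has to exceed both entries of the maximum: the first gives \<lambda> at least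
  1, the second makes the Davies error small.\<close>

definition far_speed :: "nat => real => real" where
 "far_speed d cf = (max (exp 1) (4 * 3 ^ d / (cf / real d)))\<^sup>2"

lemma gauss_arith:
 fixes Y :: real
 assumes Y: "Y >= 0" and g: "g > 0"
 shows "b * Y <= b\<^sup>2 / (4 * g) + g * Y\<^sup>2"
proof -
 have "0 <= (b / (2 * g) - Y)\<^sup>2 * g" using g by simp
 also have "... = b\<^sup>2 / (4 * g) + g * Y\<^sup>2 - b * Y" using g by (simp add: power2_eq_square field_simps)
 finally show ?thesis by simp
qed

section \<open>Heat kernel bounds in one fixed environment\<close>

locale gaussian_env = good_cluster c s C \<phi> \<rho>
 for c :: "'d::finite vertex => 'd vertex => real" and s C \<phi> \<rho> +
 fixes p r M cf D\<^sub>0 eps C\<^sub>0 :: real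
 assumes M: "M >= 1" and cf: "0 < cf" "cf <= 1" and eps: "eps > 0" and C0: "C\<^sub>0 > 0"
  and FK: "faber_krahn_bound c s C \<kappa> p r eps C\<^sub>0"
  and avg: "\<forall>x. \<exists>R\<^sub>0. \<forall>R\<ge>R\<^sub>0. box_averages c s C \<kappa> p r M x R \<and>
   (\<Sum>v\<in>box x R \<inter> C. inverse (s v) powr 1) <= M * R powr real CARD('d)"
  and fpp: "\<And>y z xs. linfnorm (y - z) >= D\<^sub>0 ==> linfnorm y <= linfnorm (y - z) ^ 3 ==> xs ~= [] ==> hd xs = y ==> last xs = z ==>
   ennreal (cf * linfnorm (y - z)) <= pcost (edge_time c s) xs"
  and nb: "\<And>v. v \<in> C ==> \<exists>w. adjacent c v w"
begin

abbreviation "td \<equiv> tdist (edge_time c s)"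
definition lv :: real where "lv = level_const (CARD('d)) eps (C\<^sub>0 * M\<^sup>2 / cf\<^sup>2)"

lemma Y0: "lv > 0" "C\<^sub>0 * M\<^sup>2 / cf\<^sup>2 * (4 * lv) powr eps * (1 + 32 * 3 ^ CARD('d)) * 4 * level_base CARD('d) eps = 1"
proof -
 have "C\<^sub>0 * M\<^sup>2 / cf\<^sup>2 > 0" using C0 M cf by simp
 from level_const[OF eps this, of "CARD('d)", folded lv_def] show "lv > 0" "C\<^sub>0 * M\<^sup>2 / cf\<^sup>2 * (4 * lv) powr eps * (1 + 32 * 3 ^ CARD('d)) * 4 * level_base CARD('d) eps = 1" by auto
qed

lemma td_lower:
 assumes "linfnorm (y - z) >= D\<^sub>0" "linfnorm y <= linfnorm (y - z) ^ 3" "K >= 0" "b <= K" "b <= cf * linfnorm (y - z)"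
 shows "b <= td K y z"
proof (rule tdist_greatest[OF assms(3,4)])
 fix xs r assume xs: "xs ~= []" "hd xs = y" "last xs = z" "r >= 0" "pcost (edge_time c s) xs <= ennreal r"
 have "ennreal (cf * linfnorm (y - z)) <= ennreal r" using fpp[OF assms(1,2) xs(1-3)] xs(5) by (rule order_trans)
 then have "cf * linfnorm (y - z) <= r" using xs(4) by (simp add: ennreal_le_iff)
 then show "b <= r" using assms(5) by linarith
qed

text \<open>A single term of the average of \<open>1 / s\<close>; such a polynomial lower bound is
  what \<open>sx\<close> in \<open>mean_value\<close> asks for.\<close>

lemma speed_lower:
 assumes avgR: "(\<Sum>v\<in>box x R \<inter> C. inverse (s v) powr 1) <= M * R powr real CARD('d)" and R: "R > 0" and y: "y \<in> C" "linfnorm (x - y) <= R"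
 shows "1 <= s y * (M * R ^ CARD('d))"
proof -
 have "inverse (s y) powr 1 <= (\<Sum>v\<in>box x R \<inter> C. inverse (s v) powr 1)"
  using y by (intro member_le_sum) (auto simp: box_def intro: finite_subset[OF _ finite_box])
 then have "inverse (s y) <= M * R ^ CARD('d)" using avgR R s_pos[of y] by (simp add: powr_realpow)
 then show ?thesis using s_pos[of y] by (simp add: field_simps)
qed

text \<open>With \<open>K >= R\<close>, truncating the distance at \<open>K\<close> does not change
  the balls of radius \<open>R\<close>, so the statement is uniform in \<open>K\<close>.\<close>

definition mean_value_at :: "'d vertex => real => real => bool" where
 "mean_value_at y R Q \<longleftrightarrow> (\<forall>W B w S K. killed_domain c s C W B --> y \<in> B --> killed_walk.heat_sol W B c s w --> S > 0 --> K >= R -->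
   (\<forall>\<tau>. 0 <= \<tau> --> \<tau> <= R\<^sup>2 --> (\<Sum>z | z \<in> B \<and> td K y z < R. s z * (w \<tau> z)\<^sup>2) <= S) --> (w (R\<^sup>2) y)\<^sup>2 <= Q * S)"

text \<open>The lower bound on the first passage distance puts its ball of radius \<open>R\<close>
  into a box of radius \<open>R / cf\<close> around \<open>y\<close>, which lies in a box around
  \<open>x\<close> larger by the factor \<open>1 + X\<close>. The averages then hold with
  \<open>M * (1 + X) ^ d\<close>, and the level \<open>y0\<close> has to shrink by
  \<open>(1 + X) powr (- (2 * d / eps))\<close>: this is the polynomial loss in the
  constant.\<close>

lemma local_mean_value:
 "\<exists>R\<^sub>1\<ge>1. \<forall>R\<ge>R\<^sub>1. \<forall>y\<in>C. \<forall>X\<ge>0. linfnorm (x - y) <= X * R --> linfnorm (x - y) <= 4 * R\<^sup>2 -->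
  mean_value_at y R (4 * (1 + X) powr (2 * real CARD('d) / eps) / ((R / cf) ^ CARD('d) * lv))"
proof -
 let ?d = "CARD('d)"
 let ?m = "3 * ?d + 1"
 obtain R0 where "\<forall>R\<ge>R0. box_averages c s C \<kappa> p r M x R \<and> (\<Sum>v\<in>box x R \<inter> C. inverse (s v) powr 1) <= M * R powr real ?d"
  using avg by blast
 then have R0: "\<And>R. R >= R0 ==> (\<Sum>v\<in>box x (R + 1) \<inter> C. ((\<kappa> v)\<^sup>2 * nu c v) powr (1 / p)) <= M * R powr real ?d"
  "\<And>R. R >= R0 ==> (\<Sum>v\<in>box x R \<inter> C. s v powr (1 / r)) <= M * R powr real ?d"
  "\<And>R. R >= R0 ==> (\<Sum>v\<in>box x R \<inter> C. inverse (s v) powr 1) <= M * R powr real ?d"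
  by (simp_all add: box_averages_def)
 \<comment> \<open>The last entry is the constant that one spare power of \<open>R\<close> must beat
   in the lower bound for \<open>s y\<close>.\<close>
 define R1 where "R1 = max (max 8 R0) (max (max D\<^sub>0 (linfnorm x)) (16 ^ ?m * lv * M * 4 ^ ?d / cf ^ ?d))"
 have main: "(w (R\<^sup>2) y)\<^sup>2 <= 4 * (1 + X) powr (2 * real ?d / eps) / ((R / cf) ^ ?d * lv) * S"
  if RR: "R >= R1" and y: "y \<in> C" and X: "X >= 0" and xy: "linfnorm (x - y) <= X * R" "linfnorm (x - y) <= 4 * R\<^sup>2"
   and kd: "killed_domain c s C W B" and yB: "y \<in> B"
   and w: "killed_walk.heat_sol W B c s w" and S: "S > 0" and K: "K >= R"
   and init: "\<And>\<tau>. 0 <= \<tau> ==> \<tau> <= R\<^sup>2 ==> (\<Sum>z | z \<in> B \<and> td K y z < R. s z * (w \<tau> z)\<^sup>2) <= S"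
  for R y X W B w S K
 proof -
  have R: "R >= 8" "R >= R0" "R >= D\<^sub>0" "R >= linfnorm x" "R >= 16 ^ ?m * lv * M * 4 ^ ?d / cf ^ ?d"
   using RR by (auto simp: R1_def)
  have K0: "K >= 0" using K R by linarith
  have R2: "R <= R\<^sup>2" using R(1) by (intro self_le_power) auto
  define Rh where "Rh = R / cf"
  have Rh: "Rh >= R" using cf R(1) by (simp add: Rh_def le_divide_eq mult_left_le)
  define V where "V = Rh ^ ?d"
  have V: "V > 0" using Rh R by (simp add: V_def)
  define My where "My = M * (1 + X) ^ ?d"
  have X1: "(1 + X) ^ ?d >= 1" using X by (simp add: one_le_power)
  have My: "My >= 1" unfolding My_def using mult_mono[of 1 M 1 "(1 + X) ^ ?d"] M X1 by simp
  define CF where "CF = C\<^sub>0 * My\<^sup>2 / cf\<^sup>2"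
  have CF: "CF > 0" using C0 My cf by (simp add: CF_def)
  define y0 where "y0 = lv * (1 + X) powr (- (2 * real ?d / eps))"
  have y0: "y0 > 0" using Y0(1) X by (simp add: y0_def)
  have Rhd: "Rh powr real ?d = V" using Rh R by (simp add: V_def powr_realpow)
  have kappa_ge: "((\<kappa> v)\<^sup>2 * nu c v) powr (1 / p) >= 0" for v by simp
  have big: "M * (X * R + Rh) powr real ?d <= My * Rh powr real ?d"
  proof -
   have "X * R + Rh <= (1 + X) * Rh" using X Rh by (simp add: distrib_right mult_left_mono)
   then have "(X * R + Rh) powr real ?d <= ((1 + X) * Rh) powr real ?d" using X Rh R by (intro powr_mono2) auto
   also have "... = (1 + X) ^ ?d * Rh powr real ?d" using X Rh R by (simp add: powr_mult powr_realpow)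
   finally have "M * (X * R + Rh) powr real ?d <= M * ((1 + X) ^ ?d * Rh powr real ?d)" using M by (intro mult_left_mono) auto
   then show ?thesis by (simp add: My_def mult.assoc)
  qed
  have XR: "X * R >= 0" using X R by simp
  have RX: "X * R + Rh >= R0" using XR Rh R by linarith
  have sum1: "(\<Sum>v\<in>box y (Rh + 1) \<inter> C. ((\<kappa> v)\<^sup>2 * nu c v) powr (1 / p)) <= My * Rh powr real ?d"
  proof -
   have "box y (Rh + 1) \<subseteq> box x (X * R + Rh + 1)" using xy(1) by (intro box_subset) (simp add: linfnorm_minus)
   then have "(\<Sum>v\<in>box y (Rh + 1) \<inter> C. ((\<kappa> v)\<^sup>2 * nu c v) powr (1 / p)) <= (\<Sum>v\<in>box x (X * R + Rh + 1) \<inter> C. ((\<kappa> v)\<^sup>2 * nu c v) powr (1 / p))"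
    by (intro sum_mono2) (auto intro: finite_subset[OF _ finite_box])
   also have "... <= M * (X * R + Rh) powr real ?d" by (rule R0(1)[OF RX])
   also note big
   finally show ?thesis .
  qed
  have sum2: "(\<Sum>v\<in>box y Rh \<inter> C. s v powr (1 / r)) <= My * Rh powr real ?d"
  proof -
   have "box y Rh \<subseteq> box x (X * R + Rh)" using xy(1) by (intro box_subset) (simp add: linfnorm_minus)
   then have "(\<Sum>v\<in>box y Rh \<inter> C. s v powr (1 / r)) <= (\<Sum>v\<in>box x (X * R + Rh) \<inter> C. s v powr (1 / r))"
    by (intro sum_mono2) (auto intro: finite_subset[OF _ finite_box])
   also have "... <= M * (X * R + Rh) powr real ?d" by (rule R0(2)[OF RX])
   also note big
   finally show ?thesis .
  qed
  have ball: "z \<in> box y Rh" if "td K y z < R" for z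
  proof (rule ccontr)
   assume "z \<notin> box y Rh"
   then have far: "linfnorm (y - z) > Rh" by (simp add: box_def)
   \<comment> \<open>The polynomial restriction on the starting point in \<open>fpp\<close> holds
     because \<open>5 * R\<^sup>2 <= R ^ 3\<close>.\<close>
   have "linfnorm y <= linfnorm x + linfnorm (x - y)" using linfnorm_triangle[of x "y - x"] linfnorm_minus[of y x] by simp
   also have "... <= R\<^sup>2 + 4 * R\<^sup>2" using R(4) xy(2) R2 by linarith
   also have "... <= R ^ 3" using R(1) mult_right_mono[of 5 R "R\<^sup>2"] by (simp add: power2_eq_square power3_eq_cube)
   also have "... <= linfnorm (y - z) ^ 3" using far Rh R by (intro power_mono) auto
   finally have "R <= td K y z"
   proof (intro td_lower[OF _ _ K0 K])
    show "D\<^sub>0 <= linfnorm (y - z)" using far Rh R by linarith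
    have "cf * Rh <= cf * linfnorm (y - z)" using far cf by (intro mult_left_mono) auto
    then show "R <= cf * linfnorm (y - z)" using cf by (simp add: Rh_def)
   qed
   then show False using that by simp
  qed
  interpret kw: killed_walk W B c s using kd by (simp add: killed_domain_def)
  have finW: "finite W" by (rule kw.finite_W)
  have y0_le: "y0 <= lv"
  proof -
   have "(1 + X) powr (- (2 * real ?d / eps)) <= (1 + X) powr 0" using X eps by (intro powr_mono) auto
   then show ?thesis unfolding y0_def using mult_left_mono[of _ 1 lv] Y0(1) X by simp
  qed
  have "(w (R\<^sup>2) y)\<^sup>2 <= 4 * S / (V * y0)"
  proof (rule kw.mean_value[where \<kappa> = "3 ^ ?d" and \<epsilon> = eps and CF = CF and m = ?m and \<rho> = "td K y" and u = w and T = "R\<^sup>2" and R = R and x = y and V = V and S = S and ?y0.0 = y0])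
   show "kw.heat_sol w" by (rule w)
   show "(0::real) <= 3 ^ ?d" by simp
   show "0 < eps" "0 < CF" "0 < V" "0 < S" "8 <= R" "R\<^sup>2 <= R\<^sup>2" "0 < y0" by (fact eps CF V S R(1) y0 | simp)+
   show "\<bar>td K y x - td K y z\<bar> <= 1" if "c x z > 0" for x z by (rule tdist_lip(2)[OF K0 that])
   show "(\<Sum>z\<in>W. c x z * (td K y x - td K y z)\<^sup>2) <= 3 ^ ?d * s x" for x by (rule tdist_carre[OF K0 finW])
   show "(\<Sum>x\<in>B. s x * (g x)\<^sup>2) <= CF * R\<^sup>2 * ((\<Sum>x | g x ~= 0. s x) / V) powr eps * kw.energy g g"
    if g: "\<And>x. 0 <= g x" "\<And>x. g x ~= 0 ==> x \<in> B \<and> td K y x < R" for g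
   proof -
    have "Rh >= 1" using Rh R by linarith
    then have "(\<Sum>x\<in>B. s x * (g x)\<^sup>2) <= C\<^sub>0 * My\<^sup>2 * Rh\<^sup>2 * ((\<Sum>x | g x ~= 0. s x) / Rh powr real ?d) powr eps * kw.energy g g"
     using FK[unfolded faber_krahn_bound_def, rule_format, OF _ My _ kd, of Rh y g] sum1 sum2 g ball by (auto simp: box_averages_def)
    also have "C\<^sub>0 * My\<^sup>2 * Rh\<^sup>2 = CF * R\<^sup>2" by (simp add: CF_def Rh_def power_divide)
    finally show ?thesis unfolding Rhd .
   qed
   show "(\<Sum>z | z \<in> B \<and> td K y z < R. s z * (w \<tau> z)\<^sup>2) <= S" if "R\<^sup>2 - R\<^sup>2 <= \<tau>" "\<tau> <= R\<^sup>2" for \<tau>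
    using that by (intro init) auto
   show "CF * (4 * y0) powr eps * (1 + 32 * 3 ^ ?d) * 4 * (4 powr (1 + 1 / eps) * 2 ^ ?m) <= 1"
   proof -
    have p2: "(1 + X) ^ (2 * ?d) = ((1 + X) ^ ?d)\<^sup>2" by (metis mult.commute power_mult)
    have CFe: "CF = C\<^sub>0 * M\<^sup>2 / cf\<^sup>2 * (1 + X) ^ (2 * ?d)" unfolding CF_def My_def p2 power_mult_distrib by simp
    have "(4 * y0) powr eps = (4 * lv) powr eps * ((1 + X) powr (- (2 * real ?d / eps))) powr eps"
     unfolding y0_def mult.assoc[symmetric] by (rule powr_mult)
    also have "((1 + X) powr (- (2 * real ?d / eps))) powr eps = (1 + X) powr (- real (2 * ?d))"
     using eps by (simp add: powr_powr)
    also have "... = inverse ((1 + X) ^ (2 * ?d))" using X by (simp only: powr_minus powr_realpow[of "1 + X"] add_pos_nonneg zero_less_one)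
    finally have "CF * (4 * y0) powr eps = C\<^sub>0 * M\<^sup>2 / cf\<^sup>2 * (4 * lv) powr eps * ((1 + X) ^ (2 * ?d) * inverse ((1 + X) ^ (2 * ?d)))"
     unfolding CFe by (simp only: mult_ac)
    also have "(1 + X) ^ (2 * ?d) * inverse ((1 + X) ^ (2 * ?d)) = 1" using X by simp
    finally show ?thesis using Y0(2) unfolding level_base_def by simp
   qed
   show "y \<in> B" by (rule yB)
   show "td K y y <= R / 2" using tdist_self[OF K0, of "edge_time c s" y] R by simp
   \<comment> \<open>\<open>V\<close> is of order \<open>R ^ d\<close> and \<open>s y\<close> at
     least of order \<open>1 / R ^ (2 * d)\<close>; the exponent \<open>3 * d + 1\<close> leaves one
     power of \<open>R\<close> for the constants.\<close>
   show "V * y0 * (16 / R) ^ ?m <= s y"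
   proof -
    have R4: "4 * R\<^sup>2 >= R0" using R R2 by linarith
    have "1 <= s y * (M * (4 * R\<^sup>2) ^ ?d)" using R xy(2) y by (intro speed_lower[OF R0(3)[OF R4]]) auto
    moreover have "(4 * R\<^sup>2) ^ ?d = 4 ^ ?d * R ^ (2 * ?d)" by (simp add: power_mult_distrib power_mult)
    ultimately have sy: "1 <= s y * (M * 4 ^ ?d * R ^ (2 * ?d))" by (simp add: mult.assoc)
    have pos: "M * 4 ^ ?d * R ^ (2 * ?d) > 0" using M R by simp
    have Rm: "R ^ ?m = R ^ ?d * R ^ (2 * ?d) * R" by (simp add: power_add[symmetric])
    have "V * y0 * (16 / R) ^ ?m * (M * 4 ^ ?d * R ^ (2 * ?d)) <= V * lv * (16 / R) ^ ?m * (M * 4 ^ ?d * R ^ (2 * ?d))"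
     using y0_le V R pos by (intro mult_right_mono mult_left_mono) auto
    also have "... = (16 ^ ?m * lv * M * 4 ^ ?d / cf ^ ?d) * (R ^ ?d * R ^ (2 * ?d)) / R ^ ?m"
     by (simp add: V_def Rh_def power_divide)
    also have "... <= R * (R ^ ?d * R ^ (2 * ?d)) / R ^ ?m" using R by (intro divide_right_mono mult_right_mono) auto
    also have "... = 1" unfolding Rm using R by simp
    also note sy
    finally show ?thesis using pos by (rule mult_right_le_imp_le)
   qed
  qed
  also have "4 * S / (V * y0) = 4 * (1 + X) powr (2 * real ?d / eps) / ((R / cf) ^ ?d * lv) * S"
  proof -
   have "1 / (1 + X) powr (- (2 * real ?d / eps)) = (1 + X) powr (2 * real ?d / eps)" by (simp add: powr_minus_divide)
   moreover have "4 * S / (V * y0) = 4 * (1 / (1 + X) powr (- (2 * real ?d / eps))) / (V * lv) * S" by (simp add: y0_def)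
   ultimately show ?thesis by (simp only: V_def Rh_def)
  qed
  finally show ?thesis .
 qed
 show ?thesis
 proof (intro exI[of _ R1] conjI allI ballI impI, goal_cases)
  case 1
  show ?case by (simp add: R1_def)
 next
  case (2 R y X)
  show ?case unfolding mean_value_at_def using main[OF 2] by blast
 qed
qed


lemma tdist_cosh_neg:
 assumes K: "K >= 0" and W: "finite W"
 shows "(\<Sum>w\<in>W. c v w * (cosh (- (l * td K x v) - - (l * td K x w)) - 1)) <= 3 ^ CARD('d) * (cosh l - 1) * s v"
proof -
 have "cosh (- (l * td K x v) - - (l * td K x w)) = cosh (l * td K x v - l * td K x w)" for w
  using cosh_minus[of "l * td K x v - l * td K x w"] by (simp only: minus_diff_minus)
 then show ?thesis by (simp only: tdist_cosh[OF K W])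
qed

lemma gauss_const_pos: "gauss_rate (CARD('d)) cf > 0" "gauss_const (CARD('d)) cf eps lv > 0"
 using cf Y0(1) by (simp_all add: gauss_rate_def gauss_const_def Let_def)

lemma td_linear:
 assumes "l1norm (x - y) >= real CARD('d) * max D\<^sub>0 (max 1 (linfnorm x))" "cf * linfnorm (x - y) <= K"
 shows "1 <= linfnorm (x - y)" "cf / real CARD('d) * l1norm (x - y) <= td K x y"
proof -
 have d1: "real CARD('d) > 0" by simp
 have l1: "l1norm (x - y) <= real CARD('d) * linfnorm (x - y)" by (rule l1norm_le_linfnorm)
 with assms(1) have "real CARD('d) * max D\<^sub>0 (max 1 (linfnorm x)) <= real CARD('d) * linfnorm (x - y)" by linarith
 then have far: "D\<^sub>0 <= linfnorm (x - y)" "1 <= linfnorm (x - y)" "linfnorm x <= linfnorm (x - y)" using d1 by (simp_all add: mult_le_cancel_left)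
 then show "1 <= linfnorm (x - y)" by simp
 have "linfnorm (x - y) ^ 1 <= linfnorm (x - y) ^ 3" using far(2) by (intro power_increasing) auto
 then have cube: "linfnorm x <= linfnorm (x - y) ^ 3" using far(3) by simp
 have "0 <= cf * linfnorm (x - y)" using cf far(2) by simp
 then have K: "0 <= K" using assms(2) by linarith
 have le: "cf / real CARD('d) * l1norm (x - y) <= cf * linfnorm (x - y)"
  using mult_left_mono[OF l1, of "cf / real CARD('d)"] cf d1 by simp
 show "cf / real CARD('d) * l1norm (x - y) <= td K x y" using le assms(2) by (intro td_lower[OF far(1) cube K]) auto
qed

lemma powr_half_square: "T > 0 ==> (T powr (- real n / 2))\<^sup>2 = 1 / T ^ n" for T :: real
 by (simp add: power2_eq_square powr_add[symmetric] powr_minus powr_realpow inverse_eq_divide)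

text \<open>The weight is \<open>l * td K x\<close> with \<open>l = e0 * D / T\<close>, and the mean
  value inequality is used at both ends on balls of radius \<open>sqrt (T / 2)\<close>. In terms of
  \<open>Y = D / sqrt T\<close> the gain in the squared kernel is
  \<open>2 * (e0 * c1) * Y\<^sup>2\<close>. The Davies error takes a quarter of it, and the terms
  linear in \<open>Y\<close> another quarter up to a constant.\<close>

lemma gaussian_bound:
 assumes x: "x \<in> C"
 shows "\<exists>N\<^sub>9\<ge>1. \<exists>N\<^sub>8. \<forall>T\<ge>N\<^sub>9. \<forall>y\<in>C. l1norm (x - y) >= N\<^sub>8 --> l1norm (x - y) <= T -->
  heat_kernel c s T x y <= gauss_const (CARD('d)) cf eps lv * T powr (- real CARD('d) / 2) * exp (- (gauss_rate (CARD('d)) cf * (cf / real CARD('d)) / 2) * (l1norm (x - y))\<^sup>2 / T)"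
proof -
 let ?d = "CARD('d)"
 define c1 where "c1 = cf / real ?d"
 have d1: "real ?d >= 1" by (simp add: Suc_le_eq)
 have "cf <= real ?d" using cf d1 by linarith
 then have c1: "c1 > 0" "c1 <= 1" using cf by (auto simp: c1_def divide_le_eq)
 define e0 where "e0 = gauss_rate (CARD('d)) cf"
 have e0: "e0 > 0" unfolding e0_def by (rule gauss_const_pos)
 have e0eq: "3 ^ ?d * e0 = c1 / 4" by (simp add: e0_def gauss_rate_def c1_def)
 have e01: "e0 <= 1"
 proof -
  have "e0 * 1 <= e0 * 3 ^ ?d" using e0 by (intro mult_left_mono) auto
  then show ?thesis using e0eq c1 by (simp add: mult.commute)
 qed
 define a where "a = real ?d / eps"
 have a0: "a >= 0" using eps by (simp add: a_def)
 obtain R1 where R1: "R1 >= 1" and mv: "\<forall>R\<ge>R1. \<forall>y\<in>C. \<forall>X\<ge>0. linfnorm (x - y) <= X * R --> linfnorm (x - y) <= 4 * R\<^sup>2 -->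
  mean_value_at y R (4 * (1 + X) powr (2 * real ?d / eps) / ((R / cf) ^ ?d * lv))"
  using local_mean_value[of x] by (elim exE conjE) (rule that)
 have main: "heat_kernel c s T x y <= gauss_const (CARD('d)) cf eps lv * T powr (- real ?d / 2) * exp (- (gauss_rate (CARD('d)) cf * (cf / real ?d) / 2) * (l1norm (x - y))\<^sup>2 / T)"
  if T: "T >= max 1 (2 * R1\<^sup>2)" and y: "y \<in> C" and far: "l1norm (x - y) >= real ?d * max D\<^sub>0 (max 1 (linfnorm x))" and near: "l1norm (x - y) <= T" for T y
 proof -
  have T1: "T >= 1" "T >= 2 * R1\<^sup>2" using T by auto
  define D where "D = l1norm (x - y)"
  define Di where "Di = linfnorm (x - y)"
  have Di: "Di >= 0" "Di <= D" "D <= real ?d * Di"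
   unfolding Di_def D_def by (rule linfnorm_nonneg linfnorm_le_l1norm l1norm_le_linfnorm)+
  have D0: "D >= 0" using Di by linarith
  define R where "R = sqrt (T / 2)"
  have Rsq: "R\<^sup>2 = T / 2" using T1 by (simp add: R_def)
  have Rge: "R >= R1"
  proof -
   have "R1 = sqrt (R1\<^sup>2)" using R1 by simp
   also have "... <= R" unfolding R_def using T1 by (intro real_sqrt_le_mono) simp
   finally show ?thesis .
  qed
  have Rpos: "R > 0" using Rge R1 by linarith
  define Y where "Y = D / sqrt T"
  have sT: "sqrt T > 0" "(sqrt T)\<^sup>2 = T" using T1 by auto
  have Y0': "Y >= 0" using D0 sT by (simp add: Y_def)
  have Ysq: "Y\<^sup>2 = D\<^sup>2 / T" using sT by (simp add: Y_def power_divide)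
  define l where "l = e0 * D / T"
  have l0: "l >= 0" using e0 D0 T1 by (simp add: l_def)
  have l1: "l <= 1"
  proof -
   have "D / T <= 1" using near T1 by (simp add: D_def)
   then have "e0 * (D / T) <= 1 * 1" using e0 e01 D0 T1 by (intro mult_mono) auto
   then show ?thesis by (simp add: l_def)
  qed
  \<comment> \<open>Large enough for the truncation to leave both the balls of radius
    \<open>R\<close> and the lower bound for the distance from \<open>x\<close> to \<open>y\<close>
    intact.\<close>
  define K where "K = max R (cf * Di)"
  have K: "K >= 0" "K >= R" "cf * Di <= K" using Rpos by (auto simp: K_def)
  define X where "X = Di / R"
  have X: "X >= 0" "Di <= X * R" using Di Rpos by (auto simp: X_def)
  have XY: "X <= 2 * Y"
  proof -
   have "R >= sqrt T / 2"
   proof -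
    have "sqrt T / 2 = sqrt (T / 4)" by (simp add: real_sqrt_divide)
    also have "... <= R" unfolding R_def using T1 by (intro real_sqrt_le_mono) auto
    finally show ?thesis .
   qed
   then have "Di / R <= D / (sqrt T / 2)" using Di sT by (intro frac_le) auto
   then show ?thesis by (simp add: X_def Y_def mult.commute)
  qed
  define Qx where "Qx = 4 * (1 + 0) powr (2 * real ?d / eps) / ((R / cf) ^ ?d * lv)"
  define Qy where "Qy = 4 * (1 + X) powr (2 * real ?d / eps) / ((R / cf) ^ ?d * lv)"
  have Q: "Qx > 0" "Qy > 0" using Rpos cf Y0(1) X by (simp_all add: Qx_def Qy_def)
  define h where "h = 3 ^ ?d * (cosh l - 1)"
  have h0: "h >= 0" using cosh_real_ge_1[of l] by (simp add: h_def)
  let ?\<rho> = "td K x"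
  have kb: "(v T x)\<^sup>2 <= (Qx * exp (2 * (l * R) + 2 * h * R\<^sup>2)) * (Qy * exp (2 * (l * R - l * ?\<rho> y) + 2 * h * R\<^sup>2))"
   if kd: "killed_domain c s C W B" and xy: "x \<in> B" "y \<in> B" and v: "killed_walk.heat_sol W B c s v" "v 0 = (\<lambda>z. if z = y then 1 / s y else 0)" for W B v
  proof -
   note s0 = s_pos
   interpret kw: killed_walk W B c s using kd by (simp add: killed_domain_def)
   have "linfnorm (x - y) <= 4 * R\<^sup>2" using Di(2) near T1 unfolding Rsq D_def Di_def by linarith
   then have mvy: "mean_value_at y R Qy"
    unfolding Qy_def using X by (intro mv[rule_format] Rge y) (simp_all add: Di_def)
   have mvx: "mean_value_at x R Qx"
    unfolding Qx_def using Rpos by (intro mv[rule_format] Rge x) simp_all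
   obtain u where u: "kw.heat_sol u" "u 0 = (\<lambda>z. if z = x then 1 / s x else 0)"
   proof (rule kw.heat_sol_exists[of "\<lambda>z. if z = x then 1 / s x else 0"])
    show "0 <= (if z = x then 1 / s x else 0)" for z using s0[of x] by simp
    show "z \<notin> B ==> (if z = x then 1 / s x else 0) = 0" for z using xy by auto
   qed (rule that)
   have hx: "(\<Sum>w\<in>W. c z w * (cosh (l * ?\<rho> z - l * ?\<rho> w) - 1)) <= h * s z" for z
    using tdist_cosh[OF K(1) kw.finite_W, of z l x] by (simp add: h_def)
   have hy: "(\<Sum>w\<in>W. c z w * (cosh (- (l * ?\<rho> z) - - (l * ?\<rho> w)) - 1)) <= h * s z" for z
    using tdist_cosh_neg[OF K(1) kw.finite_W, of z l x] by (simp only: h_def)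
   have A: "(\<Sum>z\<in>B. s z * (u (R\<^sup>2) z * exp (l * ?\<rho> z))\<^sup>2) <= Qx * exp (2 * (l * R) + 2 * h * R\<^sup>2)"
   proof (rule kw.weighted_l2_kernel[OF u xy(1) _ hx h0, where \<rho> = ?\<rho> and R = R])
    show "l * ?\<rho> z <= l * R" if "?\<rho> z < R" for z using that l0 by (intro mult_left_mono) auto
    show "(w (R\<^sup>2) x)\<^sup>2 <= Qx * S" if "kw.heat_sol w" "S > 0" "\<And>\<tau>. 0 <= \<tau> ==> \<tau> <= R\<^sup>2 ==> (\<Sum>z | z \<in> B \<and> ?\<rho> z < R. s z * (w \<tau> z)\<^sup>2) <= S" for w S
     using mvx kd xy that K(2) unfolding mean_value_at_def by blast
   qed (use Q in auto)
   have A': "(\<Sum>z\<in>B. s z * (v (R\<^sup>2) z * exp (- (l * ?\<rho> z)))\<^sup>2) <= Qy * exp (2 * (l * R - l * ?\<rho> y) + 2 * h * R\<^sup>2)"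
   proof (rule kw.weighted_l2_kernel[OF v xy(2) _ hy h0, where \<rho> = "td K y" and R = R])
    \<comment> \<open>By the triangle inequality the weight varies by at most \<open>l * R\<close>
      over the ball around \<open>y\<close>; its value at \<open>y\<close> is the gain.\<close>
    show "- (l * ?\<rho> z) <= l * R - l * ?\<rho> y" if "td K y z < R" for z
    proof -
     have "?\<rho> y <= ?\<rho> z + R" using tdist_triangle[where \<tau> = "edge_time c s", OF K(1) edge_time_sym, of x y z] that by linarith
     then have "l * ?\<rho> y <= l * (?\<rho> z + R)" using l0 by (rule mult_left_mono)
     then show ?thesis by (simp add: distrib_left)
    qed
    show "(w (R\<^sup>2) y)\<^sup>2 <= Qy * S" if "kw.heat_sol w" "S > 0" "\<And>\<tau>. 0 <= \<tau> ==> \<tau> <= R\<^sup>2 ==> (\<Sum>z | z \<in> B \<and> td K y z < R. s z * (w \<tau> z)\<^sup>2) <= S" for w S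
     using mvy kd xy that K(2) unfolding mean_value_at_def by blast
   qed (use Q in auto)
   have "2 * R\<^sup>2 = T" using Rsq by simp
   then show ?thesis using kw.kernel_bound[OF u v xy A A'] by simp
  qed
  define F where "F = gauss_const (CARD('d)) cf eps lv * T powr (- real ?d / 2) * exp (- (e0 * c1 / 2) * D\<^sup>2 / T)"
  have F0: "F >= 0" using gauss_const_pos by (simp add: F_def)
  have FF: "(Qx * exp (2 * (l * R) + 2 * h * R\<^sup>2)) * (Qy * exp (2 * (l * R - l * ?\<rho> y) + 2 * h * R\<^sup>2)) <= F\<^sup>2"
  proof -
   define E where "E = (4 * a + 4 * e0)\<^sup>2 / (4 * (e0 * c1 / 2))"
   have E0: "E >= 0" using e0 c1 by (simp add: E_def)
   have Rc: "(R / cf) ^ ?d >= R ^ ?d" using Rpos cf by (intro power_mono) (auto simp: le_divide_eq mult_left_le)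
   have Rd: "R ^ ?d > 0" using Rpos by simp
   have \<rho>y: "c1 * D <= ?\<rho> y" unfolding c1_def D_def by (rule td_linear(2)[OF far]) (use K(3) in \<open>simp add: Di_def\<close>)
   \<comment> \<open>The polynomial loss in the mean value constant at \<open>y\<close> becomes one
     of the linear terms through \<open>1 + X <= exp X\<close>.\<close>
   have Xp: "(1 + X) powr (2 * real ?d / eps) <= exp (4 * a * Y)"
   proof -
    have "(1 + X) powr (2 * real ?d / eps) <= exp X powr (2 * a)"
     unfolding a_def using X eps by (simp add: powr_mono2)
    also have "... = exp (2 * a * X)" by (simp add: powr_def)
    also have "... <= exp (4 * a * Y)" using mult_left_mono[OF XY, of "2 * a"] a0 by simp
    finally show ?thesis .
   qed
   have lR: "4 * (l * R) <= 4 * e0 * Y"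
   proof -
    have "R <= sqrt T" unfolding R_def using T1 by (intro real_sqrt_le_mono) auto
    then have "l * R <= l * sqrt T" using l0 by (rule mult_left_mono)
    also have "l * sqrt T = e0 * Y" using sT T1 by (simp add: l_def Y_def field_simps real_sqrt_mult[symmetric])
    finally show ?thesis by simp
   qed
   have l\<rho>: "2 * (e0 * c1) * Y\<^sup>2 <= 2 * (l * ?\<rho> y)"
   proof -
    have "l * (c1 * D) <= l * ?\<rho> y" using \<rho>y l0 by (rule mult_left_mono)
    moreover have "l * (c1 * D) = e0 * c1 * Y\<^sup>2" unfolding Ysq by (simp add: l_def power2_eq_square)
    ultimately show ?thesis by simp
   qed
   have hT: "4 * h * R\<^sup>2 <= e0 * c1 / 2 * Y\<^sup>2"
   proof -
    have "cosh l - 1 <= l\<^sup>2" using l0 l1 by (intro cosh_le_quadratic) auto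
    then have "h <= 3 ^ ?d * l\<^sup>2" unfolding h_def by (intro mult_left_mono) auto
    then have "2 * h * T <= 2 * (3 ^ ?d * l\<^sup>2) * T" using T1 by (intro mult_right_mono mult_left_mono) auto
    also have "... = 2 * (3 ^ ?d * e0) * e0 * (D\<^sup>2 / T)" using T1 by (simp add: l_def power2_eq_square)
    also have "... = e0 * c1 / 2 * Y\<^sup>2" unfolding e0eq Ysq by simp
    finally have "2 * h * T <= e0 * c1 / 2 * Y\<^sup>2" .
    moreover have "4 * h * R\<^sup>2 = 2 * h * T" using Rsq by simp
    ultimately show ?thesis by linarith
   qed
   have "4 * a * Y + 4 * e0 * Y <= E + e0 * c1 / 2 * Y\<^sup>2"
    using gauss_arith[OF Y0', of "e0 * c1 / 2" "4 * a + 4 * e0"] e0 c1 by (simp add: E_def distrib_right)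
   then have expo: "4 * a * Y + (2 * (l * R) + 2 * h * R\<^sup>2 + (2 * (l * R - l * ?\<rho> y) + 2 * h * R\<^sup>2)) <= E - e0 * c1 * Y\<^sup>2"
    using lR l\<rho> hT by (simp add: algebra_simps)
   have "(Qx * exp (2 * (l * R) + 2 * h * R\<^sup>2)) * (Qy * exp (2 * (l * R - l * ?\<rho> y) + 2 * h * R\<^sup>2))
    = Qx * Qy * exp (2 * (l * R) + 2 * h * R\<^sup>2 + (2 * (l * R - l * ?\<rho> y) + 2 * h * R\<^sup>2))"
    by (simp only: exp_add mult_ac)
   also have "... <= (16 / (R ^ ?d * lv)\<^sup>2 * exp (4 * a * Y)) * exp (2 * (l * R) + 2 * h * R\<^sup>2 + (2 * (l * R - l * ?\<rho> y) + 2 * h * R\<^sup>2))"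
   proof (rule mult_right_mono)
    have "Qx <= 4 / (R ^ ?d * lv)" unfolding Qx_def using Rc Rd Y0(1) by (simp add: frac_le mult_right_mono)
    moreover have "Qy <= 4 * exp (4 * a * Y) / (R ^ ?d * lv)"
     unfolding Qy_def using Rc Rd Y0(1) Xp by (intro frac_le mult_left_mono mult_right_mono) auto
    ultimately have "Qx * Qy <= 4 / (R ^ ?d * lv) * (4 * exp (4 * a * Y) / (R ^ ?d * lv))"
     using Q Rd Y0(1) by (intro mult_mono) auto
    then show "Qx * Qy <= 16 / (R ^ ?d * lv)\<^sup>2 * exp (4 * a * Y)" by (simp add: power2_eq_square mult_ac)
   qed simp
   also have "... = 16 / (R ^ ?d * lv)\<^sup>2 * exp (4 * a * Y + (2 * (l * R) + 2 * h * R\<^sup>2 + (2 * (l * R - l * ?\<rho> y) + 2 * h * R\<^sup>2)))"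
    by (simp only: exp_add mult.assoc)
   also have "... <= 16 / (R ^ ?d * lv)\<^sup>2 * exp (E - e0 * c1 * Y\<^sup>2)" using expo by (intro mult_left_mono) auto
   also have "16 / (R ^ ?d * lv)\<^sup>2 = 16 * 2 ^ ?d / lv\<^sup>2 * (1 / T ^ ?d)"
   proof -
    have "(R ^ ?d)\<^sup>2 = (R\<^sup>2) ^ ?d" by (simp only: power_mult[symmetric] mult.commute)
    then have "(R ^ ?d)\<^sup>2 = T ^ ?d / 2 ^ ?d" unfolding Rsq by (simp add: power_divide)
    then show ?thesis by (simp add: power_mult_distrib)
   qed
   also have "16 * 2 ^ ?d / lv\<^sup>2 * (1 / T ^ ?d) * exp (E - e0 * c1 * Y\<^sup>2) <= (4 * 2 ^ ?d / lv * exp E)\<^sup>2 * (1 / T ^ ?d) * exp (- (e0 * c1) * Y\<^sup>2)"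
   proof -
    have "16 * 2 ^ ?d / lv\<^sup>2 * exp E <= (4 * 2 ^ ?d / lv * exp E)\<^sup>2"
    proof -
     have p: "(2::real) ^ ?d <= (2 ^ ?d)\<^sup>2" by (intro self_le_power) (auto simp: one_le_power)
     have q: "exp E <= (exp E)\<^sup>2" using E0 by (intro self_le_power) auto
     have "16 * 2 ^ ?d / lv\<^sup>2 * exp E <= 16 * (2 ^ ?d)\<^sup>2 / lv\<^sup>2 * (exp E)\<^sup>2"
      using p q by (intro mult_mono divide_right_mono mult_left_mono) auto
     also have "... = (4 * 2 ^ ?d / lv * exp E)\<^sup>2" by (simp add: power_mult_distrib power_divide)
     finally show ?thesis .
    qed
    then have "16 * 2 ^ ?d / lv\<^sup>2 * exp E * ((1 / T ^ ?d) * exp (- (e0 * c1) * Y\<^sup>2)) <= (4 * 2 ^ ?d / lv * exp E)\<^sup>2 * ((1 / T ^ ?d) * exp (- (e0 * c1) * Y\<^sup>2))"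
     using T1 by (intro mult_right_mono) auto
    moreover have "exp (E - e0 * c1 * Y\<^sup>2) = exp E * exp (- (e0 * c1) * Y\<^sup>2)" unfolding exp_add[symmetric] by simp
    ultimately show ?thesis by (simp only: mult_ac)
   qed
   also have "... = F\<^sup>2"
   proof -
    have gc: "4 * 2 ^ ?d / lv * exp E = gauss_const (CARD('d)) cf eps lv"
     unfolding gauss_const_def Let_def E_def a_def e0_def c1_def by simp
    have t2: "(T powr (- real ?d / 2))\<^sup>2 = 1 / T ^ ?d" using T1 by (intro powr_half_square) simp
    have e2: "(exp (- (e0 * c1 / 2) * D\<^sup>2 / T))\<^sup>2 = exp (- (e0 * c1) * Y\<^sup>2)"
     unfolding Ysq by (simp add: exp_double[symmetric])
    show ?thesis unfolding F_def power_mult_distrib t2 e2 gc ..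
   qed
   finally show ?thesis .
  qed
  have "heat_kernel c s T x y <= F"
  proof (rule heat_kernel_le[OF x y closed nb])
   fix W B v
   assume k: "killed_domain c s C W B" "x \<in> B" "y \<in> B" "killed_walk.heat_sol W B c s v" "v 0 = (\<lambda>z. if z = y then 1 / s y else 0)"
   have "(v T x)\<^sup>2 <= F\<^sup>2" using kb[OF k] FF by (rule order_trans)
   then show "v T x <= F" using F0 by (rule power2_le_imp_le)
  qed (use T1 F0 in auto)
  then show ?thesis by (simp add: F_def e0_def c1_def D_def)
 qed
 show ?thesis
  by (intro exI[of _ "max 1 (2 * R1\<^sup>2)"] conjI exI[of _ "real ?d * max D\<^sub>0 (max 1 (linfnorm x))"] allI ballI impI main) auto
qed

text \<open>Here \<open>D\<close> is at least a multiple of \<open>T\<close>, so the factors from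
  \<open>s y\<close> and \<open>T powr (- d / 2)\<close> are polynomial in \<open>D\<close> and are
  absorbed by part of the exponential; \<open>davies_kernel\<close> suffices. With
  \<open>q = sqrt (D / T)\<close> and \<open>l = ln q\<close> the error \<open>h * T\<close> is at
  most \<open>3 ^ d * q * T\<close>, which is \<open>3 ^ d * D / q\<close> and thus a small multiple
  of \<open>D\<close>, against the gain \<open>c1 * D * l\<close>.\<close>

lemma far_bound:
 assumes x: "x \<in> C"
 shows "\<exists>N\<^sub>8. \<forall>T\<ge>1. \<forall>y\<in>C. l1norm (x - y) >= N\<^sub>8 --> l1norm (x - y) >= far_speed (CARD('d)) cf * T -->
  heat_kernel c s T x y <= T powr (- real CARD('d) / 2) * exp (- (cf / real CARD('d) / 4) * l1norm (x - y) * max 1 (ln (l1norm (x - y) / T)))"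
proof -
 let ?d = "CARD('d)"
 define c1 where "c1 = cf / real ?d"
 have d1: "real ?d >= 1" by (simp add: Suc_le_eq)
 have c1: "c1 > 0" using cf by (simp add: c1_def)
 define q0 where "q0 = max (exp 1) (4 * 3 ^ ?d / c1)"
 have fs: "far_speed (CARD('d)) cf = q0\<^sup>2" by (simp add: far_speed_def q0_def c1_def)
 have q0: "q0 >= exp 1" "q0 >= 4 * 3 ^ ?d / c1" by (auto simp: q0_def)
 have q0p: "q0 > 0" using q0(1) exp_gt_zero[of 1] by linarith
 obtain R0 where "\<forall>R\<ge>R0. box_averages c s C \<kappa> p r M x R \<and> (\<Sum>v\<in>box x R \<inter> C. inverse (s v) powr 1) <= M * R powr real ?d"
  using avg by blast
 then have R0: "R >= R0 ==> (\<Sum>v\<in>box x R \<inter> C. inverse (s v) powr 1) <= M * R powr real ?d" for R by simp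
 \<comment> \<open>Beyond \<open>N\<close> the factor \<open>exp (c1 / 2 * D)\<close> pays for the
   polynomial; \<open>1 / s x\<close> is a constant because \<open>x\<close> is fixed.\<close>
 have "((\<lambda>D. M / s x * D ^ (2 * ?d) * exp (- (c1 / 2 * D))) \<longlongrightarrow> 0) at_top" using c1 by real_asymp
 then have "eventually (\<lambda>D. M / s x * D ^ (2 * ?d) * exp (- (c1 / 2 * D)) < 1) at_top" by (rule order_tendstoD) simp
 then obtain N where N: "\<And>D. D >= N ==> M / s x * D ^ (2 * ?d) * exp (- (c1 / 2 * D)) < 1"
  unfolding eventually_at_top_linorder by blast
 have main: "heat_kernel c s T x y <= T powr (- real ?d / 2) * exp (- (cf / real ?d / 4) * l1norm (x - y) * max 1 (ln (l1norm (x - y) / T)))"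
  if T: "T >= 1" and y: "y \<in> C" and far: "l1norm (x - y) >= max (max R0 N) (real ?d * max D\<^sub>0 (max 1 (linfnorm x)))" and big: "l1norm (x - y) >= far_speed (CARD('d)) cf * T" for T y
 proof -
  define D where "D = l1norm (x - y)"
  define Di where "Di = linfnorm (x - y)"
  have Di: "Di >= 0" "Di <= D" "D <= real ?d * Di"
   unfolding Di_def D_def by (rule linfnorm_nonneg linfnorm_le_l1norm l1norm_le_linfnorm)+
  have D1: "D >= 1" using td_linear(1)[of x y "cf * linfnorm (x - y)"] far Di by (simp add: Di_def)
  define q where "q = sqrt (D / T)"
  have qsq: "q\<^sup>2 = D / T" using D1 T by (simp add: q_def)
  have q: "q >= q0"
  proof -
   have "q0\<^sup>2 <= D / T" using big T unfolding fs D_def by (simp add: le_divide_eq)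
   then show ?thesis unfolding q_def using q0p by (intro real_le_rsqrt)
  qed
  have qp: "q > 0" using q q0p by linarith
  define l where "l = ln q"
  have el: "exp l = q" using qp by (simp add: l_def)
  have l1: "l >= 1" unfolding l_def using q q0(1) qp ln_ge_iff[of q 1] by linarith
  have LD: "ln (D / T) = 2 * l" unfolding qsq[symmetric] l_def using qp by (simp add: ln_realpow)
  define K where "K = cf * Di"
  have K: "K >= 0" using Di cf by (simp add: K_def)
  let ?\<rho> = "td K x"
  have \<rho>y: "c1 * D <= ?\<rho> y" unfolding c1_def D_def by (rule td_linear(2)) (use far in \<open>simp_all add: K_def Di_def\<close>)
  define F where "F = T powr (- real ?d / 2) * exp (- (c1 / 4) * D * (2 * l))"
  have F0: "F >= 0" by (simp add: F_def)
  define h where "h = 3 ^ ?d * (cosh l - 1)"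
  have hT: "h * T <= c1 / 4 * D * l"
  proof -
   have "exp (- l) <= exp l" using l1 by simp
   moreover have "2 * cosh l = exp l + exp (- l)" by (simp add: cosh_field_def)
   ultimately have "cosh l - 1 <= q" unfolding el by linarith
   then have "h <= 3 ^ ?d * q" unfolding h_def by (intro mult_left_mono) auto
   then have "h * T <= 3 ^ ?d * q * T" using T by (intro mult_right_mono) auto
   also have "... = 3 ^ ?d / q * D"
   proof -
    have "q * T = D / q" using qsq qp T by (simp add: power2_eq_square field_simps)
    then show ?thesis by (simp only: mult.assoc) simp
   qed
   also have "3 ^ ?d / q * D <= c1 / 4 * D"
   proof (rule mult_right_mono)
    have "4 * 3 ^ ?d / c1 <= q" using q q0(2) by linarith
    then show "3 ^ ?d / q <= c1 / 4" using c1 qp by (simp add: field_simps)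
   qed (use D1 in simp)
   also have "... <= c1 / 4 * D * l" using mult_left_mono[OF l1, of "c1 / 4 * D"] c1 D1 by simp
   finally show ?thesis .
  qed
  have sy: "1 <= s y * (M * D ^ ?d)" using far D1 Di y by (intro speed_lower[OF R0]) (auto simp: D_def Di_def)
  have sx: "s x > 0" by (rule s_pos)
  have "heat_kernel c s T x y <= F"
  proof (rule heat_kernel_le[OF x y closed nb])
   fix W B v
   assume k: "killed_domain c s C W B" "x \<in> B" "y \<in> B" "killed_walk.heat_sol W B c s v" "v 0 = (\<lambda>z. if z = y then 1 / s y else 0)"
   have "(v T x)\<^sup>2 <= F\<^sup>2"
   proof -
    interpret kw: killed_walk W B c s using k(1) by (simp add: killed_domain_def)
    have hy: "(\<Sum>w\<in>W. c z w * (cosh (- (l * ?\<rho> z) - - (l * ?\<rho> w)) - 1)) <= h * s z" for z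
     using tdist_cosh_neg[OF K kw.finite_W, of z l x] by (simp only: h_def)
    have "s x * s y * (v T x)\<^sup>2 <= exp (2 * (h * T + - (l * ?\<rho> y) - - (l * ?\<rho> x)))"
     using T by (intro kw.davies_kernel[OF k(4,5,2,3) _ hy]) auto
    also have "... <= exp (- (3 / 2) * c1 * D * l)"
    proof -
     have "l * (c1 * D) <= l * ?\<rho> y" using \<rho>y l1 by (intro mult_left_mono) auto
     then show ?thesis using hT tdist_self[OF K, of "edge_time c s" x] by (simp add: algebra_simps)
    qed
    finally have kb: "s x * s y * (v T x)\<^sup>2 <= exp (- (3 / 2) * c1 * D * l)" .
    have "s x * (v T x)\<^sup>2 * 1 <= s x * (v T x)\<^sup>2 * (s y * (M * D ^ ?d))"
     using sy sx by (intro mult_left_mono) auto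
    also have "... = s x * s y * (v T x)\<^sup>2 * (M * D ^ ?d)" by (simp only: mult_ac)
    also have "... <= exp (- (3 / 2) * c1 * D * l) * (M * D ^ ?d)" using kb M D1 by (intro mult_right_mono) auto
    finally have "(v T x)\<^sup>2 <= M / s x * D ^ ?d * exp (- (3 / 2) * c1 * D * l)"
     using sx by (simp add: field_simps)
    also have "... <= 1 / T ^ ?d * exp (- (c1 * D * l))"
    proof -
     have "M / s x * D ^ ?d * T ^ ?d <= M / s x * D ^ ?d * D ^ ?d"
     proof -
      have "1 <= q0\<^sup>2" using q0(1) exp_ge_add_one_self[of 1] by (intro one_le_power) linarith
      then have "1 * T <= q0\<^sup>2 * T" using T by (intro mult_right_mono) auto
      then have "T <= D" using big unfolding fs D_def by linarith
      then show ?thesis using T M sx D1 by (intro mult_left_mono power_mono) auto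
     qed
     also have "... = M / s x * D ^ (2 * ?d)" by (simp add: power_add[symmetric] mult_2)
     also have "... <= exp (c1 / 2 * D)"
     proof -
      have "N <= D" using far by (simp add: D_def)
      then have "M / s x * D ^ (2 * ?d) * exp (- (c1 / 2 * D)) * exp (c1 / 2 * D) <= 1 * exp (c1 / 2 * D)"
       by (intro mult_right_mono less_imp_le[OF N]) auto
      moreover have "exp (- (c1 / 2 * D)) * exp (c1 / 2 * D) = 1" by (simp add: exp_minus)
      ultimately show ?thesis by (simp only: mult.assoc mult_1_right mult_1)
     qed
     also have "... <= exp (c1 / 2 * D * l)" using mult_left_mono[OF l1, of "c1 / 2 * D"] c1 D1 by simp
     finally have *: "M / s x * D ^ ?d * T ^ ?d <= exp (c1 / 2 * D * l)" .
     have "M / s x * D ^ ?d * exp (- (3 / 2) * c1 * D * l) = M / s x * D ^ ?d * T ^ ?d * (1 / T ^ ?d * exp (- (3 / 2) * c1 * D * l))"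
      using T by simp
     also have "... <= exp (c1 / 2 * D * l) * (1 / T ^ ?d * exp (- (3 / 2) * c1 * D * l))"
      using * T by (intro mult_right_mono) auto
     also have "... = 1 / T ^ ?d * (exp (c1 / 2 * D * l) * exp (- (3 / 2) * c1 * D * l))" by simp
     also have "exp (c1 / 2 * D * l) * exp (- (3 / 2) * c1 * D * l) = exp (- (c1 * D * l))"
      unfolding exp_add[symmetric] by simp
     finally show ?thesis .
    qed
    also have "... = F\<^sup>2"
    proof -
     have t2: "(T powr (- real ?d / 2))\<^sup>2 = 1 / T ^ ?d" using T by (intro powr_half_square) simp
     have e2: "(exp (- (c1 / 4) * D * (2 * l)))\<^sup>2 = exp (- (c1 * D * l))" by (simp add: exp_double[symmetric])
     show ?thesis unfolding F_def power_mult_distrib t2 e2 ..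
    qed
    finally show ?thesis .
   qed
   then show "v T x <= F" using F0 by (rule power2_le_imp_le)
  qed (use T F0 in auto)
  moreover have "max 1 (ln (D / T)) = 2 * l" unfolding LD using l1 by simp
  ultimately show ?thesis by (simp add: F_def c1_def D_def)
 qed
 show ?thesis
  by (intro exI[of _ "max (max R0 N) (real ?d * max D\<^sub>0 (max 1 (linfnorm x)))"] allI ballI impI main) auto
qed

end

section \<open>Exponents and conclusion\<close>

lemma ereal_inverse_exponent:
 assumes "(r :: ereal) > 1"
 obtains A where "1 / r = ereal A" "0 <= A" "A < 1" "\<And>x. x > 0 ==> A <= 1 / x ==> ereal x <= r"
proof (cases r)
 case (real y)
 then have y: "y > 1" using assms by simp
 show ?thesis
 proof (rule that[of "1 / y"])
  show "1 / r = ereal (1 / y)" using real y by (simp add: one_ereal_def)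
  show "ereal x <= r" if "x > 0" "1 / y <= 1 / x" for x using that real y by (simp add: frac_le_eq field_simps)
 qed (use y in auto)
next
 case PInf
 then show ?thesis by (intro that[of 0]) auto
next
 case MInf
 then show ?thesis using assms by simp
qed

text \<open>With \<open>A\<close> and \<open>B\<close> the reciprocals of \<open>r\<close> and
  \<open>q\<close>, the slack in \<open>A + B < 2 / d\<close> is \<open>6 * g\<close>. Each
  reciprocal is enlarged by \<open>2 * g\<close>, and the reciprocal of \<open>q\<^sub>0\<close> by
  \<open>g\<close> only, so that \<open>q\<^sub>0\<close> stays strictly above
  \<open>1 / p'\<close>; this is the room used for the high powers of
  \<open>\<kappa>\<close>.\<close>

lemma reduced_exponents:
 fixes p q r :: ereal and d :: real
 assumes p: "p > 1" and q: "q > 1" and r: "r > 1" and d: "d >= 2" and sum: "1 / r + 1 / p * (1 - 1 / r) + 1 / q < ereal (2 / d)"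
 obtains p' r' q\<^sub>0 :: real where "0 < p'" "p' < 1" "0 < r'" "r' < 1" "p' + r' < 2 / d" "0 < q\<^sub>0" "q\<^sub>0 * p' > 1" "ereal q\<^sub>0 <= q" "ereal (1 / r') <= r"
proof -
 obtain A where A: "1 / r = ereal A" "0 <= A" "A < 1" "\<And>x. x > 0 ==> A <= 1 / x ==> ereal x <= r" by (rule ereal_inverse_exponent[OF r]) (rule that)
 obtain B where B: "1 / q = ereal B" "0 <= B" "B < 1" "\<And>x. x > 0 ==> B <= 1 / x ==> ereal x <= q" by (rule ereal_inverse_exponent[OF q]) (rule that)
 obtain E where E: "1 / p = ereal E" "0 <= E" "E < 1" by (rule ereal_inverse_exponent[OF p])
 have "A + E * (1 - A) + B < 2 / d" using sum unfolding A(1) B(1) E(1) by (simp add: one_ereal_def)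
 moreover have "E * (1 - A) >= 0" using A E by simp
 ultimately have AB: "A + B < 2 / d" by linarith
 define g where "g = (2 / d - A - B) / 6"
 have g: "g > 0" using AB by (simp add: g_def)
 have d1: "2 / d <= 1" using d by simp
 have "6 * g = 2 / d - A - B" by (simp add: g_def)
 then have six: "A + B + 6 * g = 2 / d" by linarith
 show ?thesis
 proof (rule that[of "B + 2 * g" "A + 2 * g" "1 / (B + g)"])
  show "1 < 1 / (B + g) * (B + 2 * g)" using g B by (simp add: field_simps)
  show "ereal (1 / (B + g)) <= q" using g B(2) by (intro B(4)) auto
  show "ereal (1 / (A + 2 * g)) <= r" using g A(2) by (intro A(4)) auto
 qed (use g A B six d1 in auto)
qed

theorem theorem3p7:
  fixes ME :: "'e::order measure" and MV :: "'v::order measure"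
    and N :: "'d::finite region"
    and a :: "('e, 'v, 'd) config \<times> ('e, 'v, 'd) config \<times> 'e \<Rightarrow> real"
    and \<theta> :: "('e, 'v, 'd) config \<Rightarrow> real"
    and I :: "real set"
    and P :: "real \<Rightarrow> ('e, 'v, 'd) config measure"
  defines "\<Omega>\<^sub>N \<equiv> region_space ME MV N"
    and "c \<equiv> conductance N a"
    and "s \<equiv> speed N \<theta>"
  assumes "CARD('d) \<ge> 2"
    and "open I" and "is_interval I"
    and "\<And>u. u \<in> I \<Longrightarrow> prob_space (P u)"
    and "\<And>u. u \<in> I \<Longrightarrow> sets (P u) = sets (config_space ME MV)"
    and "fst N \<subseteq> lattice_edges" and "finite (fst N)" and "finite (snd N)"
    and "a \<in> borel_measurable (\<Omega>\<^sub>N \<Otimes>\<^sub>M \<Omega>\<^sub>N \<Otimes>\<^sub>M ME)"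
    and "\<And>z. z \<in> space (\<Omega>\<^sub>N \<Otimes>\<^sub>M \<Omega>\<^sub>N \<Otimes>\<^sub>M ME) \<Longrightarrow> a z \<ge> 0"
    and "\<And>w\<^sub>1 w\<^sub>2 e. \<lbrakk>w\<^sub>1 \<in> space \<Omega>\<^sub>N; w\<^sub>2 \<in> space \<Omega>\<^sub>N; e \<in> space ME\<rbrakk> \<Longrightarrow> a (w\<^sub>1, w\<^sub>2, e) = a (w\<^sub>2, w\<^sub>1, e)"
    and "monotone_fun_on (space (\<Omega>\<^sub>N \<Otimes>\<^sub>M \<Omega>\<^sub>N \<Otimes>\<^sub>M ME)) (indicator {z. a z > 0} :: _ \<Rightarrow> real)"
    and "\<theta> \<in> borel_measurable \<Omega>\<^sub>N"
    and "\<And>w. w \<in> space \<Omega>\<^sub>N \<Longrightarrow> \<theta> w > 0"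
    and "cond_P1 ME MV I P" and "cond_P2 ME MV I P" and "cond_P3 ME MV I P"
    and "cond_S1 I P c" and "cond_S2 I P c"
    and "cond_M ME MV I P N a \<theta>"
    and "u \<in> I"
  shows "\<exists>c\<^sub>2\<^sub>1>0. \<exists>c\<^sub>2\<^sub>2>0. \<exists>c\<^sub>2\<^sub>3>0. \<exists>c\<^sub>2\<^sub>4>0. \<exists>c\<^sub>2\<^sub>5>0. AE \<omega> in P u.
    \<forall>x \<in> clusters (c \<omega>) \<infinity>. \<exists>N\<^sub>8 N\<^sub>9 :: real. \<forall>t\<ge>N\<^sub>9. \<forall>y \<in> clusters (c \<omega>) \<infinity>.
      l1norm (x - y) \<ge> N\<^sub>8 \<longrightarrow>
        (l1norm (x - y) \<le> c\<^sub>2\<^sub>1 * t \<longrightarrow>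
          heat_kernel (c \<omega>) (s \<omega>) t x y
            \<le> c\<^sub>2\<^sub>2 * t powr (- real CARD('d) / 2) * exp (- c\<^sub>2\<^sub>3 * (l1norm (x - y))\<^sup>2 / t))
      \<and> (l1norm (x - y) \<ge> c\<^sub>2\<^sub>5 * t \<longrightarrow>
          heat_kernel (c \<omega>) (s \<omega>) t x y
            \<le> c\<^sub>2\<^sub>2 * t powr (- real CARD('d) / 2)
                * exp (- c\<^sub>2\<^sub>4 * l1norm (x - y) * max 1 (ln (l1norm (x - y) / t))))"
proof -
 let ?d = "CARD('d)"
 note d2 = assms(4) and openI = assms(5) and probP = assms(7) and setsP = assms(8)
  and S1 = assms(21) and S2 = assms(22) and condM = assms(23) and u = assms(24)
 note family = assms(7-14,16-18,20)[unfolded \<Omega>\<^sub>N_def] condM[unfolded cond_M_def, THEN conjunct1]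
 interpret ordered_family ME MV N a \<theta> I P
  by (intro ordered_family.intro field.intro ordered_family_axioms.intro) (fact family)+
 interpret field_prob ME MV N a \<theta> "P u" by (rule field_prob_P[OF u])
 define A where "A = {\<omega> \<in> space (P u). 0 \<in> clusters (cond \<omega>) \<infinity>}"
 have A: "A \<in> sets (P u)" using clusters_pred[of 0 \<infinity>] by (simp add: A_def pred_def space_\<mu> sets_\<mu>)
 have Apos: "measure (P u) A > 0" using S2 u unfolding cond_S2_def A_def c_def by blast
 obtain p q r :: ereal where pqr: "p > 1" "q > 1" "r > 1" "1 / r + 1 / p * (1 - 1 / r) + 1 / q < ereal (2 / real ?d)"
  and mom: "\<forall>u\<in>I. let P\<^sub>0 = uniform_measure (P u) {\<omega> \<in> space (P u). 0 \<in> clusters (cond \<omega>) \<infinity>};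
         m = (\<lambda>\<omega>. mu (cond \<omega>) 0); n = (\<lambda>\<omega>. nu (cond \<omega>) 0); s = (\<lambda>\<omega>. spd \<omega> 0)
       in finite_moment P\<^sub>0 p (\<lambda>\<omega>. m \<omega> / s \<omega>) s \<and> finite_moment P\<^sub>0 q n (\<lambda>_. 1)
       \<and> finite_moment P\<^sub>0 r s (\<lambda>_. 1) \<and> finite_moment P\<^sub>0 q (\<lambda>\<omega>. inverse (s \<omega>)) (\<lambda>_. 1)"
  using condM unfolding cond_M_def by (elim exE conjE) (rule that)
 have fm: "finite_moment (uniform_measure (P u) A) q (\<lambda>\<omega>. nu (cond \<omega>) 0) (\<lambda>_. 1)"
  "finite_moment (uniform_measure (P u) A) r (\<lambda>\<omega>. spd \<omega> 0) (\<lambda>_. 1)"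
  "finite_moment (uniform_measure (P u) A) q (\<lambda>\<omega>. inverse (spd \<omega> 0)) (\<lambda>_. 1)"
  using bspec[OF mom u] by (simp_all add: A_def Let_def)
 have "real ?d >= 2" using d2 by simp
 then obtain p' r' q\<^sub>0 :: real where ex: "0 < p'" "p' < 1" "0 < r'" "r' < 1" "p' + r' < 2 / real ?d" "0 < q\<^sub>0" "q\<^sub>0 * p' > 1" "ereal q\<^sub>0 <= q" "ereal (1 / r') <= r"
  by (rule reduced_exponents[OF pqr(1-3) _ pqr(4)]) (rule that)
 have we: "walk_env (cond \<omega>) (spd \<omega>)" if "\<omega> \<in> space (P u)" for \<omega> using walk_env that by (simp add: space_\<mu>)
 have m1: "(\<integral>\<^sup>+\<omega>. indicator A \<omega> * ennreal (nu (cond \<omega>) 0 powr q\<^sub>0) \<partial>P u) < \<infinity>"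
 proof (rule finite_moment_lower[OF probP[OF u] A Apos _ _ fm(1) ex(6,8)])
  show "0 <= nu (cond \<omega>) 0" if "\<omega> \<in> space (P u)" for \<omega>
   unfolding nu_def using walk_env.nonneg[OF we[OF that]] by (intro sum_nonneg) simp
 qed (simp add: meas_\<mu>)
 have m2: "(\<integral>\<^sup>+\<omega>. indicator A \<omega> * ennreal (spd \<omega> 0 powr (1 / r')) \<partial>P u) < \<infinity>"
 proof (rule finite_moment_lower[OF probP[OF u] A Apos _ _ fm(2) _ ex(9)])
  show "0 <= spd \<omega> 0" if "\<omega> \<in> space (P u)" for \<omega> using walk_env.s_pos[OF we[OF that], of 0] by simp
 qed (use ex in \<open>simp_all add: meas_\<mu>\<close>)
 have m3: "(\<integral>\<^sup>+\<omega>. indicator A \<omega> * ennreal (inverse (spd \<omega> 0) powr 1) \<partial>P u) < \<infinity>"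
 proof (rule finite_moment_lower[OF probP[OF u] A Apos _ _ fm(3)])
  show "0 <= inverse (spd \<omega> 0)" if "\<omega> \<in> space (P u)" for \<omega> using walk_env.s_pos[OF we[OF that], of 0] by simp
  show "ereal 1 <= q" using pqr(2) by (simp add: one_ereal_def[symmetric])
 qed (simp_all add: meas_\<mu>)
 obtain f\<^sub>S \<Delta> R\<^sub>S where "percolating ME MV N a \<theta> (P u) (f\<^sub>S u) \<Delta> R\<^sub>S"
  using S1 unfolding cond_S1_def c_def
 proof (elim exE conjE, goal_cases)
  case (1 f\<^sub>S)
  obtain \<Delta> R\<^sub>S where "\<Delta> > 0 \<and> (\<forall>R\<ge>1. real R >= R\<^sub>S --> f\<^sub>S u R >= (ln (real R)) powr (1 + \<Delta>))"
   using bspec[OF 1(2) u] by (elim exE) (rule that)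
  then have "percolating ME MV N a \<theta> (P u) (f\<^sub>S u) \<Delta> R\<^sub>S"
   using bspec[OF 1(3) u] field_prob_axioms by (simp add: percolating_def percolating_axioms_def)
  then show ?case by (rule 1(1))
 qed
 then interpret percolating ME MV N a \<theta> "P u" "f\<^sub>S u" \<Delta> R\<^sub>S .
 obtain M where M: "M >= 1" and env: "AE \<omega> in P u. \<exists>\<phi> \<rho>. good_cluster (cond \<omega>) (spd \<omega>) (clusters (cond \<omega>) \<infinity>) \<phi> \<rho> \<and>
  (\<forall>x. \<exists>R\<^sub>0. \<forall>R\<ge>R\<^sub>0. box_averages (cond \<omega>) (spd \<omega>) (clusters (cond \<omega>) \<infinity>) (good_cluster.\<kappa> \<rho>) p' r' M x R \<and>
   (\<Sum>v\<in>box x R \<inter> clusters (cond \<omega>) \<infinity>. inverse (spd \<omega> v) powr 1) <= M * R powr real ?d)"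
  using good_env[OF ex(1,6,7) m1[unfolded A_def] m2[unfolded A_def] m3[unfolded A_def]] by (elim exE conjE) (rule that)
 obtain cf' where cf': "cf' > 0" and fpp: "AE \<omega> in P u. \<exists>D\<^sub>0. \<forall>y z xs. linfnorm (y - z) >= D\<^sub>0 --> linfnorm y <= linfnorm (y - z) ^ 3 --> xs ~= [] --> hd xs = y --> last xs = z -->
  ennreal (cf' * linfnorm (y - z)) <= pcost (etime \<omega>) xs"
  using first_passage_lower_bound[OF openI u] by (elim exE conjE) (rule that)
 obtain \<epsilon> C\<^sub>0 where eps: "0 < \<epsilon>" and C0: "C\<^sub>0 > 0" and FK: "\<forall>(c :: 'd vertex => 'd vertex => real) s C \<phi> \<rho>.
   good_cluster c s C \<phi> \<rho> --> faber_krahn_bound c s C (good_cluster.\<kappa> \<rho>) p' r' \<epsilon> C\<^sub>0"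
  using faber_krahn[OF d2 ex(1-5)] by (elim exE conjE) (rule that)
 \<comment> \<open>\<open>gaussian_env\<close> asks for a constant at most 1, and decreasing it
   preserves the lower bound.\<close>
 define cf where "cf = min 1 cf'"
 have cf: "0 < cf" "cf <= 1" "cf <= cf'" using cf' by (auto simp: cf_def)
 define lv where "lv = level_const ?d \<epsilon> (C\<^sub>0 * M\<^sup>2 / cf\<^sup>2)"
 \<comment> \<open>One prefactor for both regimes: \<open>far_bound\<close> has 1,
   \<open>gaussian_bound\<close> has \<open>gauss_const\<close>.\<close>
 define k where "k = max 1 (gauss_const ?d cf \<epsilon> lv)"
 have k: "k >= 1" "gauss_const ?d cf \<epsilon> lv <= k" by (auto simp: k_def)
 have pos: "gauss_rate ?d cf * (cf / real ?d) / 2 > 0" "cf / real ?d / 4 > 0" "k > 0" "far_speed ?d cf > 0"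
  using cf k by (auto simp: gauss_rate_def far_speed_def max_def)
 have main: "AE \<omega> in P u. \<forall>x\<in>clusters (cond \<omega>) \<infinity>. \<exists>N\<^sub>8 N\<^sub>9 :: real. \<forall>t\<ge>N\<^sub>9. \<forall>y\<in>clusters (cond \<omega>) \<infinity>. l1norm (x - y) >= N\<^sub>8 -->
   (l1norm (x - y) <= t --> heat_kernel (cond \<omega>) (spd \<omega>) t x y
     <= k * t powr (- real ?d / 2) * exp (- (gauss_rate ?d cf * (cf / real ?d) / 2) * (l1norm (x - y))\<^sup>2 / t))
   \<and> (l1norm (x - y) >= far_speed ?d cf * t --> heat_kernel (cond \<omega>) (spd \<omega>) t x y
     <= k * t powr (- real ?d / 2) * exp (- (cf / real ?d / 4) * l1norm (x - y) * max 1 (ln (l1norm (x - y) / t))))"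
  using env fpp
 proof eventually_elim
  case (elim \<omega>)
  let ?C = "clusters (cond \<omega>) \<infinity>"
  let ?near = "\<lambda>k x t y. l1norm (x - y) <= t --> heat_kernel (cond \<omega>) (spd \<omega>) t x y
   <= k * t powr (- real ?d / 2) * exp (- (gauss_rate ?d cf * (cf / real ?d) / 2) * (l1norm (x - y))\<^sup>2 / t)"
  let ?far = "\<lambda>k x t y. far_speed ?d cf * t <= l1norm (x - y) --> heat_kernel (cond \<omega>) (spd \<omega>) t x y
   <= k * t powr (- real ?d / 2) * exp (- (cf / real ?d / 4) * l1norm (x - y) * max 1 (ln (l1norm (x - y) / t)))"
  obtain \<phi> \<rho> where gc: "good_cluster (cond \<omega>) (spd \<omega>) ?C \<phi> \<rho>"
   and avg: "\<forall>x. \<exists>R\<^sub>0. \<forall>R\<ge>R\<^sub>0. box_averages (cond \<omega>) (spd \<omega>) ?C (good_cluster.\<kappa> \<rho>) p' r' M x R \<and>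
    (\<Sum>v\<in>box x R \<inter> ?C. inverse (spd \<omega> v) powr 1) <= M * R powr real ?d"
   using elim(1) by (elim exE conjE) (rule that)
  obtain D\<^sub>0 where D0: "\<forall>y z xs. linfnorm (y - z) >= D\<^sub>0 --> linfnorm y <= linfnorm (y - z) ^ 3 --> xs ~= [] --> hd xs = y --> last xs = z -->
   ennreal (cf' * linfnorm (y - z)) <= pcost (etime \<omega>) xs" using elim(2) by (elim exE) (rule that)
  have et: "etime \<omega> = edge_time (cond \<omega>) (spd \<omega>)" by (intro ext) (simp add: etime_def edge_time_def)
  interpret G: gaussian_env "cond \<omega>" "spd \<omega>" ?C \<phi> \<rho> p' r' M cf D\<^sub>0 \<epsilon> C\<^sub>0
  proof (intro gaussian_env.intro gaussian_env_axioms.intro gc M cf eps C0 avg FK[rule_format, OF gc])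
   show "ennreal (cf * linfnorm (y - z)) <= pcost (edge_time (cond \<omega>) (spd \<omega>)) xs"
    if "linfnorm (y - z) >= D\<^sub>0" "linfnorm y <= linfnorm (y - z) ^ 3" "xs ~= []" "hd xs = y" "last xs = z" for y z xs
   proof -
    have "ennreal (cf * linfnorm (y - z)) <= ennreal (cf' * linfnorm (y - z))"
     using cf linfnorm_nonneg[of "y - z"] by (intro ennreal_leI mult_right_mono) auto
    also have "... <= pcost (etime \<omega>) xs" using D0 that by blast
    finally show ?thesis unfolding et .
   qed
   show "\<exists>w. adjacent (cond \<omega>) v w" if "v \<in> ?C" for v by (rule infinite_cluster_neighbour[OF that])
  qed
  have lv: "G.lv = lv" by (simp add: G.lv_def lv_def)
  show ?case
  proof
   fix x assume x: "x \<in> ?C"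
   obtain N9 N8 where N9: "N9 >= 1" and near: "\<forall>t\<ge>N9. \<forall>y\<in>?C. l1norm (x - y) >= N8 --> ?near (gauss_const ?d cf \<epsilon> lv) x t y"
    using G.gaussian_bound[OF x] unfolding lv by (elim exE conjE) (rule that)
   have "\<exists>N8'. \<forall>t\<ge>1. \<forall>y\<in>?C. l1norm (x - y) >= N8' --> ?far 1 x t y"
    using G.far_bound[OF x] by (simp only: mult_1)
   then obtain N8' where far: "\<forall>t\<ge>1. \<forall>y\<in>?C. l1norm (x - y) >= N8' --> ?far 1 x t y" by (elim exE) (rule that)
   have scale: "h <= b * T * E ==> b <= k ==> T >= 0 ==> E >= 0 ==> h <= k * T * E" for h b T E :: real
    by (meson mult_right_mono order_trans)
   show "\<exists>N\<^sub>8 N\<^sub>9 :: real. \<forall>t\<ge>N\<^sub>9. \<forall>y\<in>?C. l1norm (x - y) >= N\<^sub>8 --> ?near k x t y \<and> ?far k x t y"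
   proof (rule exI[of _ "max N8 N8'"], rule exI[of _ N9], intro allI ballI impI conjI, goal_cases)
    case (1 t y)
    then show ?case using near by (intro scale[OF _ k(2)]) auto
   next
    case (2 t y)
    then show ?case using far N9 by (intro scale[OF _ k(1)]) auto
   qed
  qed
 qed
 \<comment> \<open>The first constant is 1, since \<open>gaussian_bound\<close> covers all distances
   up to \<open>t\<close>.\<close>
 show ?thesis
  unfolding c_def s_def by (rule exI[of _ 1], rule conjI[OF zero_less_one], rule exI[of _ k], rule conjI[OF pos(3)],
    rule exI[of _ "gauss_rate ?d cf * (cf / real ?d) / 2"], rule conjI[OF pos(1)],
    rule exI[of _ "cf / real ?d / 4"], rule conjI[OF pos(2)], rule exI[of _ "far_speed ?d cf"], rule conjI[OF pos(4)], simp only: mult_1, rule main)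
qed

end
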